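(* Let $E_1,E_2$ be de Branges functions without real zeros, with associated de Branges spaces $B_1,B_2$. Suppose $B_1$ and $B_2$ are homeomorphically embedded in $L^2(\mathbb R;\mu)$ for some Borel measure $\mu$ on $\mathbb R$. If $E_1$ and $E_2$ are of exponential type zero, then $B_1\supseteq B_2$ or $B_2\supseteq B_1$.
   Context: A function analytic in the upper half-plane $\mathbb C^+$ is of bounded type if it is a quotient of two bounded analytic functions there; its mean type is $\limsup_{y\to\infty}y^{-1}\ln|N(\mathrm iy)|$. A de Branges function is an entire $E$ with $|E(z)|>|E(z^\ast)|$ for $z\in\mathbb C^+$. Its de Branges space $B$ consists of all entire $F$ with $\int_{\mathbb R}|F(\lambda)|^2|E(\lambda)|^{-2}d\lambda<\infty$ such that $F/E$ and $F^\#/E$ (where $F^\#(z)=F(z^\ast)^\ast$) are of bounded type in $\mathbb C^+$ with non-positive mean type. It carries the inner product $\frac1\pi\int F G^\ast|E|^{-2}d\lambda$. "Homeomorphically embedded in $L^2(\mathbb R;\mu)$" means restriction to $\mathbb R$ maps $B$ into $L^2(\mathbb R;\mu)$ homeomorphically onto its image (equivalent norms). An entire function $E$ is of exponential type zero if $\ln^+|E(z)|=o(|z|)$ as $|z|\to\infty$, where $\ln^+=\max(\ln,0)$. *)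

theory Defs
  imports "HOL-Analysis.Analysis" "HOL-Library.Landau_Symbols"
begin

definition upper_half_plane :: "complex set" where
  "upper_half_plane = {z. Im z > 0}"

definition bounded_type :: "(complex \<Rightarrow> complex) \<Rightarrow> bool" where
  "bounded_type N \<longleftrightarrow> N holomorphic_on upper_half_plane \<and>
     (\<exists>g h. g holomorphic_on upper_half_plane \<and> h holomorphic_on upper_half_plane \<and>
        bounded (g ` upper_half_plane) \<and> bounded (h ` upper_half_plane) \<and>
        (\<exists>z\<in>upper_half_plane. h z \<noteq> 0) \<and>
        (\<forall>z\<in>upper_half_plane. N z * h z = g z))"

definition eln :: "real \<Rightarrow> ereal" where
  "eln x = (if x = 0 then -\<infinity> else ereal (ln x))"

definition mean_type :: "(complex \<Rightarrow> complex) \<Rightarrow> ereal" where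
  "mean_type N = Limsup at_top (\<lambda>y::real. eln (cmod (N (\<i> * of_real y))) / ereal y)"

definition sharp :: "(complex \<Rightarrow> complex) \<Rightarrow> complex \<Rightarrow> complex" where
  "sharp F = (\<lambda>z. cnj (F (cnj z)))"

definition de_Branges_function :: "(complex \<Rightarrow> complex) \<Rightarrow> bool" where
  "de_Branges_function E \<longleftrightarrow> E holomorphic_on UNIV \<and>
     (\<forall>z. Im z > 0 \<longrightarrow> cmod (E z) > cmod (E (cnj z)))"

definition dB_norm2 :: "(complex \<Rightarrow> complex) \<Rightarrow> (complex \<Rightarrow> complex) \<Rightarrow> real" where
  "dB_norm2 E F = (1 / pi) * (\<integral>x. (cmod (F (of_real x)) / cmod (E (of_real x)))\<^sup>2 \<partial>lborel)"

definition de_Branges_space :: "(complex \<Rightarrow> complex) \<Rightarrow> (complex \<Rightarrow> complex) set" where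
  "de_Branges_space E = {F. F holomorphic_on UNIV \<and>
      integrable lborel (\<lambda>x. (cmod (F (of_real x)) / cmod (E (of_real x)))\<^sup>2) \<and>
      bounded_type (\<lambda>z. F z / E z) \<and> mean_type (\<lambda>z. F z / E z) \<le> 0 \<and>
      bounded_type (\<lambda>z. sharp F z / E z) \<and> mean_type (\<lambda>z. sharp F z / E z) \<le> 0}"

text \<open>Restriction to the real line maps B into L^2(mu) homeomorphically onto its image,
  i.e. with equivalent norms (the map is linear).\<close>
definition homeo_embedded_L2 :: "(complex \<Rightarrow> complex) set \<Rightarrow> (complex \<Rightarrow> complex) \<Rightarrow> real measure \<Rightarrow> bool" where
  "homeo_embedded_L2 B E \<mu> \<longleftrightarrow>
     (\<forall>F\<in>B. integrable \<mu> (\<lambda>x. (cmod (F (of_real x)))\<^sup>2)) \<and>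
     (\<exists>c C. 0 < c \<and> 0 < C \<and> (\<forall>F\<in>B.
        c * dB_norm2 E F \<le> (\<integral>x. (cmod (F (of_real x)))\<^sup>2 \<partial>\<mu>) \<and>
        (\<integral>x. (cmod (F (of_real x)))\<^sup>2 \<partial>\<mu>) \<le> C * dB_norm2 E F))"

definition exp_type_zero :: "(complex \<Rightarrow> complex) \<Rightarrow> bool" where
  "exp_type_zero E \<longleftrightarrow> E holomorphic_on UNIV \<and>
     (\<lambda>z. max 0 (ln (cmod (E z)))) \<in> o[at_infinity](\<lambda>z. cmod z)"

end

(*
Suppose F lies in B2 but not in B1, and G in B1 but not in B2. Projecting F orthogonally to B1 in L^2(nu)
yields a functional that annihilates B1 but not F. Pairing it with the kernel (F(t) G(z) - F(z) G(t)) / (z - t)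
gives an entire function which is divisible by G, since B1 is invariant under difference quotients; the quotient
K does not depend on G. Exchanging the roles of the two spaces gives an entire function L. Both are of exponential
type zero, with |K G| |Im z| <= A (|F| + |G|) and |L F| |Im z| <= A (|F| + |G|), so at every point one of |K|, |L|
is O(1 / |Im z|). By a Denjoy--Carleman--Ahlfors argument two such functions of exponential type zero cannot both
be nonzero: the mean over |z| = r of the square of log+ |K| times that for L would grow like r^4. If K = 0, then
G = o(F) along the imaginary axis, whence L vanishes there asymptotically and L = 0, so that F = o(G) as well: impossible.
*)

theory Submission
  imports Defs "HOL-Complex_Analysis.Complex_Analysis" "HOL-Real_Asymp.Real_Asymp" "HOL-Probability.Sinc_Integral"
begin

subsection \<open>The Poisson inequality in a disc\<close>

text \<open>Three obstacles shape the details. A function of bounded type is given only as a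
  quotient, so its size has to be read off from its boundary behaviour: Poisson inequalities on
  discs, a Cayley map and Phragmen--Lindeloef arguments turn an L^2 bound on the real line into a
  bound on |f z|^2 Im z. Hence evaluations are bounded, the spaces are complete and projections
  exist. Next, the bounds on \<open>K\<close> and \<open>L\<close> degenerate at the real axis. On
  the circle of radius \<open>exp t\<close> the uncontrolled arcs have angle of order
  \<open>exp (- t)\<close>, which lowers the growth exponent 4 of the product of the means only by
  an integrable amount. Finally, ln |K| is singular at the zeros of \<open>K\<close> and its
  positive part is not smooth; its square is replaced by \<open>phi0\<close> of ln |K|, which
  vanishes near the zeros and obeys the same differential inequality as the square. The exponent
  comes from geometry: zero-free arcs of lengths m and n of two functions sharing a circle satisfy m
  + n <= 2 pi up to an error, so their Wirtinger frequencies satisfy pi / m + pi / n >= 2, and each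
  mean grows with twice its frequency.\<close>

inductive trig_poly :: "(complex \<Rightarrow> real) \<Rightarrow> bool" where
  monomial: "trig_poly (\<lambda>\<zeta>. Re (c * \<zeta> ^ n))"
| add: "trig_poly f \<Longrightarrow> trig_poly g \<Longrightarrow> trig_poly (\<lambda>\<zeta>. f \<zeta> + g \<zeta>)"

lemma trig_poly_entire:
  assumes "trig_poly f"
  shows "\<exists>p. p holomorphic_on UNIV \<and> (\<forall>\<zeta>. f \<zeta> = Re (p \<zeta>))"
  using assms
proof induction
  case (monomial c n)
  show ?case by (rule exI[of _ "\<lambda>\<zeta>. c * \<zeta> ^ n"]) (auto intro!: holomorphic_intros)
next
  case (add f g)
  then obtain p q where "p holomorphic_on UNIV" "q holomorphic_on UNIV" "\<forall>\<zeta>. f \<zeta> = Re (p \<zeta>)" "\<forall>\<zeta>. g \<zeta> = Re (q \<zeta>)"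
    by blast
  then show ?case by (intro exI[of _ "\<lambda>\<zeta>. p \<zeta> + q \<zeta>"]) (auto intro!: holomorphic_intros)
qed

text \<open>On the circle \<open>\<zeta> * cnj \<zeta>\<close> is the constant \<open>r^2\<close>,
  so a conjugate power can be traded for a scalar and a lower power. With \<open>n \<le> m\<close>
  the exponent \<open>m - n\<close> is a true difference and no negative powers arise.\<close>

lemma trig_poly_mult_monomial:
  assumes "norm \<zeta> = r" "n \<le> m"
  shows "Re (a * \<zeta> ^ m) * Re (c * \<zeta> ^ n)
     = Re ((a * c / 2) * \<zeta> ^ (m + n)) + Re ((a * cnj c * of_real (r ^ (2 * n)) / 2) * \<zeta> ^ (m - n))"
proof -
  have *: "Re x * Re y = Re (x * y / 2) + Re (x * cnj y / 2)" for x y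
    by (simp add: field_simps)
  have zz: "\<zeta> * cnj \<zeta> = of_real (r ^ 2)"
    using assms(1) by (simp add: complex_norm_square[symmetric])
  have "\<zeta> ^ m * cnj \<zeta> ^ n = \<zeta> ^ (m - n) * (\<zeta> * cnj \<zeta>) ^ n"
    using assms(2) by (simp add: power_mult_distrib mult.assoc[symmetric] power_add[symmetric])
  also have "\<dots> = \<zeta> ^ (m - n) * of_real (r ^ (2 * n))"
    by (simp add: zz power_mult[symmetric])
  finally have **: "\<zeta> ^ m * cnj \<zeta> ^ n = \<zeta> ^ (m - n) * of_real (r ^ (2 * n))" .
  have 1: "a * \<zeta> ^ m * (c * \<zeta> ^ n) / 2 = (a * c / 2) * \<zeta> ^ (m + n)"
    by (simp add: power_add)
  have "a * \<zeta> ^ m * cnj (c * \<zeta> ^ n) / 2 = a * cnj c * (\<zeta> ^ m * cnj \<zeta> ^ n) / 2"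
    by simp
  then have 2: "a * \<zeta> ^ m * cnj (c * \<zeta> ^ n) / 2 = (a * cnj c * of_real (r ^ (2 * n)) / 2) * \<zeta> ^ (m - n)"
    unfolding ** by (simp add: ac_simps)
  show ?thesis
    using *[of "a * \<zeta> ^ m" "c * \<zeta> ^ n"] unfolding 1 2 .
qed

lemma trig_poly_mult1:
  assumes "trig_poly f"
  shows "\<exists>h. trig_poly h \<and> (\<forall>\<zeta>\<in>sphere 0 r. f \<zeta> * Re (c * \<zeta> ^ n) = h \<zeta>)"
  using assms
proof induction
  case (monomial a m)
  show ?case
  proof (cases "n \<le> m")
    case True
    then show ?thesis
      by (intro exI[of _ "\<lambda>\<zeta>. Re ((a * c / 2) * \<zeta> ^ (m + n)) + Re ((a * cnj c * of_real (r ^ (2 * n)) / 2) * \<zeta> ^ (m - n))"]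
          conjI trig_poly.intros ballI trig_poly_mult_monomial) auto
  next
    case False
    have "Re (a * \<zeta> ^ m) * Re (c * \<zeta> ^ n)
       = Re ((c * a / 2) * \<zeta> ^ (n + m)) + Re ((c * cnj a * of_real (r ^ (2 * m)) / 2) * \<zeta> ^ (n - m))"
      if "\<zeta> \<in> sphere 0 r" for \<zeta>
      using trig_poly_mult_monomial[of \<zeta> r m n c a] that False by (simp add: mult.commute)
    then show ?thesis
      by (intro exI[of _ "\<lambda>\<zeta>. Re ((c * a / 2) * \<zeta> ^ (n + m)) + Re ((c * cnj a * of_real (r ^ (2 * m)) / 2) * \<zeta> ^ (n - m))"]
          conjI trig_poly.intros ballI) auto
  qed
next
  case (add f g)
  then obtain h k where "trig_poly h" "\<forall>\<zeta>\<in>sphere 0 r. f \<zeta> * Re (c * \<zeta> ^ n) = h \<zeta>"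
    "trig_poly k" "\<forall>\<zeta>\<in>sphere 0 r. g \<zeta> * Re (c * \<zeta> ^ n) = k \<zeta>" by blast
  then show ?case
    by (intro exI[of _ "\<lambda>\<zeta>. h \<zeta> + k \<zeta>"]) (auto intro: trig_poly.intros simp: distrib_right)
qed

lemma trig_poly_mult:
  assumes "trig_poly g" "trig_poly f"
  shows "\<exists>h. trig_poly h \<and> (\<forall>\<zeta>\<in>sphere 0 r. f \<zeta> * g \<zeta> = h \<zeta>)"
  using assms(1)
proof induction
  case (monomial c n)
  show ?case using trig_poly_mult1[OF assms(2)] .
next
  case (add g1 g2)
  then obtain h k where "trig_poly h" "\<forall>\<zeta>\<in>sphere 0 r. f \<zeta> * g1 \<zeta> = h \<zeta>"
    "trig_poly k" "\<forall>\<zeta>\<in>sphere 0 r. f \<zeta> * g2 \<zeta> = k \<zeta>" by blast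
  then show ?case
    by (intro exI[of _ "\<lambda>\<zeta>. h \<zeta> + k \<zeta>"]) (auto intro: trig_poly.intros simp: distrib_left)
qed

lemma real_polynomial_function_trig_poly:
  assumes "real_polynomial_function (g :: complex \<Rightarrow> real)"
  shows "\<exists>h. trig_poly h \<and> (\<forall>\<zeta>\<in>sphere 0 r. g \<zeta> = h \<zeta>)"
  using assms
proof induction
  case (linear f)
  interpret bounded_linear f by fact
  have "f \<zeta> = Re ((of_real (f 1) - \<i> * of_real (f \<i>)) * \<zeta> ^ 1)" for \<zeta>
  proof -
    have "\<zeta> = Re \<zeta> *\<^sub>R 1 + Im \<zeta> *\<^sub>R \<i>" by (simp add: complex_eq_iff)
    then have "f \<zeta> = Re \<zeta> *\<^sub>R f 1 + Im \<zeta> *\<^sub>R f \<i>" by (metis add scaleR)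
    then show ?thesis by (simp add: algebra_simps)
  qed
  then show ?case by (metis trig_poly.monomial)
next
  case (const c)
  show ?case by (rule exI[of _ "\<lambda>\<zeta>. Re (of_real c * \<zeta> ^ 0)"]) (auto intro: trig_poly.monomial[of "of_real c" 0, simplified])
next
  case (add f g)
  then obtain h k where "trig_poly h" "\<forall>\<zeta>\<in>sphere 0 r. f \<zeta> = h \<zeta>"
    "trig_poly k" "\<forall>\<zeta>\<in>sphere 0 r. g \<zeta> = k \<zeta>" by blast
  then show ?case
    by (intro exI[of _ "\<lambda>\<zeta>. h \<zeta> + k \<zeta>"]) (auto intro: trig_poly.intros)
next
  case (mult f g)
  then obtain h k where hk: "trig_poly h" "\<forall>\<zeta>\<in>sphere 0 r. f \<zeta> = h \<zeta>"
    "trig_poly k" "\<forall>\<zeta>\<in>sphere 0 r. g \<zeta> = k \<zeta>" by blast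
  with trig_poly_mult[OF hk(3,1), of r] show ?case by auto
qed

text \<open>Stone--Weierstrass gives a real polynomial in two real variables; on the circle it
  agrees with the real part of an entire function. This supplies approximate harmonic extensions of
  \<open>u\<close> into the disc.\<close>

lemma continuous_circle_approx:
  assumes "continuous_on (sphere 0 r) u" "0 < e"
  obtains p where "p holomorphic_on UNIV" "\<And>\<zeta>. \<zeta> \<in> sphere 0 r \<Longrightarrow> \<bar>u \<zeta> - Re (p \<zeta>)\<bar> < e"
proof -
  obtain g where g: "real_polynomial_function g" "\<And>x. x \<in> sphere 0 r \<Longrightarrow> \<bar>u x - g x\<bar> < e"
    using Stone_Weierstrass_real_polynomial_function[OF compact_sphere assms] by blast
  obtain h where h: "trig_poly h" "\<forall>\<zeta>\<in>sphere 0 r. g \<zeta> = h \<zeta>"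
    using real_polynomial_function_trig_poly[OF g(1)] by blast
  obtain p where "p holomorphic_on UNIV" "\<forall>\<zeta>. h \<zeta> = Re (p \<zeta>)"
    using trig_poly_entire[OF h(1)] by blast
  with h g that show ?thesis by metis
qed

definition poisson_disc :: "real \<Rightarrow> complex \<Rightarrow> complex \<Rightarrow> real" where
  "poisson_disc r w \<zeta> = (r\<^sup>2 - (cmod w)\<^sup>2) / (cmod (\<zeta> - w))\<^sup>2"

text \<open>The arc-length average: \<open>circlepath\<close> has constant speed on a parameter
  interval of length 1, which absorbs the factor 1 / (2 pi) of the Poisson formula.\<close>

definition circle_mean :: "real \<Rightarrow> (complex \<Rightarrow> real) \<Rightarrow> real" where
  "circle_mean r u = integral {0..1} (\<lambda>x. u (circlepath 0 r x))"

lemma circlepath_in_sphere: "0 \<le> r \<Longrightarrow> circlepath 0 r x \<in> sphere 0 r"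
  by (simp add: circlepath norm_mult)

lemma continuous_on_circle:
  assumes "continuous_on (sphere 0 r) u" "0 \<le> r"
  shows "continuous_on {0..1} (\<lambda>x. u (circlepath 0 r x))"
  by (rule continuous_on_compose2[OF assms(1)])
     (use assms(2) circlepath_in_sphere in \<open>auto simp: circlepath intro!: continuous_intros simp del: mem_sphere_0\<close>)

lemma circle_mean_integrable:
  fixes u :: "complex \<Rightarrow> 'a::euclidean_space"
  assumes "continuous_on (sphere 0 r) u" "0 \<le> r"
  shows "(\<lambda>x. u (circlepath 0 r x)) integrable_on {0..1}"
  by (intro integrable_continuous_real continuous_on_circle assms)

lemma circle_mean_mono:
  assumes "continuous_on (sphere 0 r) u" "continuous_on (sphere 0 r) v" "0 \<le> r"
    "\<And>\<zeta>. \<zeta> \<in> sphere 0 r \<Longrightarrow> u \<zeta> \<le> v \<zeta>"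
  shows "circle_mean r u \<le> circle_mean r v"
  unfolding circle_mean_def
  by (intro integral_le circle_mean_integrable assms circlepath_in_sphere)

lemma circle_mean_add:
  assumes "continuous_on (sphere 0 r) u" "continuous_on (sphere 0 r) v" "0 \<le> r"
  shows "circle_mean r (\<lambda>\<zeta>. u \<zeta> + v \<zeta>) = circle_mean r u + circle_mean r v"
  unfolding circle_mean_def
  by (intro integral_add circle_mean_integrable assms)

lemma circle_mean_cmult: "circle_mean r (\<lambda>\<zeta>. c * u \<zeta>) = c * circle_mean r u"
  unfolding circle_mean_def by simp

lemma circle_mean_const: "circle_mean r (\<lambda>\<zeta>. c) = c"
  unfolding circle_mean_def by simp

lemma continuous_on_poisson_disc:
  assumes "cmod w < r"
  shows "continuous_on (sphere 0 r) (poisson_disc r w)"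
  unfolding poisson_disc_def
  by (intro continuous_intros) (use assms in auto)

text \<open>Cauchy's formula is applied to \<open>q\<close>, which multiplies \<open>p\<close> by a
  factor equal to 1 at \<open>w\<close>. On the circle its denominator is
  \<open>u * cnj (u - w)\<close>, and this turns the Cauchy kernel into the Poisson kernel.\<close>

lemma poisson_formula:
  assumes p: "p holomorphic_on UNIV" and w: "cmod w < r"
  shows "Re (p w) = circle_mean r (\<lambda>\<zeta>. poisson_disc r w \<zeta> * Re (p \<zeta>))"
proof -
  have r: "0 < r" using w by (smt (verit) norm_ge_zero)
  define q where "q u = p u * ((of_real (r\<^sup>2) - w * cnj w) / (of_real (r\<^sup>2) - cnj w * u))" for u
  have nz: "of_real (r\<^sup>2) - cnj w * u \<noteq> 0" if "cmod u \<le> r" for u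
  proof
    assume "of_real (r\<^sup>2) - cnj w * u = 0"
    then have "cmod (cnj w * u) = r\<^sup>2" by (metis (no_types, lifting) eq_iff_diff_eq_0 norm_of_real abs_of_nonneg zero_le_power2)
    moreover have "cmod w * cmod u < r * r"
      using w that r by (meson mult_strict_right_mono mult_left_mono norm_ge_zero order_le_less_trans)
    ultimately show False by (simp add: norm_mult power2_eq_square)
  qed
  have qh: "q holomorphic_on cball 0 r" unfolding q_def
    by (intro holomorphic_intros holomorphic_on_subset[OF p]) (use nz in auto)
  have qw: "q w = p w" using nz[of w] w unfolding q_def by (simp add: mult.commute)
  have "((\<lambda>u. q u / (u - w)) has_contour_integral 2 * of_real pi * \<i> * q w) (circlepath 0 r)"
    by (rule Cauchy_integral_circlepath_simple[OF qh]) (use w in simp)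
  then have "((\<lambda>x. q (circlepath 0 r x) / (circlepath 0 r x - w) * vector_derivative (circlepath 0 r) (at x within {0..1}))
        has_integral 2 * of_real pi * \<i> * p w) {0..1}"
    unfolding has_contour_integral_def qw .
  then have hi: "((\<lambda>x. of_real (poisson_disc r w (circlepath 0 r x)) * p (circlepath 0 r x) * (2 * of_real pi * \<i>)) has_integral 2 * of_real pi * \<i> * p w) {0..1}"
  proof (rule has_integral_eq[rotated])
    fix x :: real assume x: "x \<in> {0..1}"
    define u where "u = circlepath 0 r x"
    have un: "cmod u = r" using circlepath_in_sphere[of r x] r unfolding u_def by simp
    have vd: "vector_derivative (circlepath 0 r) (at x within {0..1}) = 2 * of_real pi * \<i> * u"
      using x unfolding u_def by (simp add: vector_derivative_circlepath01) (simp add: circlepath)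
    have u0: "u \<noteq> 0" "u \<noteq> w" using un r w by auto
    have rr: "of_real (r\<^sup>2) = u * cnj u" unfolding complex_norm_square[symmetric] un by simp
    have den: "of_real (r\<^sup>2) - cnj w * u = u * cnj (u - w)"
      unfolding rr by (simp add: algebra_simps)
    have P: "of_real (poisson_disc r w u) = (of_real (r\<^sup>2) - w * cnj w) / ((u - w) * cnj (u - w))"
      unfolding poisson_disc_def by (simp add: complex_norm_square[symmetric] del: complex_cnj_diff)
    show "q (circlepath 0 r x) / (circlepath 0 r x - w) * vector_derivative (circlepath 0 r) (at x within {0..1}) =
          of_real (poisson_disc r w (circlepath 0 r x)) * p (circlepath 0 r x) * (2 * of_real pi * \<i>)"
      unfolding vd q_def u_def[symmetric] den P using u0
      by (simp add: field_simps del: complex_cnj_diff)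
  qed
  have "((\<lambda>x. of_real (poisson_disc r w (circlepath 0 r x)) * p (circlepath 0 r x)) has_integral p w) {0..1}"
    using has_integral_mult_left[OF hi, of "1 / (2 * of_real pi * \<i>)"] by simp
  from has_integral_Re[OF this] show ?thesis
    unfolding circle_mean_def by (simp add: integral_unique)
qed

lemma circle_mean_poisson_one:
  assumes "cmod w < r"
  shows "circle_mean r (poisson_disc r w) = 1"
  using poisson_formula[of "\<lambda>_. 1", OF _ assms] by simp

lemma poisson_disc_nonneg: "cmod w \<le> r \<Longrightarrow> 0 \<le> poisson_disc r w \<zeta>"
  unfolding poisson_disc_def by (simp add: power_mono)

text \<open>With \<open>Re p\<close> close to \<open>u\<close> on the circle,
  \<open>Q * exp (- p - e)\<close> has modulus at most 1 there, so the maximum principle applies.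
  The argument never takes the logarithm of \<open>Q\<close>, so zeros of \<open>Q\<close> are
  harmless.\<close>

lemma poisson_inequality:
  assumes Q: "continuous_on (cball 0 r) Q" "Q holomorphic_on ball 0 r"
    and u: "continuous_on (sphere 0 r) u" and Qu: "\<And>\<zeta>. \<zeta> \<in> sphere 0 r \<Longrightarrow> cmod (Q \<zeta>) \<le> exp (u \<zeta>)"
    and w: "cmod w < r"
  shows "cmod (Q w) \<le> exp (circle_mean r (\<lambda>\<zeta>. poisson_disc r w \<zeta> * u \<zeta>))"
proof -
  have r: "0 < r" using w by (smt (verit) norm_ge_zero)
  define I where "I = circle_mean r (\<lambda>\<zeta>. poisson_disc r w \<zeta> * u \<zeta>)"
  \<comment> \<open>One \<open>e\<close> comes from the maximum principle, the other from replacing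
    \<open>Re p\<close> by \<open>u\<close> under the Poisson kernel, whose mean is 1.\<close>
  have *: "cmod (Q w) \<le> exp (I + 2 * e)" if e: "0 < e" for e
  proof -
    obtain p where p: "p holomorphic_on UNIV" "\<And>\<zeta>. \<zeta> \<in> sphere 0 r \<Longrightarrow> \<bar>u \<zeta> - Re (p \<zeta>)\<bar> < e"
      using continuous_circle_approx[OF u e] by blast
    have pc: "continuous_on S p" for S using p(1) holomorphic_on_imp_continuous_on holomorphic_on_subset by blast
    define q where "q z = Q z * exp (- p z - of_real e)" for z
    have "cmod (q w) \<le> 1"
    proof (rule maximum_modulus_frontier[of q "ball 0 r"])
      show "q holomorphic_on interior (ball 0 r)" unfolding q_def
        by (intro holomorphic_intros) (use Q(2) p(1) holomorphic_on_subset in \<open>auto\<close>)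
      show "continuous_on (closure (ball 0 r)) q" unfolding q_def
        using r Q(1) by (auto intro!: continuous_intros pc)
      show "cmod (q z) \<le> 1" if "z \<in> frontier (ball 0 r)" for z
      proof -
        have z: "z \<in> sphere 0 r" using that r by simp
        have "cmod (q z) \<le> exp (u z) * exp (- Re (p z) - e)"
          unfolding q_def by (auto simp: norm_mult intro!: mult_right_mono Qu[OF z])
        also have "\<dots> = exp (u z - Re (p z) - e)" by (simp add: exp_add[symmetric])
        also have "\<dots> \<le> 1" using p(2)[OF z] by simp
        finally show ?thesis .
      qed
    qed (use w in auto)
    then have "cmod (Q w) * exp (- Re (p w) - e) \<le> 1" unfolding q_def by (simp add: norm_mult)
    then have 1: "cmod (Q w) \<le> exp (Re (p w) + e)"
      by (metis (no_types, opaque_lifting) exp_minus_inverse exp_not_eq_zero minus_add_distrib mult.commute mult_le_cancel_right_pos exp_gt_zero uminus_add_conv_diff diff_minus_eq_add minus_minus add.commute)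
    have Pc: "continuous_on (sphere 0 r) (poisson_disc r w)" by (rule continuous_on_poisson_disc[OF w])
    have "Re (p w) = circle_mean r (\<lambda>\<zeta>. poisson_disc r w \<zeta> * Re (p \<zeta>))"
      by (rule poisson_formula[OF p(1) w])
    also have "\<dots> \<le> circle_mean r (\<lambda>\<zeta>. poisson_disc r w \<zeta> * u \<zeta> + e * poisson_disc r w \<zeta>)"
    proof (rule circle_mean_mono)
      fix \<zeta> :: complex assume z: "\<zeta> \<in> sphere 0 r"
      have "Re (p \<zeta>) \<le> u \<zeta> + e" using p(2)[OF z] by linarith
      then have "poisson_disc r w \<zeta> * Re (p \<zeta>) \<le> poisson_disc r w \<zeta> * (u \<zeta> + e)"
        using w by (intro mult_left_mono poisson_disc_nonneg) auto
      then show "poisson_disc r w \<zeta> * Re (p \<zeta>) \<le> poisson_disc r w \<zeta> * u \<zeta> + e * poisson_disc r w \<zeta>"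
        by (simp add: algebra_simps)
    qed (use r u in \<open>auto intro!: continuous_intros Pc pc\<close>)
    also have "\<dots> = I + e * 1"
      using r u unfolding I_def
      by (subst circle_mean_add) (auto intro!: continuous_intros Pc simp: circle_mean_cmult circle_mean_poisson_one[OF w])
    finally show ?thesis using 1 by (smt (verit) exp_le_cancel_iff)
  qed
  have "cmod (Q w) \<le> exp I"
  proof (rule tendsto_lowerbound[of _ _ "at_right 0"])
    show "((\<lambda>e. exp (I + 2 * e)) \<longlongrightarrow> exp I) (at_right 0)"
      by (rule tendsto_eq_intros refl | simp)+
    show "\<forall>\<^sub>F e in at_right 0. cmod (Q w) \<le> exp (I + 2 * e)"
      using * eventually_at_right_less by (metis (mono_tags, lifting) eventually_mono)
  qed simp
  then show ?thesis unfolding I_def .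
qed

lemma mean_value_inequality:
  assumes Q: "continuous_on (cball 0 r) Q" "Q holomorphic_on ball 0 r" and r: "0 < r"
    and u: "continuous_on (sphere 0 r) u" and Qu: "\<And>\<zeta>. \<zeta> \<in> sphere 0 r \<Longrightarrow> cmod (Q \<zeta>) \<le> exp (u \<zeta>)"
  shows "cmod (Q 0) \<le> exp (circle_mean r u)"
proof -
  have "circle_mean r (\<lambda>\<zeta>. poisson_disc r 0 \<zeta> * u \<zeta>) = circle_mean r u"
    unfolding circle_mean_def poisson_disc_def using circlepath_in_sphere[of r] r by (simp add: algebra_simps)
  then show ?thesis using poisson_inequality[OF Q u Qu, of 0] r by simp
qed

subsection \<open>Phragmen--Lindeloef principles for functions of bounded type\<close>

text \<open>The positive part of ln |Q| is at most - ln |H|, and the mean value inequality for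
  \<open>H\<close> bounds the circle means of the latter by \<open>V\<close>. Away from the boundary
  point 1 the function is nearly at most 1, so on large circles the mass that matters sits near 1,
  where the Poisson kernel is close to its value at 1. The result is the bound belonging to a point
  mass \<open>V\<close> at 1.\<close>

lemma disc_bounded_type_bound:
  assumes Q: "Q holomorphic_on ball 0 1" and H: "H holomorphic_on ball 0 1"
    and QH: "\<And>w. cmod w < 1 \<Longrightarrow> cmod (Q w * H w) \<le> 1" and H1: "\<And>w. cmod w < 1 \<Longrightarrow> cmod (H w) \<le> 1"
    and H0: "exp (- V) \<le> cmod (H 0)"
    and bd: "\<And>\<xi> e. cmod \<xi> = 1 \<Longrightarrow> \<xi> \<noteq> 1 \<Longrightarrow> 0 < e \<Longrightarrow>
       \<exists>d>0. \<forall>w. cmod w < 1 \<longrightarrow> dist w \<xi> < d \<longrightarrow> cmod (Q w) \<le> exp e"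
    and w: "cmod w < 1"
  shows "cmod (Q w) \<le> exp (V * ((1 - (cmod w)\<^sup>2) / (cmod (1 - w))\<^sup>2))"
proof -
  define P1 where "P1 = (1 - (cmod w)\<^sup>2) / (cmod (1 - w))\<^sup>2"
  have "exp (-V) \<le> exp 0" by (rule order_trans[OF H0]) (use H1[of 0] in simp)
  then have V0: "V \<ge> 0" by simp
  have w1: "w \<noteq> 1" using w by auto
  have P1: "P1 \<ge> 0" unfolding P1_def using w by (intro divide_nonneg_nonneg) (auto simp: power_le_one)
  have *: "cmod (Q w) \<le> exp ((P1 + e) * V + e)" if e: "0 < e" for e
  proof -
    have "isCont (\<lambda>\<zeta>. ((cmod \<zeta>)\<^sup>2 - (cmod w)\<^sup>2) / (cmod (\<zeta> - w))\<^sup>2) 1"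
      using w1 by (auto intro!: continuous_intros)
    then obtain \<eta> where eta: "\<eta> > 0" "\<And>\<zeta>. dist \<zeta> 1 < \<eta> \<Longrightarrow> ((cmod \<zeta>)\<^sup>2 - (cmod w)\<^sup>2) / (cmod (\<zeta> - w))\<^sup>2 < P1 + e"
      using e unfolding continuous_at_eps_delta P1_def by (fastforce simp: dist_real_def)
    \<comment> \<open>Compactness makes the boundary hypothesis uniform off a neighbourhood of 1:
      otherwise bad points would accumulate at a boundary point other than 1.\<close>
    have "\<exists>\<rho><1. \<forall>\<zeta>. \<rho> < cmod \<zeta> \<and> cmod \<zeta> < 1 \<and> \<eta> \<le> dist \<zeta> 1 \<longrightarrow> cmod (Q \<zeta>) \<le> exp e"
    proof (rule ccontr)
      assume "\<not> ?thesis"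
      then have "\<forall>n. \<exists>\<zeta>. 1 - 1 / real (Suc n) < cmod \<zeta> \<and> cmod \<zeta> < 1 \<and> \<eta> \<le> dist \<zeta> 1 \<and> cmod (Q \<zeta>) > exp e"
        by (metis diff_gt_0_iff_gt diff_less not_le of_nat_0_less_iff zero_less_Suc zero_less_divide_1_iff diff_strict_left_mono diff_zero)
      then obtain z where z: "\<And>n. 1 - 1 / real (Suc n) < cmod (z n)" "\<And>n. cmod (z n) < 1"
        "\<And>n. \<eta> \<le> dist (z n) 1" "\<And>n. cmod (Q (z n)) > exp e" by metis
      have "\<forall>n. z n \<in> cball 0 1" using z(2) by (simp add: less_imp_le)
      then obtain \<xi> \<sigma> where xi: "strict_mono \<sigma>" "(z \<circ> \<sigma>) \<longlonglongrightarrow> \<xi>"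
        using compact_cball[of "0::complex" 1] unfolding compact_def by metis
      have l1: "(\<lambda>n. cmod (z (\<sigma> n))) \<longlonglongrightarrow> cmod \<xi>" using tendsto_norm[OF xi(2)] by (simp add: o_def)
      have "(\<lambda>n. 1 - 1 / real (Suc n)) \<longlonglongrightarrow> 1"
        using LIMSEQ_inverse_real_of_nat tendsto_diff[OF tendsto_const, of "\<lambda>n. inverse (real (Suc n))" 0 sequentially 1] by (simp add: inverse_eq_divide)
      then have "(\<lambda>n. 1 - 1 / real (Suc (\<sigma> n))) \<longlonglongrightarrow> 1"
        using LIMSEQ_subseq_LIMSEQ[OF _ xi(1)] by (fastforce simp: o_def)
      moreover have "(\<lambda>n::nat. 1::real) \<longlonglongrightarrow> 1" by simp
      ultimately have "(\<lambda>n. cmod (z (\<sigma> n))) \<longlonglongrightarrow> 1"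
        by (rule tendsto_sandwich[rotated 2]) (use z in \<open>auto simp: less_imp_le\<close>)
      then have x1: "cmod \<xi> = 1" using l1 LIMSEQ_unique by blast
      have "(\<lambda>n. dist (z (\<sigma> n)) 1) \<longlonglongrightarrow> dist \<xi> 1" using xi(2) by (intro tendsto_intros) (simp add: o_def)
      then have "dist \<xi> 1 \<ge> \<eta>" by (rule LIMSEQ_le_const) (use z(3) in auto)
      then have "\<xi> \<noteq> 1" using eta(1) by auto
      then obtain d where d: "d > 0" "\<And>w. cmod w < 1 \<Longrightarrow> dist w \<xi> < d \<Longrightarrow> cmod (Q w) \<le> exp e"
        using bd[OF x1 _ e] by blast
      obtain n where "dist (z (\<sigma> n)) \<xi> < d" using metric_LIMSEQ_D[OF xi(2) d(1)] by auto
      then show False using d(2)[OF z(2)] z(4) by (meson not_le)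
    qed
    then obtain \<rho> where rho: "\<rho> < 1" "\<And>\<zeta>. \<rho> < cmod \<zeta> \<Longrightarrow> cmod \<zeta> < 1 \<Longrightarrow> \<eta> \<le> dist \<zeta> 1 \<Longrightarrow> cmod (Q \<zeta>) \<le> exp e" by blast
    obtain r where r: "max (cmod w) \<rho> < r" "r < 1" using w rho(1) dense[of "max (cmod w) \<rho>" 1] by auto
    have r0: "0 < r" "cmod w < r" using r(1) by (auto intro: le_less_trans[OF norm_ge_zero])
    have sub: "cball 0 r \<subseteq> ball (0::complex) 1" "ball 0 r \<subseteq> ball (0::complex) 1" "sphere 0 r \<subseteq> ball (0::complex) 1" using r(2) by auto
    have Qc: "continuous_on (ball 0 1) Q" and Hc: "continuous_on (ball 0 1) H"
      using Q H holomorphic_on_imp_continuous_on by auto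
    have Qs: "continuous_on (sphere 0 r) Q" "continuous_on (sphere 0 r) H" using continuous_on_subset Qc Hc sub by blast+
    define qp where "qp = (\<lambda>\<zeta>. ln (max 1 (cmod (Q \<zeta>))))"
    have qpc: "continuous_on (sphere 0 r) qp" unfolding qp_def
      by (intro continuous_intros Qs) (metis max.cobounded1 not_one_le_zero)
    obtain B where B: "\<And>\<zeta>. \<zeta> \<in> sphere 0 r \<Longrightarrow> qp \<zeta> \<le> B"
      using compact_continuous_image[OF qpc compact_sphere] compact_imp_bounded bounded_has_Sup(1)
      by (metis imageI image_is_empty empty_iff)
    \<comment> \<open>\<open>H\<close> may vanish on the circle, so its modulus is cut off at
      \<open>exp (- B)\<close>. Since \<open>B\<close> dominates \<open>qp\<close> there, the
      comparison of \<open>qp\<close> with \<open>v\<close> survives the cut.\<close>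
    define v where "v = (\<lambda>\<zeta>. - ln (max (cmod (H \<zeta>)) (exp (- B))))"
    have mpos: "max (cmod (H \<zeta>)) (exp (- B)) > 0" for \<zeta> by (simp add: max.strict_coboundedI2)
    have vc: "continuous_on (sphere 0 r) v" unfolding v_def
      by (intro continuous_intros Qs) (metis mpos less_irrefl)
    have B0: "B \<ge> 0"
    proof -
      have "of_real r \<in> sphere (0::complex) r" using r0 by simp
      then have "qp (of_real r) \<le> B" by (rule B)
      moreover have "qp (of_real r) \<ge> 0" unfolding qp_def by simp
      ultimately show ?thesis by simp
    qed
    have v0: "v \<zeta> \<ge> 0" if "\<zeta> \<in> sphere 0 r" for \<zeta>
    proof -
      have "cmod (H \<zeta>) \<le> 1" using H1 that r by simp
      then show ?thesis unfolding v_def using mpos[of \<zeta>] B0 by (simp add: ln_le_zero_iff)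
    qed
    have qv: "qp \<zeta> \<le> v \<zeta>" if z: "\<zeta> \<in> sphere 0 r" for \<zeta>
    proof (cases "exp (- B) \<le> cmod (H \<zeta>)")
      case True
      then have hp: "cmod (H \<zeta>) > 0" by (smt (verit) exp_gt_zero)
      have z1: "cmod \<zeta> < 1" using z r by simp
      have "max 1 (cmod (Q \<zeta>)) \<le> 1 / cmod (H \<zeta>)" using QH[OF z1] H1[OF z1] hp
        by (simp add: field_simps norm_mult)
      then have "ln (max 1 (cmod (Q \<zeta>))) \<le> ln (1 / cmod (H \<zeta>))" using hp by (intro ln_mono) auto
      also have "\<dots> = v \<zeta>" unfolding v_def using True hp by (simp add: max_absorb1 ln_div)
      finally show ?thesis unfolding qp_def .
    next
      case False
      then have "v \<zeta> = B" unfolding v_def by (simp add: max_def)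
      then show ?thesis using B[OF z] by simp
    qed
    have "cmod (H 0) \<le> exp (circle_mean r (\<lambda>\<zeta>. - v \<zeta>))"
    proof (rule mean_value_inequality[OF _ _ r0(1)])
      show "cmod (H \<zeta>) \<le> exp (- v \<zeta>)" for \<zeta> unfolding v_def using mpos[of \<zeta>] by simp
    qed (use Hc H sub continuous_on_subset holomorphic_on_subset vc in \<open>auto intro!: continuous_intros\<close>)
    also have "circle_mean r (\<lambda>\<zeta>. - v \<zeta>) = - circle_mean r v" using circle_mean_cmult[of r "-1" v] by simp
    finally have "exp (- V) \<le> exp (- circle_mean r v)" by (rule order_trans[OF H0])
    then have mv: "circle_mean r v \<le> V" by simp
    have Pc: "continuous_on (sphere 0 r) (poisson_disc r w)" by (rule continuous_on_poisson_disc[OF r0(2)])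
    have "cmod (Q w) \<le> exp (circle_mean r (\<lambda>\<zeta>. poisson_disc r w \<zeta> * qp \<zeta>))"
    proof (rule poisson_inequality[OF _ _ qpc _ r0(2)])
      show "cmod (Q \<zeta>) \<le> exp (qp \<zeta>)" for \<zeta> unfolding qp_def by (simp add: exp_ln)
    qed (use Qc Q sub continuous_on_subset holomorphic_on_subset in auto)
    \<comment> \<open>Near 1 the kernel is at most \<open>P1 + e\<close> and \<open>qp\<close> is at
      most \<open>v\<close>; elsewhere \<open>qp\<close> itself is at most \<open>e\<close>.\<close>
    also have "circle_mean r (\<lambda>\<zeta>. poisson_disc r w \<zeta> * qp \<zeta>) \<le> circle_mean r (\<lambda>\<zeta>. (P1 + e) * v \<zeta> + e * poisson_disc r w \<zeta>)"
    proof (rule circle_mean_mono)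
      fix \<zeta> :: complex assume z: "\<zeta> \<in> sphere 0 r"
      have zr: "cmod \<zeta> = r" using z by simp
      have P0: "0 \<le> poisson_disc r w \<zeta>" using r0 by (intro poisson_disc_nonneg) simp
      have qp0: "qp \<zeta> \<ge> 0" unfolding qp_def by simp
      show "poisson_disc r w \<zeta> * qp \<zeta> \<le> (P1 + e) * v \<zeta> + e * poisson_disc r w \<zeta>"
      proof (cases "dist \<zeta> 1 < \<eta>")
        case True
        then have "poisson_disc r w \<zeta> \<le> P1 + e" using eta(2)[OF True] unfolding poisson_disc_def zr by simp
        then have "poisson_disc r w \<zeta> * qp \<zeta> \<le> (P1 + e) * v \<zeta>" using qv[OF z] qp0 P1 e by (intro mult_mono) auto
        then show ?thesis using P0 e by (smt (verit) mult_nonneg_nonneg)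
      next
        case False
        have "cmod (Q \<zeta>) \<le> exp e" by (rule rho(2)) (use False r zr in auto)
        then have "max 1 (cmod (Q \<zeta>)) \<le> exp e" using e by simp
        then have "qp \<zeta> \<le> e" unfolding qp_def by (metis exp_gt_zero ln_exp ln_mono less_max_iff_disj zero_less_one)
        then have "poisson_disc r w \<zeta> * qp \<zeta> \<le> e * poisson_disc r w \<zeta>" using P0 by (simp add: mult.commute mult_right_mono)
        then show ?thesis using v0[OF z] P1 e by (smt (verit) mult_nonneg_nonneg)
      qed
    qed (use r0 in \<open>auto intro!: continuous_intros Pc qpc vc\<close>)
    also have "\<dots> = (P1 + e) * circle_mean r v + e"
      using r0 by (subst circle_mean_add) (auto intro!: continuous_intros Pc vc simp: circle_mean_cmult circle_mean_poisson_one)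
    also have "\<dots> \<le> (P1 + e) * V + e" using mv P1 e by (simp add: mult_left_mono)
    finally show ?thesis by simp
  qed
  have "cmod (Q w) \<le> exp (V * P1)"
  proof (rule tendsto_lowerbound[of _ _ "at_right 0"])
    show "((\<lambda>e. exp ((P1 + e) * V + e)) \<longlongrightarrow> exp (V * P1)) (at_right 0)"
      by (rule tendsto_eq_intros refl | simp add: mult.commute)+
    show "\<forall>\<^sub>F e in at_right 0. cmod (Q w) \<le> exp ((P1 + e) * V + e)"
      using * eventually_at_right_less by (metis (mono_tags, lifting) eventually_mono)
  qed simp
  then show ?thesis unfolding P1_def .
qed

text \<open>An upper limit of |q| not exceeding 1 at every point of \<open>S\<close>, phrased
  without boundary values because \<open>q\<close> need not extend continuously to
  \<open>S\<close>.\<close>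

definition subunit_boundary :: "complex set \<Rightarrow> complex set \<Rightarrow> (complex \<Rightarrow> complex) \<Rightarrow> bool" where
  "subunit_boundary D S q \<longleftrightarrow> (\<forall>\<xi>\<in>S. \<forall>e>0. \<exists>d>0. \<forall>z\<in>D. dist z \<xi> < d \<longrightarrow> cmod (q z) \<le> exp e)"

lemma subunit_boundaryD:
  assumes "subunit_boundary D S q" "\<xi> \<in> S" "0 < e"
  obtains d where "d > 0" "\<And>z. z \<in> D \<Longrightarrow> dist z \<xi> < d \<Longrightarrow> cmod (q z) \<le> exp e"
  using assms unfolding subunit_boundary_def by meson

text \<open>The Cayley map \<open>\<phi>\<close> sends 0 to \<open>z0\<close> and 1 to infinity.
  Under it the disc Poisson kernel with pole at 1 becomes \<open>Im z / Im z0\<close>, so the point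
  mass at 1 turns into exponential growth in \<open>Im z\<close>.\<close>

lemma half_plane_bounded_type_bound:
  assumes q: "q holomorphic_on upper_half_plane" and h: "h holomorphic_on upper_half_plane"
    and qh: "\<And>z. Im z > 0 \<Longrightarrow> cmod (q z * h z) \<le> 1" and h1: "\<And>z. Im z > 0 \<Longrightarrow> cmod (h z) \<le> 1"
    and z0: "Im z0 > 0" and hz0: "exp (- V) \<le> cmod (h z0)"
    and bd: "subunit_boundary upper_half_plane \<real> q"
    and z: "Im z > 0"
  shows "cmod (q z) \<le> exp (V * (Im z / Im z0))"
proof -
  define \<phi> where "\<phi> = (\<lambda>w. (z0 - cnj z0 * w) / (1 - w))"
  have Im\<phi>: "Im (\<phi> w) = Im z0 * ((1 - (cmod w)\<^sup>2) / (cmod (1 - w))\<^sup>2)" if "w \<noteq> 1" for w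
  proof -
    have nz: "(cmod (1 - w))\<^sup>2 \<noteq> 0" using that by simp
    have "\<phi> w = (z0 - cnj z0 * w) * cnj (1 - w) / of_real ((cmod (1 - w))\<^sup>2)"
      unfolding \<phi>_def complex_norm_square using that
      by (subst mult_divide_mult_cancel_right) (auto simp del: complex_cnj_diff)
    then have "Im (\<phi> w) = Im ((z0 - cnj z0 * w) * cnj (1 - w)) / (cmod (1 - w))\<^sup>2"
      by (simp only: Im_divide_of_real)
    also have "Im ((z0 - cnj z0 * w) * cnj (1 - w)) = Im z0 * (1 - (cmod w)\<^sup>2)"
      unfolding cmod_power2 by (simp add: algebra_simps power2_eq_square)
    finally show ?thesis by simp
  qed
  have lt1: "w \<noteq> 1" "(cmod w)\<^sup>2 < 1" if "cmod w < 1" for w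
    using that by (auto simp: power_less_one_iff abs_square_less_1)
  have up: "Im (\<phi> w) > 0" if "cmod w < 1" for w
    using lt1[OF that] z0 by (simp add: Im\<phi>)
  have \<phi>h: "\<phi> holomorphic_on ball 0 1" unfolding \<phi>_def by (intro holomorphic_intros) auto
  have im: "\<phi> ` ball 0 1 \<subseteq> upper_half_plane" using up by (auto simp: upper_half_plane_def)
  define w where "w = (z - z0) / (z - cnj z0)"
  have ne: "z \<noteq> cnj z0" using z z0 by (auto simp: complex_eq_iff)
  have cne: "z0 \<noteq> cnj z0" using z0 by (auto simp: complex_eq_iff)
  have w1: "w \<noteq> 1" unfolding w_def using ne cne by (auto simp: field_simps)
  have \<phi>w: "\<phi> w = z"
  proof -
    have "z0 - cnj z0 * w = z * (z0 - cnj z0) / (z - cnj z0)" unfolding w_def using ne by (simp add: field_simps)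
    moreover have "1 - w = (z0 - cnj z0) / (z - cnj z0)" unfolding w_def using ne by (simp add: field_simps)
    ultimately show ?thesis unfolding \<phi>_def using ne cne by simp
  qed
  have eq: "(1 - (cmod w)\<^sup>2) / (cmod (1 - w))\<^sup>2 = Im z / Im z0" using Im\<phi>[OF w1] z0 by (simp add: \<phi>w)
  have wl: "cmod w < 1"
  proof -
    have "(1 - (cmod w)\<^sup>2) / (cmod (1 - w))\<^sup>2 > 0" using eq z z0 by simp
    then have "(cmod w)\<^sup>2 < 1" using w1 by (simp add: zero_less_divide_iff)
    then show ?thesis by (simp add: abs_square_less_1)
  qed
  have "cmod ((q \<circ> \<phi>) w) \<le> exp (V * ((1 - (cmod w)\<^sup>2) / (cmod (1 - w))\<^sup>2))"
  proof (rule disc_bounded_type_bound[where H = "h \<circ> \<phi>"])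
    show "q \<circ> \<phi> holomorphic_on ball 0 1" "h \<circ> \<phi> holomorphic_on ball 0 1"
      using holomorphic_on_compose_gen[OF \<phi>h] q h im by (auto simp: image_subset_iff_funcset)
    show "exp (- V) \<le> cmod ((h \<circ> \<phi>) 0)" using hz0 by (simp add: \<phi>_def)
    show "\<exists>d>0. \<forall>w. cmod w < 1 \<longrightarrow> dist w \<xi> < d \<longrightarrow> cmod ((q \<circ> \<phi>) w) \<le> exp e"
      if xi: "cmod \<xi> = 1" "\<xi> \<noteq> 1" and e: "0 < e" for \<xi> e
    proof -
      have "Im (\<phi> \<xi>) = 0" using Im\<phi>[OF xi(2)] xi(1) by simp
      then have "\<phi> \<xi> \<in> \<real>" by (simp add: complex_is_Real_iff)
      then obtain d where d: "d > 0" "\<And>z. z \<in> upper_half_plane \<Longrightarrow> dist z (\<phi> \<xi>) < d \<Longrightarrow> cmod (q z) \<le> exp e"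
        using subunit_boundaryD[OF bd _ e] by blast
      have "isCont \<phi> \<xi>" unfolding \<phi>_def using xi(2) by (auto intro!: continuous_intros)
      then obtain d' where "d' > 0" "\<And>w. dist w \<xi> < d' \<Longrightarrow> dist (\<phi> w) (\<phi> \<xi>) < d"
        using d(1) unfolding continuous_at_eps_delta by blast
      then show ?thesis using d(2) up by (intro exI[of _ d']) (auto simp: upper_half_plane_def)
    qed
  qed (use qh h1 up wl in auto)
  then show ?thesis by (simp add: \<phi>w eq)
qed

text \<open>Here \<open>T\<close> is a free scale, such as the height of a base point that recedes
  to infinity.\<close>

lemma exp_scaled_limit:
  assumes "\<And>T. T > (0::real) \<Longrightarrow> a \<le> exp (c / T)"
  shows "a \<le> (1::real)"
proof (rule tendsto_lowerbound[of _ _ at_top])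
  show "((\<lambda>T. exp (c / T)) \<longlongrightarrow> 1) at_top" by real_asymp
  show "\<forall>\<^sub>F T in at_top. a \<le> exp (c / T)" using eventually_gt_at_top[of 0] by eventually_elim (rule assms)
qed simp

text \<open>The square root maps the half-plane onto the quarter-plane \<open>D\<close>, where |u|
  <= Re u + Im u. Hence \<open>exp (- (C * (1 - \<i>) * u))\<close> is a bounded denominator for
  \<open>q\<close>. At the base point \<open>\<i> * T^2\<close> it costs only
  \<open>2 * C * T\<close>, against the height \<open>T^2\<close>; growth of order 1 lies below the
  critical order 2 of the quarter-plane, and \<open>T\<close> can tend to infinity.\<close>

lemma Phragmen_Lindeloef_quarter_plane:
  fixes q :: "complex \<Rightarrow> complex"
  defines "D \<equiv> {z. Re z > 0 \<and> Im z > 0}"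
  assumes q: "q holomorphic_on D" and C: "0 \<le> C" and gr: "\<And>z. z \<in> D \<Longrightarrow> cmod (q z) \<le> exp (C * cmod z)"
    and bd: "subunit_boundary D {z. Re z \<ge> 0 \<and> Im z \<ge> 0 \<and> (Re z = 0 \<or> Im z = 0)} q"
    and z: "z \<in> D"
  shows "cmod (q z) \<le> 1"
proof -
  have csD: "csqrt s \<in> D" if "Im s > 0" for s
  proof -
    define u where "u = csqrt s"
    have "u\<^sup>2 = s" "Re u \<ge> 0" unfolding u_def using Re_csqrt by auto
    moreover from this have "2 * (Re u * Im u) = Im s" by (auto simp: power2_eq_square)
    ultimately have "Re u > 0" "Re u * Im u > 0" using that by (smt (verit) mult_eq_0_iff)+
    then show ?thesis unfolding D_def u_def[symmetric] by (simp add: zero_less_mult_iff)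
  qed
  have csh: "csqrt holomorphic_on upper_half_plane"
    by (rule holomorphic_on_subset[OF holomorphic_on_csqrt]) (auto simp: upper_half_plane_def complex_nonpos_Reals_iff)
  have im: "csqrt ` upper_half_plane \<subseteq> D" using csD by (auto simp: upper_half_plane_def)
  have le2: "cmod u \<le> Re u + Im u" "Re u + Im u \<le> 2 * cmod u" if "u \<in> D" for u
    using that cmod_le[of u] abs_Re_le_cmod[of u] abs_Im_le_cmod[of u] unfolding D_def by auto
  have zz: "csqrt (z\<^sup>2) = z" using z unfolding D_def by (simp add: csqrt_square)
  have Iz: "Im (z\<^sup>2) > 0" using z unfolding D_def by (simp add: power2_eq_square)
  have "cmod (q z) \<le> exp (2 * C * Im (z\<^sup>2) / T)" if T: "T > 0" for T :: real
  proof -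
    have T2: "Im (\<i> * of_real (T\<^sup>2)) > 0" using T by simp
    have nT: "cmod (csqrt (\<i> * of_real (T\<^sup>2))) = T" using T by (simp add: norm_csqrt norm_mult norm_power real_sqrt_abs)
    have "cmod ((q \<circ> csqrt) (z\<^sup>2)) \<le> exp ((2 * C * T) * (Im (z\<^sup>2) / Im (\<i> * of_real (T\<^sup>2))))"
    proof (rule half_plane_bounded_type_bound[where q = "q \<circ> csqrt" and h = "\<lambda>s. exp (- (of_real C * (1 - \<i>) * csqrt s))"])
      show "q \<circ> csqrt holomorphic_on upper_half_plane"
        using holomorphic_on_compose_gen[OF csh q] im by (auto simp: image_subset_iff_funcset)
      show "(\<lambda>s. exp (- (of_real C * (1 - \<i>) * csqrt s))) holomorphic_on upper_half_plane"
        by (intro holomorphic_intros csh)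
      show "cmod ((q \<circ> csqrt) s * exp (- (of_real C * (1 - \<i>) * csqrt s))) \<le> 1" if s: "Im s > 0" for s
      proof -
        have "cmod ((q \<circ> csqrt) s * exp (- (of_real C * (1 - \<i>) * csqrt s)))
            \<le> exp (C * cmod (csqrt s)) * exp (- (C * (Re (csqrt s) + Im (csqrt s))))"
          using gr[OF csD[OF s]] by (auto simp: norm_mult algebra_simps intro!: mult_mono)
        also have "\<dots> = exp (C * (cmod (csqrt s) - (Re (csqrt s) + Im (csqrt s))))"
          by (simp add: exp_add[symmetric] algebra_simps)
        also have "\<dots> \<le> 1" using le2[OF csD[OF s]] C by (simp add: mult_nonneg_nonpos)
        finally show ?thesis .
      qed
      show "cmod (exp (- (of_real C * (1 - \<i>) * csqrt s))) \<le> 1" if s: "Im s > 0" for s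
      proof -
        have "Re (csqrt s) + Im (csqrt s) \<ge> 0" using le2(1)[OF csD[OF s]] by (smt (verit) norm_ge_zero)
        then have "C * (Re (csqrt s) + Im (csqrt s)) \<ge> 0" using C by (intro mult_nonneg_nonneg)
        then show ?thesis by (simp add: algebra_simps)
      qed
      show "exp (- (2 * C * T)) \<le> cmod (exp (- (of_real C * (1 - \<i>) * csqrt (\<i> * of_real (T\<^sup>2)))))"
        using mult_left_mono[OF le2(2)[OF csD[OF T2]] C] unfolding nT by (simp add: algebra_simps)
      show "subunit_boundary upper_half_plane \<real> (q \<circ> csqrt)"
        unfolding subunit_boundary_def
      proof (intro ballI allI impI)
        fix x :: complex and e :: real assume x: "x \<in> \<real>" and e: "e > 0"
        define b where "b = csqrt x"
        have bb: "b\<^sup>2 = x" unfolding b_def by simp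
        have "Im (b\<^sup>2) = 0" using x unfolding bb by (simp add: complex_is_Real_iff)
        then have "Re b = 0 \<or> Im b = 0" by (auto simp: power2_eq_square)
        moreover have "Re b \<ge> 0" "Im b \<ge> 0 \<or> Re b > 0" unfolding b_def using csqrt_principal[of x] by auto
        ultimately have bA: "b \<in> {z. Re z \<ge> 0 \<and> Im z \<ge> 0 \<and> (Re z = 0 \<or> Im z = 0)}" by auto
        obtain d where d: "d > 0" "\<And>z. z \<in> D \<Longrightarrow> dist z b < d \<Longrightarrow> cmod (q z) \<le> exp e"
          using subunit_boundaryD[OF bd bA e] by blast
        have "cmod ((q \<circ> csqrt) s) \<le> exp e" if s: "s \<in> upper_half_plane" "dist s x < d\<^sup>2" for s
        proof -
          define u where "u = csqrt s"
          have uD: "u \<in> D" using csD s unfolding u_def upper_half_plane_def by auto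
          have us: "u\<^sup>2 = s" unfolding u_def by simp
          have "(u - b) * (u + b) = s - x" unfolding us[symmetric] bb[symmetric] by (simp add: algebra_simps power2_eq_square)
          then have pr: "cmod (u - b) * cmod (u + b) = dist s x" by (metis dist_norm norm_mult)
          \<comment> \<open>Two points of the closed quadrant form an angle of at most pi / 2, so
            \<open>u\<close> is no farther from \<open>b\<close> than from \<open>- b\<close>.
            Therefore |u - b|^2 <= |s - x|, which explains the radius \<open>d^2\<close>.\<close>
          have "0 \<le> Re u * Re b + Im u * Im b" using uD bA unfolding D_def by auto
          then have "(cmod (u - b))\<^sup>2 \<le> (cmod (u + b))\<^sup>2" unfolding cmod_power2 by (simp add: power2_eq_square algebra_simps)
          then have "cmod (u - b) \<le> cmod (u + b)" by (rule power2_le_imp_le) simp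
          then have "cmod (u - b) * cmod (u - b) < d\<^sup>2" using s(2) pr by (smt (verit) mult_left_mono norm_ge_zero)
          then have "dist u b < d" using d(1) by (metis dist_norm less_imp_le power2_eq_square power_less_imp_less_base)
          then show ?thesis using d(2)[OF uD] unfolding u_def by simp
        qed
        then show "\<exists>d>0. \<forall>z\<in>upper_half_plane. dist z x < d \<longrightarrow> cmod ((q \<circ> csqrt) z) \<le> exp e"
          using d(1) by (intro exI[of _ "d\<^sup>2"]) auto
      qed
    qed (use T2 Iz in auto)
    then have "cmod (q z) \<le> exp ((2 * C * T) * (Im (z\<^sup>2) / T\<^sup>2))" using zz by simp
    then show ?thesis using T by (simp add: power2_eq_square)
  qed
  then show ?thesis by (rule exp_scaled_limit)
qed

text \<open>Growth of order 1 is critical for the half-plane, as exp (- i z) shows, and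
  \<open>mt\<close> excludes exactly this. After a small exponential correction the function is
  bounded on the imaginary axis, and the two quadrants are treated separately.\<close>

lemma Phragmen_Lindeloef_half_plane:
  assumes q: "q holomorphic_on upper_half_plane" and C: "0 \<le> C"
    and gr: "\<And>z. Im z > 0 \<Longrightarrow> cmod (q z) \<le> exp (C * cmod z)"
    and bd: "subunit_boundary upper_half_plane \<real> q"
    and mt: "\<And>e. e > 0 \<Longrightarrow> \<forall>\<^sub>F y in at_top. cmod (q (\<i> * of_real y)) \<le> exp (e * y)"
    and z: "Im z > 0"
  shows "cmod (q z) \<le> 1"
proof -
  have oU: "open upper_half_plane" unfolding upper_half_plane_def by (rule open_halfspace_Im_gt)
  have qc: "isCont q z" if "Im z > 0" for z
    using holomorphic_on_imp_continuous_on[OF q] that continuous_on_eq_continuous_at[OF oU]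
    by (auto simp: upper_half_plane_def)
  have main: "cmod (q z) \<le> exp (e * Im z)" if e: "e > 0" for e
  proof -
    \<comment> \<open>The new factor has modulus \<open>exp (- e * Im z)\<close>: it cancels the
      growth that \<open>mt\<close> leaves on the imaginary axis and is at most 1 in the
      half-plane.\<close>
    define q1 where "q1 = (\<lambda>z. q z * exp (\<i> * of_real e * z))"
    have nq1: "cmod (q1 z) = cmod (q z) * exp (- e * Im z)" for z unfolding q1_def by (simp add: norm_mult)
    have q1h: "q1 holomorphic_on upper_half_plane" unfolding q1_def by (intro holomorphic_intros q)
    have q1c: "isCont q1 z" if "Im z > 0" for z unfolding q1_def by (intro continuous_intros qc that)
    have q1q: "cmod (q1 z) \<le> cmod (q z)" if "Im z > 0" for z
      unfolding nq1 using that e by (simp add: mult_left_le)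
    obtain Y where Y: "\<And>y. y \<ge> Y \<Longrightarrow> cmod (q (\<i> * of_real y)) \<le> exp (e * y)"
      using mt[OF e] unfolding eventually_at_top_linorder by blast
    obtain d where d: "d > 0" "\<And>z. Im z > 0 \<Longrightarrow> dist z 0 < d \<Longrightarrow> cmod (q z) \<le> exp 1"
      using subunit_boundaryD[OF bd, of 0 1] unfolding upper_half_plane_def by auto
    have "continuous_on {d/2..Y} (\<lambda>y. q1 (\<i> * of_real y))"
      using d(1) by (intro continuous_at_imp_continuous_on ballI continuous_within_compose3[OF q1c] continuous_intros) auto
    then have "bounded ((\<lambda>y. q1 (\<i> * of_real y)) ` {d/2..Y})"
      by (intro compact_imp_bounded compact_continuous_image) auto
    then obtain A0 where A0: "\<And>y. y \<in> {d/2..Y} \<Longrightarrow> cmod (q1 (\<i> * of_real y)) \<le> A0"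
      unfolding bounded_iff by blast
    define A where "A = max A0 (exp 1)"
    have A1: "A \<ge> 1" "A > 0" unfolding A_def using one_le_exp_iff[of "1::real"] by (auto simp: le_max_iff_disj less_max_iff_disj)
    have Ab: "cmod (q1 (\<i> * of_real y)) \<le> A" if y: "y > 0" for y
    proof -
      consider "y < d" | "y \<ge> Y" | "y \<in> {d/2..Y}" using d(1) by fastforce
      then show ?thesis
      proof cases
        case 1
        then have "cmod (q1 (\<i> * of_real y)) \<le> exp 1" using q1q[of "\<i> * of_real y"] d(2)[of "\<i> * of_real y"] y
          by (auto simp: norm_mult)
        then show ?thesis unfolding A_def by simp
      next
        case 2
        have "cmod (q1 (\<i> * of_real y)) \<le> exp (e * y) * exp (- e * y)" unfolding nq1 using Y[OF 2] by simp
        also have "\<dots> = 1" by (simp add: exp_add[symmetric])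
        finally show ?thesis using A1 by simp
      next
        case 3
        then show ?thesis using A0 unfolding A_def by (simp add: le_max_iff_disj)
      qed
    qed
    let ?D = "{z. Re z > 0 \<and> Im z > 0}"
    let ?S = "{z. Re z \<ge> 0 \<and> Im z \<ge> 0 \<and> (Re z = 0 \<or> Im z = 0)}"
    \<comment> \<open>Both quadrants at once: \<open>\<sigma>\<close> is the identity or the
      reflection in the imaginary axis, and \<open>p\<close> is \<open>q1\<close> or its holomorphic
      reflection.\<close>
    have quarter: "cmod (p z) \<le> A"
      if ph: "p holomorphic_on ?D" and pn: "\<And>z. cmod (p z) = cmod (q1 (\<sigma> z))"
        and s: "\<And>z. cmod (\<sigma> z) = cmod z" "\<And>z. Im (\<sigma> z) = Im z" "\<And>x y. dist (\<sigma> x) (\<sigma> y) = dist x y"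
          "\<And>y. \<sigma> (\<i> * of_real y) = \<i> * of_real y" and z: "z \<in> ?D" for p \<sigma> z
    proof -
      have "cmod (p z / of_real A) \<le> 1"
      proof (rule Phragmen_Lindeloef_quarter_plane[where C=C and q="\<lambda>z. p z / of_real A"])
        show "(\<lambda>z. p z / complex_of_real A) holomorphic_on {z. 0 < Re z \<and> 0 < Im z}"
          using A1 by (intro holomorphic_intros ph) auto
        show "cmod (p z / complex_of_real A) \<le> exp (C * cmod z)" if "z \<in> {z. 0 < Re z \<and> 0 < Im z}" for z
        proof -
          have "cmod (p z / complex_of_real A) \<le> cmod (p z)" using A1 by (simp add: norm_divide divide_le_eq mult_le_cancel_left1)
          also have "\<dots> \<le> cmod (q (\<sigma> z))" unfolding pn using that s(2) q1q by simp
          also have "\<dots> \<le> exp (C * cmod z)" using gr[of "\<sigma> z"] that s by simp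
          finally show ?thesis .
        qed
        show "subunit_boundary {z. 0 < Re z \<and> 0 < Im z} ?S (\<lambda>z. p z / complex_of_real A)"
          unfolding subunit_boundary_def
        proof (intro ballI allI impI)
          fix \<xi> :: complex and \<epsilon> :: real assume xi: "\<xi> \<in> ?S" and \<epsilon>: "\<epsilon> > 0"
          show "\<exists>d>0. \<forall>z\<in>{z. 0 < Re z \<and> 0 < Im z}. dist z \<xi> < d \<longrightarrow> cmod (p z / complex_of_real A) \<le> exp \<epsilon>"
          proof (cases "Im \<xi> = 0")
            case True
            then have "\<sigma> \<xi> \<in> \<real>" using s(2) by (simp add: complex_is_Real_iff)
            then obtain d where d: "d > 0" "\<And>z. z \<in> upper_half_plane \<Longrightarrow> dist z (\<sigma> \<xi>) < d \<Longrightarrow> cmod (q z) \<le> exp \<epsilon>"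
              using subunit_boundaryD[OF bd _ \<epsilon>] by blast
            have "cmod (p z / complex_of_real A) \<le> exp \<epsilon>" if "Im z > 0" "dist z \<xi> < d" for z
            proof -
              have "cmod (p z / complex_of_real A) \<le> cmod (p z)" using A1 by (simp add: norm_divide divide_le_eq mult_le_cancel_left1)
              also have "\<dots> \<le> cmod (q (\<sigma> z))" unfolding pn using that s(2) q1q by simp
              also have "\<dots> \<le> exp \<epsilon>" using d(2)[of "\<sigma> z"] that s by (simp add: upper_half_plane_def)
              finally show ?thesis .
            qed
            then show ?thesis using d(1) by auto
          next
            case False
            then have i0: "Im \<xi> > 0" "Re \<xi> = 0" using xi by auto
            then have xy: "\<xi> = \<i> * of_real (Im \<xi>)" by (simp add: complex_eq_iff)
            have sx: "\<sigma> \<xi> = \<xi>" using s(4)[of "Im \<xi>"] xy by metis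
            have le: "cmod (q1 \<xi>) \<le> A" using Ab[OF i0(1)] xy by metis
            have "0 < A * exp \<epsilon> - A" using A1 \<epsilon> by simp
            then obtain d where d: "d > 0" "\<And>z. dist z \<xi> < d \<Longrightarrow> dist (q1 z) (q1 \<xi>) < A * exp \<epsilon> - A"
              using q1c[OF i0(1)] unfolding continuous_at_eps_delta by blast
            have "cmod (p z / complex_of_real A) \<le> exp \<epsilon>" if "dist z \<xi> < d" for z
            proof -
              have "dist (\<sigma> z) \<xi> < d" using that s(3)[of z \<xi>] sx by simp
              then have "cmod (q1 (\<sigma> z)) \<le> A * exp \<epsilon>" using d(2)[of "\<sigma> z"] le unfolding dist_norm
                by (smt (verit) norm_triangle_sub)
              then show ?thesis using A1 by (simp add: norm_divide pn divide_le_eq mult.commute)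
            qed
            then show ?thesis using d(1) by auto
          qed
        qed
      qed (use C z in auto)
      then show ?thesis using A1 by (simp add: norm_divide)
    qed
    have sub: "?D \<subseteq> upper_half_plane" by (auto simp: upper_half_plane_def)
    have right: "cmod (q1 z) \<le> A" if "Re z > 0" "Im z > 0" for z
      by (rule quarter[of q1 "\<lambda>z. z"]) (use that holomorphic_on_subset[OF q1h sub] in auto)
    have left: "cmod (q1 z) \<le> A" if "Re z < 0" "Im z > 0" for z
    proof -
      have hol: "(cnj \<circ> (\<lambda>z. q1 (- z)) \<circ> cnj) holomorphic_on ?D"
      proof (rule holomorphic_on_compose_cnj_cnj)
        have "(q1 \<circ> uminus) holomorphic_on cnj ` ?D"
          by (rule holomorphic_on_compose_gen[OF _ q1h]) (auto intro!: holomorphic_on_minus holomorphic_on_ident simp: upper_half_plane_def)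
        then show "(\<lambda>z. q1 (- z)) holomorphic_on cnj ` ?D" by (simp add: o_def)
        have "?D = {z. Re z > 0} \<inter> {z. Im z > 0}" by auto
        then show "open ?D" by (simp add: open_halfspace_Re_gt open_halfspace_Im_gt open_Int)
      qed
      have "cmod ((cnj \<circ> (\<lambda>z. q1 (- z)) \<circ> cnj) (- cnj z)) \<le> A"
      proof (rule quarter[OF hol, of "\<lambda>z. - cnj z"])
        show "dist (- cnj x) (- cnj y) = dist x y" for x y
          by (metis complex_cnj_diff complex_mod_cnj dist_minus dist_norm)
      qed (use that in auto)
      then show ?thesis by simp
    qed
    have q1A: "cmod (q1 z) \<le> A" if "Im z > 0" for z
    proof (cases "Re z = 0")
      case True
      then have "z = \<i> * of_real (Im z)" by (simp add: complex_eq_iff)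
      then show ?thesis using Ab[OF that] by metis
    next
      case False
      then consider "Re z < 0" | "Re z > 0" by linarith
      then show ?thesis using left[OF _ that] right[OF _ that] by cases auto
    qed
    \<comment> \<open>Now that \<open>q1\<close> is bounded by \<open>A\<close>, the constant
      \<open>1 / A\<close> serves as denominator; moving the base point up the imaginary axis
      improves the bound \<open>A\<close> to 1.\<close>
    have "cmod (q1 z) \<le> exp ((ln A * Im z) / T)" if T: "T > 0" for T
    proof -
      have "cmod (q1 z) \<le> exp (ln A * (Im z / Im (\<i> * of_real T)))"
      proof (rule half_plane_bounded_type_bound[where q = q1, OF q1h, where h = "\<lambda>_. of_real (1 / A)"])
        show "subunit_boundary upper_half_plane \<real> q1"
          unfolding subunit_boundary_def
        proof (intro ballI allI impI)
          fix \<xi> :: complex and e :: real assume "\<xi> \<in> \<real>" "e > 0"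
          then obtain d where d: "d > 0" "\<And>z. z \<in> upper_half_plane \<Longrightarrow> dist z \<xi> < d \<Longrightarrow> cmod (q z) \<le> exp e"
            using subunit_boundaryD[OF bd] by blast
          show "\<exists>d>0. \<forall>z\<in>upper_half_plane. dist z \<xi> < d \<longrightarrow> cmod (q1 z) \<le> exp e"
          proof (intro exI[of _ d] conjI ballI impI d(1))
            fix z assume z: "z \<in> upper_half_plane" "dist z \<xi> < d"
            show "cmod (q1 z) \<le> exp e"
              by (rule order_trans[OF q1q d(2)[OF z]]) (use z in \<open>simp add: upper_half_plane_def\<close>)
          qed
        qed
        show "exp (- ln A) \<le> cmod (of_real (1/A))" using A1 by (simp add: exp_minus norm_divide inverse_eq_divide del: of_real_divide)
        show "cmod (q1 z * of_real (1/A)) \<le> 1" if "Im z > 0" for z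
          using q1A[OF that] A1 by (simp add: norm_mult norm_divide)
      qed (use T z A1 in \<open>simp_all add: norm_divide\<close>)
      then show ?thesis by simp
    qed
    then have "cmod (q1 z) \<le> 1" by (rule exp_scaled_limit[of _ "ln A * Im z"])
    then have *: "cmod (q z) * exp (- (e * Im z)) \<le> 1" unfolding nq1 by simp
    have "cmod (q z) = (cmod (q z) * exp (- (e * Im z))) * exp (e * Im z)"
      unfolding mult.assoc exp_add[symmetric] by simp
    also have "\<dots> \<le> 1 * exp (e * Im z)" by (rule mult_right_mono[OF *]) simp
    finally show ?thesis by simp
  qed
  show ?thesis
  proof (rule exp_scaled_limit[of _ "Im z"])
    show "cmod (q z) \<le> exp (Im z / T)" if "T > 0" for T using main[of "1 / T"] that by simp
  qed
qed

subsection \<open>Functions of bounded type and non-positive mean type\<close>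

lemma open_upper_half_plane: "open upper_half_plane"
  unfolding upper_half_plane_def by (rule open_halfspace_Im_gt)

lemma connected_upper_half_plane: "connected upper_half_plane"
  unfolding upper_half_plane_def by (rule convex_connected[OF convex_halfspace_Im_gt])

definition nonpos_bounded_type :: "(complex \<Rightarrow> complex) \<Rightarrow> bool" where
  "nonpos_bounded_type N \<longleftrightarrow> bounded_type N \<and> mean_type N \<le> 0"

lemma eln_less_iff:
  assumes "0 \<le> v" "0 < y"
  shows "eln v / ereal y < ereal e \<longleftrightarrow> v < exp (e * y)"
proof (cases "v = 0")
  case False
  then have "ln v / y < e \<longleftrightarrow> v < exp (e * y)"
    using assms by (simp add: pos_divide_less_eq) (metis exp_less_cancel_iff exp_ln less_eq_real_def)
  then show ?thesis using assms False by (simp add: eln_def)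
qed (use assms in \<open>simp add: eln_def\<close>)

text \<open>Exchanges the extended-real upper limit, with value minus infinity where
  \<open>N\<close> vanishes, for an eventual bound that is convenient to multiply. Passing from a
  weak to a strict inequality is paid for by halving \<open>e\<close>.\<close>

lemma mean_type_nonpos_iff:
  "mean_type N \<le> 0 \<longleftrightarrow> (\<forall>e>0. \<forall>\<^sub>F y in at_top. cmod (N (\<i> * of_real y)) \<le> exp (e * y))"
proof -
  have "mean_type N \<le> 0 \<longleftrightarrow> (\<forall>e>0. \<forall>\<^sub>F y in at_top. eln (cmod (N (\<i> * of_real y))) / ereal y < ereal e)"
    unfolding mean_type_def Limsup_le_iff
  proof safe
    fix e :: ereal assume a: "\<forall>e>0. \<forall>\<^sub>F y in at_top. eln (cmod (N (\<i> * complex_of_real y))) / ereal y < ereal e" and e: "0 < e"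
    obtain r where r: "0 < ereal r" "ereal r < e" using ereal_dense2[OF e] by auto
    with a have "\<forall>\<^sub>F y in at_top. eln (cmod (N (\<i> * complex_of_real y))) / ereal y < ereal r" by auto
    then show "\<forall>\<^sub>F x in at_top. eln (cmod (N (\<i> * complex_of_real x))) / ereal x < e"
      using r by (auto elim!: eventually_mono)
  qed (auto simp: zero_ereal_def)
  also have "\<dots> \<longleftrightarrow> (\<forall>e>0. \<forall>\<^sub>F y in at_top. cmod (N (\<i> * of_real y)) < exp (e * y))"
  proof -
    have "(\<forall>\<^sub>F y in at_top. eln (cmod (N (\<i> * of_real y))) / ereal y < ereal e)
        = (\<forall>\<^sub>F y in at_top. cmod (N (\<i> * of_real y)) < exp (e * y))" for e
      by (rule eventually_cong[OF eventually_gt_at_top[of 0]]) (simp add: eln_less_iff)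
    then show ?thesis by simp
  qed
  also have "\<dots> \<longleftrightarrow> (\<forall>e>0. \<forall>\<^sub>F y in at_top. cmod (N (\<i> * of_real y)) \<le> exp (e * y))"
  proof (intro iffI allI impI)
    fix e :: real assume a: "\<forall>e>0. \<forall>\<^sub>F y in at_top. cmod (N (\<i> * of_real y)) \<le> exp (e * y)" and e: "0 < e"
    have "\<forall>\<^sub>F y in at_top. cmod (N (\<i> * of_real y)) \<le> exp (e / 2 * y)" by (rule a[rule_format]) (use e in simp)
    then show "\<forall>\<^sub>F y in at_top. cmod (N (\<i> * of_real y)) < exp (e * y)"
      using eventually_gt_at_top[of 0]
    proof eventually_elim
      case (elim y)
      have "e / 2 * y < e * y" using elim e by simp
      then show ?case using elim(1) by (smt (verit) exp_less_cancel_iff)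
    qed
  next
    fix e :: real assume "\<forall>e>0. \<forall>\<^sub>F y in at_top. cmod (N (\<i> * of_real y)) < exp (e * y)" and "0 < e"
    then have "\<forall>\<^sub>F y in at_top. cmod (N (\<i> * of_real y)) < exp (e * y)" by blast
    then show "\<forall>\<^sub>F y in at_top. cmod (N (\<i> * of_real y)) \<le> exp (e * y)" by eventually_elim simp
  qed
  finally show ?thesis .
qed

lemma nonpos_bounded_typeE:
  assumes "nonpos_bounded_type N"
  obtains g h z0 where "N holomorphic_on upper_half_plane"
    "g holomorphic_on upper_half_plane" "h holomorphic_on upper_half_plane"
    "\<And>z. Im z > 0 \<Longrightarrow> cmod (g z) \<le> 1" "\<And>z. Im z > 0 \<Longrightarrow> cmod (h z) \<le> 1" "Im z0 > 0" "h z0 \<noteq> 0"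
    "\<And>z. Im z > 0 \<Longrightarrow> N z * h z = g z"
    "\<And>e. e > 0 \<Longrightarrow> \<forall>\<^sub>F y in at_top. cmod (N (\<i> * of_real y)) \<le> exp (e * y)"
proof -
  obtain g h z0 where gh: "N holomorphic_on upper_half_plane" "g holomorphic_on upper_half_plane" "h holomorphic_on upper_half_plane"
     "bounded (g ` upper_half_plane)" "bounded (h ` upper_half_plane)" "z0 \<in> upper_half_plane" "h z0 \<noteq> 0"
     "\<And>z. z \<in> upper_half_plane \<Longrightarrow> N z * h z = g z"
    using assms unfolding nonpos_bounded_type_def bounded_type_def by blast
  obtain B1 B2 where B: "\<And>z. z \<in> upper_half_plane \<Longrightarrow> cmod (g z) \<le> B1" "\<And>z. z \<in> upper_half_plane \<Longrightarrow> cmod (h z) \<le> B2"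
    using gh(4,5) unfolding bounded_iff by blast
  define B where "B = max 1 (max B1 B2)"
  have Bp: "B > 0" "\<And>z. z \<in> upper_half_plane \<Longrightarrow> cmod (g z) \<le> B" "\<And>z. z \<in> upper_half_plane \<Longrightarrow> cmod (h z) \<le> B"
    using B unfolding B_def by (auto simp: le_max_iff_disj)
  show ?thesis
  proof (rule that[of "\<lambda>z. g z / of_real B" "\<lambda>z. h z / of_real B" z0])
    show "\<forall>\<^sub>F y in at_top. cmod (N (\<i> * of_real y)) \<le> exp (e * y)" if "e > 0" for e
      using assms mean_type_nonpos_iff that unfolding nonpos_bounded_type_def by blast
  qed (use gh Bp in \<open>auto simp: upper_half_plane_def norm_divide intro!: holomorphic_intros\<close>)
qed

lemma nonpos_bounded_typeI:
  assumes "N holomorphic_on upper_half_plane"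
    "g holomorphic_on upper_half_plane" "h holomorphic_on upper_half_plane"
    "\<And>z. Im z > 0 \<Longrightarrow> cmod (g z) \<le> B" "\<And>z. Im z > 0 \<Longrightarrow> cmod (h z) \<le> B'" "\<exists>z\<in>upper_half_plane. h z \<noteq> 0"
    "\<And>z. Im z > 0 \<Longrightarrow> N z * h z = g z"
    "\<And>e. e > 0 \<Longrightarrow> \<forall>\<^sub>F y in at_top. cmod (N (\<i> * of_real y)) \<le> exp (e * y)"
  shows "nonpos_bounded_type N"
proof -
  have "bounded (g ` upper_half_plane)" "bounded (h ` upper_half_plane)"
    using assms(4,5) unfolding bounded_iff upper_half_plane_def by auto
  then have "bounded_type N" unfolding bounded_type_def
    using assms(1-3,6,7) by (intro conjI exI[of _ g] exI[of _ h]) (auto simp: upper_half_plane_def)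
  then show ?thesis using assms(8) unfolding nonpos_bounded_type_def mean_type_nonpos_iff by simp
qed

text \<open>Keeps a product of denominators from vanishing identically: where \<open>u\<close> is
  nonzero, which is an open set, \<open>v\<close> would vanish, and the identity theorem would give
  \<open>v = 0\<close> everywhere.\<close>

lemma holomorphic_mult_nonzero:
  assumes u: "u holomorphic_on S" and v: "v holomorphic_on S" and S: "open S" "connected S"
    and nz: "\<exists>z\<in>S. u z \<noteq> 0" "\<exists>z\<in>S. v z \<noteq> 0"
  shows "\<exists>z\<in>S. u z * v z \<noteq> 0"
proof (rule ccontr)
  assume z: "\<not> ?thesis"
  obtain p where p: "p \<in> S" "u p \<noteq> 0" using nz by blast
  have "open {z \<in> S. u z \<noteq> 0}"
    using continuous_open_preimage[OF holomorphic_on_imp_continuous_on[OF u] S(1), of "-{0}"]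
    by (auto simp: vimage_def Int_def open_Compl)
  then have "v z = 0" if "z \<in> S" for z
    by (rule analytic_continuation_open[of _ S v "\<lambda>_. 0"]) (use p z S v that in auto)
  then show False using nz by blast
qed

text \<open>Covers sums (\<open>\<kappa> = 1\<close>) and difference quotients (\<open>\<kappa> z = z - w\<close>) at once.\<close>

lemma nonpos_bounded_type_quotient:
  assumes N: "N holomorphic_on upper_half_plane" and N1: "nonpos_bounded_type N1" and N2: "nonpos_bounded_type N2"
    and \<kappa>: "\<kappa> holomorphic_on upper_half_plane" "\<And>z. Im z > 0 \<Longrightarrow> cmod (\<kappa> z) \<le> B * cmod (z + \<i>)" "\<exists>z\<in>upper_half_plane. \<kappa> z \<noteq> 0"
    and \<kappa>1: "\<forall>\<^sub>F y in at_top. cmod (\<kappa> (\<i> * of_real y)) \<ge> 1"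
    and eq: "\<And>z. Im z > 0 \<Longrightarrow> N z * \<kappa> z = a * N1 z + b * N2 z"
  shows "nonpos_bounded_type N"
proof -
  obtain g1 h1 z1 where "N1 holomorphic_on upper_half_plane" and 1: "g1 holomorphic_on upper_half_plane" "h1 holomorphic_on upper_half_plane"
    "\<And>z. Im z > 0 \<Longrightarrow> cmod (g1 z) \<le> 1" "\<And>z. Im z > 0 \<Longrightarrow> cmod (h1 z) \<le> 1" "Im z1 > 0" "h1 z1 \<noteq> 0"
    "\<And>z. Im z > 0 \<Longrightarrow> N1 z * h1 z = g1 z"
    "\<And>e. e > 0 \<Longrightarrow> \<forall>\<^sub>F y in at_top. cmod (N1 (\<i> * of_real y)) \<le> exp (e * y)"
    by (rule nonpos_bounded_typeE[OF N1]) (rule that)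
  obtain g2 h2 z2 where "N2 holomorphic_on upper_half_plane" and 2: "g2 holomorphic_on upper_half_plane" "h2 holomorphic_on upper_half_plane"
    "\<And>z. Im z > 0 \<Longrightarrow> cmod (g2 z) \<le> 1" "\<And>z. Im z > 0 \<Longrightarrow> cmod (h2 z) \<le> 1" "Im z2 > 0" "h2 z2 \<noteq> 0"
    "\<And>z. Im z > 0 \<Longrightarrow> N2 z * h2 z = g2 z"
    "\<And>e. e > 0 \<Longrightarrow> \<forall>\<^sub>F y in at_top. cmod (N2 (\<i> * of_real y)) \<le> exp (e * y)"
    by (rule nonpos_bounded_typeE[OF N2]) (rule that)
  have i1: "cmod (z + \<i>) \<ge> 1" if "Im z > 0" for z
    using abs_Im_le_cmod[of "z + \<i>"] that by simp
  have i0: "z + \<i> \<noteq> 0" if "Im z > 0" for z using i1[OF that] by auto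
  note [simp] = open_upper_half_plane connected_upper_half_plane
  \<comment> \<open>Dividing numerator and denominator by \<open>z + \<i>\<close>, of modulus at
    least 1, turns the possibly linearly growing \<open>\<kappa>\<close> into a bounded
    factor.\<close>
  let ?h = "\<lambda>z. h1 z * h2 z * (\<kappa> z / (z + \<i>))"
  let ?g = "\<lambda>z. (a * g1 z * h2 z + b * g2 z * h1 z) / (z + \<i>)"
  show ?thesis
  proof (rule nonpos_bounded_typeI[OF N, where g = ?g and h = ?h and B = "cmod a + cmod b" and B' = B])
    show "?g holomorphic_on upper_half_plane" "?h holomorphic_on upper_half_plane"
      by (intro holomorphic_intros 1 2 \<kappa>; use i0 in \<open>force simp: upper_half_plane_def\<close>)+
    fix z assume z: "Im z > 0"
    have "cmod (a * g1 z * h2 z + b * g2 z * h1 z) \<le> cmod a + cmod b"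
    proof (rule norm_triangle_le, rule add_mono)
      show "cmod (a * g1 z * h2 z) \<le> cmod a" "cmod (b * g2 z * h1 z) \<le> cmod b"
        using 1(3,4)[OF z] 2(3,4)[OF z] by (auto simp: norm_mult mult.assoc intro!: mult_left_le mult_le_one)
    qed
    then have "cmod (?g z) \<le> (cmod a + cmod b) / 1" unfolding norm_divide using i1[OF z] by (intro frac_le) auto
    then show "cmod (?g z) \<le> cmod a + cmod b" by simp
    have "cmod (\<kappa> z / (z + \<i>)) \<le> B" using \<kappa>(2)[OF z] i1[OF z] by (auto simp: norm_divide divide_le_eq)
    then have "cmod (h1 z * h2 z) * cmod (\<kappa> z / (z + \<i>)) \<le> 1 * B"
      using 1(4)[OF z] 2(4)[OF z] by (intro mult_mono) (auto simp: norm_mult intro: mult_le_one order_trans[OF norm_ge_zero])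
    then show "cmod (?h z) \<le> B" by (simp add: norm_mult norm_divide mult.assoc)
    have "N z * ?h z = (N z * \<kappa> z) * h1 z * h2 z / (z + \<i>)" by simp
    also have "\<dots> = (a * (N1 z * h1 z) * h2 z + b * (N2 z * h2 z) * h1 z) / (z + \<i>)" unfolding eq[OF z] by (simp add: algebra_simps)
    finally show "N z * ?h z = ?g z" unfolding 1(7)[OF z] 2(7)[OF z] .
  next
    have "\<exists>z\<in>upper_half_plane. h1 z * h2 z \<noteq> 0"
      by (rule holomorphic_mult_nonzero[OF 1(2) 2(2) open_upper_half_plane connected_upper_half_plane])
         (use 1 2 in \<open>auto simp: upper_half_plane_def\<close>)
    then have "\<exists>z\<in>upper_half_plane. (h1 z * h2 z) * \<kappa> z \<noteq> 0"
      by (intro holomorphic_mult_nonzero) (use 1 2 \<kappa> in \<open>auto intro!: holomorphic_intros\<close>)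
    then show "\<exists>z\<in>upper_half_plane. ?h z \<noteq> 0" using i0 by (auto simp: upper_half_plane_def)
  next
    fix e :: real assume e: "e > 0"
    then have e2: "e / 2 > 0" by simp
    have "\<forall>\<^sub>F y in at_top. cmod a + cmod b \<le> exp (e / 2 * y)" using e by real_asymp
    with 1(8)[OF e2] 2(8)[OF e2] \<kappa>1 eventually_gt_at_top[of 0]
    show "\<forall>\<^sub>F y in at_top. cmod (N (\<i> * of_real y)) \<le> exp (e * y)"
    proof (eventually_elim)
      case prems: (elim y)
      let ?z = "\<i> * of_real y"
      have "cmod (N ?z) * 1 \<le> cmod (N ?z) * cmod (\<kappa> ?z)" using prems(3) by (intro mult_left_mono) auto
      also have "\<dots> = cmod (a * N1 ?z + b * N2 ?z)" using eq[of ?z] prems(4) by (simp add: norm_mult[symmetric])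
      also have "\<dots> \<le> cmod a * cmod (N1 ?z) + cmod b * cmod (N2 ?z)" by (rule norm_triangle_le) (simp add: norm_mult)
      also have "\<dots> \<le> cmod a * exp (e / 2 * y) + cmod b * exp (e / 2 * y)" using prems(1,2) e by (intro add_mono mult_left_mono) auto
      also have "\<dots> = (cmod a + cmod b) * exp (e / 2 * y)" by (simp add: algebra_simps)
      also have "\<dots> \<le> exp (e / 2 * y) * exp (e / 2 * y)" using prems(5) by (intro mult_right_mono) auto
      also have "\<dots> = exp (e * y)" by (simp add: exp_add[symmetric])
      finally show ?case by simp
    qed
  qed
qed

lemma nonpos_bounded_type_linear:
  assumes N1: "nonpos_bounded_type N1" and N2: "nonpos_bounded_type N2"
  shows "nonpos_bounded_type (\<lambda>z. a * N1 z + b * N2 z)"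
proof (rule nonpos_bounded_type_quotient[OF _ N1 N2, where \<kappa> = "\<lambda>_. 1" and B = 1])
  show "(\<lambda>z. a * N1 z + b * N2 z) holomorphic_on upper_half_plane"
    using N1 N2 unfolding nonpos_bounded_type_def bounded_type_def by (auto intro!: holomorphic_intros)
  show "cmod 1 \<le> 1 * cmod (z + \<i>)" if "Im z > 0" for z
    using abs_Im_le_cmod[of "z + \<i>"] that by simp
  show "\<exists>z\<in>upper_half_plane. (1::complex) \<noteq> 0" by (rule bexI[of _ \<i>]) (auto simp: upper_half_plane_def)
qed auto

lemma nonpos_bounded_type_divide:
  assumes "N holomorphic_on upper_half_plane" "nonpos_bounded_type N1" "\<And>z. Im z > 0 \<Longrightarrow> N z * (z - w) = N1 z"
  shows "nonpos_bounded_type N"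
proof (rule nonpos_bounded_type_quotient[OF assms(1,2,2), where \<kappa> = "\<lambda>z. z - w" and B = "1 + cmod (w + \<i>)" and a = 1 and b = 0])
  show "cmod (z - w) \<le> (1 + cmod (w + \<i>)) * cmod (z + \<i>)" if "Im z > 0" for z
  proof -
    have "cmod (z + \<i>) \<ge> 1" using abs_Im_le_cmod[of "z + \<i>"] that by simp
    then have "cmod (w + \<i>) * 1 \<le> cmod (w + \<i>) * cmod (z + \<i>)" by (intro mult_left_mono) auto
    moreover have "cmod (z - w) \<le> cmod (z + \<i>) + cmod (w + \<i>)" using norm_triangle_ineq4[of "z + \<i>" "w + \<i>"] by simp
    ultimately show ?thesis by (simp add: algebra_simps)
  qed
  have "\<i> - w \<noteq> 0 \<or> 2 * \<i> - w \<noteq> 0" by (auto simp: complex_eq_iff)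
  then show "\<exists>z\<in>upper_half_plane. z - w \<noteq> 0" unfolding upper_half_plane_def by (metis (mono_tags) imaginary_unit.simps(2) mem_Collect_eq mult_2 plus_complex.simps(2) zero_less_one zero_less_two one_add_one)
  show "\<forall>\<^sub>F y in at_top. 1 \<le> cmod (\<i> * of_real y - w)"
    using eventually_ge_at_top[of "1 + Im w"]
  proof eventually_elim
    case (elim y)
    then show ?case using abs_Im_le_cmod[of "\<i> * of_real y - w"] by simp
  qed
qed (use assms in \<open>auto intro!: holomorphic_intros\<close>)

lemma nonpos_bounded_type_bounded:
  assumes "N holomorphic_on upper_half_plane" "\<And>z. Im z > 0 \<Longrightarrow> cmod (N z) \<le> B"
  shows "nonpos_bounded_type N"
proof (rule nonpos_bounded_typeI[OF assms(1) assms(1), where h = "\<lambda>_. 1" and B = B and B' = 1])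
  show "\<exists>z\<in>upper_half_plane. (1::complex) \<noteq> 0" by (rule bexI[of _ \<i>]) (auto simp: upper_half_plane_def)
  fix e :: real assume "e > 0"
  then have "\<forall>\<^sub>F y in at_top. B \<le> exp (e * y)" by real_asymp
  then show "\<forall>\<^sub>F y in at_top. cmod (N (\<i> * of_real y)) \<le> exp (e * y)" using eventually_gt_at_top[of 0]
  proof eventually_elim
    case (elim y)
    then show ?case using assms(2)[of "\<i> * of_real y"] by simp
  qed
qed (use assms in auto)

subsection \<open>Holomorphic dependence of integrals on a parameter\<close>

text \<open>Cauchy's estimate on discs of radius \<open>r / 4\<close> converts the local majorant of
  \<open>f\<close> into one for its difference quotients. Dominated convergence along sequences then
  differentiates under the integral.\<close>

lemma holomorphic_on_lebesgue_integral:
  fixes f :: "complex \<Rightarrow> 'a \<Rightarrow> complex"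
  assumes S: "open S" and hol: "\<And>x. x \<in> space M \<Longrightarrow> (\<lambda>z. f z x) holomorphic_on S"
    and meas: "\<And>z. z \<in> S \<Longrightarrow> f z \<in> borel_measurable M"
    and dom: "\<And>z0. z0 \<in> S \<Longrightarrow> \<exists>r>0. \<exists>b. integrable M b \<and> (\<forall>z\<in>ball z0 r \<inter> S. \<forall>x\<in>space M. cmod (f z x) \<le> b x)"
  shows "(\<lambda>z. \<integral>x. f z x \<partial>M) holomorphic_on S"
proof -
  have "(\<lambda>z. \<integral>x. f z x \<partial>M) field_differentiable at z0" if z0: "z0 \<in> S" for z0
  proof -
    obtain r0 b where r0: "r0 > 0" and b: "integrable M b" "\<forall>z\<in>ball z0 r0 \<inter> S. \<forall>x\<in>space M. cmod (f z x) \<le> b x"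
      using dom[OF z0] by blast
    obtain r1 where r1: "r1 > 0" "ball z0 r1 \<subseteq> S" using S z0 openE by blast
    define r where "r = min r0 r1"
    have r: "r > 0" "ball z0 r \<subseteq> S" "\<And>z x. z \<in> ball z0 r \<Longrightarrow> x \<in> space M \<Longrightarrow> cmod (f z x) \<le> b x"
      using r0 r1 b(2) unfolding r_def by auto
    define D where "D x = deriv (\<lambda>z. f z x) z0" for x
    have lip: "cmod (f z x - f z0 x) \<le> (b x / (r / 4)) * cmod (z - z0)" if z: "z \<in> ball z0 (r / 2)" and x: "x \<in> space M" for z x
    proof (rule field_differentiable_bound[where S = "ball z0 (r/2)"])
      show "((\<lambda>z. f z x) has_field_derivative deriv (\<lambda>z. f z x) w) (at w within ball z0 (r / 2))" if w: "w \<in> ball z0 (r/2)" for w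
      proof -
        have "w \<in> S" using w r by (auto simp: subset_iff)
        then show ?thesis using holomorphic_derivI[OF hol[OF x] S] has_field_derivative_at_within by blast
      qed
      show "cmod (deriv (\<lambda>z. f z x) w) \<le> b x / (r / 4)" if w: "w \<in> ball z0 (r/2)" for w
      proof -
        have sub: "cball w (r/4) \<subseteq> ball z0 r"
        proof
          fix u assume "u \<in> cball w (r/4)"
          then show "u \<in> ball z0 r" using w r(1) dist_triangle[of z0 u w] by (auto simp: dist_commute)
        qed
        have subS: "cball w (r/4) \<subseteq> S" "ball w (r/4) \<subseteq> cball w (r/4)" using sub r(2) by auto
        \<comment> \<open>The Cauchy estimate wants values in an open ball, hence the enlarged bound
          \<open>b x + e\<close>; \<open>e\<close> tends to 0 afterwards.\<close>
        have "cmod (deriv (\<lambda>z. f z x) w) \<le> (b x + e) / (r / 4)" if e: "e > 0" for e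
        proof -
          have "cmod ((deriv ^^ 1) (\<lambda>z. f z x) w) \<le> fact 1 * (b x + e) / (r/4) ^ 1"
          proof (rule Cauchy_higher_deriv_bound[where y = 0])
            show "(\<lambda>z. f z x) holomorphic_on ball w (r/4)" "continuous_on (cball w (r/4)) (\<lambda>z. f z x)"
              using holomorphic_on_subset[OF hol[OF x]] subS holomorphic_on_imp_continuous_on by blast+
            show "f u x \<in> ball 0 (b x + e)" if "u \<in> ball w (r/4)" for u
              using r(3)[OF _ x, of u] sub subS(2) that e by (auto simp: subset_iff)
          qed (use r in auto)
          then show ?thesis by simp
        qed
        then have "\<forall>\<^sub>F e in at_right 0. cmod (deriv (\<lambda>z. f z x) w) \<le> (b x + e) / (r / 4)"
          using eventually_at_right_less by (metis (mono_tags, lifting) eventually_mono)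
        moreover have "((\<lambda>e. (b x + e) / (r / 4)) \<longlongrightarrow> (b x + 0) / (r / 4)) (at_right 0)" using r by (intro tendsto_intros) auto
        ultimately show ?thesis using tendsto_lowerbound[of "\<lambda>e. (b x + e) / (r / 4)" _ "at_right 0"] by simp
      qed
    qed (use z r in auto)
    have Dlim: "((\<lambda>z. (f z x - f z0 x) / (z - z0)) \<longlongrightarrow> D x) (at z0)" if x: "x \<in> space M" for x
      using holomorphic_derivI[OF hol[OF x] S z0, of UNIV] unfolding has_field_derivative_iff D_def by simp
    have lim: "((\<lambda>z. ((\<integral>x. f z x \<partial>M) - (\<integral>x. f z0 x \<partial>M)) / (z - z0)) \<longlongrightarrow> (\<integral>x. D x \<partial>M)) (at z0)"
      unfolding tendsto_at_iff_sequentially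
    proof (intro allI impI)
      fix X :: "nat \<Rightarrow> complex" assume X: "\<forall>i. X i \<in> UNIV - {z0}" "X \<longlonglongrightarrow> z0"
      obtain n0 where n0: "\<And>n. n \<ge> n0 \<Longrightarrow> dist (X n) z0 < r/2" using metric_LIMSEQ_D[OF X(2), of "r/2"] r by auto
      define Y where "Y n = X (n + n0)" for n
      have Y: "Y n \<noteq> z0" "Y n \<in> ball z0 (r/2)" "Y n \<in> S" "Y n \<in> ball z0 r" for n
        using X(1) n0[of "n + n0"] r unfolding Y_def by (auto simp: dist_commute subset_iff)
      have Ylim: "Y \<longlonglongrightarrow> z0" unfolding Y_def using X(2) by (rule LIMSEQ_ignore_initial_segment)
      have int: "integrable M (f z)" if "z \<in> ball z0 r" for z
        by (rule Bochner_Integration.integrable_bound[OF b(1)])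
           (use meas r that in \<open>auto intro!: AE_I2 order_trans[OF r(3)]\<close>)
      have m: "(\<lambda>x. (f (Y n) x - f z0 x) / (Y n - z0)) \<in> borel_measurable M" for n
        using meas[OF Y(3)] meas[OF z0] by measurable
      have pw: "(\<lambda>n. (f (Y n) x - f z0 x) / (Y n - z0)) \<longlonglongrightarrow> D x" if "x \<in> space M" for x
        using Dlim[OF that, unfolded tendsto_at_iff_sequentially] Y(1) Ylim by (auto simp: o_def)
      have "(\<lambda>n. \<integral>x. (f (Y n) x - f z0 x) / (Y n - z0) \<partial>M) \<longlonglongrightarrow> (\<integral>x. D x \<partial>M)"
      proof (rule integral_dominated_convergence[where w = "\<lambda>x. b x / (r/4)"])
        show "D \<in> borel_measurable M" by (rule borel_measurable_LIMSEQ_metric[OF m pw])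
        show "AE x in M. cmod ((f (Y n) x - f z0 x) / (Y n - z0)) \<le> b x / (r / 4)" for n
          using lip[OF Y(2)] Y(1) by (intro AE_I2) (auto simp: norm_divide divide_le_eq)
      qed (use b(1) m pw in auto)
      also have "(\<lambda>n. \<integral>x. (f (Y n) x - f z0 x) / (Y n - z0) \<partial>M) = (\<lambda>n. ((\<integral>x. f (Y n) x \<partial>M) - (\<integral>x. f z0 x \<partial>M)) / (Y n - z0))"
        using int Y r(1) by (auto simp: Bochner_Integration.integral_diff)
      finally show "((\<lambda>z. ((\<integral>x. f z x \<partial>M) - (\<integral>x. f z0 x \<partial>M)) / (z - z0)) \<circ> X) \<longlonglongrightarrow> (\<integral>x. D x \<partial>M)"
        unfolding Y_def o_def by (rule LIMSEQ_offset)
    qed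
    then show ?thesis unfolding field_differentiable_def has_field_derivative_iff by auto
  qed
  then show ?thesis unfolding holomorphic_on_def using field_differentiable_at_within by blast
qed

subsection \<open>The Poisson majorant in the half-plane\<close>

definition poisson_half :: "(real \<Rightarrow> real) \<Rightarrow> complex \<Rightarrow> real" where
  "poisson_half \<rho> z = (1 / pi) * (\<integral>t. Im z * \<rho> t / (cmod (z - of_real t))\<^sup>2 \<partial>lborel)"

lemma Im_le_norm_diff_real: "\<bar>Im z\<bar> \<le> cmod (z - of_real t)"
  using abs_Im_le_cmod[of "z - of_real t"] by simp

lemma integrable_poisson_half:
  assumes "integrable lborel \<rho>" "Im z > 0"
  shows "integrable lborel (\<lambda>t. Im z * \<rho> t / (cmod (z - of_real t))\<^sup>2)"
proof (rule Bochner_Integration.integrable_bound)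
  show "integrable lborel (\<lambda>t. \<rho> t / Im z)" using assms by simp
  have m: "\<rho> \<in> borel_measurable borel" using assms(1) by auto
  show "(\<lambda>t. Im z * \<rho> t / (cmod (z - complex_of_real t))\<^sup>2) \<in> borel_measurable lborel"
    using m by measurable
  show "AE t in lborel. norm (Im z * \<rho> t / (cmod (z - complex_of_real t))\<^sup>2) \<le> norm (\<rho> t / Im z)"
  proof (intro AE_I2)
    fix t
    have "(Im z)\<^sup>2 \<le> (cmod (z - of_real t))\<^sup>2" using Im_le_norm_diff_real[of z t] assms(2) by (intro power_mono) auto
    then have "\<bar>\<rho> t\<bar> * Im z / (cmod (z - of_real t))\<^sup>2 \<le> \<bar>\<rho> t\<bar> * Im z / (Im z)\<^sup>2"
      using assms(2) by (intro divide_left_mono) (auto intro!: mult_pos_pos simp: complex_eq_iff)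
    also have "\<dots> = \<bar>\<rho> t\<bar> / Im z" using assms(2) by (simp add: power2_eq_square)
    finally show "norm (Im z * \<rho> t / (cmod (z - complex_of_real t))\<^sup>2) \<le> norm (\<rho> t / Im z)"
      using assms(2) by (simp add: abs_mult mult.commute)
  qed
qed

lemma poisson_half_mono:
  assumes "integrable lborel \<rho>" "integrable lborel \<sigma>" "Im z > 0" "\<And>t. \<rho> t \<le> \<sigma> t"
  shows "poisson_half \<rho> z \<le> poisson_half \<sigma> z"
  unfolding poisson_half_def
  by (intro mult_left_mono integral_mono integrable_poisson_half divide_right_mono)
     (use assms in auto)

lemma poisson_half_nonneg:
  assumes "Im z > 0" "\<And>t. 0 \<le> \<rho> t"
  shows "0 \<le> poisson_half \<rho> z"
  unfolding poisson_half_def using assms by (intro mult_nonneg_nonneg integral_nonneg_AE AE_I2) auto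

lemma poisson_half_cmult: "poisson_half (\<lambda>t. c * \<rho> t) z = c * poisson_half \<rho> z"
proof -
  have "(\<lambda>t. Im z * (c * \<rho> t) / (cmod (z - of_real t))\<^sup>2) = (\<lambda>t. c * (Im z * \<rho> t / (cmod (z - of_real t))\<^sup>2))" by auto
  then show ?thesis unfolding poisson_half_def by (simp only: integral_mult_right_zero mult.left_commute)
qed

lemma poisson_half_add:
  assumes "integrable lborel \<rho>" "integrable lborel \<sigma>" "Im z > 0"
  shows "poisson_half (\<lambda>t. \<rho> t + \<sigma> t) z = poisson_half \<rho> z + poisson_half \<sigma> z"
proof -
  have "(\<lambda>t. Im z * (\<rho> t + \<sigma> t) / (cmod (z - of_real t))\<^sup>2)
     = (\<lambda>t. Im z * \<rho> t / (cmod (z - of_real t))\<^sup>2 + Im z * \<sigma> t / (cmod (z - of_real t))\<^sup>2)"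
    by (auto simp: algebra_simps add_divide_distrib)
  then show ?thesis unfolding poisson_half_def using assms by (simp add: integrable_poisson_half algebra_simps)
qed

lemma poisson_half_le:
  assumes "integrable lborel \<rho>" "Im z > 0" "\<And>t. 0 \<le> \<rho> t"
  shows "poisson_half \<rho> z \<le> (\<integral>t. \<rho> t \<partial>lborel) / (pi * Im z)"
proof -
  have "(\<integral>t. Im z * \<rho> t / (cmod (z - of_real t))\<^sup>2 \<partial>lborel) \<le> (\<integral>t. \<rho> t / Im z \<partial>lborel)"
  proof (intro integral_mono integrable_poisson_half assms)
    fix t
    have "(Im z)\<^sup>2 \<le> (cmod (z - of_real t))\<^sup>2" using Im_le_norm_diff_real[of z t] assms(2) by (intro power_mono) auto
    then have "Im z * \<rho> t / (cmod (z - of_real t))\<^sup>2 \<le> Im z * \<rho> t / (Im z)\<^sup>2"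
      using assms(2,3) by (intro divide_left_mono) (auto intro!: mult_pos_pos simp: complex_eq_iff)
    then show "Im z * \<rho> t / (cmod (z - of_real t))\<^sup>2 \<le> \<rho> t / Im z" using assms(2) by (simp add: power2_eq_square)
  qed (use assms in auto)
  then show ?thesis unfolding poisson_half_def using assms(2) by (simp add: field_simps)
qed

text \<open>An analytic completion of the Poisson integral. As its real part is
  \<open>poisson_half \<rho>\<close>, the exponential of its negative is a zero-free analytic factor
  of modulus \<open>exp (- poisson_half \<rho> z)\<close>, acting like an outer function.\<close>

definition herglotz :: "(real \<Rightarrow> real) \<Rightarrow> complex \<Rightarrow> complex" where
  "herglotz \<rho> z = (\<integral>t. \<i> * of_real (\<rho> t) / (of_real pi * (z - of_real t)) \<partial>lborel)"

lemma norm_cauchy_kernel_le: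
  assumes "d > 0" "d \<le> \<bar>Im z\<bar>"
  shows "cmod (c / (z - of_real t)) \<le> cmod c / d"
  unfolding norm_divide using assms Im_le_norm_diff_real[of z t] by (intro frac_le) auto

lemma integrable_herglotz:
  assumes "integrable lborel \<rho>" "Im z > 0"
  shows "integrable lborel (\<lambda>t. \<i> * of_real (\<rho> t) / (of_real pi * (z - of_real t)))"
proof (rule Bochner_Integration.integrable_bound)
  show "integrable lborel (\<lambda>t. \<rho> t / (pi * Im z))" using assms by simp
  have m: "\<rho> \<in> borel_measurable borel" using assms(1) by auto
  show "(\<lambda>t. \<i> * of_real (\<rho> t) / (of_real pi * (z - of_real t))) \<in> borel_measurable lborel" using m by measurable
  show "AE t in lborel. norm (\<i> * complex_of_real (\<rho> t) / (complex_of_real pi * (z - complex_of_real t))) \<le> norm (\<rho> t / (pi * Im z))"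
    using norm_cauchy_kernel_le[of "Im z" z "\<i> * of_real (\<rho> t) / of_real pi" for t] assms(2)
    by (intro AE_I2) (simp add: norm_mult norm_divide mult.commute)
qed

lemma herglotz_holomorphic:
  assumes "integrable lborel \<rho>"
  shows "herglotz \<rho> holomorphic_on upper_half_plane"
proof -
  have m: "\<rho> \<in> borel_measurable borel" using assms(1) by auto
  show ?thesis unfolding herglotz_def
  proof (rule holomorphic_on_lebesgue_integral[OF open_upper_half_plane])
    show "(\<lambda>z. \<i> * complex_of_real (\<rho> x) / (complex_of_real pi * (z - complex_of_real x))) holomorphic_on upper_half_plane" for x
      by (intro holomorphic_intros) (auto simp: upper_half_plane_def)
    show "(\<lambda>x. \<i> * complex_of_real (\<rho> x) / (complex_of_real pi * (z - complex_of_real x))) \<in> borel_measurable lborel" for z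
      using m by measurable
    fix z0 assume z0: "z0 \<in> upper_half_plane"
    then have p: "Im z0 > 0" by (simp add: upper_half_plane_def)
    show "\<exists>r>0. \<exists>b. integrable lborel b \<and> (\<forall>z\<in>ball z0 r \<inter> upper_half_plane. \<forall>x\<in>space lborel.
              cmod (\<i> * complex_of_real (\<rho> x) / (complex_of_real pi * (z - complex_of_real x))) \<le> b x)"
    proof (intro exI[of _ "Im z0 / 2"] exI[of _ "\<lambda>x. \<bar>\<rho> x\<bar> / pi / (Im z0 / 2)"] conjI ballI)
      fix z x assume "z \<in> ball z0 (Im z0 / 2) \<inter> upper_half_plane"
      then have "Im z0 / 2 \<le> \<bar>Im z\<bar>" using abs_Im_le_cmod[of "z0 - z"] by (auto simp: dist_norm)
      then show "cmod (\<i> * complex_of_real (\<rho> x) / (complex_of_real pi * (z - complex_of_real x))) \<le> \<bar>\<rho> x\<bar> / pi / (Im z0 / 2)"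
        using norm_cauchy_kernel_le[of "Im z0 / 2" z "\<i> * of_real (\<rho> x) / of_real pi" x] p
        by (simp add: norm_mult norm_divide)
    qed (use p assms in auto)
  qed
qed

lemma Re_herglotz:
  assumes "integrable lborel \<rho>" "Im z > 0"
  shows "Re (herglotz \<rho> z) = poisson_half \<rho> z"
proof -
  have "Re (\<i> * of_real (\<rho> t) / (of_real pi * (z - of_real t))) = (1 / pi) * (Im z * \<rho> t / (cmod (z - of_real t))\<^sup>2)" for t
  proof -
    have nz: "z - of_real t \<noteq> 0" using assms(2) by (auto simp: complex_eq_iff)
    have "\<i> * of_real (\<rho> t) / (of_real pi * (z - of_real t))
       = of_real (\<rho> t / pi) * (\<i> * cnj (z - of_real t)) / of_real ((cmod (z - of_real t))\<^sup>2)"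
      unfolding complex_norm_square using nz by (simp add: field_simps del: complex_cnj_diff)
    also have "Re \<dots> = (\<rho> t / pi) * Im z / (cmod (z - of_real t))\<^sup>2" by (simp only: Re_divide_of_real) simp
    finally show ?thesis by simp
  qed
  then show ?thesis unfolding herglotz_def poisson_half_def integral_Re[OF integrable_herglotz[OF assms], symmetric]
    by (simp only: integral_mult_right_zero)
qed

text \<open>Since \<open>\<rho>\<close> is nonnegative, the integral may be restricted to an
  interval around \<open>x\<close> where \<open>\<rho>\<close> exceeds \<open>m\<close>. The kernel
  integrates there to a difference of arctangents that approaches pi at the boundary.\<close>

lemma poisson_half_lower_semicontinuous:
  assumes \<rho>: "integrable lborel \<rho>" "\<And>t. 0 \<le> \<rho> t" "isCont \<rho> x" and \<eta>: "\<eta> > 0"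
  shows "\<exists>d>0. \<forall>z. Im z > 0 \<longrightarrow> dist z (of_real x) < d \<longrightarrow> \<rho> x - \<eta> \<le> poisson_half \<rho> z"
proof (cases "\<rho> x - \<eta> \<le> 0")
  case True
  show ?thesis
  proof (intro exI[of _ 1] conjI allI impI)
    fix z assume "Im z > 0"
    then show "\<rho> x - \<eta> \<le> poisson_half \<rho> z" using poisson_half_nonneg[of z \<rho>] \<rho>(2) True by (auto intro: order_trans)
  qed simp
next
  case False
  define m where "m = \<rho> x - \<eta> / 2"
  have m: "m > 0" "\<rho> x - \<eta> < m" using False \<eta> unfolding m_def by auto
  obtain \<delta>0 where \<delta>0: "\<delta>0 > 0" "\<And>t. dist t x < \<delta>0 \<Longrightarrow> dist (\<rho> t) (\<rho> x) < \<eta> / 2"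
    using \<rho>(3) \<eta> unfolding continuous_at_eps_delta by (meson half_gt_zero)
  define \<delta> where "\<delta> = \<delta>0 / 2"
  have \<delta>: "\<delta> > 0" "\<And>t. t \<in> {x - \<delta>..x + \<delta>} \<Longrightarrow> m \<le> \<rho> t"
  proof -
    show "\<delta> > 0" using \<delta>0 unfolding \<delta>_def by simp
    fix t assume "t \<in> {x - \<delta>..x + \<delta>}"
    then have "dist t x < \<delta>0" using \<delta>0(1) unfolding \<delta>_def by (auto simp: dist_real_def)
    then show "m \<le> \<rho> t" using \<delta>0(2)[of t] unfolding m_def dist_real_def by linarith
  qed
  \<comment> \<open>The halved radius allows for the offset of \<open>Re z\<close> from
    \<open>x\<close>: with an offset of at most \<open>\<delta> / 2\<close>, both endpoints of the
    interval are at least \<open>\<delta> / 2\<close> away from \<open>Re z\<close>.\<close>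
  have "((\<lambda>y. m * (2 / pi * arctan (\<delta> / (2 * y)))) \<longlongrightarrow> m) (at_right 0)" using \<delta>(1) by real_asymp
  then have "\<forall>\<^sub>F y in at_right 0. \<rho> x - \<eta> < m * (2 / pi * arctan (\<delta> / (2 * y)))"
    using m(2) by (rule order_tendstoD)
  then obtain y0 where y0: "y0 > 0" "\<And>y. 0 < y \<Longrightarrow> y < y0 \<Longrightarrow> \<rho> x - \<eta> < m * (2 / pi * arctan (\<delta> / (2 * y)))"
    unfolding eventually_at_right_field by auto
  show ?thesis
  proof (intro exI[of _ "min (\<delta> / 2) y0"] conjI allI impI)
    fix z assume z: "Im z > 0" "dist z (of_real x) < min (\<delta> / 2) y0"
    define a y where "a = Re z" and "y = Im z"
    have y: "y > 0" "y < y0" and a: "\<bar>a - x\<bar> \<le> \<delta> / 2"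
      using z abs_Im_le_cmod[of "z - of_real x"] abs_Re_le_cmod[of "z - of_real x"] unfolding a_def y_def by (auto simp: dist_norm)
    have nz: "(cmod (z - of_real t))\<^sup>2 = (t - a)\<^sup>2 + y\<^sup>2" for t
      unfolding cmod_power2 a_def y_def by (simp add: power2_commute)
    have pos: "(t - a)\<^sup>2 + y\<^sup>2 > 0" for t using y by (simp add: add_nonneg_pos)
    have D: "((\<lambda>t. arctan ((t - a) / y)) has_real_derivative y / ((t - a)\<^sup>2 + y\<^sup>2)) (at t)" for t
    proof -
      have "((\<lambda>t. arctan ((t - a) / y)) has_real_derivative (1 / y) * inverse (1 + ((t - a) / y)\<^sup>2)) (at t)"
        by (rule derivative_eq_intros refl | use y in simp)+
      also have "(1 / y) * inverse (1 + ((t - a) / y)\<^sup>2) = y / ((t - a)\<^sup>2 + y\<^sup>2)"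
        using y pos[of t] by (simp add: field_simps power2_eq_square)
      finally show ?thesis .
    qed
    define k where "k = (\<lambda>t. y / ((t - a)\<^sup>2 + y\<^sup>2) * indicator {x - \<delta>..x + \<delta>} t)"
    have hb: "has_bochner_integral lborel k
       (arctan ((x + \<delta> - a) / y) - arctan ((x - \<delta> - a) / y))"
      unfolding k_def by (rule has_bochner_integral_FTC_Icc_real[OF _ D]) (use \<delta> pos in \<open>auto intro!: continuous_intros simp: less_imp_neq[THEN not_sym]\<close>)
    have a2: "\<delta> / 2 \<le> x + \<delta> - a" "x - \<delta> - a \<le> - (\<delta> / 2)" using a by linarith+
    have "\<delta> / (2 * y) \<le> (x + \<delta> - a) / y" "(x - \<delta> - a) / y \<le> - (\<delta> / (2 * y))"
      using a2[THEN divide_right_mono, of y] y by simp_all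
    then have "arctan (\<delta> / (2 * y)) \<le> arctan ((x + \<delta> - a) / y)" "arctan ((x - \<delta> - a) / y) \<le> arctan (- (\<delta> / (2 * y)))"
      by (simp_all only: arctan_le_iff)
    then have ar: "2 * arctan (\<delta> / (2 * y)) \<le> arctan ((x + \<delta> - a) / y) - arctan ((x - \<delta> - a) / y)" by (simp add: arctan_minus)
    have "m * (2 / pi * arctan (\<delta> / (2 * y))) \<le> (1 / pi) * (m * (arctan ((x + \<delta> - a) / y) - arctan ((x - \<delta> - a) / y)))"
      using mult_left_mono[OF ar, of m] m(1) by (simp add: field_simps)
    also have "m * (arctan ((x + \<delta> - a) / y) - arctan ((x - \<delta> - a) / y)) = (\<integral>t. m * k t \<partial>lborel)"
      using hb by (simp add: has_bochner_integral_iff)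
    also have "(1 / pi) * \<dots> \<le> (1 / pi) * (\<integral>t. Im z * \<rho> t / (cmod (z - of_real t))\<^sup>2 \<partial>lborel)"
    proof (intro mult_left_mono integral_mono integrable_poisson_half)
      show "integrable lborel (\<lambda>t. m * k t)"
        using hb by (simp add: has_bochner_integral_iff)
      fix t
      show "m * k t \<le> Im z * \<rho> t / (cmod (z - of_real t))\<^sup>2"
      proof (cases "t \<in> {x - \<delta>..x + \<delta>}")
        case True
        then have "m * y \<le> y * \<rho> t" using \<delta>(2)[OF True] y by (simp add: mult.commute)
        then have "m * y / ((t - a)\<^sup>2 + y\<^sup>2) \<le> y * \<rho> t / ((t - a)\<^sup>2 + y\<^sup>2)" using pos[of t] by (intro divide_right_mono) auto
        then show ?thesis unfolding nz y_def[symmetric] k_def using True by simp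
      next
        case False
        then show ?thesis unfolding k_def using z \<rho>(2) by simp
      qed
    qed (use \<rho> z in auto)
    finally show "\<rho> x - \<eta> \<le> poisson_half \<rho> z" using y0(2)[OF y] unfolding poisson_half_def by linarith
  qed (use \<delta> y0 in auto)
qed

text \<open>Dividing \<open>f\<close> by \<open>exp (herglotz \<bar>f\<bar>\<^sup>2)\<close> leaves a function of bounded type whose boundary values
  have modulus at most 1, since \<open>r \<le> exp (r\<^sup>2)\<close>.\<close>

lemma half_plane_poisson_bound:
  assumes f: "continuous_on {z. Im z \<ge> 0} f" and bt: "nonpos_bounded_type f"
    and int: "integrable lborel (\<lambda>t. (cmod (f (of_real t)))\<^sup>2)" and z: "Im z > 0"
  shows "cmod (f z) \<le> exp (poisson_half (\<lambda>t. (cmod (f (of_real t)))\<^sup>2) z)"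
proof -
  define \<rho> where "\<rho> = (\<lambda>t. (cmod (f (of_real t)))\<^sup>2)"
  have \<rho>i: "integrable lborel \<rho>" and \<rho>0: "\<And>t. 0 \<le> \<rho> t" using int unfolding \<rho>_def by auto
  have fc: "continuous_on UNIV (\<lambda>t. f (of_real t))" by (rule continuous_on_compose2[OF f]) (auto intro!: continuous_intros)
  have \<rho>c: "isCont \<rho> x" for x
    using fc unfolding \<rho>_def by (intro continuous_intros) (simp add: continuous_on_eq_continuous_at)
  obtain g h z0 where gh: "f holomorphic_on upper_half_plane" "g holomorphic_on upper_half_plane" "h holomorphic_on upper_half_plane"
    "\<And>z. Im z > 0 \<Longrightarrow> cmod (g z) \<le> 1" "\<And>z. Im z > 0 \<Longrightarrow> cmod (h z) \<le> 1" "Im z0 > 0" "h z0 \<noteq> 0"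
    "\<And>z. Im z > 0 \<Longrightarrow> f z * h z = g z"
    "\<And>e. e > 0 \<Longrightarrow> \<forall>\<^sub>F y in at_top. cmod (f (\<i> * of_real y)) \<le> exp (e * y)"
    by (rule nonpos_bounded_typeE[OF bt]) (rule that)
  define q where "q = (\<lambda>z. f z * exp (- herglotz \<rho> z))"
  have nq: "cmod (q z) = cmod (f z) * exp (- poisson_half \<rho> z)" if "Im z > 0" for z
    unfolding q_def norm_mult norm_exp_eq_Re uminus_complex.sel Re_herglotz[OF \<rho>i that] ..
  have qf: "cmod (q z) \<le> cmod (f z)" if "Im z > 0" for z
    unfolding nq[OF that] using poisson_half_nonneg[OF that, of \<rho>] \<rho>0 by (simp add: mult_left_le)
  have qh: "q holomorphic_on upper_half_plane" unfolding q_def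
    by (intro holomorphic_intros gh herglotz_holomorphic \<rho>i)
  have bd: "subunit_boundary upper_half_plane \<real> q"
    unfolding subunit_boundary_def
  proof (intro ballI allI impI)
    fix \<xi> :: complex and e :: real assume xi: "\<xi> \<in> \<real>" and e: "e > 0"
    then obtain x where x: "\<xi> = of_real x" by (auto elim: Reals_cases)
    define r where "r = cmod (f \<xi>)"
    have rx: "\<rho> x = r\<^sup>2" unfolding \<rho>_def r_def x by simp
    have "r \<le> 1 + r\<^sup>2" using zero_le_power2[of "r - 1/2"] by (simp add: power2_eq_square algebra_simps)
    also have "\<dots> \<le> exp (r\<^sup>2)" by (rule exp_ge_add_one_self)
    also have "\<dots> < exp (r\<^sup>2 + e / 2)" using e by simp
    finally have rl: "exp (r\<^sup>2 + e / 2) - r > 0" by simp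
    then obtain d1 where d1: "d1 > 0" "\<And>z. Im z \<ge> 0 \<Longrightarrow> dist z \<xi> < d1 \<Longrightarrow> dist (f z) (f \<xi>) < exp (r\<^sup>2 + e / 2) - r"
      using f[unfolded continuous_on_iff, rule_format, OF _ rl, of \<xi>] xi by (auto simp: complex_is_Real_iff)
    obtain d2 where d2: "d2 > 0" "\<And>z. Im z > 0 \<Longrightarrow> dist z \<xi> < d2 \<Longrightarrow> \<rho> x - e / 2 \<le> poisson_half \<rho> z"
      using poisson_half_lower_semicontinuous[OF \<rho>i \<rho>0 \<rho>c, of "e/2" x] e unfolding x by auto
    show "\<exists>d>0. \<forall>z\<in>upper_half_plane. dist z \<xi> < d \<longrightarrow> cmod (q z) \<le> exp e"
    proof (intro exI[of _ "min d1 d2"] conjI ballI impI)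
      fix z assume "z \<in> upper_half_plane" "dist z \<xi> < min d1 d2"
      then have z: "Im z > 0" "dist z \<xi> < d1" "dist z \<xi> < d2" by (auto simp: upper_half_plane_def)
      have "cmod (f z) \<le> exp (r\<^sup>2 + e / 2)"
        using d1(2)[of z] z unfolding r_def dist_norm by (smt (verit) norm_triangle_sub)
      moreover have "exp (- poisson_half \<rho> z) \<le> exp (- (r\<^sup>2 - e / 2))" using d2(2)[OF z(1,3)] rx by simp
      ultimately have "cmod (q z) \<le> exp (r\<^sup>2 + e / 2) * exp (- (r\<^sup>2 - e / 2))" unfolding nq[OF z(1)] by (intro mult_mono) auto
      also have "\<dots> = exp e" by (simp add: exp_add[symmetric])
      finally show "cmod (q z) \<le> exp e" .
    qed (use d1 d2 in auto)
  qed
  define V where "V = - ln (cmod (h z0))"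
  have V: "exp (- V) \<le> cmod (h z0)" "V \<ge> 0" using gh(5)[OF gh(6)] gh(7) unfolding V_def by (auto simp: ln_le_zero_iff)
  \<comment> \<open>Bounded type and the boundary behaviour give growth of order one, as the
    Phragmen--Lindeloef principle requires; nonpositive mean type then brings the bound down to
    1.\<close>
  have gr: "cmod (q z) \<le> exp (V / Im z0 * cmod z)" if z: "Im z > 0" for z
  proof -
    have "cmod (q z) \<le> exp (V * (Im z / Im z0))"
    proof (rule half_plane_bounded_type_bound[OF qh gh(3) _ gh(5) gh(6) V(1) bd z])
      show "cmod (q z * h z) \<le> 1" if z: "Im z > 0" for z
      proof -
        have "cmod (q z * h z) \<le> cmod (f z) * cmod (h z)" unfolding norm_mult using qf[OF z] by (intro mult_right_mono) auto
        also have "\<dots> = cmod (g z)" using gh(8)[OF z] by (metis norm_mult)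
        finally show ?thesis using gh(4)[OF z] by linarith
      qed
    qed
    also have "\<dots> \<le> exp (V * (cmod z / Im z0))"
      using V(2) gh(6) abs_Im_le_cmod[of z] by (auto intro!: mult_left_mono divide_right_mono)
    finally show ?thesis by simp
  qed
  have "cmod (q z) \<le> 1"
  proof (rule Phragmen_Lindeloef_half_plane[OF qh _ gr bd _ z])
    fix e :: real assume e: "e > 0"
    show "\<forall>\<^sub>F y in at_top. cmod (q (\<i> * complex_of_real y)) \<le> exp (e * y)"
      using gh(9)[OF e] eventually_gt_at_top[of 0]
    proof eventually_elim
      case (elim y)
      then show ?case using qf[of "\<i> * of_real y"] by simp
    qed
  qed (use V gh(6) in auto)
  then have *: "cmod (f z) * exp (- poisson_half \<rho> z) \<le> 1" using nq[OF z] by simp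
  have "cmod (f z) = (cmod (f z) * exp (- poisson_half \<rho> z)) * exp (poisson_half \<rho> z)"
    unfolding mult.assoc exp_add[symmetric] by simp
  also have "\<dots> \<le> 1 * exp (poisson_half \<rho> z)" by (rule mult_right_mono[OF *]) simp
  finally show ?thesis unfolding \<rho>_def by simp
qed

text \<open>The scale \<open>l = 1 / sqrt A\<close> makes the exponent equal to 1, and exp 1 <= 3
  produces the constant 9. For \<open>A = 0\<close>, a large scale forces
  \<open>a = 0\<close>.\<close>

lemma sq_le_of_scaled_exp_bound:
  assumes "0 \<le> A" "\<And>l. l > 0 \<Longrightarrow> l * a \<le> exp (l\<^sup>2 * A)" "0 \<le> (a::real)"
  shows "a\<^sup>2 \<le> 9 * A"
proof (cases "A = 0")
  case True
  have "a \<le> 0"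
  proof (rule ccontr)
    assume "\<not> a \<le> 0"
    then show False using assms(2)[of "2 / a"] True by simp
  qed
  then show ?thesis using True assms(3) by simp
next
  case False
  then have A: "A > 0" using assms(1) by simp
  have "1 / sqrt A * a \<le> exp ((1 / sqrt A)\<^sup>2 * A)" using A by (intro assms(2)) simp
  also have "(1 / sqrt A)\<^sup>2 * A = 1" using A by (simp add: power_divide)
  finally have "1 / sqrt A * a \<le> 3" using exp_le by linarith
  then have "a \<le> 3 * sqrt A" using A by (simp add: field_simps)
  then have "a\<^sup>2 \<le> (3 * sqrt A)\<^sup>2" using assms(3) by (intro power_mono)
  then show ?thesis using A by (simp add: power_mult_distrib)
qed

text \<open>The bound by the exponential of a Poisson integral is not homogeneous in
  \<open>f\<close>. Applied to all multiples \<open>l * f\<close>, it becomes a quadratic bound by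
  the norm, that is, a bounded point evaluation.\<close>

lemma half_plane_L2_bound:
  assumes f: "continuous_on {z. Im z \<ge> 0} f" and bt: "nonpos_bounded_type f"
    and int: "integrable lborel (\<lambda>t. (cmod (f (of_real t)))\<^sup>2)" and z: "Im z > 0"
  shows "(cmod (f z))\<^sup>2 \<le> 9 * ((\<integral>t. (cmod (f (of_real t)))\<^sup>2 \<partial>lborel) / (pi * Im z))"
proof (rule sq_le_of_scaled_exp_bound)
  let ?I = "\<integral>t. (cmod (f (of_real t)))\<^sup>2 \<partial>lborel"
  show "0 \<le> ?I / (pi * Im z)" using z by (intro divide_nonneg_nonneg integral_nonneg_AE) auto
  fix l :: real assume l: "l > 0"
  have e: "(\<lambda>t. (cmod (of_real l * f (of_real t)))\<^sup>2) = (\<lambda>t. l\<^sup>2 * (cmod (f (of_real t)))\<^sup>2)"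
    by (simp add: norm_mult power_mult_distrib)
  have "cmod (of_real l * f z) \<le> exp (poisson_half (\<lambda>t. (cmod (of_real l * f (of_real t)))\<^sup>2) z)"
  proof (rule half_plane_poisson_bound[where f = "\<lambda>z. of_real l * f z"])
    show "nonpos_bounded_type (\<lambda>z. complex_of_real l * f z)"
      using nonpos_bounded_type_linear[OF bt bt, of "of_real l" 0] by simp
    show "integrable lborel (\<lambda>t. (cmod (complex_of_real l * f (complex_of_real t)))\<^sup>2)" unfolding e using int by simp
  qed (use f z in \<open>auto intro!: continuous_intros\<close>)
  also have "\<dots> \<le> exp (l\<^sup>2 * (?I / (pi * Im z)))"
    unfolding e poisson_half_cmult exp_le_cancel_iff by (rule mult_left_mono[OF poisson_half_le[OF int z]]) auto
  finally show "l * cmod (f z) \<le> exp (l\<^sup>2 * (?I / (pi * Im z)))" using l by (simp add: norm_mult)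
qed simp

subsection \<open>De Branges spaces\<close>

lemma holomorphic_sharp:
  assumes "F holomorphic_on UNIV"
  shows "sharp F holomorphic_on UNIV"
proof -
  have "(cnj \<circ> F \<circ> cnj) holomorphic_on UNIV"
    by (rule holomorphic_on_compose_cnj_cnj) (auto intro: holomorphic_on_subset[OF assms])
  then show ?thesis by (simp add: sharp_def o_def)
qed

lemma entire_isCont: "F holomorphic_on UNIV \<Longrightarrow> isCont F z"
  using holomorphic_on_imp_continuous_on continuous_on_eq_continuous_at open_UNIV by blast

lemma entire_continuous_on: "F holomorphic_on UNIV \<Longrightarrow> continuous_on S F"
  using holomorphic_on_imp_continuous_on holomorphic_on_subset by blast

lemma entire_real_continuous:
  assumes "F holomorphic_on UNIV"
  shows "continuous_on S (\<lambda>x. F (complex_of_real x))"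
  by (rule continuous_on_compose2[OF entire_continuous_on[OF assms, of UNIV]]) (auto intro!: continuous_intros)

lemma entire_real_measurable [measurable (raw)]:
  "F holomorphic_on UNIV \<Longrightarrow> (\<lambda>x. F (complex_of_real x)) \<in> borel_measurable borel"
  by (intro borel_measurable_continuous_onI entire_real_continuous)

definition diff_quotient :: "(complex \<Rightarrow> complex) \<Rightarrow> complex \<Rightarrow> complex \<Rightarrow> complex" where
  "diff_quotient f w z = (if z = w then deriv f w else (f z - f w) / (z - w))"

lemma diff_quotient_holomorphic: "f holomorphic_on UNIV \<Longrightarrow> diff_quotient f w holomorphic_on UNIV"
  unfolding diff_quotient_def using pole_lemma[of f UNIV w] by simp

lemma diff_quotient_mult: "diff_quotient f w z * (z - w) = f z - f w"
  by (simp add: diff_quotient_def)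

text \<open>On the circle \<open>\<bar>\<zeta> - x\<bar> = 1\<close> centred at a real \<open>x\<close> one has \<open>\<bar>(\<zeta> - x)\<^sup>2 - 1\<bar> = 2 \<bar>Im \<zeta>\<bar>\<close>,
  which absorbs the singularity of the bound.\<close>

lemma entire_bound_near_real_axis:
  assumes F: "F holomorphic_on UNIV" and z: "\<bar>Im z\<bar> \<le> 1"
    and bound: "\<And>\<zeta>. dist \<zeta> z \<le> 2 \<Longrightarrow> \<bar>Im \<zeta>\<bar> \<le> 1 \<Longrightarrow> cmod (F \<zeta>) * \<bar>Im \<zeta>\<bar> \<le> A"
  shows "cmod (F z) \<le> 2 * A"
proof (cases "\<bar>Im z\<bar> < 1")
  case True
  define x where "x = complex_of_real (Re z)"
  define h where "h = (\<lambda>\<zeta>. F \<zeta> * ((\<zeta> - x)\<^sup>2 - 1))"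
  have zx: "z - x = \<i> * of_real (Im z)" unfolding x_def by (simp add: complex_eq_iff)
  have nzx: "cmod (z - x) = \<bar>Im z\<bar>" unfolding zx by (simp add: norm_mult)
  have "cmod (h z) \<le> 2 * A"
  proof (rule maximum_modulus_frontier[of h "ball x 1"])
    show "h holomorphic_on interior (ball x 1)" unfolding h_def by (intro holomorphic_intros holomorphic_on_subset[OF F]) auto
    show "continuous_on (closure (ball x 1)) h" unfolding h_def by (intro continuous_intros entire_continuous_on[OF F])
    show "z \<in> ball x 1" using True nzx by (simp add: dist_norm norm_minus_commute)
    fix \<zeta> assume "\<zeta> \<in> frontier (ball x 1)"
    then have n1: "cmod (\<zeta> - x) = 1" by (simp add: dist_norm norm_minus_commute)
    define u where "u = \<zeta> - x"
    have uu: "u * cnj u = 1" using n1 unfolding u_def complex_norm_square[symmetric] by simp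
    have "u\<^sup>2 - 1 = u * (u - cnj u)" unfolding right_diff_distrib uu by (simp add: power2_eq_square)
    then have "cmod (u\<^sup>2 - 1) = cmod (u - cnj u)" using n1 unfolding u_def[symmetric] by (simp add: norm_mult)
    also have "u - cnj u = \<i> * of_real (2 * Im u)" by (simp add: complex_eq_iff)
    also have "cmod \<dots> = 2 * \<bar>Im \<zeta>\<bar>" unfolding u_def x_def by (simp add: norm_mult)
    finally have "cmod (h \<zeta>) = 2 * (cmod (F \<zeta>) * \<bar>Im \<zeta>\<bar>)" unfolding h_def u_def by (simp add: norm_mult)
    moreover have "\<bar>Im \<zeta>\<bar> \<le> 1" using abs_Im_le_cmod[of "\<zeta> - x"] n1 unfolding x_def by simp
    moreover have "dist \<zeta> z \<le> 2" using norm_triangle_ineq4[of "\<zeta> - x" "z - x"] n1 nzx z by (simp add: dist_norm)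
    ultimately show "cmod (h \<zeta>) \<le> 2 * A" using bound[of \<zeta>] by linarith
  qed auto
  moreover have "(z - x)\<^sup>2 - 1 = of_real (- ((Im z)\<^sup>2 + 1))" unfolding zx by (simp add: power_mult_distrib)
  then have "cmod ((z - x)\<^sup>2 - 1) = \<bar>- ((Im z)\<^sup>2 + 1)\<bar>" by (simp only: norm_of_real)
  then have "cmod ((z - x)\<^sup>2 - 1) \<ge> 1" using zero_le_power2[of "Im z"] by linarith
  then have "cmod (F z) * 1 \<le> cmod (h z)" unfolding h_def norm_mult by (intro mult_left_mono) auto
  ultimately show ?thesis by simp
next
  case False
  then have "\<bar>Im z\<bar> = 1" using z by simp
  then have "cmod (F z) \<le> A" using bound[of z] by simp
  moreover have "0 \<le> A" using calculation norm_ge_zero order_trans by blast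
  ultimately show ?thesis by simp
qed

text \<open>Exponential type zero in a form free of logarithms, so that zeros of \<open>F\<close>
  need no separate case.\<close>

definition zero_type :: "(complex \<Rightarrow> complex) \<Rightarrow> bool" where
  "zero_type F \<longleftrightarrow> F holomorphic_on UNIV \<and> (\<forall>e>0. \<exists>R. \<forall>z. R \<le> cmod z \<longrightarrow> cmod (F z) \<le> exp (e * cmod z))"

lemma exp_type_zero_imp_zero_type:
  assumes "exp_type_zero E"
  shows "zero_type E"
  unfolding zero_type_def
proof (intro conjI allI impI)
  show "E holomorphic_on UNIV" using assms by (simp add: exp_type_zero_def)
  fix e :: real assume e: "e > 0"
  have "(\<lambda>z. max 0 (ln (cmod (E z)))) \<in> o[at_infinity](\<lambda>z. cmod z)" using assms by (simp add: exp_type_zero_def)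
  from landau_o.smallD[OF this e] obtain R where R: "\<And>z. R \<le> cmod z \<Longrightarrow> norm (max 0 (ln (cmod (E z)))) \<le> e * norm (cmod z)"
    unfolding eventually_at_infinity by blast
  have "cmod (E z) \<le> exp (e * cmod z)" if "R \<le> cmod z" for z
  proof (cases "E z = 0")
    case False
    have "ln (cmod (E z)) \<le> e * cmod z" using R[OF that] by simp
    then show ?thesis using False by (metis exp_le_cancel_iff exp_ln zero_less_norm_iff)
  qed simp
  then show "\<exists>R. \<forall>z. R \<le> cmod z \<longrightarrow> cmod (E z) \<le> exp (e * cmod z)" by blast
qed

section \<open>Limits of functions of bounded type\<close>

lemma integrable_Fatou:
  fixes u :: "nat \<Rightarrow> 'a \<Rightarrow> real"
  assumes u: "\<And>n. integrable M (u n)" "\<And>n x. 0 \<le> u n x" "\<And>n. n \<ge> n0 \<Longrightarrow> (\<integral>x. u n x \<partial>M) \<le> c"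
    and lim: "\<And>x. x \<in> space M \<Longrightarrow> (\<lambda>n. u n x) \<longlonglongrightarrow> v x" and v: "\<And>x. 0 \<le> v x"
  shows "integrable M v" "(\<integral>x. v x \<partial>M) \<le> c"
proof -
  have vm: "v \<in> borel_measurable M" by (rule borel_measurable_LIMSEQ_metric[OF _ lim]) (use u in auto)
  have c0: "0 \<le> c" using u(3)[of n0] integral_nonneg_AE[of "u n0" M] u(2) by (meson AE_I2 order_refl order_trans)
  have "(\<integral>\<^sup>+x. ennreal (v x) \<partial>M) = (\<integral>\<^sup>+x. liminf (\<lambda>n. ennreal (u n x)) \<partial>M)"
  proof (rule nn_integral_cong)
    fix x assume "x \<in> space M"
    then have "(\<lambda>n. ennreal (u n x)) \<longlonglongrightarrow> ennreal (v x)" using lim by (intro tendsto_ennrealI) auto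
    then show "ennreal (v x) = liminf (\<lambda>n. ennreal (u n x))" using lim_imp_Liminf[OF sequentially_bot] by metis
  qed
  also have "\<dots> \<le> liminf (\<lambda>n. \<integral>\<^sup>+x. ennreal (u n x) \<partial>M)"
    by (rule nn_integral_liminf) (use u in auto)
  also have "\<dots> \<le> liminf (\<lambda>n. ennreal c)"
  proof (rule Liminf_mono)
    show "\<forall>\<^sub>F n in sequentially. (\<integral>\<^sup>+x. ennreal (u n x) \<partial>M) \<le> ennreal c"
      using eventually_ge_at_top[of n0]
    proof eventually_elim
      case (elim n)
      have "(\<integral>\<^sup>+x. ennreal (u n x) \<partial>M) = ennreal (\<integral>x. u n x \<partial>M)"
        by (rule nn_integral_eq_integral[OF u(1)]) (use u(2) in auto)
      then show ?case using u(3)[OF elim] by (simp add: ennreal_leI)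
    qed
  qed
  also have "\<dots> = ennreal c" by (simp add: Liminf_const)
  finally have le: "(\<integral>\<^sup>+x. ennreal (v x) \<partial>M) \<le> ennreal c" .
  then show i: "integrable M v" using vm v
    by (intro integrableI_bounded) (auto simp: le_less_trans[OF _ ennreal_less_top])
  have "ennreal (\<integral>x. v x \<partial>M) \<le> ennreal c" using le nn_integral_eq_integral[OF i] v by simp
  then show "(\<integral>x. v x \<partial>M) \<le> c" using c0 by simp
qed

lemma norm_add_sq_le: "(norm (a + b))\<^sup>2 \<le> 2 * (norm a)\<^sup>2 + 2 * (norm (b::'a::real_normed_vector))\<^sup>2"
proof -
  have "(norm (a + b))\<^sup>2 \<le> (norm a + norm b)\<^sup>2" by (intro power_mono norm_triangle_ineq) auto
  also have "\<dots> \<le> 2 * (norm a)\<^sup>2 + 2 * (norm b)\<^sup>2"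
    using zero_le_power2[of "norm a - norm b"] by (simp add: power2_eq_square algebra_simps)
  finally show ?thesis .
qed

text \<open>Each \<open>f n\<close> is majorised by the Poisson integral of its squared modulus,
  which is at most twice that of \<open>f0\<close> plus twice that of the difference; the latter
  disappears in the limit. So \<open>exp (- (2 * herglotz \<rho>))\<close>, with
  \<open>\<rho>\<close> the squared modulus of \<open>f0\<close> on the line, is a denominator for
  \<open>f0\<close>. Mean type is settled by the pointwise L^2 bound, which even decays along the
  imaginary axis.\<close>

lemma nonpos_bounded_type_limit:
  assumes fn: "\<And>n. continuous_on {z. Im z \<ge> 0} (f n)" "\<And>n. nonpos_bounded_type (f n)"
    and int_fn: "\<And>n. integrable lborel (\<lambda>t. (cmod (f n (of_real t)))\<^sup>2)"
    and f: "f0 holomorphic_on upper_half_plane"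
    and lim: "\<And>z. Im z > 0 \<Longrightarrow> (\<lambda>n. f n z) \<longlonglongrightarrow> f0 z"
    and int_f: "integrable lborel (\<lambda>t. (cmod (f0 (of_real t)))\<^sup>2)"
    and int_d: "\<And>n. integrable lborel (\<lambda>t. (cmod (f n (of_real t) - f0 (of_real t)))\<^sup>2)"
    and lim2: "(\<lambda>n. \<integral>t. (cmod (f n (of_real t) - f0 (of_real t)))\<^sup>2 \<partial>lborel) \<longlonglongrightarrow> 0"
  shows "nonpos_bounded_type f0"
proof -
  let ?\<rho> = "\<lambda>t. (cmod (f0 (of_real t)))\<^sup>2"
  let ?d = "\<lambda>n t. (cmod (f n (of_real t) - f0 (of_real t)))\<^sup>2"
  let ?I = "\<integral>t. ?\<rho> t \<partial>lborel"
  have sq: "(cmod (f n (of_real t)))\<^sup>2 \<le> 2 * ?\<rho> t + 2 * ?d n t" for n t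
    using norm_add_sq_le[of "f0 (of_real t)" "f n (of_real t) - f0 (of_real t)"] by simp
  have maj: "cmod (f0 z) \<le> exp (2 * poisson_half ?\<rho> z)" if z: "Im z > 0" for z
  proof -
    have "cmod (f n z) \<le> exp (2 * poisson_half ?\<rho> z + 2 * ((\<integral>t. ?d n t \<partial>lborel) / (pi * Im z)))" for n
    proof -
      have "cmod (f n z) \<le> exp (poisson_half (\<lambda>t. (cmod (f n (of_real t)))\<^sup>2) z)"
        by (rule half_plane_poisson_bound[OF fn int_fn z])
      moreover have "poisson_half (\<lambda>t. (cmod (f n (of_real t)))\<^sup>2) z \<le> poisson_half (\<lambda>t. 2 * ?\<rho> t + 2 * ?d n t) z"
        using int_fn int_f int_d sq z by (intro poisson_half_mono) auto
      moreover have "\<dots> = 2 * poisson_half ?\<rho> z + 2 * poisson_half (?d n) z"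
        using int_f int_d z by (subst poisson_half_add) (auto simp: poisson_half_cmult)
      moreover have "poisson_half (?d n) z \<le> (\<integral>t. ?d n t \<partial>lborel) / (pi * Im z)"
        by (rule poisson_half_le[OF int_d z]) simp
      ultimately show ?thesis by (smt (verit) exp_le_cancel_iff)
    qed
    moreover have "(\<lambda>n. exp (2 * poisson_half ?\<rho> z + 2 * ((\<integral>t. ?d n t \<partial>lborel) / (pi * Im z)))) \<longlonglongrightarrow> exp (2 * poisson_half ?\<rho> z + 2 * (0 / (pi * Im z)))"
      using z by (intro tendsto_intros lim2) auto
    ultimately show ?thesis using LIMSEQ_le[OF tendsto_norm[OF lim[OF z]]] by simp
  qed
  have ptw: "(cmod (f0 z))\<^sup>2 \<le> 9 * (2 * ?I / (pi * Im z))" if z: "Im z > 0" for z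
  proof -
    have "(cmod (f n z))\<^sup>2 \<le> 9 * ((2 * ?I + 2 * (\<integral>t. ?d n t \<partial>lborel)) / (pi * Im z))" for n
    proof -
      have "(cmod (f n z))\<^sup>2 \<le> 9 * ((\<integral>t. (cmod (f n (of_real t)))\<^sup>2 \<partial>lborel) / (pi * Im z))"
        by (rule half_plane_L2_bound[OF fn int_fn z])
      also have "(\<integral>t. (cmod (f n (of_real t)))\<^sup>2 \<partial>lborel) \<le> (\<integral>t. 2 * ?\<rho> t + 2 * ?d n t \<partial>lborel)"
        using int_fn int_f int_d sq by (intro integral_mono) auto
      also have "\<dots> = 2 * ?I + 2 * (\<integral>t. ?d n t \<partial>lborel)" using int_f int_d by simp
      finally show ?thesis using z by (simp add: divide_right_mono)
    qed
    moreover have "(\<lambda>n. 9 * ((2 * ?I + 2 * (\<integral>t. ?d n t \<partial>lborel)) / (pi * Im z))) \<longlonglongrightarrow> 9 * ((2 * ?I + 2 * 0) / (pi * Im z))"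
      using z by (intro tendsto_intros lim2) auto
    ultimately show ?thesis using LIMSEQ_le[OF tendsto_power[OF tendsto_norm[OF lim[OF z]]]] by simp
  qed
  let ?h = "\<lambda>z. exp (- (2 * herglotz ?\<rho> z))"
  have hn: "cmod (?h z) = exp (- (2 * poisson_half ?\<rho> z))" if "Im z > 0" for z
    using Re_herglotz[OF int_f that] by simp
  show ?thesis
  proof (rule nonpos_bounded_typeI[OF f, where h = ?h and g = "\<lambda>z. f0 z * ?h z" and B = 1 and B' = 1])
    show "?h holomorphic_on upper_half_plane" "(\<lambda>z. f0 z * ?h z) holomorphic_on upper_half_plane"
      by (intro holomorphic_intros f herglotz_holomorphic int_f)+
    show "\<exists>z\<in>upper_half_plane. ?h z \<noteq> 0" by (rule bexI[of _ \<i>]) (auto simp: upper_half_plane_def)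
    fix z assume z: "Im z > 0"
    show "cmod (?h z) \<le> 1" unfolding hn[OF z] using poisson_half_nonneg[OF z, of ?\<rho>] by simp
    have "cmod (f0 z * ?h z) \<le> exp (2 * poisson_half ?\<rho> z) * exp (- (2 * poisson_half ?\<rho> z))"
      unfolding norm_mult hn[OF z] by (rule mult_right_mono[OF maj[OF z]]) simp
    then show "cmod (f0 z * ?h z) \<le> 1" by (simp add: exp_add[symmetric])
  next
    fix e :: real assume e: "e > 0"
    have "\<forall>\<^sub>F y in at_top. 9 * (2 * ?I / (pi * y)) \<le> (exp (e * y))\<^sup>2"
    proof -
      have "\<forall>\<^sub>F y in at_top. 9 * (2 * c / (pi * y)) \<le> (exp (e * y))\<^sup>2" for c :: real using e by real_asymp
      then show ?thesis .
    qed
    then show "\<forall>\<^sub>F y in at_top. cmod (f0 (\<i> * of_real y)) \<le> exp (e * y)" using eventually_gt_at_top[of 0]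
    proof eventually_elim
      case (elim y)
      have "(cmod (f0 (\<i> * of_real y)))\<^sup>2 \<le> 9 * (2 * ?I / (pi * Im (\<i> * of_real y)))" by (rule ptw) (use elim in simp)
      also have "\<dots> = 9 * (2 * ?I / (pi * y))" by simp
      also have "\<dots> \<le> (exp (e * y))\<^sup>2" by (rule elim(1))
      finally have "(cmod (f0 (\<i> * of_real y)))\<^sup>2 \<le> (exp (e * y))\<^sup>2" .
      then show ?case by (rule power2_le_imp_le) simp
    qed
  qed simp
qed

section \<open>The space attached to one de Branges function\<close>

locale de_Branges =
  fixes E :: "complex \<Rightarrow> complex"
  assumes de_Branges_function: "de_Branges_function E" and real_nonzero: "\<And>x. E (complex_of_real x) \<noteq> 0"
begin

abbreviation B :: "(complex \<Rightarrow> complex) set" where "B \<equiv> de_Branges_space E"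

definition sq_density :: "(complex \<Rightarrow> complex) \<Rightarrow> real \<Rightarrow> real" where
  "sq_density F x = (cmod (F (of_real x)) / cmod (E (of_real x)))\<^sup>2"

lemma E_entire: "E holomorphic_on UNIV" and E_less: "Im z > 0 \<Longrightarrow> cmod (E (cnj z)) < cmod (E z)"
  using de_Branges_function unfolding de_Branges_function_def by auto

lemma E_nonzero: "Im z \<ge> 0 \<Longrightarrow> E z \<noteq> 0"
proof (cases "Im z = 0")
  case True
  then have "z = of_real (Re z)" by (simp add: complex_eq_iff)
  then show ?thesis using real_nonzero by metis
next
  case False
  assume "Im z \<ge> 0"
  then show ?thesis using False E_less[of z] by auto
qed

lemma mem_iff: "F \<in> B \<longleftrightarrow> F holomorphic_on UNIV \<and> integrable lborel (sq_density F) \<and>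
    nonpos_bounded_type (\<lambda>z. F z / E z) \<and> nonpos_bounded_type (\<lambda>z. sharp F z / E z)"
  unfolding de_Branges_space_def nonpos_bounded_type_def sq_density_def by auto

lemma entire: "F \<in> B \<Longrightarrow> F holomorphic_on UNIV"
  by (simp add: mem_iff)

lemma dB_norm2_eq: "dB_norm2 E F = (1 / pi) * (\<integral>x. sq_density F x \<partial>lborel)"
  unfolding dB_norm2_def sq_density_def ..

lemma sq_density_nonneg: "0 \<le> sq_density F x"
  by (simp add: sq_density_def)

lemma sq_density_divide: "sq_density F x = (cmod (F (of_real x) / E (of_real x)))\<^sup>2"
  by (simp add: sq_density_def norm_divide)

lemma sq_density_sharp: "sq_density (sharp F) = sq_density F"
  by (rule ext) (simp add: sq_density_def sharp_def)

lemma continuous_sq_density: "F holomorphic_on UNIV \<Longrightarrow> continuous_on S (sq_density F)"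
  unfolding sq_density_def
  by (intro continuous_intros entire_real_continuous E_entire) (use real_nonzero in auto)

lemma measurable_sq_density: "F holomorphic_on UNIV \<Longrightarrow> sq_density F \<in> borel_measurable lborel"
  using borel_measurable_continuous_onI[OF continuous_sq_density[of F UNIV]] by simp

lemma sq_density_linear: "sq_density (\<lambda>z. a * F z + b * G z) x \<le> 2 * (cmod a)\<^sup>2 * sq_density F x + 2 * (cmod b)\<^sup>2 * sq_density G x"
proof -
  have "(cmod (a * F x + b * G x))\<^sup>2 \<le> 2 * (cmod (a * F x))\<^sup>2 + 2 * (cmod (b * G x))\<^sup>2" by (rule norm_add_sq_le)
  then show ?thesis unfolding sq_density_def power_divide
    by (simp add: norm_mult power_mult_distrib divide_right_mono add_divide_distrib[symmetric])
qed

lemma integrable_sq_density_linear: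
  assumes "F holomorphic_on UNIV" "G holomorphic_on UNIV" "integrable lborel (sq_density F)" "integrable lborel (sq_density G)"
  shows "integrable lborel (sq_density (\<lambda>z. a * F z + b * G z))"
proof (rule Bochner_Integration.integrable_bound)
  show "integrable lborel (\<lambda>x. 2 * (cmod a)\<^sup>2 * sq_density F x + 2 * (cmod b)\<^sup>2 * sq_density G x)" using assms by simp
  show "sq_density (\<lambda>z. a * F z + b * G z) \<in> borel_measurable lborel"
    by (intro measurable_sq_density holomorphic_intros assms)
qed (use sq_density_linear sq_density_nonneg in \<open>auto intro!: AE_I2 simp: abs_of_nonneg\<close>)

lemma linear:
  assumes "F \<in> B" "G \<in> B"
  shows "(\<lambda>z. a * F z + b * G z) \<in> B"
proof -
  have "(\<lambda>z. sharp (\<lambda>z. a * F z + b * G z) z / E z) = (\<lambda>z. cnj a * (sharp F z / E z) + cnj b * (sharp G z / E z))"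
    by (simp add: sharp_def add_divide_distrib)
  moreover have "(\<lambda>z. (a * F z + b * G z) / E z) = (\<lambda>z. a * (F z / E z) + b * (G z / E z))" by (simp add: add_divide_distrib)
  moreover have "(\<lambda>z. a * F z + b * G z) holomorphic_on UNIV" using assms by (intro holomorphic_intros entire)
  ultimately show ?thesis using assms
    unfolding mem_iff by (simp only: integrable_sq_density_linear nonpos_bounded_type_linear simp_thms)
qed

lemma divide_E_holomorphic:
  assumes "F holomorphic_on UNIV"
  shows "(\<lambda>z. F z / E z) holomorphic_on upper_half_plane"
proof (rule holomorphic_on_divide)
  show "F holomorphic_on upper_half_plane" "E holomorphic_on upper_half_plane"
    using assms E_entire holomorphic_on_subset by blast+
qed (use E_nonzero in \<open>auto simp: upper_half_plane_def\<close>)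

lemma divide_E_continuous:
  assumes "F holomorphic_on UNIV"
  shows "continuous_on {z. Im z \<ge> 0} (\<lambda>z. F z / E z)"
  by (intro continuous_on_divide entire_continuous_on[OF assms] entire_continuous_on[OF E_entire]) (use E_nonzero in auto)

text \<open>Outside an interval of radius 1 around \<open>Re w\<close>, dividing by
  \<open>z - w\<close> does not increase the modulus; on the interval the density of
  \<open>D\<close> is continuous and hence bounded.\<close>

lemma integrable_sq_density_divide:
  assumes D: "D holomorphic_on UNIV" and eq: "\<And>z. D z * (z - w) = f z" and int: "integrable lborel (sq_density f)"
  shows "integrable lborel (sq_density D)"
proof -
  let ?J = "{Re w - 1..Re w + 1}"
  obtain C where C: "\<And>x. x \<in> ?J \<Longrightarrow> sq_density D x \<le> C"
    using compact_imp_bounded[OF compact_continuous_image[OF continuous_sq_density[OF D] compact_Icc]]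
    unfolding bounded_iff by (metis abs_le_D1 image_eqI real_norm_def)
  show ?thesis
  proof (rule Bochner_Integration.integrable_bound)
    show "integrable lborel (\<lambda>x. sq_density f x + C * indicator ?J x)"
      using int by (intro Bochner_Integration.integrable_add integrable_mult_right) auto
    show "AE x in lborel. norm (sq_density D x) \<le> norm (sq_density f x + C * indicator ?J x)"
    proof (intro AE_I2)
      fix x
      have C0: "C \<ge> 0" using C[of "Re w"] sq_density_nonneg[of D "Re w"] by simp
      have "sq_density D x \<le> sq_density f x + C * indicator ?J x"
      proof (cases "x \<in> ?J")
        case True
        then show ?thesis using C[OF True] sq_density_nonneg[of f x] by simp
      next
        case False
        then have "\<bar>x - Re w\<bar> \<ge> 1" by auto
        then have "cmod (of_real x - w) \<ge> 1" using abs_Re_le_cmod[of "of_real x - w"] by simp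
        then have "cmod (D x) * 1 \<le> cmod (D x) * cmod (of_real x - w)" by (intro mult_left_mono) auto
        also have "\<dots> = cmod (f x)" using eq[of "of_real x"] by (simp add: norm_mult[symmetric])
        finally have "cmod (D x) / cmod (E x) \<le> cmod (f x) / cmod (E x)" by (simp add: divide_right_mono)
        then have "sq_density D x \<le> sq_density f x" unfolding sq_density_def by (intro power_mono) auto
        then show ?thesis using False by simp
      qed
      then show "norm (sq_density D x) \<le> norm (sq_density f x + C * indicator ?J x)"
        using sq_density_nonneg[of D x] by simp
    qed
  qed (rule measurable_sq_density[OF D])
qed

lemma divide_mem:
  assumes D: "D holomorphic_on UNIV" and eq: "\<And>z. D z * (z - w) = f z" and f: "f \<in> B"
  shows "D \<in> B"
proof -
  have "nonpos_bounded_type (\<lambda>z. D z / E z)"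
  proof (rule nonpos_bounded_type_divide[OF divide_E_holomorphic[OF D]])
    show "D z / E z * (z - w) = f z / E z" for z using eq[of z] by (simp add: field_simps)
  qed (use f in \<open>simp add: mem_iff\<close>)
  moreover have "nonpos_bounded_type (\<lambda>z. sharp D z / E z)"
  proof (rule nonpos_bounded_type_divide[OF divide_E_holomorphic[OF holomorphic_sharp[OF D]]])
    fix z
    have "sharp D z * (z - cnj w) = sharp f z"
      using arg_cong[OF eq[of "cnj z"], of cnj] by (simp add: sharp_def)
    then show "sharp D z / E z * (z - cnj w) = sharp f z / E z" by (simp add: field_simps)
  qed (use f in \<open>simp add: mem_iff\<close>)
  ultimately show ?thesis using D f integrable_sq_density_divide[OF D eq] unfolding mem_iff by blast
qed

lemma diff_quotient_mem:
  assumes "f \<in> B" "f w = 0"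
  shows "diff_quotient f w \<in> B"
  by (rule divide_mem[where w = w, OF diff_quotient_holomorphic[OF entire[OF assms(1)]] _ assms(1)]) (simp add: diff_quotient_mult assms(2))

text \<open>Up to a constant factor \<open>k\<close> is the reproducing kernel at
  \<open>\<i>\<close>. Membership follows from |f| <= 2 |E i| |E| on the closed upper half-plane and
  the square integrability of 1 / |x + i|; nonvanishing at \<open>\<i>\<close> is the strict de
  Branges inequality at that point.\<close>

lemma nonzero_element: "\<exists>k\<in>B. k \<i> \<noteq> 0"
proof -
  define f where "f = (\<lambda>z. E z * cnj (E \<i>) - sharp E z * E (- \<i>))"
  define k where "k = diff_quotient f (- \<i>)"
  have f: "f holomorphic_on UNIV" unfolding f_def by (intro holomorphic_intros E_entire holomorphic_sharp)
  have k: "k holomorphic_on UNIV" unfolding k_def by (rule diff_quotient_holomorphic[OF f])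
  have f0: "f (- \<i>) = 0" unfolding f_def sharp_def by simp
  have eq: "k z * (z + \<i>) = f z" for z using diff_quotient_mult[of f "- \<i>" z] f0 unfolding k_def by simp
  have lt: "cmod (E (- \<i>)) \<le> cmod (E \<i>)" using E_less[of \<i>] by simp
  have sl: "cmod (sharp E z) \<le> cmod (E z)" if "Im z \<ge> 0" for z
  proof (cases "Im z = 0")
    case True
    then have "cnj z = z" by (simp add: complex_eq_iff)
    then show ?thesis by (simp add: sharp_def)
  next
    case False
    then show ?thesis using E_less[of z] that by (simp add: sharp_def)
  qed
  have fE: "cmod (f z) \<le> 2 * cmod (E \<i>) * cmod (E z)" if "Im z \<ge> 0" for z
  proof -
    have "cmod (f z) \<le> cmod (E z) * cmod (E \<i>) + cmod (sharp E z) * cmod (E (- \<i>))"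
      unfolding f_def by (rule order_trans[OF norm_triangle_ineq4]) (simp add: norm_mult)
    also have "cmod (sharp E z) * cmod (E (- \<i>)) \<le> cmod (E z) * cmod (E \<i>)" using lt sl[OF that] by (intro mult_mono) auto
    finally show ?thesis by simp
  qed
  have sf: "sharp f z = sharp E z * E \<i> - E z * cnj (E (- \<i>))" for z unfolding f_def sharp_def by simp
  have sfE: "cmod (sharp f z) \<le> 2 * cmod (E \<i>) * cmod (E z)" if "Im z \<ge> 0" for z
  proof -
    have "cmod (sharp f z) \<le> cmod (sharp E z) * cmod (E \<i>) + cmod (E z) * cmod (E (- \<i>))"
      unfolding sf by (rule order_trans[OF norm_triangle_ineq4]) (simp add: norm_mult)
    also have "\<dots> \<le> cmod (E z) * cmod (E \<i>) + cmod (E z) * cmod (E \<i>)" using lt sl[OF that] by (intro add_mono mult_mono) auto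
    finally show ?thesis by simp
  qed
  have bt: "nonpos_bounded_type (\<lambda>z. F z / E z)"
    if "F holomorphic_on UNIV" "\<And>z. Im z \<ge> 0 \<Longrightarrow> cmod (F z) \<le> 2 * cmod (E \<i>) * cmod (E z)" for F
    by (rule nonpos_bounded_type_bounded[OF divide_E_holomorphic[OF that(1)], of "2 * cmod (E \<i>)"])
       (use that(2) E_nonzero in \<open>auto simp: norm_divide divide_le_eq\<close>)
  have "nonpos_bounded_type (\<lambda>z. k z / E z)"
  proof (rule nonpos_bounded_type_divide[OF divide_E_holomorphic[OF k] bt[OF f fE]])
    show "k z / E z * (z - (- \<i>)) = f z / E z" for z using eq[of z] by (simp add: field_simps)
  qed
  moreover have "nonpos_bounded_type (\<lambda>z. sharp k z / E z)"
  proof (rule nonpos_bounded_type_divide[OF divide_E_holomorphic[OF holomorphic_sharp[OF k]] bt[OF holomorphic_sharp[OF f] sfE]])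
    fix z
    have "sharp k z * (z - \<i>) = sharp f z"
      using arg_cong[OF eq[of "cnj z"], of cnj] by (simp add: sharp_def)
    then show "sharp k z / E z * (z - \<i>) = sharp f z / E z" by (simp add: field_simps)
  qed
  moreover have "integrable lborel (sq_density k)"
  proof (rule Bochner_Integration.integrable_bound)
    show "integrable lborel (\<lambda>x. (2 * cmod (E \<i>))\<^sup>2 * inverse (1 + x\<^sup>2))"
      using integrable_inverse_1_plus_square by (simp add: set_integrable_def einterval_def)
    show "AE x in lborel. norm (sq_density k x) \<le> norm ((2 * cmod (E \<i>))\<^sup>2 * inverse (1 + x\<^sup>2))"
    proof (intro AE_I2)
      fix x :: real
      have c: "(cmod (of_real x + \<i>))\<^sup>2 = 1 + x\<^sup>2" unfolding cmod_power2 by simp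
      have p: "1 + x\<^sup>2 > 0" by (simp add: add_pos_nonneg)
      have "(cmod (k x))\<^sup>2 * (1 + x\<^sup>2) = (cmod (f x))\<^sup>2" unfolding c[symmetric] power_mult_distrib[symmetric] norm_mult[symmetric] eq ..
      also have "\<dots> \<le> (2 * cmod (E \<i>) * cmod (E x))\<^sup>2" using fE[of "of_real x"] by (intro power_mono) auto
      finally have "(cmod (k x))\<^sup>2 \<le> (2 * cmod (E \<i>))\<^sup>2 * (cmod (E x))\<^sup>2 * inverse (1 + x\<^sup>2)"
        using p by (simp add: field_simps power_mult_distrib)
      then have "sq_density k x \<le> (2 * cmod (E \<i>))\<^sup>2 * inverse (1 + x\<^sup>2)"
        unfolding sq_density_def power_divide using real_nonzero[of x] by (simp add: divide_le_eq mult_ac)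
      then show "norm (sq_density k x) \<le> norm ((2 * cmod (E \<i>))\<^sup>2 * inverse (1 + x\<^sup>2))"
        using sq_density_nonneg[of k x] by simp
    qed
  qed (rule measurable_sq_density[OF k])
  ultimately have "k \<in> B" using k by (simp add: mem_iff)
  moreover have "k \<i> \<noteq> 0"
  proof
    assume "k \<i> = 0"
    then have "f \<i> = 0" using eq[of \<i>] by simp
    then have "E \<i> * cnj (E \<i>) = E (- \<i>) * cnj (E (- \<i>))" unfolding f_def sharp_def by simp
    then have "(cmod (E \<i>))\<^sup>2 = (cmod (E (- \<i>)))\<^sup>2" unfolding complex_norm_square[symmetric] by (simp only: of_real_eq_iff)
    then show False using E_less[of \<i>] by simp
  qed
  ultimately show ?thesis by blast
qed

text \<open>At a common zero every element could be divided by \<open>z - w\<close> within the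
  space, again and again, so a nonzero element would have a zero of infinite order.\<close>

lemma no_common_zero: "\<exists>G\<in>B. G w \<noteq> 0"
proof (rule ccontr)
  assume "\<not> ?thesis"
  then have z: "\<And>G. G \<in> B \<Longrightarrow> G w = 0" by blast
  obtain k where k: "k \<in> B" "k \<i> \<noteq> 0" using nonzero_element by blast
  have all: "\<exists>G\<in>B. \<forall>z. k z = (z - w) ^ n * G z" for n
  proof (induction n)
    case (Suc n)
    then obtain G where G: "G \<in> B" "\<forall>z. k z = (z - w) ^ n * G z" by blast
    have "G z = diff_quotient G w z * (z - w)" for z using z[OF G(1)] by (simp add: diff_quotient_mult)
    then have "k z = (z - w) ^ Suc n * diff_quotient G w z" for z using G(2) by (simp add: mult_ac)
    then show ?case using diff_quotient_mem[OF G(1) z[OF G(1)]] by blast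
  qed (use k in auto)
  have kw: "k w = 0" by (rule z[OF k(1)])
  have nc: "\<not> k constant_on UNIV" using kw k(2) unfolding constant_on_def by (metis UNIV_I)
  obtain g r n where g: "0 < n" "0 < r" "ball w r \<subseteq> UNIV" "g holomorphic_on ball w r"
      "\<And>x. x \<in> ball w r \<Longrightarrow> k x = (x - w) ^ n * g x" "\<And>x. x \<in> ball w r \<Longrightarrow> g x \<noteq> 0"
    by (rule holomorphic_factor_zero_nonconstant[OF entire[OF k(1)] open_UNIV connected_UNIV UNIV_I kw nc]) blast
  obtain G where G: "G \<in> B" "\<forall>z. k z = (z - w) ^ n * G z" using all by blast
  have "\<forall>\<^sub>F x in at w. g x = G x"
    unfolding eventually_at
  proof (intro exI[of _ r] conjI ballI impI g(2))
    fix x assume x: "x \<noteq> w \<and> dist x w < r"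
    then have "(x - w) ^ n * g x = (x - w) ^ n * G x" using g(5)[of x] G(2) by (simp add: dist_commute)
    then show "g x = G x" using x by simp
  qed
  moreover have "(G \<longlongrightarrow> G w) (at w)" using entire_isCont[OF entire[OF G(1)]] by (simp add: isCont_def)
  ultimately have "(g \<longlongrightarrow> G w) (at w)" using tendsto_cong by blast
  moreover have "(g \<longlongrightarrow> g w) (at w)" using holomorphic_on_imp_continuous_on[OF g(4)] g(2)
    by (simp add: continuous_on_eq_continuous_at isCont_def)
  ultimately have "g w = G w" using tendsto_unique[OF at_neq_bot] by blast
  then show False using z[OF G(1)] g(6)[of w] g(2) by simp
qed

text \<open>Control of \<open>F / E\<close> concerns the upper half-plane, control of
  \<open>sharp F / E\<close> the lower one; the maximum serves both.\<close>

definition E_max :: "complex \<Rightarrow> real" where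
  "E_max z = max (cmod (E z)) (cmod (E (cnj z)))"

lemma dB_norm2_nonneg: "0 \<le> dB_norm2 E F"
  unfolding dB_norm2_eq using sq_density_nonneg by (intro mult_nonneg_nonneg integral_nonneg_AE AE_I2) auto

lemma eval_bound_nonreal:
  assumes F: "F \<in> B" and z: "Im z \<noteq> 0"
  shows "(cmod (F z))\<^sup>2 * \<bar>Im z\<bar> \<le> 9 * dB_norm2 E F * (E_max z)\<^sup>2"
proof -
  have up: "(cmod (G z))\<^sup>2 * Im z \<le> 9 * dB_norm2 E G * (cmod (E z))\<^sup>2"
    if G: "G holomorphic_on UNIV" "nonpos_bounded_type (\<lambda>z. G z / E z)" "integrable lborel (sq_density G)" and z: "Im z > 0" for G z
  proof -
    have "(cmod (G z / E z))\<^sup>2 \<le> 9 * ((\<integral>t. (cmod (G (of_real t) / E (of_real t)))\<^sup>2 \<partial>lborel) / (pi * Im z))"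
      by (rule half_plane_L2_bound[OF divide_E_continuous[OF G(1)] G(2) _ z])
         (use G(3) in \<open>simp add: sq_density_divide[symmetric]\<close>)
    also have "\<dots> = 9 * dB_norm2 E G / Im z" unfolding dB_norm2_eq sq_density_divide by simp
    finally show ?thesis using z E_nonzero[of z] by (simp add: norm_divide power_divide field_simps)
  qed
  have le: "(cmod (E u))\<^sup>2 \<le> (E_max z)\<^sup>2" if "u = z \<or> u = cnj z" for u
    unfolding E_max_def using that by (intro power_mono) auto
  show ?thesis
  proof (cases "Im z > 0")
    case True
    have "(cmod (F z))\<^sup>2 * Im z \<le> 9 * dB_norm2 E F * (cmod (E z))\<^sup>2" using F True by (intro up) (auto simp: mem_iff)
    also have "\<dots> \<le> 9 * dB_norm2 E F * (E_max z)\<^sup>2" using dB_norm2_nonneg le by (intro mult_left_mono) auto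
    finally show ?thesis using True by simp
  next
    case False
    then have i: "Im (cnj z) > 0" using z by simp
    have "(cmod (sharp F (cnj z)))\<^sup>2 * Im (cnj z) \<le> 9 * dB_norm2 E (sharp F) * (cmod (E (cnj z)))\<^sup>2"
      using F i by (intro up holomorphic_sharp) (auto simp: mem_iff sq_density_sharp)
    also have "dB_norm2 E (sharp F) = dB_norm2 E F" unfolding dB_norm2_eq sq_density_sharp ..
    also have "9 * dB_norm2 E F * (cmod (E (cnj z)))\<^sup>2 \<le> 9 * dB_norm2 E F * (E_max z)\<^sup>2" using dB_norm2_nonneg le by (intro mult_left_mono) auto
    finally show ?thesis using i by (simp add: sharp_def)
  qed
qed

text \<open>The bound off the axis blows up like the inverse root of |Im z|, which is weaker than
  the singularity that \<open>entire_bound_near_real_axis\<close> absorbs. That lemma needs a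
  neighbourhood of radius 2, hence the supremum \<open>m\<close> over such a disc, and its factor 2
  times the root of 9 gives the 6.\<close>

lemma eval_bound:
  assumes F: "F \<in> B" and m: "\<And>\<zeta>. dist \<zeta> z \<le> 2 \<Longrightarrow> E_max \<zeta> \<le> m"
  shows "cmod (F z) \<le> 6 * m * sqrt (dB_norm2 E F)"
proof -
  define N where "N = dB_norm2 E F"
  have N: "N \<ge> 0" unfolding N_def by (rule dB_norm2_nonneg)
  have "0 \<le> E_max z" unfolding E_max_def by (simp add: le_max_iff_disj)
  also have "E_max z \<le> m" by (rule m) simp
  finally have m0: "0 \<le> m" .
  have b: "(cmod (F \<zeta>))\<^sup>2 * \<bar>Im \<zeta>\<bar> \<le> (3 * m * sqrt N)\<^sup>2" if "dist \<zeta> z \<le> 2" for \<zeta>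
  proof (cases "Im \<zeta> = 0")
    case False
    have "(cmod (F \<zeta>))\<^sup>2 * \<bar>Im \<zeta>\<bar> \<le> 9 * N * (E_max \<zeta>)\<^sup>2" unfolding N_def by (rule eval_bound_nonreal[OF F False])
    also have "\<dots> \<le> 9 * N * m\<^sup>2" using m[OF that] N by (intro mult_left_mono power_mono) (auto simp: E_max_def le_max_iff_disj)
    finally show ?thesis using N by (simp add: power_mult_distrib mult_ac)
  qed simp
  show ?thesis
  proof (cases "\<bar>Im z\<bar> \<le> 1")
    case True
    have "cmod (F z) \<le> 2 * (3 * m * sqrt N)"
    proof (rule entire_bound_near_real_axis[OF entire[OF F] True])
      fix \<zeta> assume z: "dist \<zeta> z \<le> 2" "\<bar>Im \<zeta>\<bar> \<le> 1"
      have "(cmod (F \<zeta>) * \<bar>Im \<zeta>\<bar>)\<^sup>2 = ((cmod (F \<zeta>))\<^sup>2 * \<bar>Im \<zeta>\<bar>) * \<bar>Im \<zeta>\<bar>" by (simp add: power2_eq_square)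
      also have "\<dots> \<le> ((cmod (F \<zeta>))\<^sup>2 * \<bar>Im \<zeta>\<bar>) * 1" using z(2) by (intro mult_left_mono) auto
      also have "\<dots> \<le> (3 * m * sqrt N)\<^sup>2" using b[OF z(1)] by simp
      finally show "cmod (F \<zeta>) * \<bar>Im \<zeta>\<bar> \<le> 3 * m * sqrt N" by (rule power2_le_imp_le) (use m0 N in simp)
    qed
    then show ?thesis unfolding N_def by simp
  next
    case False
    then have "(cmod (F z))\<^sup>2 * 1 \<le> (cmod (F z))\<^sup>2 * \<bar>Im z\<bar>" by (intro mult_left_mono) auto
    also have "\<dots> \<le> (3 * m * sqrt N)\<^sup>2" by (rule b) simp
    finally have sq: "(cmod (F z))\<^sup>2 \<le> (3 * m * sqrt N)\<^sup>2" by simp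
    have "cmod (F z) \<le> 3 * m * sqrt N" by (rule power2_le_imp_le[OF sq]) (use m0 N in simp)
    also have "\<dots> \<le> 6 * m * sqrt N" using m0 N by (intro mult_right_mono) auto
    finally show ?thesis unfolding N_def .
  qed
qed

text \<open>The evaluation bound looks at \<open>E\<close> on a disc of radius 2 about
  \<open>z\<close>; this shift and the constant factor are absorbed by starting from
  \<open>e / 2\<close>.\<close>

lemma zero_type:
  assumes E: "zero_type E" and F: "F \<in> B"
  shows "zero_type F"
  unfolding zero_type_def
proof (intro conjI allI impI entire[OF F])
  fix e :: real assume e: "e > 0"
  obtain R where R: "\<And>z. R \<le> cmod z \<Longrightarrow> cmod (E z) \<le> exp (e / 2 * cmod z)"
    using E e unfolding zero_type_def by (meson half_gt_zero)
  define c where "c = 6 * sqrt (dB_norm2 E F)"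
  have c: "c \<ge> 0" unfolding c_def using dB_norm2_nonneg by simp
  have "\<forall>\<^sub>F r in at_top. c * exp (e / 2 * (r + 2)) \<le> exp (e * r)"
  proof -
    have "\<forall>\<^sub>F r in at_top. c' * exp (e / 2 * (r + 2)) \<le> exp (e * r)" for c' :: real using e by real_asymp
    then show ?thesis .
  qed
  then obtain R1 where R1: "\<And>r. R1 \<le> r \<Longrightarrow> c * exp (e / 2 * (r + 2)) \<le> exp (e * r)"
    unfolding eventually_at_top_linorder by blast
  show "\<exists>R. \<forall>z. R \<le> cmod z \<longrightarrow> cmod (F z) \<le> exp (e * cmod z)"
  proof (intro exI[of _ "max R1 (R + 2)"] allI impI)
    fix z assume z: "max R1 (R + 2) \<le> cmod z"
    have "cmod (F z) \<le> 6 * exp (e / 2 * (cmod z + 2)) * sqrt (dB_norm2 E F)"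
    proof (rule eval_bound[OF F])
      fix \<zeta> assume d: "dist \<zeta> z \<le> 2"
      have n: "cmod \<zeta> \<le> cmod z + 2" "cmod z - 2 \<le> cmod \<zeta>" using d norm_triangle_ineq2[of \<zeta> z] norm_triangle_ineq2[of z \<zeta>] by (auto simp: dist_norm norm_minus_commute)
      have "cmod (E \<zeta>) \<le> exp (e / 2 * cmod \<zeta>)" "cmod (E (cnj \<zeta>)) \<le> exp (e / 2 * cmod \<zeta>)"
        using R[of \<zeta>] R[of "cnj \<zeta>"] n z by auto
      then have "E_max \<zeta> \<le> exp (e / 2 * cmod \<zeta>)" unfolding E_max_def by (rule max.boundedI)
      also have "\<dots> \<le> exp (e / 2 * (cmod z + 2))" using n e by simp
      finally show "E_max \<zeta> \<le> exp (e / 2 * (cmod z + 2))" .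
    qed
    also have "\<dots> = c * exp (e / 2 * (cmod z + 2))" unfolding c_def by simp
    also have "\<dots> \<le> exp (e * cmod z)" using R1 z by simp
    finally show "cmod (F z) \<le> exp (e * cmod z)" .
  qed
qed

text \<open>Evaluation bounds make a Cauchy sequence locally uniformly Cauchy, so an entire limit
  exists; Fatou gives convergence in norm, and the limit stays of bounded type by
  \<open>nonpos_bounded_type_limit\<close>. The pointwise convergence in the conclusion is what
  identifies the limit later.\<close>

lemma complete:
  assumes G: "\<And>n. G n \<in> B"
    and cauchy: "\<And>e. e > 0 \<Longrightarrow> \<exists>n0. \<forall>m\<ge>n0. \<forall>n\<ge>n0. dB_norm2 E (\<lambda>z. G m z - G n z) \<le> e"
  shows "\<exists>G0\<in>B. (\<forall>z. (\<lambda>n. G n z) \<longlonglongrightarrow> G0 z) \<and> (\<lambda>n. dB_norm2 E (\<lambda>z. G n z - G0 z)) \<longlonglongrightarrow> 0"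
proof -
  have diff: "(\<lambda>z. F z - H z) \<in> B" if "F \<in> B" "H \<in> B" for F H using linear[OF that, of 1 "-1"] by simp
  have uc: "uniformly_Cauchy_on (cball 0 r) G" for r
    unfolding uniformly_Cauchy_on_def
  proof (intro allI impI)
    fix e :: real assume e: "e > 0"
    have "continuous_on (cball 0 (r + 2)) E_max" unfolding E_max_def
      by (intro continuous_intros entire_continuous_on[OF E_entire] continuous_on_compose2[OF entire_continuous_on[OF E_entire, of UNIV]]) auto
    from compact_imp_bounded[OF compact_continuous_image[OF this compact_cball]]
    obtain m0 where "\<forall>y\<in>E_max ` cball 0 (r + 2). norm y \<le> m0" unfolding bounded_iff by blast
    then have m0: "\<And>\<zeta>. \<zeta> \<in> cball 0 (r + 2) \<Longrightarrow> E_max \<zeta> \<le> m0" by (fastforce simp: abs_le_iff)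
    define m where "m = max 1 m0"
    have m: "m > 0" "\<And>\<zeta>. \<zeta> \<in> cball 0 (r + 2) \<Longrightarrow> E_max \<zeta> \<le> m" using m0 unfolding m_def by (auto simp: le_max_iff_disj)
    have "(e / (12 * m))\<^sup>2 > 0" using e m by simp
    then obtain n0 where n0: "\<forall>a\<ge>n0. \<forall>b\<ge>n0. dB_norm2 E (\<lambda>z. G a z - G b z) \<le> (e / (12 * m))\<^sup>2" using cauchy by blast
    show "\<exists>M. \<forall>x\<in>cball 0 r. \<forall>a\<ge>M. \<forall>b\<ge>M. dist (G a x) (G b x) < e"
    proof (intro exI[of _ n0] ballI allI impI)
      fix x :: complex and a b assume x: "x \<in> cball 0 r" and ab: "n0 \<le> a" "n0 \<le> b"
      have "cmod (G a x - G b x) \<le> 6 * m * sqrt (dB_norm2 E (\<lambda>z. G a z - G b z))"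
      proof (rule eval_bound[OF diff[OF G G]])
        fix \<zeta> assume "dist \<zeta> x \<le> 2"
        then have "\<zeta> \<in> cball 0 (r + 2)" using x norm_triangle_ineq2[of \<zeta> x] by (simp add: dist_norm)
        then show "E_max \<zeta> \<le> m" by (rule m(2))
      qed
      also have "\<dots> \<le> 6 * m * (e / (12 * m))"
        using n0 ab e m by (intro mult_left_mono real_le_lsqrt) auto
      also have "\<dots> = e / 2" using m by simp
      finally show "dist (G a x) (G b x) < e" using e by (simp add: dist_norm)
    qed
  qed
  then have "\<forall>r. \<exists>g. uniform_limit (cball 0 r) G g sequentially"
    using Cauchy_uniformly_convergent unfolding uniformly_convergent_on_def by blast
  then obtain g where g: "\<And>r. uniform_limit (cball 0 r) G (g r) sequentially" by metis
  define G0 where "G0 z = lim (\<lambda>n. G n z)" for z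
  have pt: "(\<lambda>n. G n z) \<longlonglongrightarrow> G0 z" for z
    using tendsto_uniform_limitI[OF g, of z "cmod z"] unfolding G0_def by (simp add: limI)
  have ul: "uniform_limit (cball 0 r) G G0 sequentially" for r
  proof -
    have "g r z = G0 z" if "z \<in> cball 0 r" for z using tendsto_uniform_limitI[OF g that] pt LIMSEQ_unique by blast
    then show ?thesis using uniform_limit_cong'[of "cball 0 r" G G "g r" G0] g by blast
  qed
  have G0: "G0 holomorphic_on UNIV"
  proof (rule holomorphic_uniform_sequence[OF open_UNIV])
    show "G n holomorphic_on UNIV" for n by (rule entire[OF G])
    show "\<exists>d>0. cball x d \<subseteq> UNIV \<and> uniform_limit (cball x d) G G0 sequentially" for x
    proof (intro exI[of _ 1] conjI)
      have "cball x 1 \<subseteq> cball 0 (cmod x + 1)"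
      proof
        fix y assume "y \<in> cball x 1"
        then show "y \<in> cball 0 (cmod x + 1)" using norm_triangle_ineq2[of y x] by (simp add: dist_norm norm_minus_commute)
      qed
      then show "uniform_limit (cball x 1) G G0 sequentially" using uniform_limit_on_subset[OF ul] by blast
    qed auto
  qed
  have dlim: "(\<lambda>m. sq_density (\<lambda>z. G n z - G m z) x) \<longlonglongrightarrow> sq_density (\<lambda>z. G n z - G0 z) x" for n x
    unfolding sq_density_def using real_nonzero[of x] by (intro tendsto_intros pt) auto
  \<comment> \<open>For fixed \<open>n\<close>, Fatou's lemma in the second index passes the Cauchy
    estimate on to the limit.\<close>
  have F: "integrable lborel (sq_density (\<lambda>z. G n z - G0 z))" "(\<integral>x. sq_density (\<lambda>z. G n z - G0 z) x \<partial>lborel) \<le> pi * e"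
    if n0: "\<forall>a\<ge>n0. \<forall>b\<ge>n0. dB_norm2 E (\<lambda>z. G a z - G b z) \<le> e" and n: "n \<ge> n0" for n n0 e
  proof -
    have 1: "integrable lborel (sq_density (\<lambda>z. G n z - G m z))" for m using diff[OF G G] by (simp add: mem_iff)
    have 2: "(\<integral>x. sq_density (\<lambda>z. G n z - G m z) x \<partial>lborel) \<le> pi * e" if "m \<ge> n0" for m
      using n0 n that unfolding dB_norm2_eq by (simp add: field_simps)
    note F = integrable_Fatou[where u = "\<lambda>m. sq_density (\<lambda>z. G n z - G m z)" and v = "sq_density (\<lambda>z. G n z - G0 z)"
        and M = lborel and ?n0.0 = n0 and c = "pi * e"]
    show "integrable lborel (sq_density (\<lambda>z. G n z - G0 z))"
      by (rule F(1)) (use 1 2 dlim sq_density_nonneg in simp_all)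
    show "(\<integral>x. sq_density (\<lambda>z. G n z - G0 z) x \<partial>lborel) \<le> pi * e"
      by (rule F(2)) (use 1 2 dlim sq_density_nonneg in simp_all)
  qed
  obtain n1 where n1: "\<forall>a\<ge>n1. \<forall>b\<ge>n1. dB_norm2 E (\<lambda>z. G a z - G b z) \<le> 1" using cauchy[of 1] by auto
  have intG0: "integrable lborel (sq_density G0)"
  proof -
    have "integrable lborel (sq_density (\<lambda>z. 1 * G n1 z + (-1) * (G n1 z - G0 z)))"
      using F(1)[OF n1 order_refl] G[of n1] G0 by (intro integrable_sq_density_linear holomorphic_intros) (auto simp: mem_iff)
    then show ?thesis by simp
  qed
  have intd: "integrable lborel (sq_density (\<lambda>z. G n z - G0 z))" for n
    using integrable_sq_density_linear[OF entire[OF G[of n]] G0 _ intG0, of 1 "-1"] G[of n] by (simp add: mem_iff)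
  have Ilim: "(\<lambda>n. \<integral>x. sq_density (\<lambda>z. G n z - G0 z) x \<partial>lborel) \<longlonglongrightarrow> 0"
  proof (rule LIMSEQ_I)
    fix r :: real assume r: "r > 0"
    then have "r / (2 * pi) > 0" by simp
    then obtain n0 where n0: "\<forall>a\<ge>n0. \<forall>b\<ge>n0. dB_norm2 E (\<lambda>z. G a z - G b z) \<le> r / (2 * pi)" using cauchy by blast
    show "\<exists>no. \<forall>n\<ge>no. norm ((\<integral>x. sq_density (\<lambda>z. G n z - G0 z) x \<partial>lborel) - 0) < r"
    proof (intro exI[of _ n0] allI impI)
      fix n assume "n0 \<le> n"
      then have "(\<integral>x. sq_density (\<lambda>z. G n z - G0 z) x \<partial>lborel) \<le> r / 2" using F(2)[OF n0] by simp
      moreover have "0 \<le> (\<integral>x. sq_density (\<lambda>z. G n z - G0 z) x \<partial>lborel)" using sq_density_nonneg by simp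
      ultimately show "norm ((\<integral>x. sq_density (\<lambda>z. G n z - G0 z) x \<partial>lborel) - 0) < r" using r by simp
    qed
  qed
  have sd: "(cmod (F (of_real x) / E (of_real x) - H (of_real x) / E (of_real x)))\<^sup>2 = sq_density (\<lambda>z. F z - H z) x" for F H x
    by (simp add: sq_density_divide diff_divide_distrib)
  have sd': "(cmod (sharp F (of_real x) / E (of_real x) - sharp H (of_real x) / E (of_real x)))\<^sup>2 = sq_density (\<lambda>z. F z - H z) x" for F H x
    unfolding sq_density_def sharp_def complex_cnj_complex_of_real
      diff_divide_distrib[symmetric] complex_cnj_diff[symmetric] norm_divide complex_mod_cnj ..
  have "nonpos_bounded_type (\<lambda>z. G0 z / E z)"
  proof (rule nonpos_bounded_type_limit[where f = "\<lambda>n z. G n z / E z"])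
    show "(\<lambda>n. G n z / E z) \<longlonglongrightarrow> G0 z / E z" if "Im z > 0" for z using E_nonzero[of z] that by (intro tendsto_intros pt) auto
  qed (use G G0 intd Ilim intG0 in \<open>auto simp: mem_iff sd divide_E_continuous divide_E_holomorphic sq_density_divide[symmetric]\<close>)
  moreover have "nonpos_bounded_type (\<lambda>z. sharp G0 z / E z)"
  proof (rule nonpos_bounded_type_limit[where f = "\<lambda>n z. sharp (G n) z / E z"])
    show "(\<lambda>n. sharp (G n) z / E z) \<longlonglongrightarrow> sharp G0 z / E z" if "Im z > 0" for z
      unfolding sharp_def using E_nonzero[of z] that by (intro tendsto_intros pt) auto
  qed (use G G0 intd Ilim intG0 in \<open>auto simp: mem_iff sd' divide_E_continuous divide_E_holomorphic holomorphic_sharp sq_density_divide[symmetric] sq_density_sharp\<close>)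
  ultimately have "G0 \<in> B" using G0 intG0 by (simp add: mem_iff)
  moreover have "(\<lambda>n. dB_norm2 E (\<lambda>z. G n z - G0 z)) \<longlonglongrightarrow> 0"
    unfolding dB_norm2_eq using tendsto_mult_left[OF Ilim, of "1 / pi"] by simp
  ultimately show ?thesis using pt by blast
qed

end

subsection \<open>A Wirtinger inequality\<close>

text \<open>The model is G = s^2, Y = 2 s s', X = 2 s'^2, for which this is Wirtinger's inequality
  for \<open>s\<close> vanishing at both ends. Stated through the inequality between
  \<open>Y\<close>, \<open>G\<close> and \<open>X\<close>, it applies to \<open>phi0\<close> of a
  function as well. The strict bound on \<open>l * (b - a)\<close> keeps the tangent in
  \<open>c\<close> finite on the closed interval.\<close>

lemma wirtinger_interval:
  fixes G Y X :: "real \<Rightarrow> real"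
  assumes ab: "a \<le> b" and l: "0 < l" "l * (b - a) < pi"
    and G: "\<And>\<theta>. (G has_real_derivative Y \<theta>) (at \<theta>)"
    and cont: "continuous_on {a..b} Y" "continuous_on {a..b} X"
    and nn: "\<And>\<theta>. 0 \<le> G \<theta>" "\<And>\<theta>. 0 \<le> X \<theta>" and YX: "\<And>\<theta>. (Y \<theta>)\<^sup>2 \<le> 2 * G \<theta> * X \<theta>"
    and zero: "G a = 0" "G b = 0"
  shows "0 \<le> integral {a..b} (\<lambda>\<theta>. X \<theta> - 2 * l\<^sup>2 * G \<theta>)"
proof -
  define c where "c = (\<lambda>\<theta>. - l * tan (l * (\<theta> - (a + b) / 2)))"
  have cosp: "cos (l * (\<theta> - (a + b) / 2)) > 0" if "\<theta> \<in> {a..b}" for \<theta>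
  proof (rule cos_gt_zero_pi)
    have e: "- (l * (b - a) / 2) = l * (a - (a + b) / 2)" "l * (b - (a + b) / 2) = l * (b - a) / 2"
      by (simp add: field_simps, simp add: field_simps)
    have "- (l * (b - a) / 2) \<le> l * (\<theta> - (a + b) / 2)"
      unfolding e(1) using that l by (intro mult_left_mono) auto
    then show "- (pi / 2) < l * (\<theta> - (a + b) / 2)" by (rule less_le_trans[rotated]) (use l in simp)
    have "l * (\<theta> - (a + b) / 2) \<le> l * (b - a) / 2"
      unfolding e(2)[symmetric] using that l by (intro mult_left_mono) auto
    then show "l * (\<theta> - (a + b) / 2) < pi / 2" by (rule le_less_trans) (use l in simp)
  qed
  \<comment> \<open>By this Riccati equation, the integrand exceeds the derivative of \<open>2 c G\<close>
    by \<open>2 c\<^sup>2 G + X - 2 c Y\<close>, which is nonnegative because \<open>Y\<^sup>2 \<le> 2 G X\<close>.\<close>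
  have c: "(c has_real_derivative - l\<^sup>2 - (c \<theta>)\<^sup>2) (at \<theta>)" if t: "\<theta> \<in> {a..b}" for \<theta>
  proof -
    let ?x = "l * (\<theta> - (a + b) / 2)"
    have "(c has_real_derivative - l * (inverse ((cos ?x)\<^sup>2) * l)) (at \<theta>)"
      unfolding c_def by (rule derivative_eq_intros refl | use cosp[OF t] in simp)+
    also have "inverse ((cos ?x)\<^sup>2) = 1 + (tan ?x)\<^sup>2"
      using cosp[OF t] by (simp add: tan_def field_simps)
    also have "- l * ((1 + (tan ?x)\<^sup>2) * l) = - l\<^sup>2 - (c \<theta>)\<^sup>2"
      unfolding c_def by (simp add: power2_eq_square algebra_simps)
    finally show ?thesis .
  qed
  have cc: "continuous_on {a..b} c" using c by (meson DERIV_isCont continuous_at_imp_continuous_on)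
  have Gc: "continuous_on {a..b} G" using G by (meson DERIV_isCont continuous_at_imp_continuous_on)
  let ?H' = "\<lambda>\<theta>. 2 * ((- l\<^sup>2 - (c \<theta>)\<^sup>2) * G \<theta> + Y \<theta> * c \<theta>)"
  have "(?H' has_integral 2 * (c b * G b) - 2 * (c a * G a)) {a..b}"
  proof (rule fundamental_theorem_of_calculus[OF ab])
    fix \<theta> assume t: "\<theta> \<in> {a..b}"
    have "((\<lambda>\<theta>. 2 * (c \<theta> * G \<theta>)) has_real_derivative ?H' \<theta>) (at \<theta>)"
      by (intro DERIV_cmult DERIV_mult c[OF t] G)
    then show "((\<lambda>\<theta>. 2 * (c \<theta> * G \<theta>)) has_vector_derivative ?H' \<theta>) (at \<theta> within {a..b})"
      using has_vector_derivative_at_within has_real_derivative_iff_has_vector_derivative by blast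
  qed
  then have H: "(?H' has_integral 0) {a..b}" using zero by simp
  have i: "(\<lambda>\<theta>. X \<theta> - 2 * l\<^sup>2 * G \<theta>) integrable_on {a..b}"
    by (intro integrable_continuous_real continuous_intros cont Gc)
  have "0 \<le> integral {a..b} (\<lambda>\<theta>. (X \<theta> - 2 * l\<^sup>2 * G \<theta>) - ?H' \<theta>)"
  proof (rule integral_nonneg)
    show "(\<lambda>\<theta>. (X \<theta> - 2 * l\<^sup>2 * G \<theta>) - ?H' \<theta>) integrable_on {a..b}"
      by (rule integrable_diff[OF i has_integral_integrable[OF H]])
    fix \<theta> assume "\<theta> \<in> {a..b}"
    let ?p = "2 * (c \<theta>)\<^sup>2 * G \<theta>"
    have "(2 * c \<theta> * Y \<theta>)\<^sup>2 = 4 * (c \<theta>)\<^sup>2 * (Y \<theta>)\<^sup>2" by (simp add: power_mult_distrib)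
    also have "\<dots> \<le> 4 * (c \<theta>)\<^sup>2 * (2 * G \<theta> * X \<theta>)" using YX by (intro mult_left_mono) auto
    also have "\<dots> = 4 * ?p * X \<theta>" by simp
    also have "\<dots> \<le> (?p + X \<theta>)\<^sup>2" using zero_le_power2[of "?p - X \<theta>"] unfolding power2_sum power2_diff by (simp add: mult_ac)
    finally have "2 * c \<theta> * Y \<theta> \<le> ?p + X \<theta>" by (rule power2_le_imp_le) (use nn in auto)
    moreover have "(X \<theta> - 2 * l\<^sup>2 * G \<theta>) - ?H' \<theta> = ?p + X \<theta> - 2 * c \<theta> * Y \<theta>" by (simp add: algebra_simps)
    ultimately show "0 \<le> (X \<theta> - 2 * l\<^sup>2 * G \<theta>) - ?H' \<theta>" by linarith
  qed
  also have "\<dots> = integral {a..b} (\<lambda>\<theta>. X \<theta> - 2 * l\<^sup>2 * G \<theta>) - integral {a..b} ?H'"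
    by (rule integral_diff[OF i has_integral_integrable[OF H]])
  also have "integral {a..b} ?H' = 0" using H by (rule integral_unique)
  finally show ?thesis by simp
qed

lemma integral_periodic_shift:
  fixes f :: "real \<Rightarrow> real"
  assumes f: "continuous_on UNIV f" and per: "\<And>x. f (x + p) = f x" and z: "0 \<le> z" "z \<le> p"
  shows "integral {z..z + p} f = integral {0..p} f"
proof -
  have fi: "f integrable_on {a..b}" for a b using f by (intro integrable_continuous_real) (auto intro: continuous_on_subset)
  have "integral {z..z + p} f = integral {z..p} f + integral {p..z + p} f"
    using z by (intro Henstock_Kurzweil_Integration.integral_combine[symmetric] fi) auto
  also have "integral {p..z + p} f = integral {0..z} (\<lambda>x. f (x + p))"
  proof -
    have "((\<lambda>x. f (1 *\<^sub>R x + p)) has_integral integral {p..z + p} f /\<^sub>R 1 ^ DIM(real)) (cbox ((p - p) /\<^sub>R 1) ((z + p - p) /\<^sub>R 1))"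
      by (rule has_integral_affinity') (use fi[of p "z + p"] in \<open>auto intro: integrable_integral\<close>)
    then show ?thesis by (simp add: integral_unique)
  qed
  also have "\<dots> = integral {0..z} f" by (simp add: per)
  also have "integral {z..p} f + integral {0..z} f = integral {0..p} f"
    using Henstock_Kurzweil_Integration.integral_combine[of 0 z p f] z fi by simp
  finally show ?thesis .
qed

text \<open>The interval version is applied between successive zeros. As zeros may accumulate, they
  are not enumerated: a supremum over the zeros reached so far carries the inequality around the
  period.\<close>

lemma wirtinger_periodic:
  fixes G Y X :: "real \<Rightarrow> real"
  assumes l: "0 < l" "l * m < pi" and m: "0 < m" and gap: "\<And>x. \<exists>z\<in>{x..x + m}. G z = 0"
    and G: "\<And>\<theta>. (G has_real_derivative Y \<theta>) (at \<theta>)"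
    and cont: "continuous_on UNIV Y" "continuous_on UNIV X"
    and nn: "\<And>\<theta>. 0 \<le> G \<theta>" "\<And>\<theta>. 0 \<le> X \<theta>" and YX: "\<And>\<theta>. (Y \<theta>)\<^sup>2 \<le> 2 * G \<theta> * X \<theta>"
    and per: "\<And>\<theta>. G (\<theta> + 2 * pi) = G \<theta>" "\<And>\<theta>. X (\<theta> + 2 * pi) = X \<theta>"
  shows "2 * l\<^sup>2 * integral {0..2 * pi} G \<le> integral {0..2 * pi} X"
proof -
  define f where "f = (\<lambda>\<theta>. X \<theta> - 2 * l\<^sup>2 * G \<theta>)"
  have Gc: "continuous_on S G" for S using G by (meson DERIV_isCont continuous_at_imp_continuous_on)
  have Xc: "continuous_on S X" "continuous_on S Y" for S using cont continuous_on_subset by blast+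
  have fc: "continuous_on S f" for S unfolding f_def by (intro continuous_intros Gc Xc)
  have fi: "f integrable_on {a..b}" for a b by (intro integrable_continuous_real fc)
  have step: "0 \<le> integral {a..b} f" if "a \<le> b" "l * (b - a) < pi" "G a = 0" "G b = 0" for a b
    unfolding f_def by (rule wirtinger_interval[OF that(1) l(1) that(2) G Xc(2) Xc(1) nn YX that(3,4)])
  obtain z0 where z0: "G z0 = 0" "0 \<le> z0" "z0 \<le> 2 * pi"
  proof -
    obtain z where z: "G z = 0" using gap by blast
    define n where "n = \<lfloor>z / (2 * pi)\<rfloor>"
    have pn: "G (x + 2 * pi * of_nat k) = G x" for x k
    proof (induction k)
      case (Suc k)
      have "x + 2 * pi * of_nat (Suc k) = (x + 2 * pi * of_nat k) + 2 * pi" by (simp add: algebra_simps)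
      then show ?case using per(1) Suc by metis
    qed simp
    have "G (z - 2 * pi * of_int n) = G z"
    proof (cases "n \<ge> 0")
      case True
      then show ?thesis using pn[of "z - 2 * pi * of_int n" "nat n"] by simp
    next
      case False
      then show ?thesis using pn[of z "nat (- n)"] by simp
    qed
    moreover have "of_int n \<le> z / (2 * pi)" "z / (2 * pi) < of_int n + 1" unfolding n_def by linarith+
    then have "0 \<le> z - 2 * pi * of_int n" "z - 2 * pi * of_int n \<le> 2 * pi" by (auto simp: field_simps)
    ultimately show ?thesis using that z by metis
  qed
  let ?b = "z0 + 2 * pi"
  have Gb: "G ?b = 0" using per(1) z0 by simp
  \<comment> \<open>The zeros up to which the inequality is already known; the set is closed, so its
    supremum belongs to it.\<close>
  define S where "S = {z \<in> {z0..?b}. G z = 0 \<and> 0 \<le> integral {z0..z} f}"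
  have icont: "continuous_on {z0..?b} (\<lambda>z. integral {z0..z} f)" by (rule indefinite_integral_continuous_1[OF fi])
  have "closed S"
  proof -
    have "S = ({z0..?b} \<inter> (\<lambda>z. integral {z0..z} f) -` {0..}) \<inter> ({z0..?b} \<inter> G -` {0})" unfolding S_def by auto
    then show ?thesis using continuous_closed_preimage[OF icont, of "{0..}"] continuous_closed_preimage[OF Gc[of "{z0..?b}"], of "{0}"]
      by (simp add: closed_Int)
  qed
  moreover have "z0 \<in> S" using z0 unfolding S_def by simp
  moreover have "bdd_above S" unfolding S_def by (rule bdd_aboveI[of _ ?b]) auto
  ultimately have Sup: "Sup S \<in> S" using closed_contains_Sup by blast
  define s where "s = Sup S"
  have "s \<in> S" using Sup unfolding s_def .
  then have s: "z0 \<le> s" "s \<le> ?b" "G s = 0" "0 \<le> integral {z0..s} f" unfolding S_def by auto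
  have upper: "z \<le> s" if "z \<in> S" for z unfolding s_def by (rule cSup_upper[OF that \<open>bdd_above S\<close>])
  have "s = ?b"
  proof (rule ccontr)
    assume "s \<noteq> ?b"
    then have sb: "s < ?b" using s by simp
    \<comment> \<open>Half of the slack in \<open>l * m < pi\<close>: looking for the next zero only
      beyond \<open>s + e\<close> ensures progress, while the gap is still at most
      \<open>m + e\<close> and \<open>l * (m + e) = (l * m + pi) / 2 < pi\<close>.\<close>
    define e where "e = (pi / l - m) / 2"
    have e: "e > 0" unfolding e_def using l by (simp add: field_simps)
    have le: "l * (m + e) < pi" unfolding e_def using l by (simp add: field_simps)
    obtain z' where z': "z' \<in> {s + e..s + e + m}" "G z' = 0" using gap[of "s + e"] by (auto simp: add_ac)
    define z where "z = min z' ?b"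
    have z: "s < z" "z \<le> ?b" "G z = 0" "z - s \<le> m + e" using z' e sb Gb unfolding z_def by (auto simp: min_def)
    have "l * (z - s) \<le> l * (m + e)" using z l by (intro mult_left_mono) auto
    then have "0 \<le> integral {s..z} f" using z s le by (intro step) auto
    moreover have "integral {z0..s} f + integral {s..z} f = integral {z0..z} f"
      using Henstock_Kurzweil_Integration.integral_combine[of z0 s z f] s z fi by simp
    ultimately have "z \<in> S" unfolding S_def using z s by auto
    then show False using upper[of z] z by simp
  qed
  then have "0 \<le> integral {z0..z0 + 2 * pi} f" using s by simp
  also have "\<dots> = integral {0..2 * pi} f"
    by (rule integral_periodic_shift[OF fc]) (use per z0 in \<open>auto simp: f_def\<close>)
  also have "\<dots> = integral {0..2 * pi} X - 2 * l\<^sup>2 * integral {0..2 * pi} G"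
    unfolding f_def by (subst integral_diff) (auto intro!: integrable_continuous_real continuous_intros Gc Xc)
  finally show ?thesis by simp
qed

subsection \<open>Gaps between zeros on the circle\<close>

lemma abs_sin_ge:
  assumes "0 < d" "d < pi / 2" "of_int n * pi + d \<le> a" "a \<le> (of_int n + 1) * pi - d"
  shows "sin d \<le> \<bar>sin a\<bar>"
proof -
  define b where "b = a - of_int n * pi"
  have b: "d \<le> b" "b \<le> pi - d" using assms unfolding b_def by (auto simp: algebra_simps)
  have s0: "sin (of_int n * pi) = 0" by (auto simp: sin_zero_iff_int2)
  have c1: "\<bar>cos (of_int n * pi)\<bar> = 1"
    using sin_cos_squared_add[of "of_int n * pi"] unfolding s0 by (auto simp: power2_eq_1_iff)
  have "sin d \<le> sin b"
  proof (cases "b \<le> pi / 2")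
    case True
    then show ?thesis using b assms by (intro sin_monotone_2pi_le) auto
  next
    case False
    have "sin d \<le> sin (pi - b)" using b assms False by (intro sin_monotone_2pi_le) auto
    then show ?thesis by simp
  qed
  moreover have "a = b + of_int n * pi" unfolding b_def by simp
  then have "sin a = sin b * cos (of_int n * pi)" using s0 by (simp add: sin_add)
  then have "\<bar>sin a\<bar> = \<bar>sin b\<bar>" using c1 by (simp add: abs_mult)
  ultimately show ?thesis by linarith
qed

text \<open>The set where |sin x| < sin d consists of intervals of length 2 d around the multiples
  of pi, so no longer interval fits into it.\<close>

lemma good_point_in_interval:
  assumes d: "0 < d" "d < pi / 2" and ab: "2 * d < b - a"
  shows "\<exists>x\<in>{a..b}. sin d \<le> \<bar>sin x\<bar>"
proof -
  define n where "n = \<lceil>(a - d) / pi\<rceil>"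
  have "(a - d) / pi \<le> of_int n" "of_int n - 1 < (a - d) / pi" unfolding n_def by linarith+
  then have n: "a \<le> of_int n * pi + d" "of_int n * pi - pi + d < a" by (auto simp: field_simps)
  consider "of_int n * pi + d \<le> b" | "a \<le> of_int n * pi - d" using ab by linarith
  then show ?thesis
  proof cases
    case 1
    have "sin d \<le> \<bar>sin (of_int n * pi + d)\<bar>" by (rule abs_sin_ge[of d n]) (use d in \<open>auto simp: algebra_simps\<close>)
    then show ?thesis using 1 n by auto
  next
    case 2
    have "sin d \<le> \<bar>sin a\<bar>" by (rule abs_sin_ge[of d "n - 1"]) (use d 2 n in \<open>auto simp: algebra_simps\<close>)
    then show ?thesis using ab d by (intro bexI[of _ a]) auto
  qed
qed

text \<open>It is applied to nonnegative functions, where nonvanishing means positivity. Only the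
  length of the interval matters, its position being free.\<close>

definition positive_on_interval :: "(real \<Rightarrow> real) \<Rightarrow> real \<Rightarrow> bool" where
  "positive_on_interval u p \<longleftrightarrow> (\<exists>x. \<forall>z\<in>{x..x + p}. u z \<noteq> 0)"

text \<open>The two zero-free intervals can meet, modulo the period, only where |sin x| is small.
  Each of the two overlaps, one at either end, therefore has length at most
  \<open>2 * d\<close>.\<close>

lemma positive_intervals_length:
  fixes u v :: "real \<Rightarrow> real"
  assumes d: "0 < d" "d < pi / 2"
    and per: "\<And>x. u (x + 2 * pi) = u x" "\<And>x. v (x + 2 * pi) = v x"
    and uv: "\<forall>x. sin d \<le> \<bar>sin x\<bar> \<longrightarrow> u x = 0 \<or> v x = 0"
    and p: "positive_on_interval u p" "p \<le> 2 * pi" and q: "positive_on_interval v q" "q \<le> 2 * pi"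
  shows "p + q \<le> 2 * pi + 4 * d"
proof (rule ccontr)
  assume "\<not> ?thesis"
  then have pq: "p + q > 2 * pi + 4 * d" by simp
  then have pd: "p > 4 * d" "q > 4 * d" using p(2) q(2) by linarith+
  obtain x where x: "\<And>z. z \<in> {x..x + p} \<Longrightarrow> u z \<noteq> 0" using p(1) unfolding positive_on_interval_def by blast
  obtain y0 where y0: "\<And>z. z \<in> {y0..y0 + q} \<Longrightarrow> v z \<noteq> 0" using q(1) unfolding positive_on_interval_def by blast
  have vn: "v (a + 2 * pi * of_nat k) = v a" for a k
  proof (induction k)
    case (Suc k)
    have "a + 2 * pi * of_nat (Suc k) = (a + 2 * pi * of_nat k) + 2 * pi" by (simp add: algebra_simps)
    then show ?case using per(2) Suc by metis
  qed simp
  have vi: "v (a + 2 * pi * of_int k) = v a" for a k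
  proof (cases "k \<ge> 0")
    case True
    then show ?thesis using vn[of a "nat k"] by simp
  next
    case False
    then show ?thesis using vn[of "a + 2 * pi * of_int k" "nat (- k)"] by simp
  qed
  \<comment> \<open>Shifts the second interval by periods until it starts within one period after
    \<open>x\<close>.\<close>
  define k where "k = \<lfloor>(y0 - x) / (2 * pi)\<rfloor>"
  define y where "y = y0 - 2 * pi * of_int k"
  have "of_int k \<le> (y0 - x) / (2 * pi)" "(y0 - x) / (2 * pi) < of_int k + 1" unfolding k_def by linarith+
  then have yx: "x \<le> y" "y < x + 2 * pi" unfolding y_def by (auto simp: field_simps)
  have y: "v z \<noteq> 0" if "z \<in> {y..y + q}" for z
    using y0[of "z + 2 * pi * of_int k"] that vi[of z k] unfolding y_def by auto
  have x2: "u z \<noteq> 0" if "z \<in> {x + 2 * pi..x + 2 * pi + p}" for z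
    using x[of "z - 2 * pi"] that per(1)[of "z - 2 * pi"] by auto
  have bad: "b - a \<le> 2 * d" if "\<And>z. z \<in> {a..b} \<Longrightarrow> u z \<noteq> 0 \<and> v z \<noteq> 0" for a b
    using good_point_in_interval[OF d, of b a] uv that by (metis not_le)
  have "x + p - 2 * d \<le> y"
  proof (rule ccontr)
    assume a: "\<not> ?thesis"
    have "min (x + p) (y + q) - y \<le> 2 * d" by (rule bad) (use x y yx in auto)
    then show False using a pd d by (auto simp: min_def split: if_splits)
  qed
  moreover have "y + q \<le> x + 2 * pi + 2 * d"
  proof (rule ccontr)
    assume a: "\<not> ?thesis"
    have "min (x + 2 * pi + p) (y + q) - (x + 2 * pi) \<le> 2 * d" by (rule bad) (use x2 y yx in auto)
    then show False using a pd d by (auto simp: min_def split: if_splits)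
  qed
  ultimately show False using pq by linarith
qed

text \<open>Walks down from \<open>c\<close> in steps of \<open>d\<close> until \<open>P\<close>
  first holds. With \<open>P\<close> the existence of a zero-free interval of given length, this
  locates the maximal length up to \<open>d\<close>.\<close>

lemma threshold_exists:
  fixes P :: "real \<Rightarrow> bool"
  assumes "\<not> P c" "0 < c" "0 < d"
  shows "\<exists>m. 0 < m \<and> m \<le> c \<and> \<not> P m \<and> (m \<le> d \<or> P (m - d))"
proof -
  obtain n0 :: nat where "c / d < n0" using reals_Archimedean2 by blast
  then have "P (c - of_nat (Suc n0) * d) \<or> c - of_nat (Suc n0) * d \<le> 0" using assms(3) by (simp add: field_simps)
  then have ex: "\<exists>n::nat. P (c - of_nat (Suc n) * d) \<or> c - of_nat (Suc n) * d \<le> 0" by blast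
  define n where "n = (LEAST n::nat. P (c - of_nat (Suc n) * d) \<or> c - of_nat (Suc n) * d \<le> 0)"
  have n: "P (c - of_nat (Suc n) * d) \<or> c - of_nat (Suc n) * d \<le> 0" unfolding n_def by (rule LeastI_ex[OF ex])
  define m where "m = c - of_nat n * d"
  have "\<not> P m \<and> 0 < m"
  proof (cases n)
    case 0
    then show ?thesis using assms unfolding m_def by simp
  next
    case (Suc j)
    then have "\<not> (P (c - of_nat (Suc j) * d) \<or> c - of_nat (Suc j) * d \<le> 0)"
      using not_less_Least[of j "\<lambda>n. P (c - of_nat (Suc n) * d) \<or> c - of_nat (Suc n) * d \<le> 0"] unfolding n_def by simp
    then show ?thesis unfolding m_def Suc by simp
  qed
  moreover have "m - d = c - of_nat (Suc n) * d" unfolding m_def by (simp add: algebra_simps)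
  then have "m \<le> d \<or> P (m - d)" using n by auto
  moreover have "m \<le> c" unfolding m_def using assms(3) by simp
  ultimately show ?thesis by blast
qed

definition frequency_bound :: "(real \<Rightarrow> real) \<Rightarrow> real \<Rightarrow> bool" where
  "frequency_bound u l \<longleftrightarrow> l = 0 \<or> (0 < l \<and> (\<exists>m>0. l * m < pi \<and> (\<forall>x. \<exists>z\<in>{x..x + m}. u z = 0)))"

lemma frequency_boundI:
  "\<not> positive_on_interval u m \<Longrightarrow> 0 < m \<Longrightarrow> 0 < l \<Longrightarrow> l * m < pi \<Longrightarrow> frequency_bound u l"
  unfolding frequency_bound_def positive_on_interval_def by blast

text \<open>If \<open>m\<close> and \<open>n\<close> are nearly the maximal zero-free lengths, then
  \<open>m + n\<close> is nearly at most 2 pi, and convexity of the reciprocal gives pi / m + pi / n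
  >= 4 pi / (m + n). All losses are linear in \<open>d\<close>, so that they can be integrated
  later.\<close>

lemma frequency_bounds:
  fixes u v :: "real \<Rightarrow> real"
  assumes d: "0 < d" "d < pi / 16"
    and per: "\<And>x. u (x + 2 * pi) = u x" "\<And>x. v (x + 2 * pi) = v x"
    and uv: "\<forall>x. sin d \<le> \<bar>sin x\<bar> \<longrightarrow> u x = 0 \<or> v x = 0"
  shows "\<exists>lu lv. 0 \<le> lu \<and> 0 \<le> lv \<and> 2 - 4 * d \<le> lu + lv \<and> frequency_bound u lu \<and> frequency_bound v lv"
proof -
  have pi4: "pi < 4" "pi > 3" using pi_less_4 pi_gt3 by auto
  have d1: "d < 1/4" "d < pi / 2" using d pi4 by linarith+
  note len = positive_intervals_length[where u = u and v = v, OF d(1) d1(2) per uv]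
  have uv': "\<forall>x. sin d \<le> \<bar>sin x\<bar> \<longrightarrow> v x = 0 \<or> u x = 0" using uv by blast
  note len' = positive_intervals_length[where u = v and v = u, OF d(1) d1(2) per(2,1) uv']
  \<comment> \<open>Chosen so that if one function is zero-free on an interval this long, the other
    has zero-free intervals of length at most pi / 2. Its frequency is then close to 2 by itself,
    and the first function may take 0.\<close>
  let ?c = "3 * pi / 2 + 4 * d"
  have c: "?c \<le> 2 * pi" "?c > 0" using d pi4 by linarith+
  have mm: "(2 - d) * (pi / 2 + d / 4) < pi"
  proof -
    have "(2 - d) * (pi / 2 + d / 4) = pi + d / 2 - d * pi / 2 - d * d / 4" by (simp add: field_simps)
    also have "\<dots> < pi"
    proof -
      have "d * 1 < d * pi" using d pi4 by (intro mult_strict_left_mono) auto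
      moreover have "d * d \<ge> 0" by simp
      ultimately show ?thesis by linarith
    qed
    finally show ?thesis .
  qed
  consider "positive_on_interval u ?c" | "positive_on_interval v ?c"
    | "\<not> positive_on_interval u ?c" "\<not> positive_on_interval v ?c" by blast
  then show ?thesis
  proof cases
    case 1
    have "\<not> positive_on_interval v (pi / 2 + d / 4)"
      using len[OF 1 c(1), of "pi / 2 + d / 4"] d pi4 by auto
    then have "frequency_bound v (2 - d)" using d d1 mm pi4 by (intro frequency_boundI[of v "pi / 2 + d / 4"]) auto
    then show ?thesis using d d1 by (intro exI[of _ 0] exI[of _ "2 - d"]) (auto simp: frequency_bound_def)
  next
    case 2
    have "\<not> positive_on_interval u (pi / 2 + d / 4)"
      using len'[OF 2 c(1), of "pi / 2 + d / 4"] d pi4 by auto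
    then have "frequency_bound u (2 - d)" using d d1 mm pi4 by (intro frequency_boundI[of u "pi / 2 + d / 4"]) auto
    then show ?thesis using d d1 by (intro exI[of _ "2 - d"] exI[of _ 0]) (auto simp: frequency_bound_def)
  next
    case 3
    obtain m where m: "0 < m" "m \<le> ?c" "\<not> positive_on_interval u m" "m \<le> d \<or> positive_on_interval u (m - d)"
      using threshold_exists[of "positive_on_interval u", OF 3(1) c(2) d(1)] by blast
    obtain n where n: "0 < n" "n \<le> ?c" "\<not> positive_on_interval v n" "n \<le> d \<or> positive_on_interval v (n - d)"
      using threshold_exists[of "positive_on_interval v", OF 3(2) c(2) d(1)] by blast
    \<comment> \<open>The excess is \<open>4 * d\<close> from the possible overlaps and
      \<open>d\<close> from the resolution of each threshold.\<close>
    have mn: "m + n \<le> 2 * pi + 6 * d"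
    proof -
      consider "m \<le> d" | "n \<le> d" | "positive_on_interval u (m - d)" "positive_on_interval v (n - d)" using m n by blast
      then show ?thesis
      proof cases
        case 3
        have "(m - d) + (n - d) \<le> 2 * pi + 4 * d" by (rule len[OF 3(1) _ 3(2)]) (use m n c d in auto)
        then show ?thesis by simp
      qed (use m n c d in linarith)+
    qed
    \<comment> \<open>The factor \<open>1 - d\<close> makes \<open>lu * m < pi\<close> and
      \<open>lv * n < pi\<close> strict.\<close>
    define lu lv where "lu = (1 - d) * pi / m" and "lv = (1 - d) * pi / n"
    have lp: "lu > 0" "lv > 0" unfolding lu_def lv_def using m n d1 by auto
    have "(1 - d) * pi < 1 * pi" using d by (intro mult_strict_right_mono) auto
    then have fb: "frequency_bound u lu" "frequency_bound v lv"
      using m n lp by (auto intro!: frequency_boundI[of u m] frequency_boundI[of v n] simp: lu_def lv_def)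
    have "4 / (m + n) \<le> 1 / m + 1 / n"
    proof -
      have "4 * (m * n) \<le> (m + n) * (m + n)" using zero_le_power2[of "m - n"] by (simp add: power2_eq_square algebra_simps)
      then show ?thesis using m n by (simp add: field_simps)
    qed
    then have "(1 - d) * pi * (4 / (m + n)) \<le> (1 - d) * pi * (1 / m + 1 / n)" using d1 by (intro mult_left_mono) auto
    then have 1: "(1 - d) * pi * (4 / (m + n)) \<le> lu + lv" unfolding lu_def lv_def by (simp add: distrib_left)
    have "(1 - d) * pi * (4 / (2 * pi + 6 * d)) \<le> (1 - d) * pi * (4 / (m + n))"
      using d d1 m n mn pi4 by (intro mult_left_mono divide_left_mono) auto
    moreover have "2 - 4 * d \<le> (1 - d) * pi * (4 / (2 * pi + 6 * d))"
    proof -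
      have "d * 3 \<le> d * pi" using d pi4 by (intro mult_left_mono) auto
      moreover have "d * d \<ge> 0" by simp
      ultimately have "4 * pi + 12 * d - 8 * (d * pi) - 24 * (d * d) \<le> 4 * pi - 4 * (d * pi)" by linarith
      then have "(2 - 4 * d) * (2 * pi + 6 * d) \<le> (1 - d) * pi * 4" by (simp add: algebra_simps)
      then show ?thesis using d pi4 by (simp add: pos_le_divide_eq)
    qed
    ultimately have "2 - 4 * d \<le> lu + lv" using 1 by linarith
    then show ?thesis using fb lp by (intro exI[of _ lu] exI[of _ lv]) auto
  qed
qed

text \<open>With \<open>u\<close> zero-free on a full period, \<open>v\<close> can be nonzero only
  on intervals of length at most \<open>4 * d\<close>. Frequency 2 already exceeds what growth of
  type zero permits, as it would mean a mean of order r^4.\<close>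

lemma frequency_bound_positive:
  fixes u v :: "real \<Rightarrow> real"
  assumes d: "0 < d" "d < pi / 16"
    and per: "\<And>x. u (x + 2 * pi) = u x" "\<And>x. v (x + 2 * pi) = v x"
    and uv: "\<forall>x. sin d \<le> \<bar>sin x\<bar> \<longrightarrow> u x = 0 \<or> v x = 0" and u: "\<And>x. u x \<noteq> 0"
  shows "frequency_bound v 2"
proof (rule frequency_boundI[of _ "5 * d"])
  have "positive_on_interval u (2 * pi)" using u unfolding positive_on_interval_def by blast
  then show "\<not> positive_on_interval v (5 * d)"
    using positive_intervals_length[where u = u and v = v, OF d(1) _ per uv, of "2 * pi" "5 * d"] d by auto
qed (use d in auto)

subsection \<open>Logarithmic means of entire functions\<close>

text \<open>A twice continuously differentiable replacement for the square of the positive part: it satisfies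
  \<open>phi1\<^sup>2 \<le> 2 phi0 phi2\<close>, exactly as \<open>s\<^sup>2\<close> does, so no constants are lost by the smoothing.\<close>

definition phi0 :: "real \<Rightarrow> real" where "phi0 s = (max 0 s) ^ 3 / (max 0 s + 1)"
definition phi1 :: "real \<Rightarrow> real" where "phi1 s = (max 0 s)\<^sup>2 * (2 * max 0 s + 3) / (max 0 s + 1)\<^sup>2"
definition phi2 :: "real \<Rightarrow> real" where "phi2 s = 2 * max 0 s * ((max 0 s)\<^sup>2 + 3 * max 0 s + 3) / (max 0 s + 1) ^ 3"

lemma phi_nonneg: "0 \<le> phi0 s" "0 \<le> phi1 s" "0 \<le> phi2 s"
  unfolding phi0_def phi1_def phi2_def by auto

lemma phi_nonpos: "s \<le> 0 \<Longrightarrow> phi0 s = 0" "s \<le> 0 \<Longrightarrow> phi1 s = 0" "s \<le> 0 \<Longrightarrow> phi2 s = 0"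
  unfolding phi0_def phi1_def phi2_def by (auto simp: max_def)

lemma phi_pos: "0 < s \<Longrightarrow> 0 < phi0 s" "0 < s \<Longrightarrow> 0 < phi2 s"
  unfolding phi0_def phi2_def by (auto simp: max_def intro!: divide_pos_pos mult_pos_pos add_pos_pos)

text \<open>After cancelling common factors the claim is (2 x + 3)^2 <= 4 (x^2 + 3 x + 3), that is,
  9 <= 12.\<close>

lemma phi_ineq: "(phi1 s)\<^sup>2 \<le> 2 * phi0 s * phi2 s"
proof -
  define x where "x = max 0 s"
  have x: "x \<ge> 0" unfolding x_def by simp
  have "(phi1 s)\<^sup>2 = x ^ 4 * (2 * x + 3)\<^sup>2 / (x + 1) ^ 4"
    unfolding phi1_def x_def[symmetric] by (simp add: power_divide power_mult_distrib flip: power_mult)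
  also have "\<dots> \<le> x ^ 4 * (4 * (x\<^sup>2 + 3 * x + 3)) / (x + 1) ^ 4"
    using x by (intro divide_right_mono mult_left_mono) (auto simp: power2_eq_square algebra_simps)
  also have "\<dots> = 2 * (x ^ 3 / (x + 1)) * (2 * x * (x\<^sup>2 + 3 * x + 3) / (x + 1) ^ 3)"
    using x by (simp add: divide_simps eval_nat_numeral)
  finally show ?thesis unfolding phi0_def phi2_def x_def[symmetric] .
qed

lemma phi0_le: "phi0 s \<le> (max 0 s)\<^sup>2"
proof -
  define x where "x = max 0 s"
  have x: "x \<ge> 0" unfolding x_def by simp
  have "x ^ 3 / (x + 1) \<le> x\<^sup>2" using x by (simp add: divide_le_eq power3_eq_cube power2_eq_square mult_left_mono algebra_simps)
  then show ?thesis unfolding phi0_def x_def .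
qed

lemma DERIV_zero_quadratic:
  fixes f :: "real \<Rightarrow> real"
  assumes "\<And>x. \<bar>f x\<bar> \<le> C * x\<^sup>2"
  shows "(f has_real_derivative 0) (at 0)"
proof -
  have f0: "f 0 = 0" using assms[of 0] by simp
  have "((\<lambda>y. (f y - f 0) / (y - 0)) \<longlongrightarrow> 0) (at 0)"
  proof (rule Lim_null_comparison)
    show "\<forall>\<^sub>F y in at 0. norm ((f y - f 0) / (y - 0)) \<le> C * \<bar>y\<bar>"
    proof (rule eventually_at_filter[THEN iffD2], rule always_eventually, intro allI impI)
      fix y :: real assume "y \<noteq> 0"
      then show "norm ((f y - f 0) / (y - 0)) \<le> C * \<bar>y\<bar>"
        using assms[of y] f0 by (simp add: divide_le_eq power2_eq_square mult.assoc flip: abs_mult)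
    qed
    show "((\<lambda>y. C * \<bar>y\<bar>) \<longlongrightarrow> 0) (at 0)" by (rule tendsto_eq_intros refl | simp)+
  qed
  then show ?thesis by (simp add: has_field_derivative_iff)
qed

text \<open>The quadratic bound forces the derivative 0 at the junction, which agrees with the value
  of \<open>f'\<close> there; on either side the one-sided formula applies.\<close>

lemma DERIV_piecewise:
  fixes f g :: "real \<Rightarrow> real"
  assumes neg: "\<And>x. x \<le> 0 \<Longrightarrow> f x = 0" "\<And>x. x \<le> 0 \<Longrightarrow> f' x = 0" and pos: "\<And>x. 0 < x \<Longrightarrow> f x = g x"
    and g: "\<And>x. 0 < x \<Longrightarrow> (g has_real_derivative f' x) (at x)" and quad: "\<And>x. \<bar>f x\<bar> \<le> C * x\<^sup>2"
  shows "(f has_real_derivative f' s) (at s)"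
proof -
  consider "s < 0" | "s = 0" | "s > 0" by linarith
  then show ?thesis
  proof cases
    case 1
    have "((\<lambda>_. 0) has_real_derivative 0) (at s)" by simp
    then have "(f has_real_derivative 0) (at s)"
      by (rule has_field_derivative_transform_within_open[where S = "{..<0}"]) (use 1 neg in auto)
    then show ?thesis using neg 1 by simp
  next
    case 2
    then show ?thesis using DERIV_zero_quadratic[OF quad] neg(2)[of 0] by simp
  next
    case 3
    show ?thesis
      by (rule has_field_derivative_transform_within_open[OF g[OF 3], where S = "{0<..}"]) (use 3 pos in auto)
  qed
qed

lemma DERIV_phi0: "(phi0 has_real_derivative phi1 s) (at s)"
proof (rule DERIV_piecewise[where g = "\<lambda>x. x ^ 3 / (x + 1)" and C = 1])
  fix x :: real assume x: "0 < x"
  have "((\<lambda>x. x ^ 3 / (x + 1)) has_real_derivative (3 * x\<^sup>2 * (x + 1) - x ^ 3) / (x + 1)\<^sup>2) (at x)"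
    by (rule derivative_eq_intros refl | use x in \<open>simp add: power2_eq_square\<close>)+
  also have "(3 * x\<^sup>2 * (x + 1) - x ^ 3) / (x + 1)\<^sup>2 = phi1 x" unfolding phi1_def using x
    by (simp add: max_def eval_nat_numeral algebra_simps)
  finally show "((\<lambda>x. x ^ 3 / (x + 1)) has_real_derivative phi1 x) (at x)" .
next
  fix x :: real
  have "(max 0 x)\<^sup>2 \<le> x\<^sup>2" by (auto simp: max_def)
  then show "\<bar>phi0 x\<bar> \<le> 1 * x\<^sup>2" using phi0_le[of x] phi_nonneg(1)[of x] by simp
qed (auto simp: phi_nonpos phi0_def max_def)

lemma phi1_eq:
  assumes "0 < x"
  shows "phi1 x = 2 * x - 1 + 1 / (x + 1)\<^sup>2"
proof -
  have "x\<^sup>2 * (2 * x + 3) = (2 * x - 1) * (x + 1)\<^sup>2 + 1" by (simp add: power2_eq_square algebra_simps)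
  then show ?thesis unfolding phi1_def using assms by (simp add: max_def add_divide_distrib)
qed

lemma phi2_eq:
  assumes "0 < x"
  shows "phi2 x = 2 - 2 / (x + 1) ^ 3"
proof -
  have "2 * x * (x\<^sup>2 + 3 * x + 3) = 2 * (x + 1) ^ 3 - 2" by (simp add: power2_eq_square power3_eq_cube algebra_simps)
  then show ?thesis unfolding phi2_def using assms by (simp add: max_def diff_divide_distrib)
qed

lemma DERIV_phi1: "(phi1 has_real_derivative phi2 s) (at s)"
proof (rule DERIV_piecewise[where g = "\<lambda>x. 2 * x - 1 + 1 / (x + 1)\<^sup>2" and C = 3])
  fix x :: real assume x: "0 < x"
  have nz: "(x + 1)\<^sup>2 \<noteq> 0" "x + 1 \<noteq> 0" using x by auto
  have "((\<lambda>x. 2 * x - 1 + 1 / (x + 1)\<^sup>2) has_real_derivative 2 + - (2 * (x + 1)) / ((x + 1)\<^sup>2 * (x + 1)\<^sup>2)) (at x)"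
    by (rule derivative_eq_intros refl | use nz in simp)+
  also have "- (2 * y) / (y\<^sup>2 * y\<^sup>2) = - (2 / y ^ 3)" if "y \<noteq> 0" for y :: real
    using that by (simp add: power2_eq_square power3_eq_cube)
  note this[OF nz(2)]
  finally show "((\<lambda>x. 2 * x - 1 + 1 / (x + 1)\<^sup>2) has_real_derivative phi2 x) (at x)" using phi2_eq[OF x] by simp
  show "phi1 x = 2 * x - 1 + 1 / (x + 1)\<^sup>2" by (rule phi1_eq[OF x])
next
  fix x :: real
  define y where "y = max 0 x"
  have y: "y \<ge> 0" "y\<^sup>2 \<le> x\<^sup>2" unfolding y_def by (auto simp: max_def)
  have "y\<^sup>2 * (2 * y + 3) \<le> y\<^sup>2 * (3 * (y + 1)\<^sup>2)" using y by (intro mult_left_mono) (auto simp: power2_eq_square algebra_simps)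
  then have "y\<^sup>2 * (2 * y + 3) / (y + 1)\<^sup>2 \<le> 3 * y\<^sup>2" using y by (simp add: divide_le_eq mult_ac)
  then show "\<bar>phi1 x\<bar> \<le> 3 * x\<^sup>2" using phi_nonneg(2)[of x] y unfolding phi1_def y_def[symmetric] by linarith
qed (auto simp: phi_nonpos)

lemma continuous_phi: "isCont phi0 s" "isCont phi1 s" "isCont phi2 s"
proof -
  show "isCont phi0 s" "isCont phi1 s" using DERIV_phi0 DERIV_phi1 DERIV_isCont by blast+
  have "max 0 s + 1 > 0" by (simp add: add_nonneg_pos)
  then show "isCont phi2 s" unfolding phi2_def[abs_def] by (intro continuous_intros) auto
qed

section \<open>Means of the smoothed logarithm in logarithmic polar coordinates\<close>

lemma Re_has_real_derivative:
  assumes "(h has_field_derivative h') (at (\<zeta> + c * of_real u))"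
  shows "((\<lambda>v. Re (h (\<zeta> + c * of_real v))) has_real_derivative Re (c * h')) (at u)"
proof -
  have "((\<lambda>v. \<zeta> + c * of_real v) has_vector_derivative c) (at u)"
    by (rule derivative_eq_intros refl | simp)+
  from field_vector_diff_chain_at[OF this assms]
  have "((\<lambda>v. h (\<zeta> + c * of_real v)) has_vector_derivative c * h') (at u)" by (simp add: o_def)
  from bounded_linear.has_vector_derivative[OF bounded_linear_Re this]
  show ?thesis by (simp add: has_real_derivative_iff_has_vector_derivative)
qed

locale log_means =
  fixes K :: "complex \<Rightarrow> complex"
  assumes K_entire: "K holomorphic_on UNIV"
begin

text \<open>In the coordinate \<open>t + \<i> * \<theta>\<close> the circle of radius
  \<open>exp t\<close> becomes a vertical segment, radial and angular derivatives have constant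
  coefficients, and ln |k| is harmonic off the zeros.\<close>

definition k :: "complex \<Rightarrow> complex" where "k \<zeta> = K (exp \<zeta>)"
text \<open>At a zero of \<open>k\<close> the value is 0 by the convention for \<open>ln 0\<close>.
  That agrees with the rule that the cut-off functions \<open>phi0\<close>, \<open>phi1\<close>,
  \<open>phi2\<close> vanish at arguments at most 0.\<close>

definition lk :: "complex \<Rightarrow> real" where "lk \<zeta> = ln (cmod (k \<zeta>))"
definition L :: "complex \<Rightarrow> complex" where "L \<zeta> = deriv k \<zeta> / k \<zeta>"

lemma k_entire: "k holomorphic_on UNIV"
proof -
  have "(K \<circ> exp) holomorphic_on UNIV"
    by (rule holomorphic_on_compose[OF holomorphic_on_exp]) (auto intro: holomorphic_on_subset[OF K_entire])
  then show ?thesis unfolding k_def[abs_def] o_def .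
qed

lemma k_deriv: "(k has_field_derivative deriv k \<zeta>) (at \<zeta>)"
  using holomorphic_derivI[OF k_entire open_UNIV] by simp

lemma k_isCont: "isCont k \<zeta>" by (rule entire_isCont[OF k_entire])

lemma open_k_nonzero: "open {\<zeta>. k \<zeta> \<noteq> 0}"
  by (rule open_Collect_neq) (auto intro: entire_continuous_on[OF k_entire])

lemma L_holomorphic: "L holomorphic_on {\<zeta>. k \<zeta> \<noteq> 0}"
  unfolding L_def[abs_def]
  by (intro holomorphic_on_divide holomorphic_deriv open_k_nonzero holomorphic_on_subset[OF k_entire]) auto

lemma L_deriv: "k \<zeta> \<noteq> 0 \<Longrightarrow> (L has_field_derivative deriv L \<zeta>) (at \<zeta>)"
  using holomorphic_derivI[OF L_holomorphic open_k_nonzero] by simp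

lemma L_isCont: "k \<zeta> \<noteq> 0 \<Longrightarrow> isCont L \<zeta>"
  using L_deriv DERIV_isCont by blast

lemma deriv_L_isCont: "k \<zeta> \<noteq> 0 \<Longrightarrow> isCont (deriv L) \<zeta>"
  using holomorphic_on_imp_continuous_on[OF holomorphic_deriv[OF L_holomorphic open_k_nonzero]]
    continuous_on_eq_continuous_at[OF open_k_nonzero] by blast

lemma lk_nonpos: "cmod (k \<zeta>) \<le> 1 \<Longrightarrow> lk \<zeta> \<le> 0"
  unfolding lk_def by (cases "k \<zeta> = 0") (auto simp: ln_le_zero_iff)

text \<open>In a whole neighbourhood of a zero |k| < 1, so every cut-off integrand is identically 0
  there and the singularities of \<open>lk\<close> and \<open>L\<close> stay invisible.\<close>

lemma near_zero:
  assumes "k \<zeta> = 0"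
  shows "\<forall>\<^sub>F w in nhds \<zeta>. lk w \<le> 0"
proof -
  have "(k \<longlongrightarrow> k \<zeta>) (nhds \<zeta>)" using k_isCont by (simp add: continuous_at tendsto_at_iff_tendsto_nhds)
  then have "\<forall>\<^sub>F w in nhds \<zeta>. cmod (k w) < 1" using assms order_tendstoD(2)[OF tendsto_norm, of k 0 "nhds \<zeta>" 1] by simp
  then show ?thesis by eventually_elim (rule lk_nonpos, simp)
qed

lemma isCont_cut:
  assumes \<Phi>: "\<And>s. isCont \<Phi> s" "\<And>s. s \<le> 0 \<Longrightarrow> \<Phi> s = (0::real)" and f: "\<And>\<zeta>. k \<zeta> \<noteq> 0 \<Longrightarrow> isCont f \<zeta>"
  shows "isCont (\<lambda>\<zeta>. \<Phi> (lk \<zeta>) * f \<zeta>) \<zeta>"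
proof (cases "k \<zeta> = 0")
  case True
  have "\<forall>\<^sub>F w in nhds \<zeta>. 0 = \<Phi> (lk w) * f w"
    using near_zero[OF True] by eventually_elim (simp add: \<Phi>(2))
  then show ?thesis using isCont_cong[of "\<lambda>_. 0" "\<lambda>\<zeta>. \<Phi> (lk \<zeta>) * f \<zeta>" \<zeta>] by simp
next
  case False
  have "isCont lk \<zeta>" unfolding lk_def[abs_def] using False by (intro continuous_intros k_isCont) auto
  then have "isCont (\<lambda>\<zeta>. \<Phi> (lk \<zeta>)) \<zeta>" by (rule isCont_o2) (rule \<Phi>)
  then show ?thesis by (intro continuous_intros f[OF False])
qed

text \<open>Dividing by the value \<open>w0\<close> at the base point places the argument of
  \<open>Ln\<close> at 1, off the branch cut; the real part agrees with \<open>lk\<close> up to a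
  constant wherever \<open>k\<close> is nonzero. The direction \<open>c\<close> is 1 for the radial
  and \<open>\<i>\<close> for the angular derivative.\<close>

lemma lk_deriv:
  assumes "k (\<zeta> + c * of_real u) \<noteq> 0"
  shows "((\<lambda>v. lk (\<zeta> + c * of_real v)) has_real_derivative Re (c * L (\<zeta> + c * of_real u))) (at u)"
proof -
  let ?\<gamma> = "\<lambda>v. \<zeta> + c * of_real v"
  define w0 where "w0 = k (?\<gamma> u)"
  have w0: "w0 \<noteq> 0" using assms unfolding w0_def .
  have D: "((\<lambda>\<zeta>. Ln (k \<zeta> / w0)) has_field_derivative L (?\<gamma> u)) (at (?\<gamma> u))"
  proof -
    have "((\<lambda>\<zeta>. k \<zeta> / w0) has_field_derivative deriv k (?\<gamma> u) / w0) (at (?\<gamma> u))"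
      by (rule DERIV_cdivide[OF k_deriv])
    moreover have "(Ln has_field_derivative inverse (k (?\<gamma> u) / w0)) (at (k (?\<gamma> u) / w0))"
      by (rule has_field_derivative_Ln) (use w0 in \<open>simp add: w0_def[symmetric]\<close>)
    ultimately have "((\<lambda>\<zeta>. Ln (k \<zeta> / w0)) has_field_derivative inverse (k (?\<gamma> u) / w0) * (deriv k (?\<gamma> u) / w0)) (at (?\<gamma> u))"
      by (rule DERIV_chain2[rotated])
    then show ?thesis using w0 unfolding L_def w0_def[symmetric] by simp
  qed
  have "((\<lambda>v. ln (cmod w0) + Re (Ln (k (?\<gamma> v) / w0))) has_real_derivative 0 + Re (c * L (?\<gamma> u))) (at u)"
    by (intro DERIV_add DERIV_const Re_has_real_derivative D)
  then have D2: "((\<lambda>v. ln (cmod w0) + Re (Ln (k (?\<gamma> v) / w0))) has_real_derivative Re (c * L (?\<gamma> u))) (at u)" by simp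
  have op: "open {v. k (?\<gamma> v) \<noteq> 0}"
    by (rule open_Collect_neq) (auto intro!: continuous_intros continuous_on_compose2[OF entire_continuous_on[OF k_entire, of UNIV]])
  show ?thesis
  proof (rule has_field_derivative_transform_within_open[OF D2 op])
    fix v assume "v \<in> {v. k (?\<gamma> v) \<noteq> 0}"
    then show "ln (cmod w0) + Re (Ln (k (?\<gamma> v) / w0)) = lk (?\<gamma> v)"
      using w0 by (simp add: lk_def norm_divide ln_div)
  qed (use assms in simp)
qed

lemma cut_deriv:
  assumes \<Phi>: "\<And>s. (\<Phi> has_real_derivative \<Phi>' s) (at s)" "\<And>s. s \<le> 0 \<Longrightarrow> \<Phi> s = 0" "\<And>s. s \<le> 0 \<Longrightarrow> \<Phi>' s = 0"
    and f: "k (\<zeta> + c * of_real u) \<noteq> 0 \<Longrightarrow> ((\<lambda>v. f (\<zeta> + c * of_real v)) has_real_derivative f') (at u)"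
  shows "((\<lambda>v. \<Phi> (lk (\<zeta> + c * of_real v)) * f (\<zeta> + c * of_real v)) has_real_derivative
     \<Phi>' (lk (\<zeta> + c * of_real u)) * Re (c * L (\<zeta> + c * of_real u)) * f (\<zeta> + c * of_real u) + \<Phi> (lk (\<zeta> + c * of_real u)) * f') (at u)"
proof (cases "k (\<zeta> + c * of_real u) = 0")
  case True
  have "((\<lambda>v. \<zeta> + c * of_real v) \<longlongrightarrow> \<zeta> + c * of_real u) (at u)" by (intro tendsto_intros)
  then have "((\<lambda>v. \<zeta> + c * of_real v) \<longlongrightarrow> \<zeta> + c * of_real u) (nhds u)"
    using tendsto_at_iff_tendsto_nhds[of "\<lambda>v. \<zeta> + c * of_real v" u] by simp
  then have ev: "\<forall>\<^sub>F v in nhds u. lk (\<zeta> + c * of_real v) \<le> 0" by (rule eventually_compose_filterlim[OF near_zero[OF True]])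
  then have lk0: "lk (\<zeta> + c * of_real u) \<le> 0" by (rule eventually_nhds_x_imp_x)
  have "\<forall>\<^sub>F v in nhds u. \<Phi> (lk (\<zeta> + c * of_real v)) * f (\<zeta> + c * of_real v) = 0"
    using ev by eventually_elim (simp add: \<Phi>(2))
  then have "((\<lambda>v. \<Phi> (lk (\<zeta> + c * of_real v)) * f (\<zeta> + c * of_real v)) has_real_derivative 0) (at u)"
    using DERIV_cong_ev[of u u _ "\<lambda>_. 0" 0 0] by simp
  then show ?thesis using lk0 \<Phi>(2,3) by simp
next
  case False
  have "((\<lambda>v. \<Phi> (lk (\<zeta> + c * of_real v))) has_real_derivative \<Phi>' (lk (\<zeta> + c * of_real u)) * Re (c * L (\<zeta> + c * of_real u))) (at u)"
    by (rule DERIV_chain2[OF \<Phi>(1) lk_deriv[OF False]])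
  from DERIV_mult[OF this f[OF False]] show ?thesis by (simp add: mult_ac add.commute)
qed

abbreviation pt :: "real \<Rightarrow> real \<Rightarrow> complex" where "pt t \<theta> \<equiv> of_real t + \<i> * of_real \<theta>"

text \<open>\<open>M1\<close> and \<open>M2\<close> turn out to be the first and second derivatives
  of \<open>M\<close> in \<open>t\<close>, the logarithm of the radius.\<close>

definition M :: "real \<Rightarrow> real" where "M t = integral {0..2 * pi} (\<lambda>\<theta>. phi0 (lk (pt t \<theta>)))"
definition M1 :: "real \<Rightarrow> real" where "M1 t = integral {0..2 * pi} (\<lambda>\<theta>. phi1 (lk (pt t \<theta>)) * Re (L (pt t \<theta>)))"
definition M2 :: "real \<Rightarrow> real" where "M2 t = integral {0..2 * pi} (\<lambda>\<theta>. phi2 (lk (pt t \<theta>)) * (cmod (L (pt t \<theta>)))\<^sup>2)"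

lemma cut_continuous:
  assumes \<Phi>: "\<And>s. isCont \<Phi> s" "\<And>s. s \<le> 0 \<Longrightarrow> \<Phi> s = (0::real)" and f: "\<And>\<zeta>. k \<zeta> \<noteq> 0 \<Longrightarrow> isCont f \<zeta>"
  shows "continuous_on S (\<lambda>(t, \<theta>). \<Phi> (lk (pt t \<theta>)) * f (pt t \<theta>))" "continuous_on T (\<lambda>\<theta>. \<Phi> (lk (pt t \<theta>)) * f (pt t \<theta>))"
proof -
  have c: "continuous_on UNIV (\<lambda>\<zeta>. \<Phi> (lk \<zeta>) * f \<zeta>)" by (intro continuous_at_imp_continuous_on ballI isCont_cut assms)
  show "continuous_on T (\<lambda>\<theta>. \<Phi> (lk (pt t \<theta>)) * f (pt t \<theta>))"
    by (rule continuous_on_compose2[OF c]) (auto intro!: continuous_intros)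
  show "continuous_on S (\<lambda>(t, \<theta>). \<Phi> (lk (pt t \<theta>)) * f (pt t \<theta>))"
    unfolding case_prod_beta by (rule continuous_on_compose2[OF c]) (auto intro!: continuous_intros)
qed

lemma phi0_continuous: "continuous_on T (\<lambda>\<theta>. phi0 (lk (pt t \<theta>)))"
  using cut_continuous(2)[of phi0 "\<lambda>_. 1"] continuous_phi(1) phi_nonpos(1) by simp

lemma cut1_continuous:
  assumes "\<And>\<zeta>. k \<zeta> \<noteq> 0 \<Longrightarrow> isCont f \<zeta>"
  shows "continuous_on S (\<lambda>(t, \<theta>). phi1 (lk (pt t \<theta>)) * f (pt t \<theta>))" "continuous_on T (\<lambda>\<theta>. phi1 (lk (pt t \<theta>)) * f (pt t \<theta>))"
  by (rule cut_continuous[OF continuous_phi(2)]; simp add: phi_nonpos assms)+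

lemma cut2_continuous:
  assumes "\<And>\<zeta>. k \<zeta> \<noteq> 0 \<Longrightarrow> isCont f \<zeta>"
  shows "continuous_on S (\<lambda>(t, \<theta>). phi2 (lk (pt t \<theta>)) * f (pt t \<theta>))" "continuous_on T (\<lambda>\<theta>. phi2 (lk (pt t \<theta>)) * f (pt t \<theta>))"
  by (rule cut_continuous[OF continuous_phi(3)]; simp add: phi_nonpos assms)+

lemma L_parts_isCont:
  assumes "k \<zeta> \<noteq> 0"
  shows "isCont (\<lambda>\<zeta>. Re (L \<zeta>)) \<zeta>" "isCont (\<lambda>\<zeta>. Im (L \<zeta>)) \<zeta>" "isCont (\<lambda>\<zeta>. (Re (L \<zeta>))\<^sup>2) \<zeta>" "isCont (\<lambda>\<zeta>. (Im (L \<zeta>))\<^sup>2) \<zeta>"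
    "isCont (\<lambda>\<zeta>. (cmod (L \<zeta>))\<^sup>2) \<zeta>" "isCont (\<lambda>\<zeta>. Re (deriv L \<zeta>)) \<zeta>"
  using L_isCont[OF assms] deriv_L_isCont[OF assms] by (simp_all add: continuous_intros)

lemmas re_cont = cut1_continuous[OF L_parts_isCont(1)] and im_cont = cut1_continuous[OF L_parts_isCont(2)]
  and re2_cont = cut2_continuous[OF L_parts_isCont(3)] and im2_cont = cut2_continuous[OF L_parts_isCont(4)]
  and norm2_cont = cut2_continuous[OF L_parts_isCont(5)] and deriv_cont = cut1_continuous[OF L_parts_isCont(6)]

lemma phi0_deriv: "((\<lambda>v. phi0 (lk (\<zeta> + c * of_real v))) has_real_derivative phi1 (lk (\<zeta> + c * of_real u)) * Re (c * L (\<zeta> + c * of_real u))) (at u)"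
  using cut_deriv[of phi0 phi1 \<zeta> c u "\<lambda>_. 1" 0] DERIV_phi0 phi_nonpos by simp

lemma phi1_deriv: "((\<lambda>v. phi1 (lk (\<zeta> + c * of_real v)) * Re (c * L (\<zeta> + c * of_real v))) has_real_derivative
    phi2 (lk (\<zeta> + c * of_real u)) * (Re (c * L (\<zeta> + c * of_real u)))\<^sup>2 + phi1 (lk (\<zeta> + c * of_real u)) * Re (c\<^sup>2 * deriv L (\<zeta> + c * of_real u))) (at u)"
proof -
  have "((\<lambda>v. Re (c * L (\<zeta> + c * of_real v))) has_real_derivative Re (c * (c * deriv L (\<zeta> + c * of_real u)))) (at u)"
    if "k (\<zeta> + c * of_real u) \<noteq> 0"
    using Re_has_real_derivative[of "\<lambda>z. c * L z", OF DERIV_cmult[OF L_deriv[OF that], of c]] .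
  then show ?thesis
    using cut_deriv[of phi1 phi2 \<zeta> c u "\<lambda>z. Re (c * L z)" "Re (c * (c * deriv L (\<zeta> + c * of_real u)))"] DERIV_phi1 phi_nonpos
    by (simp add: power2_eq_square mult.assoc)
qed

lemma M_deriv: "(M has_real_derivative M1 t) (at t)"
proof -
  have "((\<lambda>t. integral (cbox 0 (2 * pi)) (\<lambda>\<theta>. phi0 (lk (pt t \<theta>)))) has_real_derivative
      integral (cbox 0 (2 * pi)) (\<lambda>\<theta>. phi1 (lk (pt t \<theta>)) * Re (L (pt t \<theta>)))) (at t within UNIV)"
  proof (rule leibniz_rule_field_derivative)
    show "((\<lambda>t. phi0 (lk (pt t \<theta>))) has_real_derivative phi1 (lk (pt t \<theta>)) * Re (L (pt t \<theta>))) (at t within UNIV)" for t \<theta>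
      using phi0_deriv[of "\<i> * of_real \<theta>" 1 t] by (simp add: add.commute)
    show "(\<lambda>\<theta>. phi0 (lk (pt t \<theta>))) integrable_on cbox 0 (2 * pi)" for t
      by (intro integrable_continuous phi0_continuous)
    show "continuous_on (UNIV \<times> cbox 0 (2 * pi)) (\<lambda>(t, \<theta>). phi1 (lk (pt t \<theta>)) * Re (L (pt t \<theta>)))"
      by (rule re_cont(1))
  qed auto
  then show ?thesis unfolding M_def[abs_def] M1_def by simp
qed

lemma pt_periodic: "k (pt t (\<theta> + 2 * pi)) = k (pt t \<theta>)" "lk (pt t (\<theta> + 2 * pi)) = lk (pt t \<theta>)" "L (pt t (\<theta> + 2 * pi)) = L (pt t \<theta>)"
proof -
  have e: "pt t (\<theta> + 2 * pi) = pt t \<theta> + 2 * of_real pi * \<i>" by (simp add: algebra_simps)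
  have kp: "k (\<zeta> + 2 * of_real pi * \<i>) = k \<zeta>" for \<zeta> unfolding k_def by (simp add: exp_add)
  have "deriv k \<zeta> = deriv k (\<zeta> + 2 * of_real pi * \<i>)" for \<zeta>
  proof -
    have "((\<lambda>z. k (z + 2 * of_real pi * \<i>)) has_field_derivative deriv k (\<zeta> + 2 * of_real pi * \<i>)) (at \<zeta>)"
      using k_deriv[of "\<zeta> + 2 * of_real pi * \<i>"] by (simp add: DERIV_shift)
    then show ?thesis unfolding kp by (rule DERIV_imp_deriv)
  qed
  then show "k (pt t (\<theta> + 2 * pi)) = k (pt t \<theta>)" "lk (pt t (\<theta> + 2 * pi)) = lk (pt t \<theta>)" "L (pt t (\<theta> + 2 * pi)) = L (pt t \<theta>)"
    unfolding e L_def lk_def kp by auto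
qed

text \<open>Differentiation leaves a term with \<open>deriv L\<close> of unknown sign. The second
  angular derivative, which contains it with the opposite sign since ln |k| is harmonic, integrates
  to 0 over a period; adding it completes the square of the modulus of \<open>L\<close>.\<close>

lemma M1_deriv: "(M1 has_real_derivative M2 t) (at t)"
proof -
  let ?tt = "\<lambda>t \<theta>. phi2 (lk (pt t \<theta>)) * (Re (L (pt t \<theta>)))\<^sup>2 + phi1 (lk (pt t \<theta>)) * Re (deriv L (pt t \<theta>))"
  let ?hh = "\<lambda>t \<theta>. phi2 (lk (pt t \<theta>)) * (Im (L (pt t \<theta>)))\<^sup>2 - phi1 (lk (pt t \<theta>)) * Re (deriv L (pt t \<theta>))"
  have c1: "continuous_on S (\<lambda>(t, \<theta>). ?tt t \<theta>)" for S
    using continuous_on_add[OF re2_cont(1)[of S] deriv_cont(1)[of S]] by (simp add: case_prod_beta)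
  have c2: "continuous_on S (?tt t)" for S t by (rule continuous_on_add[OF re2_cont(2) deriv_cont(2)])
  have c3: "continuous_on S (?hh t)" for S t by (rule continuous_on_diff[OF im2_cont(2) deriv_cont(2)])
  have D: "(M1 has_real_derivative integral {0..2 * pi} (?tt t)) (at t)"
  proof -
    have "((\<lambda>t. integral (cbox 0 (2 * pi)) (\<lambda>\<theta>. phi1 (lk (pt t \<theta>)) * Re (L (pt t \<theta>)))) has_real_derivative
        integral (cbox 0 (2 * pi)) (?tt t)) (at t within UNIV)"
    proof (rule leibniz_rule_field_derivative)
      show "((\<lambda>t. phi1 (lk (pt t \<theta>)) * Re (L (pt t \<theta>))) has_real_derivative ?tt t \<theta>) (at t within UNIV)" for t \<theta>
        using phi1_deriv[of "\<i> * of_real \<theta>" 1 t] by (simp add: add.commute)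
      show "(\<lambda>\<theta>. phi1 (lk (pt t \<theta>)) * Re (L (pt t \<theta>))) integrable_on cbox 0 (2 * pi)" for t
        by (intro integrable_continuous re_cont(2))
    qed (use c1 in auto)
    then show ?thesis unfolding M1_def[abs_def] by simp
  qed
  have "(?hh t has_integral - (phi1 (lk (pt t (2 * pi))) * Im (L (pt t (2 * pi)))) - - (phi1 (lk (pt t 0)) * Im (L (pt t 0)))) {0..2 * pi}"
  proof (rule fundamental_theorem_of_calculus)
    fix \<theta> :: real
    have "((\<lambda>\<theta>. - (phi1 (lk (pt t \<theta>)) * Im (L (pt t \<theta>)))) has_real_derivative ?hh t \<theta>) (at \<theta>)"
      using phi1_deriv[of "of_real t" \<i> \<theta>] by simp
    then show "((\<lambda>\<theta>. - (phi1 (lk (pt t \<theta>)) * Im (L (pt t \<theta>)))) has_vector_derivative ?hh t \<theta>) (at \<theta> within {0..2 * pi})"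
      using has_vector_derivative_at_within has_real_derivative_iff_has_vector_derivative by blast
  qed simp
  then have h0: "integral {0..2 * pi} (?hh t) = 0"
    using pt_periodic(2,3)[of t 0] by (simp add: integral_unique)
  have "M2 t = integral {0..2 * pi} (\<lambda>\<theta>. ?tt t \<theta> + ?hh t \<theta>)"
    unfolding M2_def by (rule integral_cong) (simp add: cmod_power2 algebra_simps)
  also have "\<dots> = integral {0..2 * pi} (?tt t) + integral {0..2 * pi} (?hh t)"
    by (intro integral_add integrable_continuous_real c2 c3)
  finally show ?thesis using D h0 by simp
qed

lemma M2_integrand_continuous: "continuous_on S (\<lambda>\<theta>. phi2 (lk (pt t \<theta>)) * (cmod (L (pt t \<theta>)))\<^sup>2)"
  by (rule norm2_cont(2))

lemma M2_nonneg: "0 \<le> M2 t"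
  unfolding M2_def by (intro integral_nonneg integrable_continuous_real M2_integrand_continuous) (simp add: phi_nonneg)

text \<open>This is convexity of \<open>M\<close> in the logarithm of the radius, the device by
  which bounds on \<open>M\<close> become bounds on its slope.\<close>

lemma M1_mono: "s \<le> t \<Longrightarrow> M1 s \<le> M1 t"
  by (rule DERIV_nonneg_imp_nondecreasing) (use M1_deriv M2_nonneg in blast)+

lemma M_nonneg: "0 \<le> M t"
  unfolding M_def by (intro integral_nonneg integrable_continuous_real phi0_continuous) (simp add: phi_nonneg)

text \<open>The Carleman differential inequality. The angular half of \<open>M2\<close> dominates
  \<open>2 * l^2\<close> times the integral of \<open>phi0\<close> by Wirtinger; together with the
  radial half this dominates \<open>2 * l * M1\<close> by the arithmetic-geometric inequality and
  \<open>phi_ineq\<close>. Hence \<open>M1\<close> grows like the exponential of twice the integral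
  of \<open>l\<close>.\<close>

lemma M2_ge:
  assumes "frequency_bound (\<lambda>\<theta>. phi0 (lk (pt t \<theta>))) l"
  shows "2 * l * M1 t \<le> M2 t"
proof (cases "l = 0")
  case True
  then show ?thesis using M2_nonneg by simp
next
  case False
  then obtain m where l: "0 < l" and m: "0 < m" "l * m < pi" "\<And>x. \<exists>z\<in>{x..x + m}. phi0 (lk (pt t z)) = 0"
    using assms unfolding frequency_bound_def by auto
  let ?G = "\<lambda>\<theta>. phi0 (lk (pt t \<theta>))"
  let ?Xt = "\<lambda>\<theta>. phi2 (lk (pt t \<theta>)) * (Re (L (pt t \<theta>)))\<^sup>2"
  let ?Xh = "\<lambda>\<theta>. phi2 (lk (pt t \<theta>)) * (Im (L (pt t \<theta>)))\<^sup>2"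
  have Gc: "continuous_on S ?G" for S by (rule phi0_continuous)
  have Xt: "continuous_on S ?Xt" for S by (rule re2_cont(2))
  have Xh: "continuous_on S ?Xh" for S by (rule im2_cont(2))
  note Xc = Xt Xh
  have "2 * l\<^sup>2 * integral {0..2 * pi} ?G \<le> integral {0..2 * pi} ?Xh"
  proof (rule wirtinger_periodic[OF l m(2,1) m(3), where Y = "\<lambda>\<theta>. - (phi1 (lk (pt t \<theta>)) * Im (L (pt t \<theta>)))"])
    show "(?G has_real_derivative - (phi1 (lk (pt t \<theta>)) * Im (L (pt t \<theta>)))) (at \<theta>)" for \<theta>
      using phi0_deriv[of "of_real t" \<i> \<theta>] by simp
    show "continuous_on UNIV (\<lambda>\<theta>. - (phi1 (lk (pt t \<theta>)) * Im (L (pt t \<theta>))))"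
      by (intro continuous_on_minus im_cont(2))
    show "(- (phi1 (lk (pt t \<theta>)) * Im (L (pt t \<theta>))))\<^sup>2 \<le> 2 * ?G \<theta> * ?Xh \<theta>" for \<theta>
      using mult_right_mono[OF phi_ineq[of "lk (pt t \<theta>)"], of "(Im (L (pt t \<theta>)))\<^sup>2"]
      by (simp add: power_mult_distrib mult_ac)
    show "?G (\<theta> + 2 * pi) = ?G \<theta>" "?Xh (\<theta> + 2 * pi) = ?Xh \<theta>" for \<theta>
      by (simp_all only: pt_periodic)
    show "continuous_on UNIV ?Xh" by (rule Xc)
  qed (auto simp: phi_nonneg)
  moreover have "2 * l * M1 t \<le> integral {0..2 * pi} (\<lambda>\<theta>. ?Xt \<theta> + 2 * l\<^sup>2 * ?G \<theta>)"
  proof -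
    have "2 * l * M1 t = integral {0..2 * pi} (\<lambda>\<theta>. 2 * l * (phi1 (lk (pt t \<theta>)) * Re (L (pt t \<theta>))))" unfolding M1_def by simp
    also have "\<dots> \<le> integral {0..2 * pi} (\<lambda>\<theta>. ?Xt \<theta> + 2 * l\<^sup>2 * ?G \<theta>)"
    proof (intro integral_le integrable_continuous_real)
      show "continuous_on {0..2 * pi} (\<lambda>\<theta>. 2 * l * (phi1 (lk (pt t \<theta>)) * Re (L (pt t \<theta>))))"
        by (rule continuous_on_mult[OF continuous_on_const re_cont(2)])
      show "continuous_on {0..2 * pi} (\<lambda>\<theta>. ?Xt \<theta> + 2 * l\<^sup>2 * ?G \<theta>)" by (intro continuous_on_add continuous_on_mult continuous_on_const Xc Gc)
      fix \<theta>
      define p1 p2 p0 r where "p1 = phi1 (lk (pt t \<theta>))" and "p2 = phi2 (lk (pt t \<theta>))" and "p0 = phi0 (lk (pt t \<theta>))" and "r = Re (L (pt t \<theta>))"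
      have nn: "p0 \<ge> 0" "p2 \<ge> 0" unfolding p0_def p2_def by (simp_all add: phi_nonneg)
      have "(2 * l * (p1 * r))\<^sup>2 = 4 * l\<^sup>2 * r\<^sup>2 * p1\<^sup>2" by (simp add: power_mult_distrib)
      also have "\<dots> \<le> 4 * l\<^sup>2 * r\<^sup>2 * (2 * p0 * p2)" unfolding p0_def p1_def p2_def by (intro mult_left_mono phi_ineq) auto
      also have "\<dots> = 4 * (p2 * r\<^sup>2) * (2 * l\<^sup>2 * p0)" by simp
      also have "\<dots> \<le> (p2 * r\<^sup>2 + 2 * l\<^sup>2 * p0)\<^sup>2"
        using zero_le_power2[of "p2 * r\<^sup>2 - 2 * l\<^sup>2 * p0"] unfolding power2_sum power2_diff by (simp add: mult_ac)
      finally have "2 * l * (p1 * r) \<le> p2 * r\<^sup>2 + 2 * l\<^sup>2 * p0" by (rule power2_le_imp_le) (use nn in auto)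
      then show "2 * l * (phi1 (lk (pt t \<theta>)) * Re (L (pt t \<theta>))) \<le> ?Xt \<theta> + 2 * l\<^sup>2 * ?G \<theta>" unfolding p0_def p1_def p2_def r_def .
    qed
    finally show ?thesis .
  qed
  moreover have "integral {0..2 * pi} (\<lambda>\<theta>. ?Xt \<theta> + 2 * l\<^sup>2 * ?G \<theta>) = integral {0..2 * pi} ?Xt + 2 * l\<^sup>2 * integral {0..2 * pi} ?G"
    by (subst integral_add) (auto intro!: integrable_continuous_real continuous_on_mult continuous_on_const Xc Gc)
  moreover have "M2 t = integral {0..2 * pi} ?Xt + integral {0..2 * pi} ?Xh"
  proof -
    have "M2 t = integral {0..2 * pi} (\<lambda>\<theta>. ?Xt \<theta> + ?Xh \<theta>)"
      unfolding M2_def by (rule integral_cong) (simp add: cmod_power2 algebra_simps)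
    also have "\<dots> = integral {0..2 * pi} ?Xt + integral {0..2 * pi} ?Xh" by (intro integral_add integrable_continuous_real Xc)
    finally show ?thesis .
  qed
  ultimately show ?thesis by linarith
qed

lemma M_le:
  assumes "\<And>z. cmod z = exp t \<Longrightarrow> cmod (K z) \<le> exp b" "0 \<le> b"
  shows "M t \<le> 2 * pi * b\<^sup>2"
proof -
  have "M t \<le> integral {0..2 * pi} (\<lambda>\<theta>. b\<^sup>2)"
    unfolding M_def
  proof (intro integral_le integrable_continuous_real)
    show "continuous_on {0..2 * pi} (\<lambda>\<theta>. phi0 (lk (pt t \<theta>)))" by (rule phi0_continuous)
    fix \<theta>
    have "cmod (exp (pt t \<theta>)) = exp t" by (simp add: norm_exp_eq_Re)
    then have "cmod (k (pt t \<theta>)) \<le> exp b" unfolding k_def by (rule assms)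
    have "lk (pt t \<theta>) \<le> b"
    proof (cases "k (pt t \<theta>) = 0")
      case True
      then show ?thesis using assms(2) by (simp add: lk_def)
    next
      case False
      then have "ln (cmod (k (pt t \<theta>))) \<le> ln (exp b)" using \<open>cmod (k (pt t \<theta>)) \<le> exp b\<close> by (intro ln_mono) auto
      then show ?thesis by (simp add: lk_def)
    qed
    then have "(max 0 (lk (pt t \<theta>)))\<^sup>2 \<le> b\<^sup>2" using assms(2) by (intro power_mono) auto
    then show "phi0 (lk (pt t \<theta>)) \<le> b\<^sup>2" using phi0_le order_trans by blast
  qed auto
  then show ?thesis by simp
qed

text \<open>\<open>M\<close> is bounded on the left because \<open>K\<close> is bounded near 0,
  whereas a negative slope at \<open>t\<close> and convexity would make \<open>M\<close> grow
  linearly to the left. The point \<open>s\<close> lies far enough to gain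
  \<open>2 * pi * c^2 + 1\<close>, one more than the bound on \<open>M\<close>.\<close>

lemma M1_nonneg: "0 \<le> M1 t"
proof (rule ccontr)
  assume "\<not> ?thesis"
  then have neg: "M1 t < 0" by simp
  have "bounded (K ` cball 0 (exp t))" by (intro compact_imp_bounded compact_continuous_image entire_continuous_on K_entire) auto
  then obtain b where "\<forall>y\<in>K ` cball 0 (exp t). cmod y \<le> b" unfolding bounded_iff by blast
  then have b: "\<And>z. cmod z \<le> exp t \<Longrightarrow> cmod (K z) \<le> b" by simp
  define c where "c = max 0 (ln (max 1 b))"
  have c: "0 \<le> c" "b \<le> exp c" unfolding c_def by (auto simp: max_def)
  have Mb: "M s \<le> 2 * pi * c\<^sup>2" if "s \<le> t" for s
  proof (rule M_le)
    fix z assume "cmod z = exp s"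
    then have "cmod (K z) \<le> b" using b that by simp
    then show "cmod (K z) \<le> exp c" using c by linarith
  qed (rule c)
  define s where "s = t - (2 * pi * c\<^sup>2 + 1) / (- M1 t)"
  have "2 * pi * c\<^sup>2 + 1 > 0" by (intro add_nonneg_pos) auto
  then have "(2 * pi * c\<^sup>2 + 1) / (- M1 t) > 0" using neg by (intro divide_pos_pos) auto
  then have st: "s < t" unfolding s_def by linarith
  obtain x where x: "s < x" "x < t" "M t - M s = (t - s) * M1 x" using MVT2[OF st, of M M1] M_deriv by blast
  have "(t - s) * M1 x \<le> (t - s) * M1 t" using M1_mono[of x t] x st by (intro mult_left_mono) auto
  also have "\<dots> = - (2 * pi * c\<^sup>2 + 1)" unfolding s_def using neg by (simp add: field_simps)
  finally have "M s \<ge> M t + 2 * pi * c\<^sup>2 + 1" using x(3) by linarith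
  then show False using Mb[of s] st M_nonneg[of t] by linarith
qed

text \<open>By convexity \<open>M1 t\<close> is at most \<open>M (t + 1) - M t\<close>, and
  \<open>M\<close> is quadratic in the logarithm of the maximum modulus.\<close>

lemma M1_small:
  assumes "zero_type K" and e: "e > 0"
  shows "\<exists>T. \<forall>t\<ge>T. M1 t \<le> e * exp (2 * t)"
proof -
  \<comment> \<open>Solves \<open>2 * pi * (e1 * exp (t + 1))^2 = e * exp (2 * t)\<close>.\<close>
  define e1 where "e1 = sqrt (e / (2 * pi * exp 2))"
  have e1: "e1 > 0" "2 * pi * exp 2 * e1\<^sup>2 = e" unfolding e1_def using e by auto
  obtain R where R: "\<And>z. R \<le> cmod z \<Longrightarrow> cmod (K z) \<le> exp (e1 * cmod z)" using assms(1) e1 unfolding zero_type_def by blast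
  show ?thesis
  proof (intro exI[of _ "max 0 (ln (max 1 R))"] allI impI)
    fix t assume t: "max 0 (ln (max 1 R)) \<le> t"
    have "R \<le> exp (t + 1)"
    proof -
      have "R \<le> max 1 R" by simp
      also have "\<dots> = exp (ln (max 1 R))" by simp
      also have "\<dots> \<le> exp (t + 1)" unfolding exp_le_cancel_iff using t by linarith
      finally show ?thesis .
    qed
    then have "cmod (K z) \<le> exp (e1 * exp (t + 1))" if "cmod z = exp (t + 1)" for z using R[of z] that by simp
    then have "M (t + 1) \<le> 2 * pi * (e1 * exp (t + 1))\<^sup>2" using e1 by (intro M_le) auto
    also have "\<dots> = (2 * pi * exp 2 * e1\<^sup>2) * exp (2 * t)"
      by (simp add: power_mult_distrib exp_double[symmetric] exp_add[symmetric] algebra_simps)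
    finally have 1: "M (t + 1) \<le> e * exp (2 * t)" unfolding e1(2) .
    obtain x where x: "t < x" "x < t + 1" "M (t + 1) - M t = (t + 1 - t) * M1 x" using MVT2[of t "t + 1" M M1] M_deriv by auto
    have "M1 t \<le> M1 x" using x by (intro M1_mono) auto
    then show "M1 t \<le> e * exp (2 * t)" using x(3) 1 M_nonneg[of t] by simp
  qed
qed

text \<open>If \<open>M1\<close> vanished identically, so would \<open>M2\<close>; then
  \<open>L\<close> would vanish wherever |k| > 1, making \<open>K\<close> locally constant on a
  nonempty open set and thus constant.\<close>

lemma M1_eventually_pos:
  assumes nc: "\<not> K constant_on UNIV" and z1: "cmod (K z1) > 1"
  shows "\<exists>t. M1 t > 0"
proof (rule ccontr)
  assume "\<not> ?thesis"
  then have M10: "M1 = (\<lambda>_. 0)" using M1_nonneg by (auto simp: fun_eq_iff intro: antisym simp: not_less)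
  have M20: "M2 t = 0" for t using M1_deriv[of t] unfolding M10 by (metis DERIV_const DERIV_unique)
  have z: "phi2 (lk (pt t \<theta>)) * (cmod (L (pt t \<theta>)))\<^sup>2 = 0" if "\<theta> \<in> {0..2*pi}" for t \<theta>
  proof -
    have int: "((\<lambda>\<theta>. phi2 (lk (pt t \<theta>)) * (cmod (L (pt t \<theta>)))\<^sup>2) has_integral 0) (cbox 0 (2 * pi))"
      using integrable_integral[OF integrable_continuous_real[OF M2_integrand_continuous[of "{0..2*pi}" t]]] M20[of t]
      unfolding M2_def by simp
    have "pi \<in> box 0 (2 * pi)" using pi_gt_zero by (simp add: box_real)
    then have ne: "box 0 (2 * pi) \<noteq> {}" by blast
    show ?thesis
    proof (rule has_integral_0_cbox_imp_0[OF M2_integrand_continuous[of "cbox 0 (2*pi)" t] _ int ne])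
      show "\<theta> \<in> cbox 0 (2 * pi)" using that by simp
    qed (simp add: phi_nonneg)
  qed
  have dk: "deriv k (pt t \<theta>) = 0" if "\<theta> \<in> {0..2*pi}" "cmod (k (pt t \<theta>)) > 1" for t \<theta>
  proof -
    have "lk (pt t \<theta>) > 0" unfolding lk_def by (rule ln_gt_zero[OF that(2)])
    then have "L (pt t \<theta>) = 0" using z[OF that(1), of t] phi_pos(2)[of "lk (pt t \<theta>)"] by simp
    then show ?thesis unfolding L_def using that(2) by auto
  qed
  have "open {z. cmod (K z) > 1}" by (intro open_Collect_less continuous_intros entire_continuous_on K_entire)
  then obtain r where r: "r > 0" "ball z1 r \<subseteq> {z. cmod (K z) > 1}" using z1 openE by blast
  \<comment> \<open>The origin is removed because the exponential omits it.\<close>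
  define S where "S = ball z1 r - {0}"
  have S: "open S" unfolding S_def by (simp add: open_Diff)
  have dK: "deriv K w = 0" if w: "w \<in> S" for w
  proof -
    obtain \<theta> where th: "0 \<le> \<theta>" "\<theta> < 2 * pi" "w = rcis (cmod w) \<theta>"
    proof -
      have "w = rcis (cmod w) (Arg2pi w)" using Arg2pi_eq[of w] by (simp add: rcis_def cis_conv_exp)
      then show ?thesis using that Arg2pi_ge_0 Arg2pi_lt_2pi by blast
    qed
    have w0: "w \<noteq> 0" using w unfolding S_def by simp
    have "exp (pt (ln (cmod w)) \<theta>) = rcis (cmod w) \<theta>"
      using w0 by (simp add: exp_add exp_of_real rcis_def cis_conv_exp)
    then have e: "exp (pt (ln (cmod w)) \<theta>) = w" using th(3) by simp
    have "cmod (k (pt (ln (cmod w)) \<theta>)) > 1" unfolding k_def e using w r(2) unfolding S_def by auto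
    then have "deriv k (pt (ln (cmod w)) \<theta>) = 0" using th by (intro dk) auto
    moreover have "(k has_field_derivative deriv K (exp (pt (ln (cmod w)) \<theta>)) * exp (pt (ln (cmod w)) \<theta>)) (at (pt (ln (cmod w)) \<theta>))"
      unfolding k_def[abs_def] using holomorphic_derivI[OF K_entire open_UNIV UNIV_I] by (intro DERIV_chain2[OF _ DERIV_exp]) auto
    then have "deriv k (pt (ln (cmod w)) \<theta>) = deriv K w * w" unfolding e by (rule DERIV_imp_deriv)
    ultimately show ?thesis using w0 by simp
  qed
  obtain p where p: "p \<in> S"
  proof -
    have "z1 + of_real (r / 2) \<in> ball z1 r" "z1 \<in> ball z1 r" using r(1) by (auto simp: dist_norm)
    moreover have "z1 \<noteq> 0 \<or> z1 + of_real (r / 2) \<noteq> 0" using r(1) by auto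
    ultimately show ?thesis using that unfolding S_def by blast
  qed
  have "deriv K w = 0" for w
    by (rule analytic_continuation_open[of S UNIV "deriv K" "\<lambda>_. 0"])
       (use S p dK holomorphic_deriv[OF K_entire open_UNIV] in auto)
  then have "(K has_field_derivative 0) (at x within UNIV)" for x
    using holomorphic_derivI[OF K_entire open_UNIV UNIV_I, of x] by simp
  then have "\<exists>c. \<forall>x\<in>UNIV. K x = c" by (intro has_field_derivative_zero_constant) auto
  then show False using nc unfolding constant_on_def by blast
qed

end

subsection \<open>Two entire functions with essentially disjoint tracts\<close>

text \<open>A Gronwall argument: \<open>P t * exp (- w t)\<close> is nondecreasing from
  \<open>T\<close> on, so \<open>P\<close> grows at least like \<open>exp (4 * t)\<close>. The
  function \<open>w\<close> is a primitive of the growth rate and may carry an integrable correction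
  to \<open>4 * t\<close>.\<close>

lemma exponential_growth:
  fixes P P' w w' :: "real \<Rightarrow> real"
  assumes P: "\<And>t. (P has_real_derivative P' t) (at t)" and w: "\<And>t. (w has_real_derivative w' t) (at t)"
    and ge: "\<And>t. T \<le> t \<Longrightarrow> w' t * P t \<le> P' t" and wt: "\<And>t. w t \<ge> 4 * t" and pos: "P T > 0"
    and small: "\<And>e. e > 0 \<Longrightarrow> \<exists>T. \<forall>t\<ge>T. P t \<le> e * exp (4 * t)"
  shows False
proof -
  define c where "c = P T * exp (- w T)"
  have c: "c > 0" unfolding c_def using pos by simp
  have grow: "c * exp (4 * t) \<le> P t" if t: "T \<le> t" for t
  proof -
    have "P T * exp (- w T) \<le> P t * exp (- w t)"
    proof (rule DERIV_nonneg_imp_nondecreasing[OF t])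
      fix x assume x: "T \<le> x" "x \<le> t"
      have "((\<lambda>t. P t * exp (- w t)) has_real_derivative P' x * exp (- w x) + exp (- w x) * (- w' x) * P x) (at x)"
        by (intro DERIV_mult P DERIV_chain2[OF DERIV_exp] DERIV_minus w)
      moreover have "P' x * exp (- w x) + exp (- w x) * (- w' x) * P x = exp (- w x) * (P' x - w' x * P x)"
        by (simp add: algebra_simps)
      moreover have "\<dots> \<ge> 0" using ge[OF x(1)] by simp
      ultimately show "\<exists>y. ((\<lambda>t. P t * exp (- w t)) has_real_derivative y) (at x) \<and> 0 \<le> y" by metis
    qed
    then have "c * exp (w t) \<le> (P t * exp (- w t)) * exp (w t)" unfolding c_def by (rule mult_right_mono) simp
    also have "\<dots> = P t" by (simp add: mult.assoc exp_add[symmetric])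
    finally have "c * exp (w t) \<le> P t" .
    moreover have "c * exp (4 * t) \<le> c * exp (w t)" using c wt[of t] by simp
    ultimately show ?thesis by linarith
  qed
  obtain T1 where T1: "\<And>t. T1 \<le> t \<Longrightarrow> P t \<le> c / 2 * exp (4 * t)" using small[of "c / 2"] c by auto
  define t where "t = max T T1"
  have "c * exp (4 * t) \<le> c / 2 * exp (4 * t)" using grow[of t] T1[of t] unfolding t_def by simp
  then show False using c by simp
qed

lemma sin_ge_half:
  assumes "0 < d" "d < pi / 16"
  shows "d / 2 \<le> sin d"
proof -
  obtain x where x: "0 < x" "x < d" "sin d - sin 0 = (d - 0) * cos x" using MVT2[OF assms(1), of sin cos] by auto
  have "cos (pi / 3) \<le> cos x" using x assms by (intro cos_monotone_0_pi_le) auto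
  then have "1 / 2 \<le> cos x" by (simp add: cos_60)
  then have "d * (1 / 2) \<le> d * cos x" using assms by (intro mult_left_mono) auto
  then show ?thesis using x(3) by simp
qed

locale disjoint_tracts =
  K: log_means K + L: log_means L for K L +
  fixes C0 :: real
  assumes zero_type: "zero_type K" "zero_type L" and C0: "C0 > 0"
    and disjoint: "\<And>z. C0 \<le> \<bar>Im z\<bar> \<Longrightarrow> cmod (K z) \<le> 1 \<or> cmod (L z) \<le> 1"
begin

text \<open>Half the angle of the uncontrolled arcs on the circle of radius \<open>exp t\<close>.
  The factor 2 makes up for the estimate \<open>\<delta> / 2 \<le> sin \<delta>\<close>, so that
  |sin x| >= sin \<delta> implies \<open>C0 \<le> \<bar>Im z\<bar>\<close>.\<close>

definition \<delta> :: "real \<Rightarrow> real" where "\<delta> t = 2 * C0 * exp (- t)"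

lemma \<delta>_small: "\<exists>T. \<forall>t\<ge>T. \<delta> t < pi / 16"
proof -
  have "\<forall>\<^sub>F t in at_top. \<delta> t < pi / 16"
  proof (rule order_tendstoD(2))
    show "(\<delta> \<longlongrightarrow> 0) at_top" unfolding \<delta>_def by real_asymp
  qed simp
  then show ?thesis by (simp add: eventually_at_top_linorder)
qed

lemma \<delta>_pos: "\<delta> t > 0"
  unfolding \<delta>_def using C0 by simp

lemma vanish:
  assumes "\<delta> t < pi / 16"
  shows "\<forall>x. sin (\<delta> t) \<le> \<bar>sin x\<bar> \<longrightarrow> phi0 (K.lk (of_real t + \<i> * of_real x)) = 0 \<or> phi0 (L.lk (of_real t + \<i> * of_real x)) = 0"
proof (intro allI impI)
  fix x assume x: "sin (\<delta> t) \<le> \<bar>sin x\<bar>"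
  let ?z = "of_real t + \<i> * of_real x"
  have "C0 = exp t * (\<delta> t / 2)" unfolding \<delta>_def by (simp add: exp_minus)
  also have "\<dots> \<le> exp t * sin (\<delta> t)" by (intro mult_left_mono sin_ge_half[OF \<delta>_pos assms]) auto
  also have "\<dots> \<le> exp t * \<bar>sin x\<bar>" using x by simp
  also have "\<dots> = \<bar>Im (exp ?z)\<bar>" by (simp add: Im_exp abs_mult)
  finally have "cmod (K (exp ?z)) \<le> 1 \<or> cmod (L (exp ?z)) \<le> 1" by (rule disjoint)
  then show "phi0 (K.lk ?z) = 0 \<or> phi0 (L.lk ?z) = 0"
    using K.lk_nonpos[of ?z] L.lk_nonpos[of ?z] phi_nonpos(1) unfolding K.k_def L.k_def by blast
qed

text \<open>A constant \<open>K\<close> of modulus above 1 is never cut off, so \<open>L\<close> is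
  at most 1 in modulus outside the strip. Its positive arcs are tiny, frequency 2 is available, and
  its mean alone would grow like \<open>exp (4 * t)\<close>.\<close>

lemma constant_case:
  assumes K: "K constant_on UNIV" "cmod (K z1) > 1" and z2: "cmod (L z2) > 1"
  shows False
proof (cases "L constant_on UNIV")
  case True
  have "K z1 = K (\<i> * of_real C0)" "L z2 = L (\<i> * of_real C0)" using K(1) True unfolding constant_on_def by auto
  then show False using disjoint[of "\<i> * of_real C0"] C0 K(2) z2 by auto
next
  case False
  obtain t1 where t1: "L.M1 t1 > 0" using L.M1_eventually_pos[OF False z2] by blast
  obtain T where T: "\<And>t. T \<le> t \<Longrightarrow> \<delta> t < pi / 16" using \<delta>_small by blast
  define t0 where "t0 = max t1 T"
  show False
  proof (rule exponential_growth[of L.M1 L.M2 "\<lambda>t. 4 * t" "\<lambda>_. 4" t0])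
    show "((*) 4 has_real_derivative 4) (at t)" for t :: real by (rule derivative_eq_intros refl | simp)+
    show "0 < L.M1 t0" using L.M1_mono[of t1 t0] t1 unfolding t0_def by simp
    show "4 * L.M1 t \<le> L.M2 t" if t: "t0 \<le> t" for t
    proof -
      have d: "\<delta> t < pi / 16" using T t unfolding t0_def by simp
      have nz: "phi0 (K.lk (of_real t + \<i> * of_real x)) \<noteq> 0" for x
      proof -
        have "K (exp (of_real t + \<i> * of_real x)) = K z1" using K(1) unfolding constant_on_def by auto
        then have "K.lk (of_real t + \<i> * of_real x) > 0" using ln_gt_zero[OF K(2)] unfolding K.lk_def K.k_def by simp
        then show ?thesis using phi_pos(1) by fastforce
      qed
      then have "frequency_bound (\<lambda>\<theta>. phi0 (L.lk (of_real t + \<i> * of_real \<theta>))) 2"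
        by (intro frequency_bound_positive[OF \<delta>_pos d _ _ vanish[OF d]]) (use nz in \<open>simp_all only: K.pt_periodic L.pt_periodic simp_thms\<close>)
      then show ?thesis using L.M2_ge[of t 2] by simp
    qed
    show "\<exists>T. \<forall>t\<ge>T. L.M1 t \<le> e * exp (4 * t)" if e: "e > 0" for e
    proof -
      obtain T where T: "\<And>t. T \<le> t \<Longrightarrow> L.M1 t \<le> e * exp (2 * t)" using L.M1_small[OF zero_type(2) e] by blast
      have "L.M1 t \<le> e * exp (4 * t)" if "max 0 T \<le> t" for t
      proof -
        have "e * exp (2 * t) \<le> e * exp (4 * t)" using e that by simp
        then show ?thesis using T[of t] that by simp
      qed
      then show ?thesis by blast
    qed
  qed (use L.M1_deriv in auto)
qed

text \<open>The logarithmic derivative of the product of the two \<open>M1\<close> is at least twice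
  the sum of the frequencies, that is \<open>4 - 8 * \<delta> t\<close>; its primitive is
  \<open>4 * t + 16 * C0 * exp (- t)\<close>. Type zero bounds each factor by o(exp (2 t)).\<close>

lemma nonconstant_case:
  assumes K: "\<not> K constant_on UNIV" "cmod (K z1) > 1" and L: "\<not> L constant_on UNIV" "cmod (L z2) > 1"
  shows False
proof -
  obtain t1 where t1: "K.M1 t1 > 0" using K.M1_eventually_pos[OF K] by blast
  obtain t2 where t2: "L.M1 t2 > 0" using L.M1_eventually_pos[OF L] by blast
  obtain T where T: "\<And>t. T \<le> t \<Longrightarrow> \<delta> t < pi / 16" using \<delta>_small by blast
  define t0 where "t0 = max (max t1 t2) T"
  have KL: "K.M1 t > 0" "L.M1 t > 0" if "t0 \<le> t" for t
    using K.M1_mono[of t1 t] L.M1_mono[of t2 t] t1 t2 that unfolding t0_def by auto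
  show False
  proof (rule exponential_growth[of "\<lambda>t. K.M1 t * L.M1 t" "\<lambda>t. K.M2 t * L.M1 t + L.M2 t * K.M1 t"
        "\<lambda>t. 4 * t + 16 * C0 * exp (- t)" "\<lambda>t. 4 - 8 * \<delta> t" t0])
    show "((\<lambda>t. K.M1 t * L.M1 t) has_real_derivative K.M2 t * L.M1 t + L.M2 t * K.M1 t) (at t)" for t
      by (rule DERIV_mult[OF K.M1_deriv L.M1_deriv])
    show "((\<lambda>t. 4 * t + 16 * C0 * exp (- t)) has_real_derivative 4 - 8 * \<delta> t) (at t)" for t
      unfolding \<delta>_def by (rule derivative_eq_intros refl | simp)+
    show "(4 - 8 * \<delta> t) * (K.M1 t * L.M1 t) \<le> K.M2 t * L.M1 t + L.M2 t * K.M1 t" if t: "t0 \<le> t" for t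
    proof -
      have d: "\<delta> t < pi / 16" using T t unfolding t0_def by simp
      obtain lu lv where l: "2 - 4 * \<delta> t \<le> lu + lv"
        "frequency_bound (\<lambda>\<theta>. phi0 (K.lk (of_real t + \<i> * of_real \<theta>))) lu" "frequency_bound (\<lambda>\<theta>. phi0 (L.lk (of_real t + \<i> * of_real \<theta>))) lv"
        using frequency_bounds[OF \<delta>_pos d _ _ vanish[OF d]] by (auto simp only: K.pt_periodic L.pt_periodic)
      have "2 * lu * K.M1 t * L.M1 t \<le> K.M2 t * L.M1 t" using K.M2_ge[OF l(2)] KL(2)[OF t] by (intro mult_right_mono) auto
      moreover have "2 * lv * L.M1 t * K.M1 t \<le> L.M2 t * K.M1 t" using L.M2_ge[OF l(3)] KL(1)[OF t] by (intro mult_right_mono) auto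
      moreover have "(4 - 8 * \<delta> t) * (K.M1 t * L.M1 t) \<le> (2 * (lu + lv)) * (K.M1 t * L.M1 t)"
        using l(1) KL[OF t] by (intro mult_right_mono) auto
      moreover have "(2 * (lu + lv)) * (K.M1 t * L.M1 t) = 2 * lu * K.M1 t * L.M1 t + 2 * lv * L.M1 t * K.M1 t" by (simp add: algebra_simps)
      ultimately show ?thesis by linarith
    qed
    show "4 * t \<le> 4 * t + 16 * C0 * exp (- t)" for t using C0 by simp
    show "0 < K.M1 t0 * L.M1 t0" using KL[of t0] by simp
    show "\<exists>T. \<forall>t\<ge>T. K.M1 t * L.M1 t \<le> e * exp (4 * t)" if e: "e > 0" for e
    proof -
      have e': "sqrt e > 0" using e by simp
      obtain T where T: "\<And>t. T \<le> t \<Longrightarrow> L.M1 t \<le> sqrt e * exp (2 * t)" using L.M1_small[OF zero_type(2) e'] by blast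
      obtain T' where T': "\<And>t. T' \<le> t \<Longrightarrow> K.M1 t \<le> sqrt e * exp (2 * t)" using K.M1_small[OF zero_type(1) e'] by blast
      have "K.M1 t * L.M1 t \<le> e * exp (4 * t)" if "max T T' \<le> t" for t
      proof -
        have "K.M1 t * L.M1 t \<le> (sqrt e * exp (2 * t)) * (sqrt e * exp (2 * t))"
          using T[of t] T'[of t] that e by (intro mult_mono K.M1_nonneg L.M1_nonneg) auto
        also have "\<dots> = (sqrt e * sqrt e) * (exp (2 * t) * exp (2 * t))" by (simp only: mult_ac)
        also have "\<dots> = e * exp (4 * t)" using e by (simp add: exp_add[symmetric])
        finally show ?thesis .
      qed
      then show ?thesis by blast
    qed
  qed
qed

end

text \<open>A form of the Denjoy--Carleman--Ahlfors theorem for two tracts: by the sharp monotonicity of the two logarithmic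
  means, their product grows at least like the fourth power of the radius, whereas each is of order \<open>o(r\<^sup>2)\<close>.
  The strip where both functions may be large only contributes an integrable error.\<close>

lemma two_tracts:
  assumes K: "zero_type K" and L: "zero_type L" and C0: "C0 > 0"
    and disjoint: "\<And>z. C0 \<le> \<bar>Im z\<bar> \<Longrightarrow> cmod (K z) \<le> 1 \<or> cmod (L z) \<le> 1"
  shows "(\<forall>z. cmod (K z) \<le> 1) \<or> (\<forall>z. cmod (L z) \<le> 1)"
proof (rule ccontr)
  assume "\<not> ?thesis"
  then obtain z1 z2 where z: "cmod (K z1) > 1" "cmod (L z2) > 1" by (auto simp: not_le)
  have hol: "K holomorphic_on UNIV" "L holomorphic_on UNIV" using K L unfolding zero_type_def by auto
  interpret KL: disjoint_tracts K L C0 by (unfold_locales; use hol K L C0 disjoint in blast)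
  interpret LK: disjoint_tracts L K C0 by (unfold_locales; use hol K L C0 disjoint in blast)
  show False
    using KL.constant_case[OF _ z] LK.constant_case[OF _ z(2,1)] KL.nonconstant_case[OF _ z(1) _ z(2)] by blast
qed

text \<open>The dichotomy with bound 1 is applied to all multiples of the pair by
  \<open>Suc n\<close>, at the price of a wider strip. One of the two alternatives occurs for
  infinitely many \<open>n\<close> and makes that function smaller than every 1 / (n + 1).\<close>

lemma two_tracts_zero:
  assumes K: "zero_type K" and L: "zero_type L" and C: "C > 0"
    and min: "\<And>z. Im z \<noteq> 0 \<Longrightarrow> cmod (K z) * \<bar>Im z\<bar> \<le> C \<or> cmod (L z) * \<bar>Im z\<bar> \<le> C"
  shows "(\<forall>z. K z = 0) \<or> (\<forall>z. L z = 0)"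
proof -
  have scale: "zero_type (\<lambda>z. of_real m * F z)" if F: "zero_type F" for F and m :: real
    unfolding zero_type_def
  proof (intro conjI allI impI)
    show "(\<lambda>z. of_real m * F z) holomorphic_on UNIV" using F unfolding zero_type_def by (auto intro!: holomorphic_intros)
    fix e :: real assume e: "e > 0"
    obtain R where R: "\<And>z. R \<le> cmod z \<Longrightarrow> cmod (F z) \<le> exp (e / 2 * cmod z)" using F e unfolding zero_type_def by (meson half_gt_zero)
    have "\<forall>\<^sub>F r in at_top. \<bar>m\<bar> * exp (e / 2 * r) \<le> exp (e * r)"
    proof -
      have "\<forall>\<^sub>F r in at_top. m' * exp (e / 2 * r) \<le> exp (e * r)" for m' using e by real_asymp
      then show ?thesis .
    qed
    then obtain R1 where R1: "\<And>r. R1 \<le> r \<Longrightarrow> \<bar>m\<bar> * exp (e / 2 * r) \<le> exp (e * r)" unfolding eventually_at_top_linorder by blast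
    have "cmod (of_real m * F z) \<le> exp (e * cmod z)" if "max R R1 \<le> cmod z" for z
    proof -
      have "cmod (of_real m * F z) \<le> \<bar>m\<bar> * exp (e / 2 * cmod z)" unfolding norm_mult using R[of z] that by (auto intro!: mult_left_mono)
      then show ?thesis using R1[of "cmod z"] that by simp
    qed
    then show "\<exists>R. \<forall>z. R \<le> cmod z \<longrightarrow> cmod (of_real m * F z) \<le> exp (e * cmod z)" by blast
  qed
  have n: "(\<forall>z. cmod (K z) \<le> 1 / real (Suc n)) \<or> (\<forall>z. cmod (L z) \<le> 1 / real (Suc n))" for n
  proof -
    let ?m = "real (Suc n)"
    have "(\<forall>z. cmod (of_real ?m * K z) \<le> 1) \<or> (\<forall>z. cmod (of_real ?m * L z) \<le> 1)"
    proof (rule two_tracts[OF scale[OF K] scale[OF L], of "?m * C"])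
      show "0 < ?m * C" using C by simp
      fix z assume z: "?m * C \<le> \<bar>Im z\<bar>"
      have "Im z \<noteq> 0" using z C by (smt (verit) mult_pos_pos of_nat_0_less_iff zero_less_Suc)
      have le: "cmod (of_real ?m * F z) \<le> 1" if F: "cmod (F z) * \<bar>Im z\<bar> \<le> C" for F
      proof -
        have "cmod (F z) * (?m * C) \<le> C" using z F by (smt (verit) mult_left_mono norm_ge_zero)
        then have "(?m * cmod (F z)) * C \<le> 1 * C" by (simp add: mult_ac)
        then have "?m * cmod (F z) \<le> 1" using C by (simp only: mult_le_cancel_right_pos)
        then show ?thesis by (simp add: norm_mult del: of_nat_Suc)
      qed
      show "cmod (of_real ?m * K z) \<le> 1 \<or> cmod (of_real ?m * L z) \<le> 1" using min[OF \<open>Im z \<noteq> 0\<close>] le by blast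
    qed
    then show ?thesis by (simp add: norm_mult field_simps del: of_nat_Suc)
  qed
  have zero: "F z = 0" if inf: "\<exists>\<^sub>\<infinity>n. \<forall>z. cmod (F z) \<le> 1 / real (Suc n)" for F :: "complex \<Rightarrow> complex" and z
  proof (rule ccontr)
    assume "F z \<noteq> 0"
    then obtain m where m: "1 / real (Suc m) < cmod (F z)" using nat_approx_posE[of "cmod (F z)"] by auto
    obtain n where n: "n > m" "\<forall>z. cmod (F z) \<le> 1 / real (Suc n)" using inf unfolding INFM_nat by blast
    have "1 / real (Suc n) \<le> 1 / real (Suc m)" using n(1) by (intro divide_left_mono) auto
    then show False using m n(2) by (meson not_le order_trans)
  qed
  have "\<exists>\<^sub>\<infinity>n. (\<forall>z. cmod (K z) \<le> 1 / real (Suc n)) \<or> (\<forall>z. cmod (L z) \<le> 1 / real (Suc n))"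
    using n by (simp add: INFM_nat)
  then show ?thesis unfolding frequently_disj_iff using zero by blast
qed

subsection \<open>Sums of measures\<close>

text \<open>The measurable sets are those of \<open>M\<close>; it is evaluated under the assumption
  that \<open>N\<close> has the same ones. It serves to enlarge \<mu> by an absolutely continuous
  part.\<close>

definition add_measure :: "'a measure \<Rightarrow> 'a measure \<Rightarrow> 'a measure" where
  "add_measure M N = measure_of (space M) (sets M) (\<lambda>A. emeasure M A + emeasure N A)"

lemma sets_add_measure [simp]: "sets (add_measure M N) = sets M" "space (add_measure M N) = space M"
  unfolding add_measure_def by simp_all

lemma emeasure_add_measure:
  assumes "sets N = sets M" "A \<in> sets M"
  shows "emeasure (add_measure M N) A = emeasure M A + emeasure N A"
proof (rule emeasure_measure_of[OF add_measure_def])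
  show "sets M \<subseteq> Pow (space M)" by (rule sets.space_closed)
  show "A \<in> sets (add_measure M N)" using assms by simp
  show "positive (sets (add_measure M N)) (\<lambda>A. emeasure M A + emeasure N A)" by (simp add: positive_def)
  show "countably_additive (sets (add_measure M N)) (\<lambda>A. emeasure M A + emeasure N A)"
  proof (rule countably_additiveI)
    fix F :: "nat \<Rightarrow> _" assume F: "range F \<subseteq> sets (add_measure M N)" "disjoint_family F"
    have "(\<Sum>i. emeasure M (F i) + emeasure N (F i)) = (\<Sum>i. emeasure M (F i)) + (\<Sum>i. emeasure N (F i))"
      by (rule suminf_add[symmetric]) auto
    also have "\<dots> = emeasure M (\<Union>i. F i) + emeasure N (\<Union>i. F i)"
      using F assms(1) by (simp add: suminf_emeasure)
    finally show "(\<Sum>i. emeasure M (F i) + emeasure N (F i)) = emeasure M (\<Union>i. F i) + emeasure N (\<Union>i. F i)" .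
  qed
qed

lemma nn_integral_add_measure:
  assumes s: "sets N = sets M" and f: "f \<in> borel_measurable M"
  shows "(\<integral>\<^sup>+x. f x \<partial>add_measure M N) = (\<integral>\<^sup>+x. f x \<partial>M) + (\<integral>\<^sup>+x. f x \<partial>N)"
proof -
  have mN: "borel_measurable N = (borel_measurable M :: (_ \<Rightarrow> ennreal) set)" by (rule measurable_cong_sets) (simp_all add: s)
  have mS: "borel_measurable (add_measure M N) = (borel_measurable M :: (_ \<Rightarrow> ennreal) set)" by (rule measurable_cong_sets) simp_all
  show ?thesis using f
  proof (induction rule: borel_measurable_induct)
    case (cong f g)
    then have "(\<integral>\<^sup>+x. f x \<partial>L) = (\<integral>\<^sup>+x. g x \<partial>L)" if "space L = space M" for L :: "'a measure"
      using that by (intro nn_integral_cong) auto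
    then show ?case using cong(4) sets_eq_imp_space_eq[OF s] by simp
  next
    case (set A)
    then show ?case using s by (simp add: emeasure_add_measure)
  next
    case (mult u c)
    then show ?case by (simp add: nn_integral_cmult mN mS distrib_left)
  next
    case (add u v)
    then show ?case by (simp add: nn_integral_add mN mS add_ac)
  next
    case (seq U)
    have mono: "incseq (\<lambda>i. \<integral>\<^sup>+x. U i x \<partial>L)" for L :: "'a measure"
      using seq(3) by (auto simp: incseq_def le_fun_def intro!: nn_integral_mono)
    have sup: "(\<integral>\<^sup>+x. (SUP i. U i) x \<partial>L) = (SUP i. \<integral>\<^sup>+x. U i x \<partial>L)" if "\<And>i. U i \<in> borel_measurable L" for L
      using nn_integral_monotone_convergence_SUP[OF seq(3) that] by (simp add: image_comp)
    show ?case
      using seq(1) sup[of M] sup[of N] sup[of "add_measure M N"] mono[of M] mono[of N]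
      by (simp add: mN mS seq.IH ennreal_SUP_add)
  qed
qed

lemma integrable_add_measure:
  fixes f :: "'a \<Rightarrow> real"
  assumes s: "sets N = sets M" and f: "integrable M f" "integrable N f" and nn: "\<And>x. 0 \<le> f x"
  shows "integrable (add_measure M N) f" "(\<integral>x. f x \<partial>add_measure M N) = (\<integral>x. f x \<partial>M) + (\<integral>x. f x \<partial>N)"
proof -
  have fm: "f \<in> borel_measurable M" using f(1) by auto
  have fS: "f \<in> borel_measurable (add_measure M N)" using fm by (simp cong: measurable_cong_sets)
  have eq: "(\<integral>\<^sup>+x. ennreal (f x) \<partial>add_measure M N) = ennreal ((\<integral>x. f x \<partial>M) + (\<integral>x. f x \<partial>N))"
    using fm f nn by (subst nn_integral_add_measure[OF s]) (auto simp: nn_integral_eq_integral ennreal_plus[symmetric] simp del: ennreal_plus)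
  then show i: "integrable (add_measure M N) f"
    using fS nn by (intro integrableI_bounded) auto
  have "ennreal (\<integral>x. f x \<partial>add_measure M N) = ennreal ((\<integral>x. f x \<partial>M) + (\<integral>x. f x \<partial>N))"
    using eq nn_integral_eq_integral[OF i] nn by simp
  then show "(\<integral>x. f x \<partial>add_measure M N) = (\<integral>x. f x \<partial>M) + (\<integral>x. f x \<partial>N)"
    using nn f by (subst (asm) ennreal_inj) auto
qed

subsection \<open>Square integrable functions and orthogonal projection\<close>

definition sq_integrable :: "real measure \<Rightarrow> (real \<Rightarrow> complex) \<Rightarrow> bool" where
  "sq_integrable M f \<longleftrightarrow> f \<in> borel_measurable M \<and> integrable M (\<lambda>x. (cmod (f x))\<^sup>2)"

lemma sq_integrable_linear:
  assumes "sq_integrable M f" "sq_integrable M g"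
  shows "sq_integrable M (\<lambda>x. a * f x + b * g x)"
  unfolding sq_integrable_def
proof
  show m: "(\<lambda>x. a * f x + b * g x) \<in> borel_measurable M"
    using assms unfolding sq_integrable_def by (intro borel_measurable_add borel_measurable_times borel_measurable_const) auto
  show "integrable M (\<lambda>x. (cmod (a * f x + b * g x))\<^sup>2)"
  proof (rule Bochner_Integration.integrable_bound)
    show "integrable M (\<lambda>x. 2 * (cmod a)\<^sup>2 * (cmod (f x))\<^sup>2 + 2 * (cmod b)\<^sup>2 * (cmod (g x))\<^sup>2)"
      using assms unfolding sq_integrable_def by simp
    have "(cmod (a * f x + b * g x))\<^sup>2 \<le> 2 * (cmod a)\<^sup>2 * (cmod (f x))\<^sup>2 + 2 * (cmod b)\<^sup>2 * (cmod (g x))\<^sup>2" for x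
      using norm_add_sq_le[of "a * f x" "b * g x"] by (simp add: norm_mult power_mult_distrib)
    then show "AE x in M. norm ((cmod (a * f x + b * g x))\<^sup>2) \<le> norm (2 * (cmod a)\<^sup>2 * (cmod (f x))\<^sup>2 + 2 * (cmod b)\<^sup>2 * (cmod (g x))\<^sup>2)"
      by (intro AE_I2) (simp add: abs_of_nonneg)
  qed (use m in measurable)
qed

lemma integrable_product:
  assumes "sq_integrable M f" "sq_integrable M g"
  shows "integrable M (\<lambda>x. cmod (f x) * cmod (g x))" "integrable M (\<lambda>x. f x * cnj (g x))"
proof -
  have m: "f \<in> borel_measurable M" "g \<in> borel_measurable M" using assms unfolding sq_integrable_def by auto
  have i: "integrable M (\<lambda>x. (cmod (f x))\<^sup>2 + (cmod (g x))\<^sup>2)" using assms unfolding sq_integrable_def by simp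
  have le: "cmod (f x) * cmod (g x) \<le> (cmod (f x))\<^sup>2 + (cmod (g x))\<^sup>2" for x
  proof -
    have "0 \<le> (cmod (f x) - cmod (g x))\<^sup>2" by simp
    then have "2 * (cmod (f x) * cmod (g x)) \<le> (cmod (f x))\<^sup>2 + (cmod (g x))\<^sup>2" unfolding power2_diff by simp
    moreover have "0 \<le> cmod (f x) * cmod (g x)" by simp
    ultimately show ?thesis by linarith
  qed
  show "integrable M (\<lambda>x. cmod (f x) * cmod (g x))"
    by (rule Bochner_Integration.integrable_bound[OF i]) (use m le in \<open>auto intro!: AE_I2 simp: abs_of_nonneg\<close>)
  have "(\<lambda>x. cnj (g x)) \<in> borel_measurable M"
    by (rule borel_measurable_continuous_on[OF _ m(2)]) (intro continuous_intros)
  then have mm: "(\<lambda>x. f x * cnj (g x)) \<in> borel_measurable M" using m(1) by simp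
  show "integrable M (\<lambda>x. f x * cnj (g x))"
    by (rule Bochner_Integration.integrable_bound[OF i mm]) (use le in \<open>auto intro!: AE_I2 simp: norm_mult abs_of_nonneg\<close>)
qed

text \<open>The parallelogram law in terms of distances to \<open>f\<close>: two near-minimisers are
  close, because their midpoint cannot beat the infimum.\<close>

lemma parallelogram_midpoint:
  "(cmod (a - b))\<^sup>2 = 2 * (cmod (f - a))\<^sup>2 + 2 * (cmod (f - b))\<^sup>2 + (- 4) * (cmod (f - (1/2 * a + 1/2 * b)))\<^sup>2"
  unfolding cmod_power2 by (simp add: power2_eq_square algebra_simps)

lemma integral_combination:
  fixes f g h :: "'a \<Rightarrow> real"
  assumes "integrable M f" "integrable M g" "integrable M h"
  shows "(\<integral>x. p * f x + q * g x + r * h x \<partial>M) = p * (\<integral>x. f x \<partial>M) + q * (\<integral>x. g x \<partial>M) + r * (\<integral>x. h x \<partial>M)"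
  using assms by simp

text \<open>The condition \<open>null\<close> goes beyond the embedding of \<open>B\<close>: it
  concerns entire functions outside the space as well, and guarantees that the distance of such a
  function from \<open>B\<close> is not zero by accident.\<close>

locale embedded_space = de_Branges E for E +
  fixes \<nu> :: "real measure" and c C :: real
  assumes sets_\<nu>: "sets \<nu> = sets borel" and c: "0 < c" and C: "0 < C"
    and integrable_sq: "\<And>F. F \<in> B \<Longrightarrow> integrable \<nu> (\<lambda>x. (cmod (F (of_real x)))\<^sup>2)"
    and lower: "\<And>F. F \<in> B \<Longrightarrow> c * dB_norm2 E F \<le> (\<integral>x. (cmod (F (of_real x)))\<^sup>2 \<partial>\<nu>)"
    and upper: "\<And>F. F \<in> B \<Longrightarrow> (\<integral>x. (cmod (F (of_real x)))\<^sup>2 \<partial>\<nu>) \<le> C * dB_norm2 E F"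
    and null: "\<And>F. F holomorphic_on UNIV \<Longrightarrow> integrable \<nu> (\<lambda>x. (cmod (F (of_real x)))\<^sup>2) \<Longrightarrow>
       (\<integral>x. (cmod (F (of_real x)))\<^sup>2 \<partial>\<nu>) = 0 \<Longrightarrow> F = (\<lambda>_. 0)"
begin

lemma entire_measurable: "F holomorphic_on UNIV \<Longrightarrow> (\<lambda>x. F (of_real x)) \<in> borel_measurable \<nu>"
  using entire_real_measurable[of F] sets_\<nu> by (simp cong: measurable_cong_sets)

lemma sq_integrable: "F \<in> B \<Longrightarrow> sq_integrable \<nu> (\<lambda>x. F (of_real x))"
  unfolding sq_integrable_def using integrable_sq entire_measurable entire by blast

text \<open>A minimising sequence is Cauchy in the norm of \<nu>, hence by \<open>lower\<close> in
  the de Branges norm, where completeness gives an entire limit. Fatou shows that the limit attains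
  the infimum, and the first variation gives orthogonality.\<close>

lemma projection:
  assumes F0: "F0 holomorphic_on UNIV" "sq_integrable \<nu> (\<lambda>x. F0 (of_real x))"
  obtains G0 where "G0 \<in> B" "\<And>H. H \<in> B \<Longrightarrow> (\<integral>x. H (of_real x) * cnj (F0 (of_real x) - G0 (of_real x)) \<partial>\<nu>) = 0"
proof -
  define q where "q G = (\<integral>x. (cmod (F0 (of_real x) - G (complex_of_real x)))\<^sup>2 \<partial>\<nu>)" for G
  have sq: "sq_integrable \<nu> (\<lambda>x. F0 (of_real x) - G (of_real x))" if "G \<in> B" for G
    using sq_integrable_linear[OF F0(2) sq_integrable[OF that], of 1 "-1"] by simp
  have qi: "integrable \<nu> (\<lambda>x. (cmod (F0 (of_real x) - G (of_real x)))\<^sup>2)" if "G \<in> B" for G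
    using sq[OF that] unfolding sq_integrable_def by blast
  have q0: "0 \<le> q G" for G unfolding q_def by simp
  define d where "d = Inf (q ` B)"
  have Bne: "B \<noteq> {}" using nonzero_element by blast
  have bdd: "bdd_below (q ` B)" using q0 by (intro bdd_belowI[of _ 0]) auto
  have dle: "d \<le> q G" if "G \<in> B" for G unfolding d_def using that bdd by (intro cInf_lower) auto
  have "\<exists>G\<in>B. q G < d + 1 / real (Suc n)" for n
  proof -
    have "Inf (q ` B) < d + 1 / real (Suc n)" unfolding d_def by simp
    then show ?thesis using cInf_lessD[of "q ` B"] Bne by auto
  qed
  then obtain G where G: "\<And>n. G n \<in> B" "\<And>n. q (G n) < d + 1 / real (Suc n)" by metis
  have diffB: "(\<lambda>z. F z - H z) \<in> B" if "F \<in> B" "H \<in> B" for F H using linear[OF that, of 1 "-1"] by simp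
  have par: "(\<integral>x. (cmod (G m (of_real x) - G n (of_real x)))\<^sup>2 \<partial>\<nu>) \<le> 2 / real (Suc m) + 2 / real (Suc n)" for m n
  proof -
    let ?mid = "\<lambda>z. 1/2 * G m z + 1/2 * G n z"
    have mid: "?mid \<in> B" by (rule linear[OF G(1) G(1)])
    have "(\<integral>x. (cmod (G m (of_real x) - G n (of_real x)))\<^sup>2 \<partial>\<nu>) = (\<integral>x. 2 * (cmod (F0 (of_real x) - G m (of_real x)))\<^sup>2
        + 2 * (cmod (F0 (of_real x) - G n (of_real x)))\<^sup>2 + (- 4) * (cmod (F0 (of_real x) - ?mid (of_real x)))\<^sup>2 \<partial>\<nu>)"
      by (rule Bochner_Integration.integral_cong[OF refl]) (rule parallelogram_midpoint)
    also have "\<dots> = 2 * q (G m) + 2 * q (G n) + (- 4) * q ?mid"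
      unfolding q_def by (rule integral_combination[OF qi[OF G(1)] qi[OF G(1)] qi[OF mid]])
    finally have "(\<integral>x. (cmod (G m (of_real x) - G n (of_real x)))\<^sup>2 \<partial>\<nu>) = 2 * q (G m) + 2 * q (G n) + (- 4) * q ?mid" .
    then show ?thesis using G(2)[of m] G(2)[of n] dle[OF mid] by simp
  qed
  obtain G0 where G0: "G0 \<in> B" "\<And>z. (\<lambda>n. G n z) \<longlonglongrightarrow> G0 z"
  proof -
    have "\<exists>G0\<in>B. (\<forall>z. (\<lambda>n. G n z) \<longlonglongrightarrow> G0 z) \<and> (\<lambda>n. dB_norm2 E (\<lambda>z. G n z - G0 z)) \<longlonglongrightarrow> 0"
    proof (rule complete[OF G(1)])
      fix e :: real assume e: "e > 0"
      then have "c * e / 4 > 0" using c by simp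
      then obtain n0 where n0: "1 / real (Suc n0) < c * e / 4" using nat_approx_posE by blast
      have small: "1 / real (Suc n) \<le> c * e / 4" if "n0 \<le> n" for n
      proof -
        have "1 / real (Suc n) \<le> 1 / real (Suc n0)" using that by (intro divide_left_mono) auto
        then show ?thesis using n0 by linarith
      qed
      have "dB_norm2 E (\<lambda>z. G m z - G n z) \<le> e" if "n0 \<le> m" "n0 \<le> n" for m n
      proof -
        have "c * dB_norm2 E (\<lambda>z. G m z - G n z) \<le> (\<integral>x. (cmod (G m (of_real x) - G n (of_real x)))\<^sup>2 \<partial>\<nu>)"
          by (rule lower[OF diffB[OF G(1) G(1)]])
        also have "\<dots> \<le> 2 / real (Suc m) + 2 / real (Suc n)" by (rule par)
        also have "\<dots> = 2 * (1 / real (Suc m)) + 2 * (1 / real (Suc n))" by simp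
        also have "\<dots> \<le> c * e" using small[OF that(1)] small[OF that(2)] by linarith
        finally show ?thesis using c by simp
      qed
      then show "\<exists>n0. \<forall>m\<ge>n0. \<forall>n\<ge>n0. dB_norm2 E (\<lambda>z. G m z - G n z) \<le> e" by blast
    qed
    then show ?thesis using that by blast
  qed
  define g where "g = (\<lambda>x. F0 (complex_of_real x) - G0 (of_real x))"
  have qG0: "q G0 \<le> d + 1 / real (Suc n0)" for n0
    unfolding q_def
  proof (rule integrable_Fatou(2)[where u = "\<lambda>n x. (cmod (F0 (of_real x) - G n (of_real x)))\<^sup>2" and ?n0.0 = n0])
    fix n assume "n \<ge> n0"
    then have "1 / real (Suc n) \<le> 1 / real (Suc n0)" by (intro divide_left_mono) auto
    then show "(\<integral>x. (cmod (F0 (of_real x) - G n (of_real x)))\<^sup>2 \<partial>\<nu>) \<le> d + 1 / real (Suc n0)" using G(2)[of n] unfolding q_def by linarith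
  qed (use qi[OF G(1)] in \<open>auto intro!: tendsto_intros G0(2)\<close>)
  have qd: "q G0 \<le> d"
  proof (rule field_le_epsilon)
    fix e :: real assume "e > 0"
    then obtain n where "1 / real (Suc n) < e" using nat_approx_posE by blast
    then show "q G0 \<le> d + e" using qG0[of n] by linarith
  qed
  have gs: "sq_integrable \<nu> g" unfolding g_def by (rule sq[OF G0(1)])
  show ?thesis
  proof (rule that[OF G0(1)])
    fix H assume H: "H \<in> B"
    define I where "I = (\<integral>x. H (of_real x) * cnj (g x) \<partial>\<nu>)"
    define h where "h = (\<integral>x. (cmod (H (of_real x)))\<^sup>2 \<partial>\<nu>)"
    have Ii: "integrable \<nu> (\<lambda>x. H (of_real x) * cnj (g x))" by (rule integrable_product(2)[OF sq_integrable[OF H] gs])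
    have h0: "h \<ge> 0" unfolding h_def by simp
    have key: "0 \<le> - 2 * Re (a * I) + (cmod a)\<^sup>2 * h" for a
    proof -
      let ?G = "\<lambda>z. 1 * G0 z + a * H z"
      have exp: "(cmod (F0 (of_real x) - ?G (of_real x)))\<^sup>2 = 1 * (cmod (g x))\<^sup>2 + (- 2) * Re (a * (H (of_real x) * cnj (g x))) + (cmod a)\<^sup>2 * (cmod (H (of_real x)))\<^sup>2" for x
      proof -
        have "(cmod (u - v))\<^sup>2 = (cmod u)\<^sup>2 - 2 * Re (v * cnj u) + (cmod v)\<^sup>2" for u v
          unfolding cmod_power2 by (simp add: power2_eq_square algebra_simps)
        from this[of "g x" "a * H (of_real x)"] show ?thesis
          unfolding g_def by (simp add: norm_mult power_mult_distrib mult.assoc diff_diff_eq)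
      qed
      have "d \<le> q ?G" by (rule dle[OF linear[OF G0(1) H]])
      also have "q ?G = (\<integral>x. 1 * (cmod (g x))\<^sup>2 + (- 2) * Re (a * (H (of_real x) * cnj (g x))) + (cmod a)\<^sup>2 * (cmod (H (of_real x)))\<^sup>2 \<partial>\<nu>)"
        unfolding q_def exp ..
      also have "\<dots> = 1 * (\<integral>x. (cmod (g x))\<^sup>2 \<partial>\<nu>) + (- 2) * (\<integral>x. Re (a * (H (of_real x) * cnj (g x))) \<partial>\<nu>) + (cmod a)\<^sup>2 * h"
        unfolding h_def
      proof (rule integral_combination)
        show "integrable \<nu> (\<lambda>x. (cmod (g x))\<^sup>2)" using gs unfolding sq_integrable_def by blast
        show "integrable \<nu> (\<lambda>x. Re (a * (H (of_real x) * cnj (g x))))" by (rule integrable_Re[OF integrable_mult_right[OF Ii]])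
      qed (rule integrable_sq[OF H])
      also have "(\<integral>x. Re (a * (H (of_real x) * cnj (g x))) \<partial>\<nu>) = Re (a * I)"
        using Ii unfolding I_def by (subst integral_Re) auto
      also have "(\<integral>x. (cmod (g x))\<^sup>2 \<partial>\<nu>) = q G0" unfolding q_def g_def ..
      finally show ?thesis using qd by simp
    qed
    have "I = 0"
    proof (rule ccontr)
      assume "I \<noteq> 0"
      then have Ip: "(cmod I)\<^sup>2 > 0" by simp
      \<comment> \<open>Testing with the multiple \<open>s * cnj I\<close> of \<open>H\<close>
        changes the squared distance by \<open>s * (cmod I)^2 * (s * h - 2)\<close>; this
        \<open>s\<close> keeps \<open>s * h\<close> below 1 and the change negative.\<close>
      define s where "s = 1 / (h + 1)"
      have s: "s > 0" "s * h < 1" unfolding s_def using h0 by auto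
      have "Re (of_real s * cnj I * I) = s * (cmod I)\<^sup>2" unfolding cmod_power2 by (simp add: power2_eq_square algebra_simps)
      then have "0 \<le> - 2 * (s * (cmod I)\<^sup>2) + s\<^sup>2 * (cmod I)\<^sup>2 * h" using key[of "of_real s * cnj I"] s by (simp add: norm_mult power_mult_distrib)
      also have "\<dots> = s * (cmod I)\<^sup>2 * (s * h - 2)" by (simp add: power2_eq_square algebra_simps)
      also have "\<dots> < 0" using s Ip by (intro mult_pos_neg) auto
      finally show False by simp
    qed
    then show "(\<integral>x. H (of_real x) * cnj (F0 (of_real x) - G0 (of_real x)) \<partial>\<nu>) = 0" unfolding I_def g_def .
  qed
qed

text \<open>For \<open>g\<close> the component of \<open>F0\<close> orthogonal to \<open>B\<close>,
  the pairing of \<open>F0\<close> with \<open>g\<close> is the squared norm of \<open>g\<close>.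
  Were it zero, \<open>null\<close> would identify \<open>F0\<close> with its projection, an element
  of \<open>B\<close>.\<close>

lemma orthogonal_function:
  assumes F0: "F0 holomorphic_on UNIV" "sq_integrable \<nu> (\<lambda>x. F0 (of_real x))" "F0 \<notin> B"
  obtains g where "sq_integrable \<nu> g" "\<And>H. H \<in> B \<Longrightarrow> (\<integral>x. H (of_real x) * cnj (g x) \<partial>\<nu>) = 0"
    "(\<integral>x. F0 (of_real x) * cnj (g x) \<partial>\<nu>) \<noteq> 0"
proof -
  obtain G0 where G0: "G0 \<in> B" "\<And>H. H \<in> B \<Longrightarrow> (\<integral>x. H (of_real x) * cnj (F0 (of_real x) - G0 (of_real x)) \<partial>\<nu>) = 0"
    using projection[OF F0(1,2)] by blast
  define g where "g = (\<lambda>x. F0 (complex_of_real x) - G0 (of_real x))"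
  have gs: "sq_integrable \<nu> g" unfolding g_def
    using sq_integrable_linear[OF F0(2) sq_integrable[OF G0(1)], of 1 "-1"] by simp
  have orth: "(\<integral>x. H (of_real x) * cnj (g x) \<partial>\<nu>) = 0" if "H \<in> B" for H using G0(2)[OF that] unfolding g_def .
  have "(\<integral>x. F0 (of_real x) * cnj (g x) \<partial>\<nu>) = (\<integral>x. g x * cnj (g x) + G0 (of_real x) * cnj (g x) \<partial>\<nu>)"
    by (rule Bochner_Integration.integral_cong) (auto simp: g_def algebra_simps)
  also have "\<dots> = (\<integral>x. g x * cnj (g x) \<partial>\<nu>)"
    using integrable_product(2)[OF gs gs] integrable_product(2)[OF sq_integrable[OF G0(1)] gs] orth[OF G0(1)] by simp
  also have "\<dots> = (\<integral>x. of_real ((cmod (g x))\<^sup>2) \<partial>\<nu>)" unfolding complex_norm_square ..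
  also have "\<dots> = of_real (\<integral>x. (cmod (g x))\<^sup>2 \<partial>\<nu>)" by (rule integral_complex_of_real)
  finally have eq: "(\<integral>x. F0 (of_real x) * cnj (g x) \<partial>\<nu>) = of_real (\<integral>x. (cmod (g x))\<^sup>2 \<partial>\<nu>)" .
  have "(\<integral>x. (cmod (g x))\<^sup>2 \<partial>\<nu>) \<noteq> 0"
  proof
    assume z: "(\<integral>x. (cmod (g x))\<^sup>2 \<partial>\<nu>) = 0"
    have "(\<lambda>z. F0 z - G0 z) = (\<lambda>_. 0)"
      by (rule null) (use F0 entire[OF G0(1)] gs z in \<open>auto intro!: holomorphic_intros simp: sq_integrable_def g_def\<close>)
    then have "F0 = G0" by (auto simp: fun_eq_iff)
    then show False using G0(1) F0(3) by simp
  qed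
  then show ?thesis using that[OF gs orth] eq by simp
qed

text \<open>Around each real point some element of \<open>B\<close> stays away from 0, and its
  square is integrable, so a neighbourhood has finite measure; compactness does the rest.\<close>

lemma locally_finite: "emeasure \<nu> {- r..r} < \<infinity>"
proof -
  have "\<exists>U. open U \<and> x \<in> U \<and> emeasure \<nu> U < \<infinity>" for x :: real
  proof -
    obtain G where G: "G \<in> B" "G (of_real x) \<noteq> 0" using no_common_zero by blast
    define e where "e = (cmod (G (of_real x)) / 2)\<^sup>2"
    have e: "e > 0" unfolding e_def using G by simp
    define U where "U = {t. e < (cmod (G (of_real t)))\<^sup>2}"
    have U: "open U" unfolding U_def by (intro open_Collect_less continuous_intros entire_real_continuous entire G)
    have Us: "U \<in> sets \<nu>" using U sets_\<nu> by simp
    have "integrable \<nu> (indicator U :: real \<Rightarrow> real)"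
    proof (rule Bochner_Integration.integrable_bound)
      show "integrable \<nu> (\<lambda>t. (cmod (G (of_real t)))\<^sup>2 / e)" using integrable_sq[OF G(1)] by simp
      show "AE t in \<nu>. norm (indicat_real U t) \<le> norm ((cmod (G (of_real t)))\<^sup>2 / e)"
        using e by (intro AE_I2) (auto simp: indicator_def U_def)
    qed (use Us in measurable)
    then have "emeasure \<nu> U < \<infinity>" using Us by (simp add: integrable_indicator_iff Int_absorb2 sets.sets_into_space)
    moreover have "x \<in> U" unfolding U_def e_def using G(2) by (simp add: power_divide)
    ultimately show ?thesis using U by blast
  qed
  then obtain U where U: "\<And>x. open (U x)" "\<And>x. x \<in> U x" "\<And>x. emeasure \<nu> (U x) < \<infinity>" by metis
  have "{- r..r} \<subseteq> (\<Union>x\<in>{- r..r}. U x)" using U(2) by blast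
  then obtain D where D: "finite D" "{- r..r} \<subseteq> (\<Union>x\<in>D. U x)"
    using compactE_image[OF compact_Icc, of "{- r..r}" U] U(1) by metis
  have Us: "U x \<in> sets \<nu>" for x using U(1) sets_\<nu> by simp
  have "emeasure \<nu> {- r..r} \<le> emeasure \<nu> (\<Union>x\<in>D. U x)" by (rule emeasure_mono[OF D(2)]) (use D Us in auto)
  also have "\<dots> \<le> (\<Sum>x\<in>D. emeasure \<nu> (U x))" by (rule emeasure_subadditive_finite) (use D Us in auto)
  also have "\<dots> < \<infinity>" using D(1) by (induction D rule: finite_induct) (use U(3) in \<open>auto simp: ennreal_add_less_top\<close>)
  finally show ?thesis .
qed

end

subsection \<open>Entire functions of exponential type zero\<close>

text \<open>On a circle ln |K| = ln |N| - ln |G|, and the mean of - ln |G| is bounded by means of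
  the value \<open>G 0\<close>. The Poisson inequality on the circle of radius
  \<open>2 * cmod z\<close>, where the kernel is at most 3, transfers the estimate to
  \<open>z\<close>.\<close>

lemma zero_type_quotient:
  assumes K: "K holomorphic_on UNIV" and KG: "\<And>z. K z * G z = N z" and N: "zero_type N" and G: "zero_type G" and G0: "G 0 \<noteq> 0"
  shows "zero_type K"
  unfolding zero_type_def
proof (intro conjI allI impI K)
  fix e :: real assume e: "e > 0"
  \<comment> \<open>The 24 consists of the kernel bound 3, the 2 in the radius, the 2 in the
    definition of \<open>u\<close>, and a last 2 that reserves half of \<open>e\<close> for
    \<open>ln (cmod (G 0))\<close>.\<close>
  define e' where "e' = e / 24"
  have e': "e' > 0" using e unfolding e'_def by simp
  obtain R1 where R1: "\<And>z. R1 \<le> cmod z \<Longrightarrow> cmod (N z) \<le> exp (e' * cmod z)" using N e' unfolding zero_type_def by blast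
  obtain R2 where R2: "\<And>z. R2 \<le> cmod z \<Longrightarrow> cmod (G z) \<le> exp (e' * cmod z)" using G e' unfolding zero_type_def by blast
  have Gh: "G holomorphic_on UNIV" using G unfolding zero_type_def by blast
  define R where "R = max (max 1 (max R1 R2)) (- 6 * ln (cmod (G 0)) / e)"
  have "cmod (K z) \<le> exp (e * cmod z)" if z: "R \<le> cmod z" for z
  proof -
    define r where "r = 2 * cmod z"
    have z1: "1 \<le> cmod z" "R1 \<le> cmod z" "R2 \<le> cmod z" "- 6 * ln (cmod (G 0)) / e \<le> cmod z" using z unfolding R_def by auto
    then have r: "r > 0" "cmod z < r" "R1 \<le> r" "R2 \<le> r" unfolding r_def by auto
    have lnG: "- 3 * ln (cmod (G 0)) \<le> e * cmod z / 2" using z1(4) e by (simp add: field_simps)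
    have "bounded (K ` sphere 0 r)" by (intro compact_imp_bounded compact_continuous_image entire_continuous_on K) auto
    then obtain b where b: "\<forall>y\<in>K ` sphere 0 r. cmod y \<le> b" unfolding bounded_iff by blast
    define B where "B = ln (max 1 b)"
    have B: "cmod (K \<zeta>) \<le> exp B" if "\<zeta> \<in> sphere 0 r" for \<zeta>
    proof -
      have "cmod (K \<zeta>) \<le> b" using b that by blast
      also have "b \<le> max 1 b" by simp
      also have "\<dots> = exp B" unfolding B_def by (subst exp_ln) auto
      finally show ?thesis .
    qed
    have B0: "B \<ge> 0" unfolding B_def by simp
    \<comment> \<open>The logarithm of |G|, cut off because \<open>G\<close> may vanish on the
      circle. As \<open>B\<close> bounds ln |K| there, the estimate for \<open>K\<close> holds where
      the cut takes effect, too.\<close>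
    define v where "v \<zeta> = ln (max (cmod (G \<zeta>)) (exp (- B)))" for \<zeta>
    define u where "u \<zeta> = 2 * e' * r - v \<zeta>" for \<zeta>
    have mpos: "max (cmod (G \<zeta>)) (exp (- B)) > 0" for \<zeta> by (simp add: max.strict_coboundedI2)
    have vc: "continuous_on (sphere 0 r) v" unfolding v_def
      by (intro continuous_intros entire_continuous_on Gh) (metis mpos less_irrefl)
    have uc: "continuous_on (sphere 0 r) u" unfolding u_def by (intro continuous_intros vc)
    have GN: "cmod (G \<zeta>) \<le> exp (e' * r)" "cmod (N \<zeta>) \<le> exp (e' * r)" if "\<zeta> \<in> sphere 0 r" for \<zeta>
      using R1[of \<zeta>] R2[of \<zeta>] that r by auto
    have er: "e' * r > 0" using e' r by simp
    have u0: "u \<zeta> \<ge> 0" if "\<zeta> \<in> sphere 0 r" for \<zeta>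
    proof -
      have "exp (- B) \<le> exp (e' * r)" using B0 er by simp
      then have "max (cmod (G \<zeta>)) (exp (- B)) \<le> exp (e' * r)" using GN(1)[OF that] by simp
      then have "v \<zeta> \<le> ln (exp (e' * r))" unfolding v_def using mpos by (intro ln_mono) auto
      then show ?thesis unfolding u_def using er by simp
    qed
    have Ku: "cmod (K \<zeta>) \<le> exp (u \<zeta>)" if "\<zeta> \<in> sphere 0 r" for \<zeta>
    proof (cases "exp (- B) \<le> cmod (G \<zeta>)")
      case True
      then have gp: "cmod (G \<zeta>) > 0" by (smt (verit) exp_gt_zero)
      have "cmod (K \<zeta>) * cmod (G \<zeta>) \<le> exp (e' * r)" using GN(2)[OF that] KG[of \<zeta>] by (metis norm_mult)
      then have "cmod (K \<zeta>) \<le> exp (e' * r) / cmod (G \<zeta>)" using gp by (simp add: pos_le_divide_eq)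
      also have "\<dots> = exp (e' * r - v \<zeta>)" unfolding v_def using True gp by (simp add: max_absorb1 exp_diff)
      also have "\<dots> \<le> exp (u \<zeta>)" unfolding u_def using er by simp
      finally show ?thesis .
    next
      case False
      then have "v \<zeta> = - B" unfolding v_def by (simp add: max_def)
      then have "exp B \<le> exp (u \<zeta>)" unfolding u_def using er by simp
      then show ?thesis using B[OF that] by linarith
    qed
    have "cmod (G 0) \<le> exp (circle_mean r v)"
      by (rule mean_value_inequality[OF _ _ r(1) vc])
         (use mpos in \<open>auto simp: v_def intro: entire_continuous_on[OF Gh] holomorphic_on_subset[OF Gh]\<close>)
    then have "ln (cmod (G 0)) \<le> circle_mean r v" using G0 by (metis ln_exp ln_mono zero_less_norm_iff)
    moreover have "circle_mean r u = 2 * e' * r - circle_mean r v"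
    proof -
      have "circle_mean r (\<lambda>\<zeta>. 2 * e' * r + (- 1) * v \<zeta>) = circle_mean r (\<lambda>_. 2 * e' * r) + circle_mean r (\<lambda>\<zeta>. (- 1) * v \<zeta>)"
        using r by (intro circle_mean_add continuous_intros vc) auto
      then show ?thesis unfolding u_def circle_mean_cmult circle_mean_const by simp
    qed
    ultimately have mu: "circle_mean r u \<le> 2 * e' * r - ln (cmod (G 0))" by linarith
    have "cmod (K z) \<le> exp (circle_mean r (\<lambda>\<zeta>. poisson_disc r z \<zeta> * u \<zeta>))"
      by (rule poisson_inequality[OF _ _ uc Ku r(2)]) (use entire_continuous_on[OF K] holomorphic_on_subset[OF K] in auto)
    also have "circle_mean r (\<lambda>\<zeta>. poisson_disc r z \<zeta> * u \<zeta>) \<le> circle_mean r (\<lambda>\<zeta>. 3 * u \<zeta>)"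
    proof (rule circle_mean_mono)
      fix \<zeta> :: complex assume s: "\<zeta> \<in> sphere 0 r"
      have "cmod z \<le> cmod (\<zeta> - z)" using norm_triangle_ineq2[of \<zeta> z] s unfolding r_def by simp
      then have "(cmod z)\<^sup>2 \<le> (cmod (\<zeta> - z))\<^sup>2" by (intro power_mono) auto
      moreover have "(cmod z)\<^sup>2 > 0" using z1(1) by (intro zero_less_power) linarith
      ultimately have "poisson_disc r z \<zeta> \<le> 3"
        unfolding poisson_disc_def r_def by (simp add: power_mult_distrib divide_le_eq)
      then show "poisson_disc r z \<zeta> * u \<zeta> \<le> 3 * u \<zeta>" using u0[OF s] by (intro mult_right_mono)
    qed (use r in \<open>auto intro!: continuous_intros uc continuous_on_poisson_disc\<close>)
    also have "circle_mean r (\<lambda>\<zeta>. 3 * u \<zeta>) = 3 * circle_mean r u" by (rule circle_mean_cmult)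
    also have "\<dots> \<le> 3 * (2 * e' * r - ln (cmod (G 0)))" using mu by simp
    also have "\<dots> = e * cmod z / 2 + - 3 * ln (cmod (G 0))" unfolding e'_def r_def by simp
    also have "\<dots> \<le> e * cmod z" using lnG by linarith
    finally show ?thesis by simp
  qed
  then show "\<exists>R. \<forall>z. R \<le> cmod z \<longrightarrow> cmod (K z) \<le> exp (e * cmod z)" by blast
qed

text \<open>The hypothesis says little near the real axis; the maximum principle on unit discs
  centred on the axis extends the growth bound across it.\<close>

lemma zero_type_of_bound:
  assumes N: "N holomorphic_on UNIV" and A: "A \<ge> 0" and F: "zero_type F" and G: "zero_type G"
    and bound: "\<And>z. cmod (N z) * \<bar>Im z\<bar> \<le> A * (cmod (F z) + cmod (G z))"
  shows "zero_type N"
  unfolding zero_type_def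
proof (intro conjI allI impI N)
  fix e :: real assume e: "e > 0"
  obtain R1 where R1: "\<And>z. R1 \<le> cmod z \<Longrightarrow> cmod (F z) \<le> exp (e / 2 * cmod z)" using F e unfolding zero_type_def by (meson half_gt_zero)
  obtain R2 where R2: "\<And>z. R2 \<le> cmod z \<Longrightarrow> cmod (G z) \<le> exp (e / 2 * cmod z)" using G e unfolding zero_type_def by (meson half_gt_zero)
  have "\<forall>\<^sub>F r in at_top. 2 * (A * (2 * exp (e / 2 * (r + 2)))) \<le> exp (e * r)"
  proof -
    have "\<forall>\<^sub>F r in at_top. 2 * (A' * (2 * exp (e / 2 * (r + 2)))) \<le> exp (e * r)" for A' :: real using e by real_asymp
    then show ?thesis .
  qed
  then obtain R3 where R3: "\<And>r. R3 \<le> r \<Longrightarrow> 2 * (A * (2 * exp (e / 2 * (r + 2)))) \<le> exp (e * r)" unfolding eventually_at_top_linorder by blast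
  have "cmod (N z) \<le> exp (e * cmod z)" if z: "max (max R1 R2 + 2) R3 \<le> cmod z" for z
  proof -
    let ?A = "A * (2 * exp (e / 2 * (cmod z + 2)))"
    have b: "cmod (N \<zeta>) * \<bar>Im \<zeta>\<bar> \<le> ?A" if d: "dist \<zeta> z \<le> 2" for \<zeta>
    proof -
      have n: "cmod \<zeta> \<le> cmod z + 2" "cmod z - 2 \<le> cmod \<zeta>" using d norm_triangle_ineq2[of \<zeta> z] norm_triangle_ineq2[of z \<zeta>] by (auto simp: dist_norm norm_minus_commute)
      have "cmod (F \<zeta>) + cmod (G \<zeta>) \<le> exp (e / 2 * cmod \<zeta>) + exp (e / 2 * cmod \<zeta>)" using R1[of \<zeta>] R2[of \<zeta>] n z by (intro add_mono) auto
      also have "\<dots> \<le> 2 * exp (e / 2 * (cmod z + 2))" using n e by simp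
      finally have "A * (cmod (F \<zeta>) + cmod (G \<zeta>)) \<le> ?A" using A by (intro mult_left_mono)
      then show ?thesis using bound[of \<zeta>] by linarith
    qed
    have A0: "?A \<ge> 0" using A by simp
    have "cmod (N z) \<le> 2 * ?A"
    proof (cases "\<bar>Im z\<bar> \<le> 1")
      case True
      then show ?thesis by (rule entire_bound_near_real_axis[OF N]) (use b in blast)
    next
      case False
      then have "cmod (N z) * 1 \<le> cmod (N z) * \<bar>Im z\<bar>" by (intro mult_left_mono) auto
      then show ?thesis using b[of z] A0 by simp
    qed
    also have "\<dots> \<le> exp (e * cmod z)" using R3 z by simp
    finally show ?thesis .
  qed
  then show "\<exists>R. \<forall>z. R \<le> cmod z \<longrightarrow> cmod (N z) \<le> exp (e * cmod z)" by blast
qed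

text \<open>Boundedness on the imaginary axis spreads to the right and left half-planes by
  Phragmen--Lindeloef, since type zero excludes exponential growth. Liouville then makes
  \<open>L\<close> constant, and the limit along the axis is 0.\<close>

lemma zero_type_vanishing_on_imaginary_axis:
  assumes L: "zero_type L" and lim: "\<And>e. e > 0 \<Longrightarrow> \<exists>Y. \<forall>y. Y \<le> \<bar>y\<bar> \<longrightarrow> cmod (L (\<i> * of_real y)) \<le> e"
  shows "L z = 0"
proof -
  have Lh: "L holomorphic_on UNIV" using L unfolding zero_type_def by blast
  obtain R where R: "\<And>z. R \<le> cmod z \<Longrightarrow> cmod (L z) \<le> exp (1 * cmod z)" using L unfolding zero_type_def by (meson zero_less_one)
  obtain Y where Y: "\<And>y. Y \<le> \<bar>y\<bar> \<Longrightarrow> cmod (L (\<i> * of_real y)) \<le> 1" using lim[of 1] by auto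
  have "bounded (L ` cball 0 (max R Y))" by (intro compact_imp_bounded compact_continuous_image entire_continuous_on Lh) auto
  then obtain b where b: "\<forall>y\<in>L ` cball 0 (max R Y). cmod y \<le> b" unfolding bounded_iff by blast
  define M where "M = max 1 b"
  have M: "M \<ge> 1" "\<And>z. cmod z \<le> max R Y \<Longrightarrow> cmod (L z) \<le> M" using b unfolding M_def by (auto simp: le_max_iff_disj)
  have axis: "cmod (L (\<i> * of_real y)) \<le> M" for y
  proof (cases "Y \<le> \<bar>y\<bar>")
    case True
    then show ?thesis using Y M(1) by fastforce
  next
    case False
    then show ?thesis by (intro M(2)) (simp add: norm_mult le_max_iff_disj)
  qed
  have half: "cmod (L (s * z)) \<le> M" if s: "s = \<i> \<or> s = - \<i>" and z: "Im z > 0" for s z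
  proof -
    have ns: "cmod (s * w) = cmod w" for w using s by (auto simp: norm_mult)
    have ax: "cmod (L (s * of_real x)) \<le> M" for x using s axis[of x] axis[of "- x"] by auto
    define q where "q = (\<lambda>z. L (s * z) / of_real M)"
    have nq: "cmod (q w) = cmod (L (s * w)) / M" for w unfolding q_def using M(1) by (simp add: norm_divide)
    have qh: "q holomorphic_on UNIV"
    proof -
      have "(L \<circ> (*) s) holomorphic_on UNIV" by (rule holomorphic_on_compose) (auto intro!: holomorphic_intros holomorphic_on_subset[OF Lh])
      then show ?thesis unfolding q_def using M(1) by (intro holomorphic_intros) (auto simp: o_def)
    qed
    have gr: "cmod (q w) \<le> exp (e * cmod w)" if e: "cmod (L (s * w)) \<le> exp (e * cmod w)" for w e
    proof -
      have "cmod (L (s * w)) / M \<le> cmod (L (s * w)) / 1" using M(1) by (intro divide_left_mono) auto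
      then show ?thesis using e nq by simp
    qed
    have "cmod (q z) \<le> 1"
    proof (rule Phragmen_Lindeloef_half_plane[where q = q and z = z and C = 1])
      show "q holomorphic_on upper_half_plane" using holomorphic_on_subset[OF qh] by blast
      show "cmod (q w) \<le> exp (1 * cmod w)" if "Im w > 0" for w
      proof (cases "R \<le> cmod w")
        case True
        then show ?thesis using R[of "s * w"] ns by (intro gr) simp
      next
        case False
        then have "cmod (L (s * w)) \<le> M" using ns False by (intro M(2)) (simp add: le_max_iff_disj)
        then have "cmod (q w) \<le> 1" using M(1) nq by (simp add: divide_le_eq)
        also have "1 \<le> exp (1 * cmod w)" by simp
        finally show ?thesis .
      qed
      show "subunit_boundary upper_half_plane \<real> q"
        unfolding subunit_boundary_def
      proof (intro ballI allI impI)
        fix \<xi> :: complex and e :: real assume xi: "\<xi> \<in> \<real>" and e: "e > 0"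
        then obtain x where x: "\<xi> = of_real x" by (auto elim: Reals_cases)
        have q1: "cmod (q \<xi>) \<le> 1" using ax[of x] M(1) nq[of \<xi>] x by (simp add: divide_le_eq)
        have "exp e - 1 > 0" using e by simp
        then obtain d where d: "d > 0" "\<And>w. dist w \<xi> < d \<Longrightarrow> dist (q w) (q \<xi>) < exp e - 1"
          using entire_isCont[OF qh, of \<xi>] unfolding continuous_at_eps_delta by blast
        have "cmod (q w) \<le> exp e" if "dist w \<xi> < d" for w
          using d(2)[OF that] q1 norm_triangle_sub[of "q w" "q \<xi>"] unfolding dist_norm by linarith
        then show "\<exists>d>0. \<forall>z\<in>upper_half_plane. dist z \<xi> < d \<longrightarrow> cmod (q z) \<le> exp e" using d(1) by blast
      qed
      fix e :: real assume e: "e > 0"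
      obtain Re where Re: "\<And>z. Re \<le> cmod z \<Longrightarrow> cmod (L z) \<le> exp (e * cmod z)" using L e unfolding zero_type_def by blast
      show "\<forall>\<^sub>F y in at_top. cmod (q (\<i> * of_real y)) \<le> exp (e * y)"
        using eventually_ge_at_top[of "max 0 Re"]
      proof eventually_elim
        case (elim y)
        have n: "cmod (\<i> * complex_of_real y) = y" using elim by (simp add: norm_mult)
        have "cmod (q (\<i> * of_real y)) \<le> exp (e * cmod (\<i> * of_real y))"
        proof (rule gr)
          show "cmod (L (s * (\<i> * of_real y))) \<le> exp (e * cmod (\<i> * of_real y))"
            using Re[of "s * (\<i> * of_real y)"] unfolding ns n using elim by simp
        qed
        then show ?case unfolding n .
      qed
    qed (use z in auto)
    then show ?thesis using nq M(1) by (simp add: divide_le_eq)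
  qed
  have all: "cmod (L w) \<le> M" for w
  proof -
    consider "Re w > 0" | "Re w < 0" | "Re w = 0" by linarith
    then show ?thesis
    proof cases
      case 1
      then show ?thesis using half[of "- \<i>" "\<i> * w"] by (simp add: mult.assoc[symmetric])
    next
      case 2
      then show ?thesis using half[of "\<i>" "- \<i> * w"] by (simp add: mult.assoc[symmetric])
    next
      case 3
      then have "w = \<i> * of_real (Im w)" by (simp add: complex_eq_iff)
      then show ?thesis using axis[of "Im w"] by simp
    qed
  qed
  then have "bounded (range L)" unfolding bounded_iff by auto
  then obtain c where c: "\<And>z. L z = c" using Liouville_theorem[OF Lh] unfolding constant_on_def by blast
  have "c = 0"
  proof (rule ccontr)
    assume "c \<noteq> 0"
    then obtain Y where "\<And>y. Y \<le> \<bar>y\<bar> \<Longrightarrow> cmod (L (\<i> * of_real y)) \<le> cmod c / 2" using lim[of "cmod c / 2"] by auto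
    from this[of Y] have "cmod c \<le> cmod c / 2" using abs_ge_self[of Y] unfolding c .
    then show False using \<open>c \<noteq> 0\<close> by simp
  qed
  then show ?thesis using c by simp
qed

subsection \<open>The entire function attached to an orthogonal functional\<close>

locale orthogonal_functional = embedded_space E \<nu> c C for E \<nu> c C +
  fixes F :: "complex \<Rightarrow> complex" and g :: "real \<Rightarrow> complex"
  assumes F_entire: "F holomorphic_on UNIV" and F_sq: "sq_integrable \<nu> (\<lambda>x. F (of_real x))" and g_sq: "sq_integrable \<nu> g"
    and orth: "\<And>H. H \<in> B \<Longrightarrow> (\<integral>x. H (of_real x) * cnj (g x) \<partial>\<nu>) = 0"
begin

lemma measurable_\<nu>: "f \<in> borel_measurable borel \<Longrightarrow> f \<in> borel_measurable \<nu>"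
  using sets_\<nu> by (simp cong: measurable_cong_sets)

lemma cnj_g_measurable: "(\<lambda>x. cnj (g x)) \<in> borel_measurable \<nu>"
  using g_sq unfolding sq_integrable_def by (intro borel_measurable_continuous_on[of cnj g]) (auto intro: continuous_intros)

text \<open>The difference quotient removes the singularity at \<open>z = of_real x\<close>, so the
  kernel is entire in \<open>z\<close> for every \<open>x\<close>. That is why \<open>N G\<close> is
  entire, whereas the Cauchy integrals are controlled only off the real axis.\<close>

definition kernel :: "(complex \<Rightarrow> complex) \<Rightarrow> real \<Rightarrow> complex \<Rightarrow> complex" where
  "kernel G x = diff_quotient (\<lambda>u. F (of_real x) * G u - F u * G (of_real x)) (of_real x)"

definition N :: "(complex \<Rightarrow> complex) \<Rightarrow> complex \<Rightarrow> complex" where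
  "N G z = (\<integral>x. kernel G x z * cnj (g x) \<partial>\<nu>)"

definition cauchy :: "(complex \<Rightarrow> complex) \<Rightarrow> complex \<Rightarrow> complex" where
  "cauchy H z = (\<integral>x. H (of_real x) * cnj (g x) / (z - of_real x) \<partial>\<nu>)"

lemma kernel_eq: "z \<noteq> of_real x \<Longrightarrow> kernel G x z = (F (of_real x) * G z - F z * G (of_real x)) / (z - of_real x)"
  by (simp add: kernel_def diff_quotient_def)

lemma kernel_holomorphic: "G holomorphic_on UNIV \<Longrightarrow> kernel G x holomorphic_on UNIV"
  unfolding kernel_def by (intro diff_quotient_holomorphic holomorphic_intros F_entire)

lemma kernel_measurable:
  assumes G: "G holomorphic_on UNIV"
  shows "(\<lambda>x. kernel G x z) \<in> borel_measurable \<nu>"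
proof (rule measurable_\<nu>)
  \<comment> \<open>The diagonal value, a derivative, occurs for at most one \<open>x\<close>,
    namely \<open>Re z\<close>; elsewhere the explicit quotient is measurable.\<close>
  have "(\<lambda>x. kernel G x z) = (\<lambda>x. if x \<in> {x. of_real x = z} then kernel G (Re z) z else (F (of_real x) * G z - F z * G (of_real x)) / (z - of_real x))"
  proof
    fix x
    show "kernel G x z = (if x \<in> {x. of_real x = z} then kernel G (Re z) z else (F (of_real x) * G z - F z * G (of_real x)) / (z - of_real x))"
      by (cases "of_real x = z") (auto simp: kernel_eq)
  qed
  moreover have "\<dots> \<in> borel_measurable borel"
  proof (rule measurable_If_set)
    have "closed {x. complex_of_real x = z}" by (intro closed_Collect_eq continuous_intros)
    then show "{x. complex_of_real x = z} \<inter> space borel \<in> sets borel" by simp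
    show "(\<lambda>x. (F (of_real x) * G z - F z * G (of_real x)) / (z - of_real x)) \<in> borel_measurable borel"
      using entire_real_measurable[OF F_entire] entire_real_measurable[OF G] by measurable
  qed simp
  ultimately show "(\<lambda>x. kernel G x z) \<in> borel_measurable borel" by simp
qed

text \<open>For \<open>\<bar>x\<bar> \<le> 2 * R\<close> the maximum principle moves the estimate to
  the circle of radius \<open>3 * R\<close>, at distance at least \<open>R\<close> from
  \<open>x\<close>. For other \<open>x\<close> the denominator itself is at least
  \<open>R\<close>.\<close>

lemma kernel_bound:
  assumes G: "G holomorphic_on UNIV" and R: "R > 0"
  shows "\<exists>M\<ge>0. \<forall>z x. cmod z < R \<longrightarrow> cmod (kernel G x z) \<le> M * (indicator {- (2 * R)..2 * R} x + cmod (F (of_real x)) + cmod (G (of_real x)))"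
proof -
  have "bounded (F ` cball 0 (3 * R))" "bounded (G ` cball 0 (3 * R))"
    by (intro compact_imp_bounded compact_continuous_image entire_continuous_on F_entire G; simp)+
  then obtain bF bG where bb: "\<forall>y\<in>F ` cball 0 (3 * R). cmod y \<le> bF" "\<forall>y\<in>G ` cball 0 (3 * R). cmod y \<le> bG" unfolding bounded_iff by blast
  define b where "b = max 1 (max bF bG)"
  have b: "b \<ge> 1" "\<And>z. cmod z \<le> 3 * R \<Longrightarrow> cmod (F z) \<le> b" "\<And>z. cmod z \<le> 3 * R \<Longrightarrow> cmod (G z) \<le> b"
    using bb unfolding b_def by (auto simp: le_max_iff_disj)
  define M where "M = 2 * b * b / R"
  have M: "M \<ge> 0" "b / R \<le> M" using b(1) R unfolding M_def by (auto simp: divide_right_mono)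
  have "cmod (kernel G x z) \<le> M * (indicator {- (2 * R)..2 * R} x + cmod (F (of_real x)) + cmod (G (of_real x)))" if z: "cmod z < R" for z x
  proof (cases "\<bar>x\<bar> \<le> 2 * R")
    case True
    have "cmod (kernel G x z) \<le> M"
    proof (rule maximum_modulus_frontier[of "kernel G x" "ball 0 (3 * R)"])
      show "kernel G x holomorphic_on interior (ball 0 (3 * R))" using holomorphic_on_subset[OF kernel_holomorphic[OF G]] by blast
      show "continuous_on (closure (ball 0 (3 * R))) (kernel G x)" by (rule entire_continuous_on[OF kernel_holomorphic[OF G]])
      fix w assume "w \<in> frontier (ball (0::complex) (3 * R))"
      then have w: "cmod w = 3 * R" using R by simp
      have wx: "R \<le> cmod (w - of_real x)" using norm_triangle_ineq2[of w "of_real x"] w True by simp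
      then have ne: "w \<noteq> of_real x" using R by auto
      have "cmod (F (of_real x) * G w - F w * G (of_real x)) \<le> cmod (F (of_real x)) * cmod (G w) + cmod (F w) * cmod (G (of_real x))"
        by (rule order_trans[OF norm_triangle_ineq4]) (simp add: norm_mult)
      also have "\<dots> \<le> b * b + b * b" using b True w R by (intro add_mono mult_mono) auto
      finally have "cmod (F (of_real x) * G w - F w * G (of_real x)) / cmod (w - of_real x) \<le> (b * b + b * b) / R" using wx R by (intro frac_le) auto
      then show "cmod (kernel G x w) \<le> M" unfolding kernel_eq[OF ne] M_def norm_divide by simp
    qed (use z R in auto)
    also have "M \<le> M * (indicator {- (2 * R)..2 * R} x + cmod (F (of_real x)) + cmod (G (of_real x)))"
      using M(1) True by (auto simp: indicator_def mult_le_cancel_left1)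
    finally show ?thesis .
  next
    case False
    have zx: "R \<le> cmod (z - of_real x)" using norm_triangle_ineq2[of "of_real x" z] z False by (simp add: norm_minus_commute)
    then have ne: "z \<noteq> of_real x" using R by auto
    have "cmod (F (of_real x) * G z - F z * G (of_real x)) \<le> cmod (F (of_real x)) * cmod (G z) + cmod (F z) * cmod (G (of_real x))"
      by (rule order_trans[OF norm_triangle_ineq4]) (simp add: norm_mult)
    also have "\<dots> \<le> cmod (F (of_real x)) * b + b * cmod (G (of_real x))" using b z R by (intro add_mono mult_mono) auto
    also have "\<dots> = b * (cmod (F (of_real x)) + cmod (G (of_real x)))" by (simp add: algebra_simps)
    finally have "cmod (kernel G x z) \<le> b * (cmod (F (of_real x)) + cmod (G (of_real x))) / R"
      unfolding kernel_eq[OF ne] norm_divide using zx R b(1) by (intro frac_le mult_nonneg_nonneg add_nonneg_nonneg) auto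
    also have "\<dots> = b / R * (cmod (F (of_real x)) + cmod (G (of_real x)))" by simp
    also have "\<dots> \<le> M * (indicator {- (2 * R)..2 * R} x + cmod (F (of_real x)) + cmod (G (of_real x)))"
      using M b(1) R by (intro mult_mono) (auto simp: indicator_def)
    finally show ?thesis .
  qed
  then show ?thesis using M(1) by blast
qed

lemma N_entire:
  assumes G: "G \<in> B"
  shows "N G holomorphic_on UNIV"
  unfolding N_def[abs_def]
proof (rule holomorphic_on_lebesgue_integral[OF open_UNIV])
  show "(\<lambda>z. kernel G x z * cnj (g x)) holomorphic_on UNIV" for x by (intro holomorphic_intros kernel_holomorphic entire G)
  show "(\<lambda>x. kernel G x z * cnj (g x)) \<in> borel_measurable \<nu>" for z
    by (intro borel_measurable_times kernel_measurable entire[OF G] cnj_g_measurable)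
  fix z0 :: complex
  define R where "R = cmod z0 + 1"
  have R: "R > 0" unfolding R_def by (simp add: add_nonneg_pos)
  let ?I = "{- (2 * R)..2 * R}"
  obtain M where M: "M \<ge> 0" "\<And>z x. cmod z < R \<Longrightarrow> cmod (kernel G x z) \<le> M * (indicator ?I x + cmod (F (of_real x)) + cmod (G (of_real x)))"
    using kernel_bound[OF entire[OF G] R] by blast
  let ?b = "\<lambda>x. M * (cmod (indicator ?I x) * cmod (g x) + cmod (F (of_real x)) * cmod (g x) + cmod (G (of_real x)) * cmod (g x))"
  \<comment> \<open>Local finiteness of \<nu> enters here: it makes the constant part of the kernel
    bound pair integrably with \<open>g\<close>.\<close>
  have ind: "sq_integrable \<nu> (indicator ?I)"
  proof -
    have s: "?I \<in> sets \<nu>" using sets_\<nu> by simp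
    have "(\<lambda>x. (cmod (indicator ?I x))\<^sup>2) = (indicator ?I :: real \<Rightarrow> real)" by (auto simp: indicator_def)
    then show ?thesis unfolding sq_integrable_def using s locally_finite[of "2 * R"]
      by (simp add: integrable_indicator_iff Int_absorb2 sets.sets_into_space)
  qed
  have "integrable \<nu> ?b"
    using integrable_product(1)[OF ind g_sq] integrable_product(1)[OF F_sq g_sq] integrable_product(1)[OF sq_integrable[OF G] g_sq] by simp
  moreover have "cmod (kernel G x z * cnj (g x)) \<le> ?b x" if "z \<in> ball z0 1 \<inter> UNIV" for z x
  proof -
    have "cmod z < R" using that norm_triangle_ineq2[of z z0] unfolding R_def by (simp add: dist_norm norm_minus_commute)
    then have "cmod (kernel G x z) * cmod (g x) \<le> M * (indicator ?I x + cmod (F (of_real x)) + cmod (G (of_real x))) * cmod (g x)"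
      by (intro mult_right_mono M(2)) auto
    also have "\<dots> = ?b x" by (simp add: algebra_simps indicator_def)
    finally show ?thesis by (simp add: norm_mult)
  qed
  ultimately have "integrable \<nu> ?b \<and> (\<forall>z\<in>ball z0 1 \<inter> UNIV. \<forall>x\<in>space \<nu>. cmod (kernel G x z * cnj (g x)) \<le> ?b x)" by blast
  then show "\<exists>r>0. \<exists>b. integrable \<nu> b \<and> (\<forall>z\<in>ball z0 r \<inter> UNIV. \<forall>x\<in>space \<nu>. cmod (kernel G x z * cnj (g x)) \<le> b x)"
    using zero_less_one by blast
qed

lemma integrable_cauchy:
  assumes "sq_integrable \<nu> (\<lambda>x. H (of_real x))" "Im z \<noteq> 0"
  shows "integrable \<nu> (\<lambda>x. H (of_real x) * cnj (g x) / (z - of_real x))"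
    "cmod (cauchy H z) * \<bar>Im z\<bar> \<le> (\<integral>x. cmod (H (of_real x)) * cmod (g x) \<partial>\<nu>)"
proof -
  have i: "integrable \<nu> (\<lambda>x. cmod (H (of_real x)) * cmod (g x) / \<bar>Im z\<bar>)" using integrable_product(1)[OF assms(1) g_sq] by simp
  have le: "cmod (H (of_real x) * cnj (g x) / (z - of_real x)) \<le> cmod (H (of_real x)) * cmod (g x) / \<bar>Im z\<bar>" for x
    using norm_cauchy_kernel_le[of "\<bar>Im z\<bar>" z "H (of_real x) * cnj (g x)" x] assms(2) by (simp add: norm_mult)
  have "(\<lambda>x. 1 / (z - of_real x)) \<in> borel_measurable \<nu>" by (rule measurable_\<nu>) measurable
  then have m: "(\<lambda>x. H (of_real x) * cnj (g x) / (z - of_real x)) \<in> borel_measurable \<nu>"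
    using borel_measurable_times[OF borel_measurable_times[OF _ cnj_g_measurable], of "\<lambda>x. H (of_real x)" "\<lambda>x. 1 / (z - of_real x)"] assms(1)
    unfolding sq_integrable_def by simp
  show int: "integrable \<nu> (\<lambda>x. H (of_real x) * cnj (g x) / (z - of_real x))"
    by (rule Bochner_Integration.integrable_bound[OF i m]) (use le in \<open>auto intro!: AE_I2\<close>)
  have "cmod (cauchy H z) \<le> (\<integral>x. cmod (H (of_real x)) * cmod (g x) / \<bar>Im z\<bar> \<partial>\<nu>)"
    unfolding cauchy_def by (rule Bochner_Integration.integral_norm_bound_integral[OF int i le])
  then show "cmod (cauchy H z) * \<bar>Im z\<bar> \<le> (\<integral>x. cmod (H (of_real x)) * cmod (g x) \<partial>\<nu>)"
    using assms(2) by (simp add: pos_le_divide_eq)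
qed

lemma cauchy_combination:
  assumes "sq_integrable \<nu> (\<lambda>x. G1 (of_real x))" "sq_integrable \<nu> (\<lambda>x. G2 (of_real x))" "Im z \<noteq> 0"
  shows "(\<integral>x. p * (G1 (of_real x) * cnj (g x) / (z - of_real x)) - q * (G2 (of_real x) * cnj (g x) / (z - of_real x)) \<partial>\<nu>) = p * cauchy G1 z - q * cauchy G2 z"
  unfolding cauchy_def
  using integrable_cauchy(1)[OF assms(1,3)] integrable_cauchy(1)[OF assms(2,3)]
  by (simp only: Bochner_Integration.integral_diff[OF integrable_mult_right integrable_mult_right] integral_mult_right_zero)

lemma nonreal_ne: "Im z \<noteq> 0 \<Longrightarrow> z \<noteq> of_real x"
  by auto

lemma N_eq:
  assumes G: "G \<in> B" and z: "Im z \<noteq> 0"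
  shows "N G z = G z * cauchy F z - F z * cauchy G z"
proof -
  have "N G z = (\<integral>x. G z * (F (of_real x) * cnj (g x) / (z - of_real x)) - F z * (G (of_real x) * cnj (g x) / (z - of_real x)) \<partial>\<nu>)"
    unfolding N_def kernel_eq[OF nonreal_ne[OF z]]
    by (rule Bochner_Integration.integral_cong) (auto simp: algebra_simps diff_divide_distrib)
  also have "\<dots> = G z * cauchy F z - F z * cauchy G z"
    by (rule cauchy_combination[OF F_sq sq_integrable[OF G] z])
  finally show ?thesis .
qed

lemma N_bound:
  assumes G: "G \<in> B"
  shows "\<exists>A>0. \<forall>z. cmod (N G z) * \<bar>Im z\<bar> \<le> A * (cmod (F z) + cmod (G z))"
proof -
  define A where "A = 1 + (\<integral>x. cmod (F (of_real x)) * cmod (g x) \<partial>\<nu>) + (\<integral>x. cmod (G (of_real x)) * cmod (g x) \<partial>\<nu>)"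
  have i: "0 \<le> (\<integral>x. cmod (F (of_real x)) * cmod (g x) \<partial>\<nu>)" "0 \<le> (\<integral>x. cmod (G (of_real x)) * cmod (g x) \<partial>\<nu>)" by simp_all
  then have A: "A > 0" unfolding A_def by linarith
  have "cmod (N G z) * \<bar>Im z\<bar> \<le> A * (cmod (F z) + cmod (G z))" for z
  proof (cases "Im z = 0")
    case True
    then show ?thesis using A by simp
  next
    case False
    have "cmod (cauchy F z) * \<bar>Im z\<bar> \<le> A" "cmod (cauchy G z) * \<bar>Im z\<bar> \<le> A"
      using integrable_cauchy(2)[OF F_sq False] integrable_cauchy(2)[OF sq_integrable[OF G] False] i unfolding A_def by linarith+
    then have "cmod (G z) * (cmod (cauchy F z) * \<bar>Im z\<bar>) + cmod (F z) * (cmod (cauchy G z) * \<bar>Im z\<bar>) \<le> cmod (G z) * A + cmod (F z) * A"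
      by (intro add_mono mult_left_mono) auto
    moreover have "cmod (N G z) \<le> cmod (G z) * cmod (cauchy F z) + cmod (F z) * cmod (cauchy G z)"
      unfolding N_eq[OF G False] by (rule order_trans[OF norm_triangle_ineq4]) (simp add: norm_mult)
    then have "cmod (N G z) * \<bar>Im z\<bar> \<le> (cmod (G z) * cmod (cauchy F z) + cmod (F z) * cmod (cauchy G z)) * \<bar>Im z\<bar>" by (intro mult_right_mono) auto
    ultimately show ?thesis by (simp add: algebra_simps)
  qed
  then show ?thesis using A by blast
qed

text \<open>The function \<open>?f\<close> vanishes at \<open>z\<close>, so its difference quotient
  lies in \<open>B\<close> and is annihilated. Thus the ratio of \<open>cauchy G\<close> to
  \<open>G\<close> is the same for all \<open>G\<close> in \<open>B\<close>, and this makes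
  \<open>K\<close> independent of \<open>G\<close>.\<close>

lemma cauchy_cross:
  assumes G1: "G1 \<in> B" and G2: "G2 \<in> B" and z: "Im z \<noteq> 0"
  shows "G2 z * cauchy G1 z = G1 z * cauchy G2 z"
proof -
  let ?f = "\<lambda>u. G2 z * G1 u + (- G1 z) * G2 u"
  have D: "diff_quotient ?f z \<in> B" by (rule diff_quotient_mem[OF linear[OF G1 G2]]) simp
  have "0 = (\<integral>x. diff_quotient ?f z (of_real x) * cnj (g x) \<partial>\<nu>)" using orth[OF D] by simp
  also have "\<dots> = (\<integral>x. G1 z * (G2 (of_real x) * cnj (g x) / (z - of_real x)) - G2 z * (G1 (of_real x) * cnj (g x) / (z - of_real x)) \<partial>\<nu>)"
  proof (rule Bochner_Integration.integral_cong[OF refl])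
    fix x
    have ne: "of_real x \<noteq> z" "z - of_real x \<noteq> 0" "of_real x - z \<noteq> 0" using nonreal_ne[OF z, of x] by auto
    have eq: "diff_quotient ?f z (of_real x) = (G1 z * G2 (of_real x) - G2 z * G1 (of_real x)) / (z - of_real x)"
      using ne by (simp add: diff_quotient_def divide_simps) (simp add: algebra_simps)
    show "diff_quotient ?f z (of_real x) * cnj (g x) = G1 z * (G2 (of_real x) * cnj (g x) / (z - of_real x)) - G2 z * (G1 (of_real x) * cnj (g x) / (z - of_real x))"
      unfolding eq by (simp add: algebra_simps diff_divide_distrib)
  qed
  also have "\<dots> = G1 z * cauchy G2 z - G2 z * cauchy G1 z"
    by (rule cauchy_combination[OF sq_integrable[OF G2] sq_integrable[OF G1] z])
  finally show ?thesis by simp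
qed

text \<open>The terms with \<open>cauchy F\<close> cancel and leave \<open>F\<close> times a
  difference that vanishes by \<open>cauchy_cross\<close>. The identity theorem carries the equality
  from the upper half-plane to the real axis and beyond.\<close>

lemma N_cross:
  assumes G1: "G1 \<in> B" and G2: "G2 \<in> B"
  shows "G2 z * N G1 z = G1 z * N G2 z"
proof (rule analytic_continuation_open[of upper_half_plane UNIV "\<lambda>z. G2 z * N G1 z" "\<lambda>z. G1 z * N G2 z"])
  show "upper_half_plane \<noteq> {}" by (auto simp: upper_half_plane_def intro: exI[of _ \<i>])
  show "G2 z * N G1 z = G1 z * N G2 z" if "z \<in> upper_half_plane" for z
  proof -
    have z: "Im z \<noteq> 0" using that by (auto simp: upper_half_plane_def)
    have "G2 z * N G1 z - G1 z * N G2 z = F z * (G1 z * cauchy G2 z - G2 z * cauchy G1 z)"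
      unfolding N_eq[OF G1 z] N_eq[OF G2 z] by (simp add: algebra_simps)
    then show ?thesis using cauchy_cross[OF G1 G2 z] by simp
  qed
  show "(\<lambda>z. G2 z * N G1 z) holomorphic_on UNIV" by (rule holomorphic_on_mult[OF entire[OF G2] N_entire[OF G1]])
  show "(\<lambda>z. G1 z * N G2 z) holomorphic_on UNIV" by (rule holomorphic_on_mult[OF entire[OF G1] N_entire[OF G2]])
qed (auto simp: open_upper_half_plane intro: convex_connected)

text \<open>Near each point \<open>K\<close> is \<open>N G / G\<close> for an element
  \<open>G\<close> without a zero there; \<open>N_cross\<close> makes the local definitions
  agree.\<close>

lemma quotient_exists: "\<exists>K. K holomorphic_on UNIV \<and> (\<forall>G\<in>B. \<forall>z. K z * G z = N G z)"
proof -
  obtain S where S: "\<And>z. S z \<in> B" "\<And>z. S z z \<noteq> 0" using no_common_zero by metis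
  define K where "K z = N (S z) z / S z z" for z
  have K: "K z * G z = N G z" if "G \<in> B" for G z
    using N_cross[OF that S(1)[of z], of z] S(2)[of z] unfolding K_def by (simp add: field_simps)
  have "K field_differentiable at w" for w
  proof -
    let ?U = "{z. S w z \<noteq> 0}"
    have U: "open ?U" by (rule open_Collect_neq) (auto intro: entire_continuous_on[OF entire[OF S(1)]])
    have "(\<lambda>z. N (S w) z / S w z) holomorphic_on ?U"
      by (intro holomorphic_on_divide holomorphic_on_subset[OF N_entire[OF S(1)]] holomorphic_on_subset[OF entire[OF S(1)]]) auto
    moreover have "K z = N (S w) z / S w z" if "z \<in> ?U" for z using K[OF S(1)[of w], of z] that by (simp add: field_simps)
    ultimately have "K holomorphic_on ?U" using holomorphic_cong[of ?U ?U K "\<lambda>z. N (S w) z / S w z"] by blast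
    then show ?thesis using U S(2)[of w] by (simp add: holomorphic_on_imp_differentiable_at)
  qed
  then have "K holomorphic_on UNIV" by (simp add: holomorphic_on_def field_differentiable_at_within)
  then show ?thesis using K by blast
qed

text \<open>On the imaginary axis z / (z - x) has modulus at most 1 and tends to 1, so dominated
  convergence applies. The sign \<open>s\<close> covers the two ends of the axis.\<close>

lemma cauchy_asymptotics:
  assumes H: "sq_integrable \<nu> (\<lambda>x. H (of_real x))" and e: "e > 0"
  shows "\<exists>Y. \<forall>y. Y \<le> \<bar>y\<bar> \<longrightarrow> cmod (\<i> * of_real y * cauchy H (\<i> * of_real y) - (\<integral>x. H (of_real x) * cnj (g x) \<partial>\<nu>)) < e"
proof -
  have lim: "((\<lambda>y. \<integral>x. H (of_real x) * cnj (g x) * (\<i> * of_real (s * y) / (\<i> * of_real (s * y) - of_real x)) \<partial>\<nu>) \<longlongrightarrow> (\<integral>x. H (of_real x) * cnj (g x) \<partial>\<nu>)) at_top"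
    if s: "s = 1 \<or> s = -1" for s :: real
  proof (rule integral_dominated_convergence_at_top[where w = "\<lambda>x. cmod (H (of_real x)) * cmod (g x)"])
    have "(\<lambda>x. \<i> * of_real (s * y) / (\<i> * of_real (s * y) - of_real x)) \<in> borel_measurable \<nu>" for y by (rule measurable_\<nu>) measurable
    then show "(\<lambda>x. H (of_real x) * cnj (g x) * (\<i> * of_real (s * y) / (\<i> * of_real (s * y) - of_real x))) \<in> borel_measurable \<nu>" for y
      using H cnj_g_measurable unfolding sq_integrable_def by (intro borel_measurable_times) auto
    show "(\<lambda>x. H (of_real x) * cnj (g x)) \<in> borel_measurable \<nu>" using integrable_product(2)[OF H g_sq] by auto
    show "integrable \<nu> (\<lambda>x. cmod (H (of_real x)) * cmod (g x))" by (rule integrable_product(1)[OF H g_sq])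
    show "AE x in \<nu>. ((\<lambda>y. H (of_real x) * cnj (g x) * (\<i> * of_real (s * y) / (\<i> * of_real (s * y) - of_real x))) \<longlongrightarrow> H (of_real x) * cnj (g x)) at_top"
    proof (rule AE_I2)
      fix x
      have "((\<lambda>y. 1 / (1 + \<i> * of_real (x * s / y))) \<longlongrightarrow> 1 / (1 + \<i> * of_real 0)) at_top"
        by (intro tendsto_intros) (real_asymp, simp)
      then have "((\<lambda>y. 1 / (1 + \<i> * of_real (x * s / y))) \<longlongrightarrow> 1) at_top" by simp
      moreover have "\<forall>\<^sub>F y in at_top. 1 / (1 + \<i> * complex_of_real (x * s / y)) = \<i> * of_real (s * y) / (\<i> * of_real (s * y) - of_real x)"
        using eventually_gt_at_top[of 0]
      proof eventually_elim
        case (elim y)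
        have ne: "\<i> * of_real (s * y) \<noteq> (0::complex)" using elim s by auto
        have "1 + \<i> * complex_of_real (x * s / y) = (\<i> * of_real (s * y) - of_real x) / (\<i> * of_real (s * y))"
          using elim s by (auto simp: complex_eq_iff Re_divide Im_divide power2_eq_square)
        then show ?case using ne by simp
      qed
      ultimately have "((\<lambda>y. \<i> * of_real (s * y) / (\<i> * of_real (s * y) - of_real x)) \<longlongrightarrow> 1) at_top" by (rule Lim_transform_eventually)
      from tendsto_mult_left[OF this, of "H (of_real x) * cnj (g x)"]
      show "((\<lambda>y. H (of_real x) * cnj (g x) * (\<i> * of_real (s * y) / (\<i> * of_real (s * y) - of_real x))) \<longlongrightarrow> H (of_real x) * cnj (g x)) at_top" by simp
    qed
    show "\<forall>\<^sub>F y in at_top. AE x in \<nu>. cmod (H (of_real x) * cnj (g x) * (\<i> * of_real (s * y) / (\<i> * of_real (s * y) - of_real x))) \<le> cmod (H (of_real x)) * cmod (g x)"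
      using eventually_gt_at_top[of 0]
    proof eventually_elim
      case (elim y)
      show ?case
      proof (rule AE_I2)
        fix x
        have "cmod (\<i> * of_real (s * y)) = \<bar>Im (\<i> * of_real (s * y))\<bar>" by (simp add: norm_mult abs_mult)
        also have "\<dots> \<le> cmod (\<i> * of_real (s * y) - of_real x)" by (rule Im_le_norm_diff_real)
        finally have "cmod (\<i> * of_real (s * y) / (\<i> * of_real (s * y) - of_real x)) \<le> 1" by (simp add: norm_divide divide_le_eq)
        then have "cmod (H (of_real x) * cnj (g x)) * cmod (\<i> * of_real (s * y) / (\<i> * of_real (s * y) - of_real x)) \<le> cmod (H (of_real x) * cnj (g x)) * 1"
          by (intro mult_left_mono) auto
        then show "cmod (H (of_real x) * cnj (g x) * (\<i> * of_real (s * y) / (\<i> * of_real (s * y) - of_real x))) \<le> cmod (H (of_real x)) * cmod (g x)"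
          unfolding norm_mult by simp
      qed
    qed
  qed
  have eq: "(\<integral>x. H (of_real x) * cnj (g x) * (\<i> * of_real y / (\<i> * of_real y - of_real x)) \<partial>\<nu>) = \<i> * of_real y * cauchy H (\<i> * of_real y)" for y
  proof -
    have "(\<lambda>x. H (of_real x) * cnj (g x) * (\<i> * of_real y / (\<i> * of_real y - of_real x))) = (\<lambda>x. \<i> * of_real y * (H (of_real x) * cnj (g x) / (\<i> * of_real y - of_real x)))"
      by (auto simp: field_simps)
    then show ?thesis unfolding cauchy_def by (simp only: integral_mult_right_zero)
  qed
  have "\<exists>Y. \<forall>y\<ge>Y. cmod (\<i> * of_real (s * y) * cauchy H (\<i> * of_real (s * y)) - (\<integral>x. H (of_real x) * cnj (g x) \<partial>\<nu>)) < e" if s: "s = 1 \<or> s = -1" for s :: real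
    using tendstoD[OF lim[OF s] e] unfolding eq dist_norm eventually_at_top_linorder by blast
  from this[of 1] this[of "-1"] obtain Y1 Y2 where Y: "\<And>y. Y1 \<le> y \<Longrightarrow> cmod (\<i> * of_real (1 * y) * cauchy H (\<i> * of_real (1 * y)) - (\<integral>x. H (of_real x) * cnj (g x) \<partial>\<nu>)) < e"
    "\<And>y. Y2 \<le> y \<Longrightarrow> cmod (\<i> * of_real (-1 * y) * cauchy H (\<i> * of_real (-1 * y)) - (\<integral>x. H (of_real x) * cnj (g x) \<partial>\<nu>)) < e" by blast
  show ?thesis
  proof (intro exI[of _ "max Y1 Y2"] allI impI)
    fix y assume y: "max Y1 Y2 \<le> \<bar>y\<bar>"
    show "cmod (\<i> * of_real y * cauchy H (\<i> * of_real y) - (\<integral>x. H (of_real x) * cnj (g x) \<partial>\<nu>)) < e"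
    proof (cases "y \<ge> 0")
      case True
      then show ?thesis using Y(1)[of y] y by simp
    next
      case False
      then show ?thesis using Y(2)[of "- y"] y by simp
    qed
  qed
qed

text \<open>If \<open>N G\<close> vanishes, then \<open>G * cauchy F = F * cauchy G\<close> off the
  real axis. Here z times \<open>cauchy F\<close> tends to the nonzero pairing of \<open>F\<close>
  with \<open>g\<close>, while z times \<open>cauchy G\<close> tends to 0 by orthogonality.\<close>

lemma growth_comparison:
  assumes G: "G \<in> B" and N0: "\<And>z. N G z = 0" and nz: "(\<integral>x. F (of_real x) * cnj (g x) \<partial>\<nu>) \<noteq> 0" and e: "e > 0"
  shows "\<exists>Y. \<forall>y. Y \<le> \<bar>y\<bar> \<longrightarrow> cmod (G (\<i> * of_real y)) \<le> e * cmod (F (\<i> * of_real y))"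
proof -
  define I where "I = (\<integral>x. F (of_real x) * cnj (g x) \<partial>\<nu>)"
  have I: "cmod I > 0" using nz unfolding I_def by simp
  obtain Y1 where Y1: "\<And>y. Y1 \<le> \<bar>y\<bar> \<Longrightarrow> cmod (\<i> * of_real y * cauchy F (\<i> * of_real y) - I) < cmod I / 2"
    using cauchy_asymptotics[OF F_sq, of "cmod I / 2"] I unfolding I_def by auto
  have "e * cmod I / 2 > 0" using e I by simp
  then obtain Y2 where Y2: "\<And>y. Y2 \<le> \<bar>y\<bar> \<Longrightarrow> cmod (\<i> * of_real y * cauchy G (\<i> * of_real y)) < e * cmod I / 2"
    using cauchy_asymptotics[OF sq_integrable[OF G], of "e * cmod I / 2"] orth[OF G] by auto
  show ?thesis
  proof (intro exI[of _ "max 1 (max Y1 Y2)"] allI impI)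
    fix y assume y: "max 1 (max Y1 Y2) \<le> \<bar>y\<bar>"
    let ?z = "\<i> * complex_of_real y"
    have "Im ?z \<noteq> 0" using y by auto
    then have "G ?z * cauchy F ?z = F ?z * cauchy G ?z" using N_eq[OF G, of ?z] N0[of ?z] by simp
    then have eq: "G ?z * (?z * cauchy F ?z) = F ?z * (?z * cauchy G ?z)" by (simp add: mult_ac)
    have "cmod I \<le> cmod (?z * cauchy F ?z) + cmod (?z * cauchy F ?z - I)" by (metis norm_minus_commute norm_triangle_sub)
    then have "cmod I / 2 \<le> cmod (?z * cauchy F ?z)" using Y1[of y] y by simp
    then have "cmod (G ?z) * (cmod I / 2) \<le> cmod (G ?z) * cmod (?z * cauchy F ?z)" by (intro mult_left_mono) auto
    also have "\<dots> = cmod (F ?z) * cmod (?z * cauchy G ?z)" using eq by (metis norm_mult)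
    also have "\<dots> \<le> cmod (F ?z) * (e * cmod I / 2)" using Y2[of y] y by (intro mult_left_mono) auto
    finally have "cmod (G ?z) * (cmod I / 2) \<le> (e * cmod (F ?z)) * (cmod I / 2)" by (simp add: mult_ac)
    then show "cmod (G ?z) \<le> e * cmod (F ?z)" using I by (simp only: mult_le_cancel_right_pos half_gt_zero)
  qed
qed

end

lemma (in embedded_space) comparison_function:
  assumes E: "zero_type E" and F: "zero_type F" "sq_integrable \<nu> (\<lambda>x. F (of_real x))" "F \<notin> B" and G: "G \<in> B"
  obtains K A where "zero_type K" "A > 0" "\<And>z. cmod (K z) * cmod (G z) * \<bar>Im z\<bar> \<le> A * (cmod (F z) + cmod (G z))"
    "\<And>e. (\<And>z. K z = 0) \<Longrightarrow> e > 0 \<Longrightarrow> \<exists>Y. \<forall>y. Y \<le> \<bar>y\<bar> \<longrightarrow> cmod (G (\<i> * of_real y)) \<le> e * cmod (F (\<i> * of_real y))"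
proof -
  have Fh: "F holomorphic_on UNIV" using F(1) unfolding zero_type_def by blast
  obtain g where g: "sq_integrable \<nu> g" "\<And>H. H \<in> B \<Longrightarrow> (\<integral>x. H (of_real x) * cnj (g x) \<partial>\<nu>) = 0"
    "(\<integral>x. F (of_real x) * cnj (g x) \<partial>\<nu>) \<noteq> 0"
    using orthogonal_function[OF Fh F(2,3)] by blast
  interpret O: orthogonal_functional E \<nu> c C F g
    by unfold_locales (use Fh F(2) g in blast)+
  obtain K where K: "K holomorphic_on UNIV" "\<And>G z. G \<in> B \<Longrightarrow> K z * G z = O.N G z" using O.quotient_exists by blast
  \<comment> \<open>The growth of \<open>K\<close> is found through \<open>H\<close> because
    \<open>G\<close> may vanish at 0, where the quotient lemma is anchored; both elements give the
    same \<open>K\<close>.\<close>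
  obtain H where H: "H \<in> B" "H 0 \<noteq> 0" using no_common_zero by blast
  obtain AH where AH: "AH > 0" "\<And>z. cmod (O.N H z) * \<bar>Im z\<bar> \<le> AH * (cmod (F z) + cmod (H z))" using O.N_bound[OF H(1)] by blast
  have Kz: "zero_type K"
  proof (rule zero_type_quotient[OF K(1) K(2)[OF H(1)] _ _ H(2)])
    show "zero_type (O.N H)" by (rule zero_type_of_bound[OF O.N_entire[OF H(1)] _ F(1) zero_type[OF E H(1)] AH(2)]) (use AH in simp)
    show "zero_type H" by (rule zero_type[OF E H(1)])
  qed
  obtain A where A: "A > 0" "\<And>z. cmod (O.N G z) * \<bar>Im z\<bar> \<le> A * (cmod (F z) + cmod (G z))" using O.N_bound[OF G] by blast
  show ?thesis
  proof (rule that[OF Kz A(1)])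
    show "cmod (K z) * cmod (G z) * \<bar>Im z\<bar> \<le> A * (cmod (F z) + cmod (G z))" for z
      using A(2)[of z] K(2)[OF G, of z] by (metis norm_mult)
    fix e :: real assume K0: "\<And>z. K z = 0" and e: "e > 0"
    have "O.N G z = 0" for z using K(2)[OF G, of z] K0[of z] by simp
    then show "\<exists>Y. \<forall>y. Y \<le> \<bar>y\<bar> \<longrightarrow> cmod (G (\<i> * of_real y)) \<le> e * cmod (F (\<i> * of_real y))"
      by (rule O.growth_comparison[OF G _ g(3) e])
  qed
qed

subsection \<open>Comparing two embedded de Branges spaces\<close>

text \<open>The identity theorem for a segment on a line through 0; the directions \<open>1\<close>
  and \<open>\<i>\<close> give the real and the imaginary axis.\<close>

lemma entire_zero_on_segment:
  assumes F: "F holomorphic_on UNIV" and a: "a \<noteq> 0" and Y: "Y < Y'" and zero: "\<And>y. Y < y \<Longrightarrow> y < Y' \<Longrightarrow> F (a * of_real y) = 0"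
  shows "F z = 0"
proof -
  let ?U = "(\<lambda>y. a * complex_of_real y) ` {Y<..<Y'}" and ?m = "(Y + Y') / 2"
  have "a * of_real ?m islimpt ?U"
    unfolding islimpt_approachable
  proof (intro allI impI)
    fix e :: real assume e: "e > 0"
    define d where "d = min (e / (2 * cmod a)) ((Y' - Y) / 4)"
    have d: "d > 0" "d \<le> e / (2 * cmod a)" "d \<le> (Y' - Y) / 4" using e a Y unfolding d_def by (simp_all only: min.cobounded1 min.cobounded2) simp
    have "cmod a * d \<le> e / 2" using mult_left_mono[OF d(2), of "cmod a"] a by simp
    moreover have "dist (a * of_real (?m + d)) (a * of_real ?m) = cmod a * d"
      using d(1) by (simp add: dist_norm algebra_simps norm_mult flip: right_diff_distrib)
    ultimately have "dist (a * of_real (?m + d)) (a * of_real ?m) < e" using e by linarith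
    moreover have "?m + d \<in> {Y<..<Y'}" using d Y by (simp add: field_simps)
    moreover have "a * of_real (?m + d) \<noteq> a * of_real ?m"
    proof
      assume "a * of_real (?m + d) = a * of_real ?m"
      then have "complex_of_real (?m + d) = of_real ?m" using a by (simp only: mult_cancel_left) blast
      then have "?m + d = ?m" unfolding of_real_eq_iff .
      then show False using d(1) by linarith
    qed
    ultimately show "\<exists>x'\<in>?U. x' \<noteq> a * of_real ?m \<and> dist x' (a * of_real ?m) < e" by blast
  qed
  then show ?thesis
    by (rule analytic_continuation[OF F open_UNIV convex_connected[OF convex_UNIV] subset_UNIV UNIV_I _ _ UNIV_I]) (use zero in auto)
qed

text \<open>The bound on \<open>\<rho>\<close> makes the added squared norm at most pi times the de
  Branges one, so the embedding survives. Its positivity yields \<open>null\<close>: an entire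
  function of norm zero vanishes Lebesgue almost everywhere on the line, hence by continuity on all
  of it.\<close>

lemma embedded_space_add_density:
  assumes E: "de_Branges E" and emb: "homeo_embedded_L2 (de_Branges_space E) E \<mu>" and sets: "sets \<mu> = sets borel"
    and \<rho>: "continuous_on UNIV \<rho>" "\<And>x. 0 < \<rho> x" "\<And>x. \<rho> x \<le> 1 / (cmod (E (of_real x)))\<^sup>2"
  obtains c C where "embedded_space E (add_measure \<mu> (density lborel (\<lambda>x. ennreal (\<rho> x)))) c C"
proof -
  interpret de_Branges E by (rule E)
  let ?\<tau> = "density lborel (\<lambda>x. ennreal (\<rho> x))"
  let ?\<nu> = "add_measure \<mu> ?\<tau>"
  let ?sq = "\<lambda>F x. (cmod (F (complex_of_real x)))\<^sup>2"
  obtain c C where c: "0 < c" "0 < C"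
    and cC: "\<And>F. F \<in> B \<Longrightarrow> c * dB_norm2 E F \<le> (\<integral>x. ?sq F x \<partial>\<mu>)" "\<And>F. F \<in> B \<Longrightarrow> (\<integral>x. ?sq F x \<partial>\<mu>) \<le> C * dB_norm2 E F"
    and i\<mu>: "\<And>F. F \<in> B \<Longrightarrow> integrable \<mu> (?sq F)"
    using emb unfolding homeo_embedded_L2_def by blast
  have s: "sets ?\<tau> = sets \<mu>" using sets by simp
  have \<rho>m: "\<rho> \<in> borel_measurable borel" using \<rho>(1) by (rule borel_measurable_continuous_onI)
  have sqm: "?sq F \<in> borel_measurable borel" if "F holomorphic_on UNIV" for F
    using entire_real_measurable[OF that] by measurable
  have le: "\<rho> x * ?sq F x \<le> sq_density F x" for F x
    using mult_right_mono[OF \<rho>(3)[of x], of "?sq F x"] unfolding sq_density_def by (simp add: power_divide)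
  have il: "integrable lborel (\<lambda>x. \<rho> x * ?sq F x)" if "F \<in> B" for F
  proof (rule Bochner_Integration.integrable_bound)
    show "integrable lborel (sq_density F)" using that by (simp add: mem_iff)
    show "(\<lambda>x. \<rho> x * ?sq F x) \<in> borel_measurable lborel" using \<rho>m sqm[OF entire[OF that]] by simp
    show "AE x in lborel. norm (\<rho> x * ?sq F x) \<le> norm (sq_density F x)"
      using le \<rho>(2) by (auto simp: abs_mult abs_of_pos sq_density_nonneg)
  qed
  have i\<tau>: "integrable ?\<tau> (?sq F)" "(\<integral>x. ?sq F x \<partial>?\<tau>) = (\<integral>x. \<rho> x * ?sq F x \<partial>lborel)" if "F \<in> B" for F
    using il[OF that] \<rho>m \<rho>(2) sqm[OF entire[OF that]]
    by (auto simp: integrable_real_density integral_real_density less_imp_le)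
  have nn: "0 \<le> (\<integral>x. ?sq F x \<partial>?\<tau>)" for F by simp
  have up: "(\<integral>x. ?sq F x \<partial>?\<tau>) \<le> pi * dB_norm2 E F" if "F \<in> B" for F
  proof -
    have "(\<integral>x. \<rho> x * ?sq F x \<partial>lborel) \<le> (\<integral>x. sq_density F x \<partial>lborel)"
      using il[OF that] that le by (intro integral_mono) (auto simp: mem_iff)
    then show ?thesis unfolding i\<tau>(2)[OF that] dB_norm2_eq by simp
  qed
  have eq: "integrable ?\<nu> (?sq F)" "(\<integral>x. ?sq F x \<partial>?\<nu>) = (\<integral>x. ?sq F x \<partial>\<mu>) + (\<integral>x. ?sq F x \<partial>?\<tau>)" if "F \<in> B" for F
    using integrable_add_measure[OF s i\<mu>[OF that] i\<tau>(1)[OF that]] by auto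
  have null: "F = (\<lambda>_. 0)" if F: "F holomorphic_on UNIV" and int: "integrable ?\<nu> (?sq F)" and z: "(\<integral>x. ?sq F x \<partial>?\<nu>) = 0" for F
  proof -
    have "(\<integral>\<^sup>+x. ennreal (?sq F x) \<partial>?\<nu>) = 0" using nn_integral_eq_integral[OF int] z by simp
    moreover have fm: "(\<lambda>x. ennreal (?sq F x)) \<in> borel_measurable borel" using sqm[OF F] by measurable
    then have "(\<lambda>x. ennreal (?sq F x)) \<in> borel_measurable \<mu>" using sets by (simp cong: measurable_cong_sets)
    ultimately have "(\<integral>\<^sup>+x. ennreal (?sq F x) \<partial>?\<tau>) = 0" using nn_integral_add_measure[OF s] by simp
    then have "(\<integral>\<^sup>+x. ennreal (\<rho> x) * ennreal (?sq F x) \<partial>lborel) = 0"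
      using \<rho>m fm by (simp add: nn_integral_density)
    then have "AE x in lborel. ennreal (\<rho> x) * ennreal (?sq F x) = 0"
      using \<rho>m fm by (subst (asm) nn_integral_0_iff_AE) auto
    then have "AE x in lborel. x \<in> {x. F (of_real x) = 0}"
    proof eventually_elim
      case (elim x)
      have "ennreal (\<rho> x) \<noteq> 0" using \<rho>(2)[of x] by (simp add: ennreal_eq_0_iff not_le)
      then show ?case using elim by simp
    qed
    then have ae: "AE x in lebesgue. x \<in> {x. F (of_real x) = 0}" by (rule AE_completion)
    have cl: "closed {x. F (complex_of_real x) = 0}" by (intro closed_Collect_eq entire_real_continuous F continuous_on_const)
    have "F (1 * of_real x) = 0" for x using mem_closed_if_AE_lebesgue[OF cl ae, of x] by simp
    then have "F z = 0" for z using entire_zero_on_segment[OF F, of 1 0 1 z] by simp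
    then show ?thesis by blast
  qed
  have "embedded_space E ?\<nu> c (C + pi)"
  proof unfold_locales
    show "sets ?\<nu> = sets borel" using sets by simp
    show "0 < c" by (rule c(1))
    show "0 < C + pi" using c(2) pi_gt_zero by linarith
    show "integrable ?\<nu> (?sq F)" if "F \<in> B" for F by (rule eq(1)[OF that])
    show "c * dB_norm2 E F \<le> (\<integral>x. ?sq F x \<partial>?\<nu>)" if "F \<in> B" for F
      using cC(1)[OF that] nn[of F] unfolding eq(2)[OF that] by linarith
    show "(\<integral>x. ?sq F x \<partial>?\<nu>) \<le> (C + pi) * dB_norm2 E F" if "F \<in> B" for F
      using cC(2)[OF that] up[OF that] unfolding eq(2)[OF that] distrib_right by linarith
    show "F = (\<lambda>_. 0)" if "F holomorphic_on UNIV" "integrable ?\<nu> (?sq F)" "(\<integral>x. ?sq F x \<partial>?\<nu>) = 0" for F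
      by (rule null[OF that])
  qed
  then show thesis by (rule that)
qed

text \<open>At zeros of \<open>F\<close> the bound on \<open>L\<close> is void. But the places on
  the imaginary axis where the desired estimate fails form an open set, on which \<open>F\<close>
  would have to vanish, and a nonzero entire function cannot vanish on a segment.\<close>

lemma comparison_function_nonzero:
  assumes L: "zero_type L" and F: "F holomorphic_on UNIV" "F w \<noteq> 0"
    and bound: "\<And>z. cmod (L z) * cmod (F z) * \<bar>Im z\<bar> \<le> A * (cmod (G z) + cmod (F z))" and A: "A > 0"
    and GF: "\<And>e. e > 0 \<Longrightarrow> \<exists>Y. \<forall>y. Y \<le> \<bar>y\<bar> \<longrightarrow> cmod (G (\<i> * of_real y)) \<le> e * cmod (F (\<i> * of_real y))"
    and FG: "\<And>e. (\<And>z. L z = 0) \<Longrightarrow> e > 0 \<Longrightarrow> \<exists>Y. \<forall>y. Y \<le> \<bar>y\<bar> \<longrightarrow> cmod (F (\<i> * of_real y)) \<le> e * cmod (G (\<i> * of_real y))"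
  shows False
proof -
  have nz: False if U: "open U" "y0 \<in> U" "\<And>y. y \<in> U \<Longrightarrow> F (\<i> * of_real y) = 0" for U y0
  proof -
    obtain d where d: "d > 0" "ball y0 d \<subseteq> U" using U(1,2) open_contains_ball by blast
    have "F w = 0"
    proof (rule entire_zero_on_segment[OF F(1), of \<i> y0 "y0 + d"])
      fix y assume "y0 < y" "y < y0 + d"
      then have "y \<in> ball y0 d" by (simp add: dist_real_def)
      then show "F (\<i> * of_real y) = 0" using d(2) U(3) by blast
    qed (use d in auto)
    then show False using F(2) by simp
  qed
  obtain Y1 where Y1: "\<And>y. Y1 \<le> \<bar>y\<bar> \<Longrightarrow> cmod (G (\<i> * of_real y)) \<le> (1/2) * cmod (F (\<i> * of_real y))"
    using GF[of "1/2"] by auto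
  have Lh: "L holomorphic_on UNIV" using L unfolding zero_type_def by blast
  have Lb: "cmod (L (\<i> * of_real y)) * \<bar>y\<bar> \<le> 2 * A" if y: "Y1 < \<bar>y\<bar>" for y
  proof (rule ccontr)
    assume neg: "\<not> ?thesis"
    let ?U = "{y. Y1 < \<bar>y\<bar>} \<inter> {y. 2 * A < cmod (L (\<i> * of_real y)) * \<bar>y\<bar>}"
    have "continuous_on UNIV (\<lambda>y. L (\<i> * complex_of_real y))"
      by (rule continuous_on_compose2[OF entire_continuous_on[OF Lh, of UNIV]]) (auto intro!: continuous_intros)
    then have "open ?U" by (intro open_Int open_Collect_less continuous_intros)
    moreover have "y \<in> ?U" using y neg by simp
    moreover have "F (\<i> * of_real t) = 0" if t: "t \<in> ?U" for t
    proof (rule ccontr)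
      assume f: "F (\<i> * of_real t) \<noteq> 0"
      have "Y1 \<le> \<bar>t\<bar>" using t by simp
      from Y1[OF this] have Gt: "cmod (G (\<i> * of_real t)) \<le> cmod (F (\<i> * of_real t))" using norm_ge_zero[of "F (\<i> * of_real t)"] by linarith
      have "(cmod (L (\<i> * of_real t)) * \<bar>t\<bar>) * cmod (F (\<i> * of_real t)) \<le> A * (cmod (G (\<i> * of_real t)) + cmod (F (\<i> * of_real t)))"
        using bound[of "\<i> * of_real t"] by (simp add: mult_ac)
      also have "\<dots> \<le> A * (2 * cmod (F (\<i> * of_real t)))" using Gt A by (intro mult_left_mono) linarith+
      finally have "(cmod (L (\<i> * of_real t)) * \<bar>t\<bar>) * cmod (F (\<i> * of_real t)) \<le> (2 * A) * cmod (F (\<i> * of_real t))" by simp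
      then have "cmod (L (\<i> * of_real t)) * \<bar>t\<bar> \<le> 2 * A" using f by (subst (asm) mult_le_cancel_right_pos) auto
      then show False using t by simp
    qed
    ultimately show False using nz by blast
  qed
  have L0: "L z = 0" for z
  proof (rule zero_type_vanishing_on_imaginary_axis[OF L])
    fix e :: real assume e: "e > 0"
    show "\<exists>Y. \<forall>y. Y \<le> \<bar>y\<bar> \<longrightarrow> cmod (L (\<i> * of_real y)) \<le> e"
    proof (intro exI[of _ "max (\<bar>Y1\<bar> + 1) (2 * A / e)"] allI impI)
      fix y assume y: "max (\<bar>Y1\<bar> + 1) (2 * A / e) \<le> \<bar>y\<bar>"
      then have yp: "\<bar>y\<bar> > 0" and "Y1 < \<bar>y\<bar>" by linarith+
      have "2 * A \<le> e * \<bar>y\<bar>" using y e by (simp add: divide_le_eq mult.commute)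
      then have "cmod (L (\<i> * of_real y)) * \<bar>y\<bar> \<le> e * \<bar>y\<bar>" using Lb[OF \<open>Y1 < \<bar>y\<bar>\<close>] by linarith
      then show "cmod (L (\<i> * of_real y)) \<le> e" using yp by (simp only: mult_le_cancel_right_pos)
    qed
  qed
  \<comment> \<open>Both comparisons hold with the constant 1/2, so far out on the axis |F| <= |F| /
    4, which forces \<open>F\<close> to vanish there.\<close>
  obtain Y2 where Y2: "\<And>y. Y2 \<le> \<bar>y\<bar> \<Longrightarrow> cmod (F (\<i> * of_real y)) \<le> (1/2) * cmod (G (\<i> * of_real y))"
    using FG[OF L0, of "1/2"] by auto
  have "F (\<i> * of_real y) = 0" if "y \<in> {max Y1 Y2 <..}" "y > 0" for y
  proof -
    have "Y1 \<le> \<bar>y\<bar>" "Y2 \<le> \<bar>y\<bar>" using that by auto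
    from Y1[OF this(1)] Y2[OF this(2)] have "cmod (F (\<i> * of_real y)) \<le> 0" using norm_ge_zero[of "F (\<i> * of_real y)"] by linarith
    then show ?thesis by simp
  qed
  then show False using nz[of "{max 0 (max Y1 Y2) <..}" "max 0 (max Y1 Y2) + 1"] by auto
qed

theorem theoremA2:
  fixes E1 E2 :: "complex \<Rightarrow> complex" and \<mu> :: "real measure"
  assumes "de_Branges_function E1" and "de_Branges_function E2"
    and "\<forall>x::real. E1 (of_real x) \<noteq> 0" and "\<forall>x::real. E2 (of_real x) \<noteq> 0"
    and "sets \<mu> = sets borel"
    and "homeo_embedded_L2 (de_Branges_space E1) E1 \<mu>"
    and "homeo_embedded_L2 (de_Branges_space E2) E2 \<mu>"
    and "exp_type_zero E1" and "exp_type_zero E2"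
  shows "de_Branges_space E2 \<subseteq> de_Branges_space E1 \<or> de_Branges_space E1 \<subseteq> de_Branges_space E2"
proof (rule ccontr)
  assume "\<not> ?thesis"
  then obtain F G where F: "F \<in> de_Branges_space E2" "F \<notin> de_Branges_space E1"
    and G: "G \<in> de_Branges_space E1" "G \<notin> de_Branges_space E2" by blast
  have dB: "de_Branges E1" "de_Branges E2" using assms(1-4) by (auto intro: de_Branges.intro)
  \<comment> \<open>\<open>\<mu>\<close> need not separate entire functions outside the two spaces; adding the density \<open>\<rho>\<close> repairs this
    and keeps both norms equivalent.\<close>
  define \<rho> where "\<rho> x = min (1 / (cmod (E1 (of_real x)))\<^sup>2) (1 / (cmod (E2 (of_real x)))\<^sup>2)" for x
  have \<rho>: "continuous_on UNIV \<rho>" "\<And>x. 0 < \<rho> x" "\<And>x. \<rho> x \<le> 1 / (cmod (E1 (of_real x)))\<^sup>2" "\<And>x. \<rho> x \<le> 1 / (cmod (E2 (of_real x)))\<^sup>2"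
  proof -
    show "continuous_on UNIV \<rho>"
      unfolding \<rho>_def[abs_def] using assms(3,4)
      by (intro continuous_intros entire_real_continuous de_Branges.E_entire dB) auto
  qed (use assms(3,4) in \<open>auto simp: \<rho>_def\<close>)
  define \<nu> where "\<nu> = add_measure \<mu> (density lborel (\<lambda>x. ennreal (\<rho> x)))"
  obtain c1 C1 where e1: "embedded_space E1 \<nu> c1 C1"
    unfolding \<nu>_def using embedded_space_add_density[OF dB(1) assms(6,5) \<rho>(1,2,3)] by blast
  obtain c2 C2 where e2: "embedded_space E2 \<nu> c2 C2"
    unfolding \<nu>_def using embedded_space_add_density[OF dB(2) assms(7,5) \<rho>(1,2,4)] by blast
  note zE = assms(8,9)[THEN exp_type_zero_imp_zero_type]
  have zF: "zero_type F" and zG: "zero_type G"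
    using de_Branges.zero_type[OF dB(2) zE(2) F(1)] de_Branges.zero_type[OF dB(1) zE(1) G(1)] .
  obtain K A where K: "zero_type K" "A > 0" "\<And>z. cmod (K z) * cmod (G z) * \<bar>Im z\<bar> \<le> A * (cmod (F z) + cmod (G z))"
    "\<And>e. (\<And>z. K z = 0) \<Longrightarrow> e > 0 \<Longrightarrow> \<exists>Y. \<forall>y. Y \<le> \<bar>y\<bar> \<longrightarrow> cmod (G (\<i> * of_real y)) \<le> e * cmod (F (\<i> * of_real y))"
    using embedded_space.comparison_function[OF e1 zE(1) zF embedded_space.sq_integrable[OF e2 F(1)] F(2) G(1)] by blast
  obtain L A' where L: "zero_type L" "A' > 0" "\<And>z. cmod (L z) * cmod (F z) * \<bar>Im z\<bar> \<le> A' * (cmod (G z) + cmod (F z))"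
    "\<And>e. (\<And>z. L z = 0) \<Longrightarrow> e > 0 \<Longrightarrow> \<exists>Y. \<forall>y. Y \<le> \<bar>y\<bar> \<longrightarrow> cmod (F (\<i> * of_real y)) \<le> e * cmod (G (\<i> * of_real y))"
    using embedded_space.comparison_function[OF e2 zE(2) zG embedded_space.sq_integrable[OF e1 G(1)] G(2) F(1)] by blast
  have Fh: "F holomorphic_on UNIV" and Gh: "G holomorphic_on UNIV" and Kh: "K holomorphic_on UNIV" and Lh: "L holomorphic_on UNIV"
    using zF zG K(1) L(1) unfolding zero_type_def by blast+
  have "(\<lambda>_. 0) \<in> de_Branges_space E1" "(\<lambda>_. 0) \<in> de_Branges_space E2"
    using de_Branges.linear[OF dB(1) G(1) G(1), of 0 0] de_Branges.linear[OF dB(2) F(1) F(1), of 0 0] by simp_all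
  then have "F \<noteq> (\<lambda>_. 0)" "G \<noteq> (\<lambda>_. 0)" using F G by auto
  then obtain w w' where w: "F w \<noteq> 0" "G w' \<noteq> 0" by blast
  \<comment> \<open>The 2 arises from bounding the sum of |F| and |G| by twice the larger one; which
    of them is larger decides whether \<open>K\<close> or \<open>L\<close> is estimated.\<close>
  define C where "C = 2 * max A A'"
  have C: "C > 0" "2 * A \<le> C" "2 * A' \<le> C" using K(2) L(2) unfolding C_def by auto
  have "cmod (K z) * \<bar>Im z\<bar> \<le> C \<or> cmod (L z) * \<bar>Im z\<bar> \<le> C" for z
  proof (rule ccontr)
    assume neg: "\<not> ?thesis"
    \<comment> \<open>The bounds are void only where \<open>F\<close> and \<open>G\<close> both
      vanish, so \<open>F\<close> would vanish on this open set; if the set were nonempty,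
      \<open>F\<close> would be zero identically.\<close>
    let ?U = "{z. C < cmod (K z) * \<bar>Im z\<bar>} \<inter> {z. C < cmod (L z) * \<bar>Im z\<bar>}"
    have dominated: "a \<le> C" if "a * g \<le> A'' * (f + g)" "f \<le> g" "0 < g" "0 < A''" "2 * A'' \<le> C" for a f g A'' :: real
    proof -
      have "A'' * (f + g) \<le> A'' * (2 * g)" using that by (intro mult_left_mono) auto
      then have "a * g \<le> (2 * A'') * g" using that(1) by (simp add: mult_ac)
      then have "a \<le> 2 * A''" using that(3) by (simp only: mult_le_cancel_right_pos)
      then show ?thesis using that(5) by linarith
    qed
    have F0: "F z = 0" if z: "z \<in> ?U" for z
    proof (rule ccontr)
      assume f: "F z \<noteq> 0"
      show False
      proof (cases "cmod (G z) \<le> cmod (F z)")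
        case True
        have "cmod (L z) * \<bar>Im z\<bar> \<le> C"
          by (rule dominated[OF _ True _ L(2) C(3)]) (use L(3)[of z] f in \<open>simp_all add: mult_ac\<close>)
        then show False using z by simp
      next
        case False
        then have g: "0 < cmod (G z)" "cmod (F z) \<le> cmod (G z)" using norm_ge_zero[of "F z"] by linarith+
        have "cmod (K z) * \<bar>Im z\<bar> \<le> C"
          by (rule dominated[OF _ g(2,1) K(2) C(2)]) (use K(3)[of z] in \<open>simp add: mult_ac\<close>)
        then show False using z by simp
      qed
    qed
    have "F w = 0"
    proof (rule analytic_continuation_open[of ?U UNIV F "\<lambda>_. 0"])
      show "open ?U" by (intro open_Int open_Collect_less continuous_intros entire_continuous_on Kh Lh)
      show "?U \<noteq> {}" using neg by (auto simp: not_le)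
    qed (use F0 Fh in \<open>auto intro: convex_connected\<close>)
    then show False using w by simp
  qed
  then consider "\<And>z. K z = 0" | "\<And>z. L z = 0" using two_tracts_zero[OF K(1) L(1) C(1)] by blast
  then show False
  proof cases
    case 1
    show False by (rule comparison_function_nonzero[OF L(1) Fh w(1) L(3,2) K(4)[OF 1] L(4)])
  next
    case 2
    show False by (rule comparison_function_nonzero[OF K(1) Gh w(2) K(3,2) L(4)[OF 2] K(4)])
  qed
qed

end
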